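(* Consider on $\mathbb{R}_+=[0,\infty)$ (resp. $\mathbb{R}_-=(-\infty,0]$) the $2n\times2n$ symmetric system $\tilde Jf'+\tilde Bf=\tilde{\mathcal H}g$ with $$\tilde J=\begin{pmatrix}0 & J^* \\ -J & 0\end{pmatrix},\quad \tilde B=\begin{pmatrix}V & B \\ {B^*-J'} & -A\end{pmatrix},\quad \tilde{\mathcal H}=\begin{pmatrix}\mathcal H & 0 \\ 0 & 0\end{pmatrix},$$ with coefficients as in the context and with $A(x)$ positive semi-definite for each $x$. Let $$c(x)=\begin{cases}\max\bigl(1,\|A(x)^{-1/2}J(x)\mathcal{H}(x)^{-1/2}\|\bigr),&\det(A(x)\mathcal{H}(x))\neq0,\\ \infty,&\text{otherwise}.\end{cases}$$ Let $\delta>0$ and let $q\ge\delta$ be a function on $\mathbb{R}_+$ (resp. $\mathbb{R}_-$) such that $V\ge-q\mathcal{H}$ and $$\int_0^\infty\frac{dx}{c(x)q(x)^{1/2}}=\infty\qquad\Bigl(\text{resp. }\int_{-\infty}^0\frac{dx}{c(x)q(x)^{1/2}}=\infty\Bigr).$$ Assume moreover that one of the following holds: (1) $q$ is absolutely continuous and, for some constant $C_1$, $\bigl|\frac{d}{dx}q^{-1/2}(x)\bigr|\,c(x)\le C_1$ on $\mathbb{R}_+$ (resp. $\mathbb{R}_-$); (2) $q$ is non-decreasing (resp. non-increasing). Then $\mathcal{N}_\pm(\tilde{\mathcal S}_+)=N_\pm(\tilde S_+)=n$ (resp. $\mathcal{N}_\pm(\tilde{\mathcal S}_-)=N_\pm(\tilde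 S_-)=n$).
   Context: Let $I=\mathbb{R}_+$ (resp. $\mathbb{R}_-$). Assumptions on coefficients: $J\in AC(I,\mathrm{Mat}(n,\mathbb{C}))$ (absolutely continuous on compact subintervals), $\det J(x)\ne0$; $V,B,A,\mathcal{H}\in L^1_{loc}(I,\mathrm{Mat}(n,\mathbb{C}))$; $V=V^*$, $A=A^*$, $\mathcal{H}=\mathcal{H}^*\ge0$. Conventions: $1/\infty=0$, $0\cdot\infty=0$, so (1) means $|\frac{d}{dx}q^{-1/2}|\le C_1/c(x)$ a.e. "Absolutely continuous" means on compact subintervals. $\mathcal{L}^2_{\tilde{\mathcal H}}(I)$: Borel measurable $f:I\to\mathbb{C}^{2n}$ with $\int_I f^*\tilde{\mathcal H}f<\infty$, $\langle f,g\rangle=\int_I f^*\tilde{\mathcal H}g$; $L^2_{\tilde{\mathcal H}}(I)$ is the quotient Hilbert space by the null functions; $[f]$ is the class of $f$. $\tilde S_\pm$ is the closure of the set of pairs $\{[f],[g]\}$ with $f\in AC(I,\mathbb{C}^{2n})$, $g\in\mathcal{L}^2_{\tilde{\mathcal H}}(I)$, both compactly supported in the interior of $I$, $\tilde Jf'+\tilde Bf=\tilde{\mathcal H}g$ a.e. For a relation $T$, $T^*=\{\{u,v\}:\langle u,\psi\rangle=\langle v,\varphi\rangle\ \forall\{\varphi,\psi\}\in T\}$ and $N_\pm(T)=\dim\{u:\{u,\pm iu\}\in T^*\}$. The formal deficiency indices $\mathcal{N}_\pm$ are the dimensions of $\{f\in AC(I,\mathbb{C}^{2n})\cap\mathcal{L}^2_{\tilde{\mathcal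 H}}(I):\tilde Jf'+\tilde Bf=\pm i\tilde{\mathcal H}f\}$. *)

theory Defs
  imports "HOL-Analysis.Analysis" "HOL-Library.Function_Algebras"
begin

section \<open>Complex matrices\<close>

text \<open>Antilinear in the first argument, so that \<open>cdot f (H *v g)\<close> is $f^* H g$.\<close>

definition cdot :: "complex ^ 'm \<Rightarrow> complex ^ 'm \<Rightarrow> complex" where
  "cdot u v = (\<Sum>i\<in>UNIV. cnj (u $ i) * v $ i)"

definition ctranspose :: "complex ^ 'n ^ 'm \<Rightarrow> complex ^ 'm ^ 'n" where
  "ctranspose M = transpose (map_matrix cnj M)"

definition hermitian :: "complex ^ 'm ^ 'm \<Rightarrow> bool" where
  "hermitian M \<longleftrightarrow> ctranspose M = M"

definition psd :: "complex ^ 'm ^ 'm \<Rightarrow> bool" where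
  "psd M \<longleftrightarrow> hermitian M \<and> (\<forall>v. 0 \<le> Re (cdot v (M *v v)))"

text \<open>The positive semi-definite square root exists and is unique for positive semi-definite
  matrices; \<open>msqrt M\<close> is unspecified otherwise.\<close>

definition msqrt :: "complex ^ 'm ^ 'm \<Rightarrow> complex ^ 'm ^ 'm" where
  "msqrt M = (THE S. psd S \<and> S ** S = M)"

definition minv_sqrt :: "complex ^ 'm ^ 'm \<Rightarrow> complex ^ 'm ^ 'm" where
  "minv_sqrt M = matrix_inv (msqrt M)"

definition block_matrix ::
  "complex ^ 'n ^ 'n \<Rightarrow> complex ^ 'n ^ 'n \<Rightarrow> complex ^ 'n ^ 'n \<Rightarrow> complex ^ 'n ^ 'n
    \<Rightarrow> complex ^ ('n + 'n) ^ ('n + 'n)" where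
  "block_matrix P Q R S = (\<chi> i j.
     case i of
       Inl a \<Rightarrow> (case j of Inl b \<Rightarrow> P $ a $ b | Inr b \<Rightarrow> Q $ a $ b)
     | Inr a \<Rightarrow> (case j of Inl b \<Rightarrow> R $ a $ b | Inr b \<Rightarrow> S $ a $ b))"


section \<open>Function classes on an interval\<close>

definition absolutely_continuous_on :: "real set \<Rightarrow> (real \<Rightarrow> 'a::real_normed_vector) \<Rightarrow> bool" where
  "absolutely_continuous_on S f \<longleftrightarrow>
     (\<forall>e>0. \<exists>d>0. \<forall>D T. D division_of T \<and> T \<subseteq> S \<and> (\<Sum>K\<in>D. measure lborel K) < d
        \<longrightarrow> (\<Sum>K\<in>D. norm (f (Sup K) - f (Inf K))) < e)"

definition AC :: "real set \<Rightarrow> (real \<Rightarrow> 'a::real_normed_vector) \<Rightarrow> bool" where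
  "AC I f \<longleftrightarrow> (\<forall>a b. {a..b} \<subseteq> I \<longrightarrow> absolutely_continuous_on {a..b} f)"

definition L1_loc :: "real set \<Rightarrow> (real \<Rightarrow> 'a::euclidean_space) \<Rightarrow> bool" where
  "L1_loc I f \<longleftrightarrow> (\<forall>a b. {a..b} \<subseteq> I \<longrightarrow> f absolutely_integrable_on {a..b})"

definition compactly_supported_inside :: "real set \<Rightarrow> (real \<Rightarrow> 'a::zero) \<Rightarrow> bool" where
  "compactly_supported_inside I f \<longleftrightarrow>
     (\<exists>K. compact K \<and> K \<subseteq> interior I \<and> (\<forall>x\<in>I - K. f x = 0))"


section \<open>The space of square integrable functions and its Hilbert space quotient\<close>

text \<open>A function on \<open>I\<close> is represented by any of its extensions to the reals; the
  conditions below do not depend on the values outside \<open>I\<close>, and the null relation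
  identifies all extensions.\<close>

definition L2_fun :: "(real \<Rightarrow> complex ^ 'm ^ 'm) \<Rightarrow> real set \<Rightarrow> (real \<Rightarrow> complex ^ 'm) set" where
  "L2_fun H I = {f. f \<in> borel_measurable (restrict_space borel I) \<and>
                    set_integrable lebesgue I (\<lambda>x. cdot (f x) (H x *v f x))}"

definition L2_fun_inner ::
  "(real \<Rightarrow> complex ^ 'm ^ 'm) \<Rightarrow> real set \<Rightarrow> (real \<Rightarrow> complex ^ 'm) \<Rightarrow> (real \<Rightarrow> complex ^ 'm) \<Rightarrow> complex"
  where "L2_fun_inner H I f g = (LINT x:I|lebesgue. cdot (f x) (H x *v g x))"

definition L2_null :: "(real \<Rightarrow> complex ^ 'm ^ 'm) \<Rightarrow> real set \<Rightarrow> (real \<Rightarrow> complex ^ 'm) set" where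
  "L2_null H I = {f \<in> L2_fun H I. L2_fun_inner H I f f = 0}"

definition L2_rel ::
  "(real \<Rightarrow> complex ^ 'm ^ 'm) \<Rightarrow> real set \<Rightarrow> ((real \<Rightarrow> complex ^ 'm) \<times> (real \<Rightarrow> complex ^ 'm)) set"
  where "L2_rel H I = {(f, g). f \<in> L2_fun H I \<and> g \<in> L2_fun H I \<and> f - g \<in> L2_null H I}"

definition L2_class ::
  "(real \<Rightarrow> complex ^ 'm ^ 'm) \<Rightarrow> real set \<Rightarrow> (real \<Rightarrow> complex ^ 'm) \<Rightarrow> (real \<Rightarrow> complex ^ 'm) set"
  where "L2_class H I f = L2_rel H I `` {f}"

definition L2_space ::
  "(real \<Rightarrow> complex ^ 'm ^ 'm) \<Rightarrow> real set \<Rightarrow> (real \<Rightarrow> complex ^ 'm) set set" where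
  "L2_space H I = L2_fun H I // L2_rel H I"

definition L2_rep :: "(real \<Rightarrow> complex ^ 'm) set \<Rightarrow> real \<Rightarrow> complex ^ 'm" where
  "L2_rep u = (SOME f. f \<in> u)"

text \<open>The operations on classes are the usual ones, computed on chosen representatives.\<close>

definition L2_inner ::
  "(real \<Rightarrow> complex ^ 'm ^ 'm) \<Rightarrow> real set \<Rightarrow> (real \<Rightarrow> complex ^ 'm) set \<Rightarrow> (real \<Rightarrow> complex ^ 'm) set \<Rightarrow> complex"
  where "L2_inner H I u v = L2_fun_inner H I (L2_rep u) (L2_rep v)"

definition L2_dist ::
  "(real \<Rightarrow> complex ^ 'm ^ 'm) \<Rightarrow> real set \<Rightarrow> (real \<Rightarrow> complex ^ 'm) set \<Rightarrow> (real \<Rightarrow> complex ^ 'm) set \<Rightarrow> real"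
  where "L2_dist H I u v =
    sqrt (Re (L2_fun_inner H I (L2_rep u - L2_rep v) (L2_rep u - L2_rep v)))"

definition L2_scale ::
  "(real \<Rightarrow> complex ^ 'm ^ 'm) \<Rightarrow> real set \<Rightarrow> complex \<Rightarrow> (real \<Rightarrow> complex ^ 'm) set \<Rightarrow> (real \<Rightarrow> complex ^ 'm) set"
  where "L2_scale H I z u = L2_class H I (\<lambda>x. z *s L2_rep u x)"

definition L2_lincomb ::
  "(real \<Rightarrow> complex ^ 'm ^ 'm) \<Rightarrow> real set \<Rightarrow> nat \<Rightarrow> (nat \<Rightarrow> complex) \<Rightarrow>
    (nat \<Rightarrow> (real \<Rightarrow> complex ^ 'm) set) \<Rightarrow> (real \<Rightarrow> complex ^ 'm) set"
  where "L2_lincomb H I k a u = L2_class H I (\<lambda>x. \<Sum>i<k. a i *s L2_rep (u i) x)"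

text \<open>Complex dimension of a linear subspace \<open>U\<close> of the quotient: the supremum of the lengths
  of linearly independent families in \<open>U\<close>.\<close>

definition L2_dim ::
  "(real \<Rightarrow> complex ^ 'm ^ 'm) \<Rightarrow> real set \<Rightarrow> (real \<Rightarrow> complex ^ 'm) set set \<Rightarrow> enat" where
  "L2_dim H I U = Sup {enat k | k. \<exists>u. (\<forall>i<k. u i \<in> U) \<and>
     (\<forall>a. L2_lincomb H I k a u = L2_class H I (\<lambda>x. 0) \<longrightarrow> (\<forall>i<k. a i = 0))}"


section \<open>Linear relations and deficiency indices\<close>

type_synonym 'm L2_relation =
  "((real \<Rightarrow> complex ^ 'm) set \<times> (real \<Rightarrow> complex ^ 'm) set) set"

definition rel_closure ::
  "(real \<Rightarrow> complex ^ 'm ^ 'm) \<Rightarrow> real set \<Rightarrow> 'm L2_relation \<Rightarrow> 'm L2_relation" where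
  "rel_closure H I T = {(u, v). u \<in> L2_space H I \<and> v \<in> L2_space H I \<and>
     (\<forall>e>0. \<exists>(\<phi>, \<psi>)\<in>T. L2_dist H I u \<phi> < e \<and> L2_dist H I v \<psi> < e)}"

definition rel_adjoint ::
  "(real \<Rightarrow> complex ^ 'm ^ 'm) \<Rightarrow> real set \<Rightarrow> 'm L2_relation \<Rightarrow> 'm L2_relation" where
  "rel_adjoint H I T = {(u, v). u \<in> L2_space H I \<and> v \<in> L2_space H I \<and>
     (\<forall>(\<phi>, \<psi>)\<in>T. L2_inner H I u \<psi> = L2_inner H I v \<phi>)}"

text \<open>$N_\pm(T)$ is \<open>deficiency_index H I T (\<plusminus> \<i>)\<close>.\<close>

definition deficiency_index ::
  "(real \<Rightarrow> complex ^ 'm ^ 'm) \<Rightarrow> real set \<Rightarrow> 'm L2_relation \<Rightarrow> complex \<Rightarrow> enat" where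
  "deficiency_index H I T z =
     L2_dim H I {u \<in> L2_space H I. (u, L2_scale H I z u) \<in> rel_adjoint H I T}"


section \<open>Symmetric systems\<close>

text \<open>\<open>solves_system J B H I f g\<close> is $J f' + B f = H g$ almost everywhere on \<open>I\<close>; it is only used
  for \<open>f\<close> locally absolutely continuous, so that the derivative exists almost everywhere.\<close>

definition solves_system ::
  "(real \<Rightarrow> complex ^ 'm ^ 'm) \<Rightarrow> (real \<Rightarrow> complex ^ 'm ^ 'm) \<Rightarrow> (real \<Rightarrow> complex ^ 'm ^ 'm) \<Rightarrow>
    real set \<Rightarrow> (real \<Rightarrow> complex ^ 'm) \<Rightarrow> (real \<Rightarrow> complex ^ 'm) \<Rightarrow> bool" where
  "solves_system J B H I f g \<longleftrightarrow>
     (AE x in lebesgue. x \<in> I \<longrightarrow>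
        J x *v vector_derivative f (at x within I) + B x *v f x = H x *v g x)"

definition minimal_relation ::
  "(real \<Rightarrow> complex ^ 'm ^ 'm) \<Rightarrow> (real \<Rightarrow> complex ^ 'm ^ 'm) \<Rightarrow> (real \<Rightarrow> complex ^ 'm ^ 'm) \<Rightarrow>
    real set \<Rightarrow> 'm L2_relation" where
  "minimal_relation J B H I = rel_closure H I
     {(L2_class H I f, L2_class H I g) | f g.
        AC I f \<and> g \<in> L2_fun H I \<and>
        compactly_supported_inside I f \<and> compactly_supported_inside I g \<and>
        solves_system J B H I f g}"

text \<open>Functions on \<open>I\<close> are represented here by their extension by zero, so that
  the dimension counts functions on \<open>I\<close> only. The library dimension is 0 on infinite-dimensional
  spaces, but the space of solutions of a \<open>d\<close>-dimensional system with invertible leading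
  coefficient has dimension at most \<open>d\<close>.\<close>

definition formal_deficiency_index ::
  "(real \<Rightarrow> complex ^ 'm ^ 'm) \<Rightarrow> (real \<Rightarrow> complex ^ 'm ^ 'm) \<Rightarrow> (real \<Rightarrow> complex ^ 'm ^ 'm) \<Rightarrow>
    real set \<Rightarrow> complex \<Rightarrow> nat" where
  "formal_deficiency_index J B H I z =
     vector_space.dim (\<lambda>(a::complex) f x. a *s f x)
       {f. (\<forall>x. x \<notin> I \<longrightarrow> f x = 0) \<and> AC I f \<and> f \<in> L2_fun H I \<and>
           solves_system J B H I f (\<lambda>x. z *s f x)}"


section \<open>The \<open>2n \<times> 2n\<close> system\<close>

definition J_tilde :: "(real \<Rightarrow> complex ^ 'n ^ 'n) \<Rightarrow> real \<Rightarrow> complex ^ ('n + 'n) ^ ('n + 'n)" where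
  "J_tilde J x = block_matrix 0 (ctranspose (J x)) (- J x) 0"

definition B_tilde ::
  "real set \<Rightarrow> (real \<Rightarrow> complex ^ 'n ^ 'n) \<Rightarrow> (real \<Rightarrow> complex ^ 'n ^ 'n) \<Rightarrow>
    (real \<Rightarrow> complex ^ 'n ^ 'n) \<Rightarrow> (real \<Rightarrow> complex ^ 'n ^ 'n) \<Rightarrow>
    real \<Rightarrow> complex ^ ('n + 'n) ^ ('n + 'n)" where
  "B_tilde I J V B A x =
     block_matrix (V x) (B x) (ctranspose (B x) - vector_derivative J (at x within I)) (- A x)"

definition H_tilde :: "(real \<Rightarrow> complex ^ 'n ^ 'n) \<Rightarrow> real \<Rightarrow> complex ^ ('n + 'n) ^ ('n + 'n)" where
  "H_tilde H x = block_matrix (H x) 0 0 0"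

text \<open>In \<^typ>\<open>ennreal\<close> one has \<open>1 / \<infinity> = 0\<close> and \<open>0 * \<infinity> = 0\<close>.\<close>

definition c_coeff ::
  "(real \<Rightarrow> complex ^ 'n ^ 'n) \<Rightarrow> (real \<Rightarrow> complex ^ 'n ^ 'n) \<Rightarrow> (real \<Rightarrow> complex ^ 'n ^ 'n) \<Rightarrow>
    real \<Rightarrow> ennreal" where
  "c_coeff A J H x =
     (if det (A x ** H x) \<noteq> 0
      then ennreal (max 1 (onorm (\<lambda>v. (minv_sqrt (A x) ** J x ** minv_sqrt (H x)) *v v)))
      else \<infinity>)"

end

theory Submission
  imports Defs
begin

text \<open>
  For a solution \<open>f = (u, w)\<close> of the homogeneous equation with \<open>z = \<plusminus>\<i>\<close>, the boundary form
  \<open>p = (J u)\<^sup>* w\<close> has derivative \<open>z u\<^sup>*Hu - u\<^sup>*Vu - w\<^sup>*Aw\<close>, so \<open>Im p\<close> is monotone, and \<open>V \<ge> -qH\<close>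
  bounds \<open>w\<^sup>*Aw\<close>, weighted by the square of a cut-off of size \<open>q powr (-1/2)\<close>, by the energy
  \<open>u\<^sup>*Hu\<close>. Since \<open>|p| \<le> c (u\<^sup>*Hu)\<^sup>1\<^sup>/\<^sup>2 (w\<^sup>*Aw)\<^sup>1\<^sup>/\<^sup>2\<close>, finite energy and the divergence of the integral
  of \<open>1 / (c sqrt q)\<close> force \<open>Im p\<close> to vanish at infinity. Hence \<open>Im p(0)\<close> has a definite sign, and
  \<open>f \<mapsto> J(0) u(0) \<plusminus> \<i> w(0)\<close> is injective on the square integrable solutions. It is onto \<open>\<complex>\<^sup>n\<close>:
  solutions with a dissipative condition at a point \<open>b\<close> and a prescribed value at 0 exist by
  linear algebra, have bounded energy, and converge along a sequence as \<open>b\<close> tends to infinity.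

  The quotient space gives the same count. Where \<open>H\<close> and \<open>A\<close> are invertible, which happens on a set
  of positive measure, \<open>Hu = 0\<close> makes \<open>u\<close> and then \<open>w\<close> vanish, so the system is definite, and
  the adjoint of the minimal relation consists of classes of square integrable solutions.
\<close>

section \<open>Absolutely continuous functions\<close>

text \<open>If \<open>Im p\<close> had a limit L other than 0, then |p| >= |L|/2 far out, whereas
  for a cut-off \<open>\<eta>\<close> below \<open>s = 1 / sqrt q\<close> and a measurable
  \<open>k\<close> below 1/c the integral of k \<eta> |p| is at most half that of \<eta>^2 a + h,
  which stays bounded. So cut-offs with large \<integral> k \<eta> are wanted. The energy bound also
  needs |\<eta>'| |p| <= C sqrt (h a), in effect |\<eta>'| <= C / c. Hypothesis (1) makes
  \<open>s\<close> that regular and only a falling factor is added; under (2) \<open>s\<close> may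
  jump and is replaced by an average. The size q^(-1/2) comes from V >= -qH, which makes -s^2 u*Vu
  at most u*Hu. The coefficients are merely locally integrable, so equations hold almost everywhere
  and each integration by parts rests on the fundamental theorem for absolutely continuous
  functions. Measurability of c is never established; a minorant replaces 1/c. The half-lines are
  exchanged by passing from p(x) to -p(-x), which keeps the derivative and flips one sign.\<close>

lemma absolutely_continuous_onD:
  assumes "absolutely_continuous_on S f" "e > 0"
  obtains d where "d > 0"
    "\<And>D T. D division_of T \<Longrightarrow> T \<subseteq> S \<Longrightarrow> (\<Sum>K\<in>D. measure lborel K) < d \<Longrightarrow>
       (\<Sum>K\<in>D. norm (f (Sup K) - f (Inf K))) < e"
  using assms unfolding absolutely_continuous_on_def by (metis (no_types, lifting))

lemma absolutely_continuous_on_subset: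
  "absolutely_continuous_on S f \<Longrightarrow> T \<subseteq> S \<Longrightarrow> absolutely_continuous_on T f"
  unfolding absolutely_continuous_on_def by (meson order_trans)

lemma division_of_real_memE:
  fixes K :: "real set"
  assumes "D division_of T" "K \<in> D"
  obtains a b where "a \<le> b" "K = {a..b}" "Inf K = a" "Sup K = b" "a \<in> T" "b \<in> T" "{a..b} \<subseteq> T"
proof -
  obtain a b where K: "K = cbox a b" "K \<noteq> {}" "K \<subseteq> T"
    using division_ofD(2,3,4)[OF assms(1)] assms(2) by metis
  then have "a \<le> b" by auto
  with K have "K = {a..b}" "Inf K = a" "Sup K = b" "a \<in> T" "b \<in> T" "{a..b} \<subseteq> T"
    by (auto simp: cbox_interval)
  with \<open>a \<le> b\<close> show thesis by (rule that)
qed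

text \<open>The closure properties below, for sums, linear and bilinear maps and C^1 compositions,
  all come from this one comparison of increments.\<close>

lemma absolutely_continuous_on_dominated:
  assumes f: "absolutely_continuous_on S f" and g: "absolutely_continuous_on S g"
    and le: "\<And>x y. x \<in> S \<Longrightarrow> y \<in> S \<Longrightarrow> norm (h y - h x) \<le> C * (norm (f y - f x) + norm (g y - g x))"
  shows "absolutely_continuous_on S h"
  unfolding absolutely_continuous_on_def
proof (intro allI impI)
  fix e :: real assume e: "e > 0"
  \<comment> \<open>The sign of \<open>C\<close> is left open, so it is replaced by a larger
    constant that can be divided by.\<close>
  define C' where "C' = max C 1"
  have C': "C' > 0" "C \<le> C'" by (auto simp: C'_def)
  have e': "e / (2 * C') > 0" using e C' by simp
  from absolutely_continuous_onD[OF f e'] obtain d1 where d1: "d1 > 0"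
    "\<And>D T. D division_of T \<Longrightarrow> T \<subseteq> S \<Longrightarrow> (\<Sum>K\<in>D. measure lborel K) < d1 \<Longrightarrow>
       (\<Sum>K\<in>D. norm (f (Sup K) - f (Inf K))) < e / (2 * C')" by blast
  from absolutely_continuous_onD[OF g e'] obtain d2 where d2: "d2 > 0"
    "\<And>D T. D division_of T \<Longrightarrow> T \<subseteq> S \<Longrightarrow> (\<Sum>K\<in>D. measure lborel K) < d2 \<Longrightarrow>
       (\<Sum>K\<in>D. norm (g (Sup K) - g (Inf K))) < e / (2 * C')" by blast
  show "\<exists>d>0. \<forall>D T. D division_of T \<and> T \<subseteq> S \<and> (\<Sum>K\<in>D. measure lborel K) < d
        \<longrightarrow> (\<Sum>K\<in>D. norm (h (Sup K) - h (Inf K))) < e"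
  proof (intro exI[of _ "min d1 d2"] conjI allI impI)
    fix D T assume D: "D division_of T \<and> T \<subseteq> S \<and> (\<Sum>K\<in>D. measure lborel K) < min d1 d2"
    have "norm (h (Sup K) - h (Inf K)) \<le> C' * (norm (f (Sup K) - f (Inf K)) + norm (g (Sup K) - g (Inf K)))"
      if "K \<in> D" for K
    proof -
      have "Sup K \<in> S" "Inf K \<in> S"
        using D that by (metis division_of_real_memE subsetD)+
      then have "norm (h (Sup K) - h (Inf K)) \<le> C * (norm (f (Sup K) - f (Inf K)) + norm (g (Sup K) - g (Inf K)))"
        by (rule le[rotated])
      also have "\<dots> \<le> C' * (norm (f (Sup K) - f (Inf K)) + norm (g (Sup K) - g (Inf K)))"
        using C' by (intro mult_right_mono) auto
      finally show ?thesis .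
    qed
    then have "(\<Sum>K\<in>D. norm (h (Sup K) - h (Inf K)))
        \<le> (\<Sum>K\<in>D. C' * (norm (f (Sup K) - f (Inf K)) + norm (g (Sup K) - g (Inf K))))"
      by (rule sum_mono)
    also have "\<dots> = C' * ((\<Sum>K\<in>D. norm (f (Sup K) - f (Inf K))) + (\<Sum>K\<in>D. norm (g (Sup K) - g (Inf K))))"
      by (simp add: sum_distrib_left sum.distrib distrib_left)
    also have "\<dots> < C' * (e / (2 * C') + e / (2 * C'))"
      using C' D d1(2)[of D T] d2(2)[of D T] by (intro mult_strict_left_mono add_strict_mono) auto
    also have "\<dots> = e" using C' by (simp add: field_simps)
    finally show "(\<Sum>K\<in>D. norm (h (Sup K) - h (Inf K))) < e" .
  qed (use d1 d2 in auto)
qed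

lemma absolutely_continuous_on_imp_continuous_on:
  assumes "absolutely_continuous_on {a..b} f"
  shows "continuous_on {a..b} f"
  unfolding continuous_on_iff
proof (intro ballI allI impI)
  fix x and e :: real assume x: "x \<in> {a..b}" and e: "e > 0"
  obtain d where d: "d > 0"
    "\<And>D T. D division_of T \<Longrightarrow> T \<subseteq> {a..b} \<Longrightarrow> (\<Sum>K\<in>D. measure lborel K) < d \<Longrightarrow>
       (\<Sum>K\<in>D. norm (f (Sup K) - f (Inf K))) < e"
    using absolutely_continuous_onD[OF assms e] by blast
  have "norm (f v - f u) < e" if "u \<le> v" "u \<in> {a..b}" "v \<in> {a..b}" "v - u < d" for u v
  proof -
    have "{{u..v}} division_of {u..v}"
      using division_of_self[of u v] that by (auto simp: cbox_interval)
    from d(2)[OF this] that show ?thesis by auto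
  qed
  then have "dist (f y) (f x) < e" if "y \<in> {a..b}" "dist y x < d" for y
    using that x linear[of x y] by (metis abs_le_D1 abs_minus_commute dist_norm dist_real_def
      dist_commute order_le_less_trans abs_ge_self)
  then show "\<exists>d>0. \<forall>y\<in>{a..b}. dist y x < d \<longrightarrow> dist (f y) (f x) < e"
    using d(1) by blast
qed

lemma absolutely_continuous_on_cong:
  assumes "\<And>x. x \<in> S \<Longrightarrow> f x = g x"
  shows "absolutely_continuous_on S f \<longleftrightarrow> absolutely_continuous_on S g"
proof -
  have "(\<Sum>K\<in>D. norm (f (Sup K) - f (Inf K))) = (\<Sum>K\<in>D. norm (g (Sup K) - g (Inf K)))"
    if "D division_of T" "T \<subseteq> S" for D T
    using that by (intro sum.cong refl) (metis assms division_of_real_memE subsetD)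
  then show ?thesis
    unfolding absolutely_continuous_on_def by (smt (verit, best))
qed

text \<open>Absolute continuity of the integral: the part of \<open>G\<close> above level
  \<open>n\<close> has small integral by dominated convergence, and the rest is bounded, hence small
  over a small set.\<close>

lemma small_integral_on_small_set:
  fixes G :: "real \<Rightarrow> real"
  assumes G: "integrable lebesgue G" and nn: "\<And>x. G x \<ge> 0" and e: "e > 0"
  obtains d where "d > 0"
    "\<And>T. T \<in> lmeasurable \<Longrightarrow> measure lebesgue T < d \<Longrightarrow> (LINT x:T|lebesgue. G x) < e"
proof -
  define H where "H n x = (if G x > real n then G x else 0)" for n x
  have [measurable]: "G \<in> borel_measurable lebesgue" using G by auto
  have [measurable]: "H n \<in> borel_measurable lebesgue" for n unfolding H_def by measurable
  have "(\<lambda>n. H n x) \<longlonglongrightarrow> 0" for x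
  proof (rule tendsto_eventually)
    obtain N where "G x \<le> real N" using real_arch_simple by blast
    then show "\<forall>\<^sub>F n in sequentially. H n x = 0"
      unfolding eventually_sequentially H_def by (intro exI[of _ N]) auto
  qed
  then have "(\<lambda>n. integral\<^sup>L lebesgue (H n)) \<longlonglongrightarrow> integral\<^sup>L lebesgue (\<lambda>x::real. 0::real)"
  proof -
    assume lim: "\<And>x. (\<lambda>n. H n x) \<longlonglongrightarrow> 0"
    show ?thesis
    proof (rule Bochner_Integration.integral_dominated_convergence[where f="\<lambda>_. 0" and s=H])
      show "integrable lebesgue G" by (rule G)
      show "AE x in lebesgue. norm (H n x) \<le> G x" for n by (auto simp: H_def nn)
    qed (use lim in auto)
  qed
  then have "\<forall>\<^sub>F n in sequentially. integral\<^sup>L lebesgue (H n) < e / 2"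
    using e by (intro order_tendstoD(2)) auto
  then obtain n where n: "integral\<^sup>L lebesgue (H n) < e / 2"
    by (auto simp: eventually_sequentially)
  have Hi: "integrable lebesgue (H n)"
    by (rule Bochner_Integration.integrable_bound[OF G]) (auto simp: H_def nn)
  show thesis
  \<comment> \<open>Half of \<open>e\<close> goes to the bounded part and half to the tail;
    \<open>n + 1\<close> keeps the divisor positive at \<open>n = 0\<close>.\<close>
  proof (rule that[of "e / (2 * (real n + 1))"])
    fix T :: "real set" assume T: "T \<in> lmeasurable" "measure lebesgue T < e / (2 * (real n + 1))"
    have Ti: "integrable lebesgue (\<lambda>x. indicator T x * (real n + 1))"
      using T by (intro integrable_mult_left) (auto simp: fmeasurable_def less_top[symmetric])
    have "(LINT x:T|lebesgue. G x) \<le> (LINT x|lebesgue. indicator T x * (real n + 1) + H n x)"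
      unfolding set_lebesgue_integral_def
      by (intro integral_mono Bochner_Integration.integrable_add Ti Hi integrable_mult_indicator G)
        (use T nn in \<open>auto simp: H_def indicator_def fmeasurable_def\<close>)
    also have "\<dots> = measure lebesgue T * (real n + 1) + integral\<^sup>L lebesgue (H n)"
      using Ti Hi T by (subst Bochner_Integration.integral_add) (auto simp: fmeasurable_def)
    also have "\<dots> < (e / (2 * (real n + 1))) * (real n + 1) + e / 2"
      using T n by (intro add_strict_mono mult_strict_right_mono) auto
    also have "\<dots> = e" by (simp add: field_simps)
    finally show "(LINT x:T|lebesgue. G x) < e" .
  qed (use e in auto)
qed

lemma absolutely_continuous_on_integral:
  fixes g :: "real \<Rightarrow> 'a::euclidean_space"
  assumes g: "g absolutely_integrable_on {a..b}"
  shows "absolutely_continuous_on {a..b} (\<lambda>x. c + integral {a..x} g)"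
  unfolding absolutely_continuous_on_def
proof (intro allI impI)
  fix e :: real assume e: "e > 0"
  define G where "G x = (if x \<in> {a..b} then norm (g x) else 0)" for x
  have ng: "(\<lambda>x. norm (g x)) absolutely_integrable_on {a..b}"
    using g by (rule set_integrable_norm)
  then have Gi: "integrable lebesgue G"
    unfolding set_integrable_def G_def by (rule back_subst[of "integrable lebesgue"]) (auto simp: indicator_def)
  have Gn: "G x \<ge> 0" for x by (simp add: G_def)
  obtain d where d: "d > 0"
    "\<And>T. T \<in> lmeasurable \<Longrightarrow> measure lebesgue T < d \<Longrightarrow> (LINT x:T|lebesgue. G x) < e"
    using small_integral_on_small_set[OF Gi Gn e] by blast
  show "\<exists>d>0. \<forall>D T. D division_of T \<and> T \<subseteq> {a..b} \<and> (\<Sum>K\<in>D. measure lborel K) < d \<longrightarrow>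
      (\<Sum>K\<in>D. norm (c + integral {a..Sup K} g - (c + integral {a..Inf K} g))) < e"
  proof (intro exI[of _ d] conjI allI impI)
    fix D T assume A: "D division_of T \<and> T \<subseteq> {a..b} \<and> (\<Sum>K\<in>D. measure lborel K) < d"
    then have D: "D division_of T" and T: "T \<subseteq> {a..b}" and l: "(\<Sum>K\<in>D. measure lborel K) < d" by auto
    have Tc: "compact T" using D by (metis division_ofD(1,4,6) compact_Union compact_cbox)
    have Tm: "T \<in> lmeasurable" using Tc by (rule lmeasurable_compact)
    have "measure lebesgue T = (\<Sum>K\<in>D. measure lborel K)"
      using lmeasure_integral[OF Tm] integral_combine_division_topdown[OF _ D, of "\<lambda>_. 1::real"] Tm
      by (auto simp: lmeasurable_iff_integrable_on intro!: sum.cong elim!: division_of_real_memE[OF D]) 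
    with l have mT: "measure lebesgue T < d" by simp
    have gT: "(\<lambda>x. norm (g x)) absolutely_integrable_on T"
      using ng T Tm by (meson fmeasurableD set_integrable_subset)
    have "norm (c + integral {a..Sup K} g - (c + integral {a..Inf K} g)) \<le> integral K (\<lambda>x. norm (g x))"
      if K: "K \<in> D" for K
    proof -
      obtain u v where uv: "u \<le> v" "K = {u..v}" "Inf K = u" "Sup K = v" "{u..v} \<subseteq> T"
        using division_of_real_memE[OF D K] by metis
      have "u \<in> {u..v}" "v \<in> {u..v}" using uv(1) by auto
      then have ui: "u \<in> {a..b}" "v \<in> {a..b}" using uv T by blast+
      have "g integrable_on {a..v}"
        using g ui by (meson absolutely_integrable_on_def atLeastAtMost_iff atLeastatMost_subset_iff integrable_on_subinterval order_refl)
      then have "integral {a..u} g + integral {u..v} g = integral {a..v} g"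
        using ui uv by (intro Henstock_Kurzweil_Integration.integral_combine) auto
      then have "c + integral {a..Sup K} g - (c + integral {a..Inf K} g) = integral {u..v} g"
        using uv by (simp add: algebra_simps)
      moreover have "norm (integral {u..v} g) \<le> integral {u..v} (\<lambda>x. norm (g x))"
      proof (rule Henstock_Kurzweil_Integration.integral_norm_bound_integral)
        have "g absolutely_integrable_on {u..v}"
          using ui uv(1) by (intro set_integrable_subset[OF g]) auto
        then show "g integrable_on {u..v}" "(\<lambda>x. norm (g x)) integrable_on {u..v}"
          by (auto simp: absolutely_integrable_on_def)
      qed simp
      ultimately show ?thesis using uv by simp
    qed
    then have "(\<Sum>K\<in>D. norm (c + integral {a..Sup K} g - (c + integral {a..Inf K} g)))
        \<le> (\<Sum>K\<in>D. integral K (\<lambda>x. norm (g x)))" by (rule sum_mono)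
    also have "\<dots> = integral T (\<lambda>x. norm (g x))"
      using gT D by (intro integral_combine_division_topdown[symmetric]) (auto simp: absolutely_integrable_on_def)
    also have "\<dots> = (LINT x:T|lebesgue. norm (g x))"
      using gT by (simp add: set_lebesgue_integral_eq_integral(2))
    also have "\<dots> = (LINT x:T|lebesgue. G x)"
      unfolding set_lebesgue_integral_def using T by (intro Bochner_Integration.integral_cong) (auto simp: G_def indicator_def)
    also have "\<dots> < e" using d(2)[OF Tm mT] .
    finally show "(\<Sum>K\<in>D. norm (c + integral {a..Sup K} g - (c + integral {a..Inf K} g))) < e" .
  qed (use d in auto)
qed

text \<open>The differentiation theorem invoked here averages over cubes with corner
  \<open>x\<close>; in dimension one this yields right-hand difference quotients only.\<close>

lemma right_derivative_of_integral:
  fixes g :: "real \<Rightarrow> 'a::euclidean_space"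
  assumes g: "\<And>a b. g integrable_on {a..b}"
  obtains N where "negligible N"
    "\<And>x. x \<notin> N \<Longrightarrow> ((\<lambda>h. integral {x..x+h} g /\<^sub>R h) \<longlongrightarrow> g x) (at_right 0)"
proof -
  have g': "g integrable_on cbox a b" for a b using g by simp
  obtain N where N: "negligible N" "\<And>x e. \<lbrakk>x \<notin> N; 0 < e\<rbrakk> \<Longrightarrow>
       \<exists>d>0. \<forall>h. 0 < h \<and> h < d \<longrightarrow> norm(integral (cbox x (x + h *\<^sub>R One)) g /\<^sub>R h ^ DIM(real) - g x) < e"
    by (rule integrable_ccontinuous_explicit[OF g']) blast
  show thesis
  proof (rule that[OF N(1)])
    fix x assume x: "x \<notin> N"
    show "((\<lambda>h. integral {x..x+h} g /\<^sub>R h) \<longlongrightarrow> g x) (at_right 0)"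
    proof (rule tendstoI)
      fix e :: real assume "e > 0"
      from N(2)[OF x this] obtain d where d: "d > 0"
        "\<And>h. 0 < h \<and> h < d \<Longrightarrow> norm(integral {x..x + h} g /\<^sub>R h - g x) < e"
        by auto
      then show "\<forall>\<^sub>F h in at_right 0. dist (integral {x..x + h} g /\<^sub>R h) (g x) < e"
        unfolding eventually_at_right_field dist_norm by blast
    qed
  qed
qed

text \<open>Left-hand quotients at \<open>x\<close> are right-hand quotients of the reflected
  integrand at \<open>-x\<close>, so both one-sided limits come from
  \<open>right_derivative_of_integral\<close>.\<close>

lemma AE_deriv_integral:
  fixes g :: "real \<Rightarrow> 'a::euclidean_space"
  assumes g: "g absolutely_integrable_on {a..b}"
  shows "AE x in lebesgue. x \<in> {a<..<b} \<longrightarrow> ((\<lambda>x. c + integral {a..x} g) has_vector_derivative g x) (at x)"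
proof -
  \<comment> \<open>Extension by zero makes the integrand integrable on every interval, as the
    one-sided result demands.\<close>
  define g0 where "g0 x = (if x \<in> {a..b} then g x else 0)" for x
  have "g0 integrable_on UNIV"
    using g integrable_restrict_UNIV[of "{a..b}" g] unfolding g0_def absolutely_integrable_on_def by blast
  then have g0: "g0 integrable_on {u..v}" for u v
    using integrable_on_subcbox[of g0 UNIV u v] by auto
  then have g0r: "(\<lambda>x. g0 (- x)) integrable_on {u..v}" for u v
    using Henstock_Kurzweil_Integration.integrable_reflect_real[of g0 "-u" "-v"] by simp
  obtain N1 where N1: "negligible N1"
    "\<And>x. x \<notin> N1 \<Longrightarrow> ((\<lambda>h. integral {x..x+h} g0 /\<^sub>R h) \<longlongrightarrow> g0 x) (at_right 0)"
    using right_derivative_of_integral[OF g0] by blast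
  obtain N2 where N2: "negligible N2"
    "\<And>x. x \<notin> N2 \<Longrightarrow> ((\<lambda>h. integral {x..x+h} (\<lambda>x. g0 (- x)) /\<^sub>R h) \<longlongrightarrow> g0 (- x)) (at_right 0)"
    using right_derivative_of_integral[OF g0r] by blast
  have N2': "negligible (uminus ` N2)"
    by (rule negligible_differentiable_image_negligible[OF order_refl N2(1)]) (auto intro!: derivative_intros)
  have "((\<lambda>x. c + integral {a..x} g) has_vector_derivative g x) (at x)"
    if x: "x \<in> {a<..<b}" "x \<notin> N1" "x \<notin> uminus ` N2" for x
  proof -
    have r: "((\<lambda>h. integral {x..x+h} g0 /\<^sub>R h) \<longlongrightarrow> g x) (at_right 0)"
      using N1(2)[OF x(2)] x(1) by (simp add: g0_def)
    have "- x \<notin> N2" using x(3) by force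
    from N2(2)[OF this] have l: "((\<lambda>h. integral {-x..-x+h} (\<lambda>x. g0 (- x)) /\<^sub>R h) \<longlongrightarrow> g x) (at_right 0)"
      using x(1) by (simp add: g0_def)
    have refl: "integral {-x..-x+h} (\<lambda>x. g0 (- x)) = integral {x-h..x} g0" for h
      using Henstock_Kurzweil_Integration.integral_reflect_real[of "x" "x-h" g0] by simp
    have comb: "integral {a..u} g + integral {u..v} g0 = integral {a..v} g"
      if "a \<le> u" "u \<le> v" "v \<le> b" for u v
    proof -
      have "integral {u..v} g0 = integral {u..v} g"
        using that by (intro integral_cong) (auto simp: g0_def)
      moreover have "g integrable_on {a..v}"
        using g that by (meson absolutely_integrable_on_def atLeastatMost_subset_iff integrable_on_subinterval order_refl)
      ultimately show ?thesis
        using that by (simp add: Henstock_Kurzweil_Integration.integral_combine)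
    qed
    let ?F = "\<lambda>x. c + integral {a..x} g"
    have R: "((\<lambda>h. (?F (x + h) - ?F x) /\<^sub>R h) \<longlongrightarrow> g x) (at_right 0)"
    proof (rule Lim_transform_eventually[OF r])
      have "\<forall>\<^sub>F h in at_right (0::real). h < b - x"
        using x by (intro eventually_at_right_less[THEN eventually_mono] order_tendstoD(2)[OF tendsto_ident_at]) auto
      then show "\<forall>\<^sub>F h in at_right 0. integral {x..x + h} g0 /\<^sub>R h = (?F (x + h) - ?F x) /\<^sub>R h"
        using eventually_at_right_less[of 0]
      proof eventually_elim
        case (elim h)
        then have "?F (x + h) - ?F x = integral {x..x+h} g0" using comb[of x "x+h"] x by (simp add: algebra_simps)
        then show ?case by (simp del: add_diff_cancel_left)
      qed
    qed
    have L: "((\<lambda>h. (?F (x + h) - ?F x) /\<^sub>R h) \<longlongrightarrow> g x) (at_left 0)"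
      unfolding at_left_minus[of 0] filterlim_filtermap minus_zero
    proof (rule Lim_transform_eventually[OF l])
      have "\<forall>\<^sub>F h in at_right (0::real). h < x - a"
        using x by (intro order_tendstoD(2)[OF tendsto_ident_at]) auto
      then show "\<forall>\<^sub>F h in at_right 0. integral {-x..-x+h} (\<lambda>x. g0 (- x)) /\<^sub>R h = (?F (x + - h) - ?F x) /\<^sub>R (- h)"
        using eventually_at_right_less[of 0]
      proof eventually_elim
        case (elim h)
        have "integral {a..x-h} g = integral {a..x} g - integral {x-h..x} g0"
          using comb[of "x-h" x] elim x by (simp add: algebra_simps)
        then have "?F (x + - h) - ?F x = - integral {x-h..x} g0" by simp
        then show ?case unfolding refl by (simp del: add_diff_cancel_left)
      qed
    qed
    have "((\<lambda>h. (?F (x + h) - ?F x) /\<^sub>R h) \<longlongrightarrow> g x) (at 0)"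
      using L R filterlim_at_split by blast
    then have "((\<lambda>h. norm ((?F (x + h) - ?F x) /\<^sub>R h - g x)) \<longlongrightarrow> 0) (at 0)"
      by (intro tendsto_norm_zero) (simp add: LIM_zero)
    then have "((\<lambda>h. norm (?F (x + h) - ?F x - h *\<^sub>R g x) / norm h) \<longlongrightarrow> 0) (at 0)"
    proof (rule Lim_transform_eventually)
      have "norm ((?F (x + h) - ?F x) /\<^sub>R h - g x) = norm (?F (x + h) - ?F x - h *\<^sub>R g x) / norm h"
        if "h \<noteq> 0" for h
      proof -
        have "(?F (x + h) - ?F x) /\<^sub>R h - g x = (?F (x + h) - ?F x - h *\<^sub>R g x) /\<^sub>R h"
          using that by (simp add: scaleR_diff_right)
        then show ?thesis by (simp add: divide_inverse mult.commute)
      qed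
      then show "\<forall>\<^sub>F h in at 0. norm ((?F (x + h) - ?F x) /\<^sub>R h - g x) = norm (?F (x + h) - ?F x - h *\<^sub>R g x) / norm h"
        by (auto simp: eventually_at_filter)
    qed
    then show ?thesis
      unfolding has_vector_derivative_def has_derivative_at by (simp add: bounded_linear_scaleR_left)
  qed
  moreover have "N1 \<union> uminus ` N2 \<in> null_sets lebesgue"
    using N1 N2' negligible_iff_null_sets by blast
  ultimately show ?thesis
    by (intro AE_I'[of "N1 \<union> uminus ` N2"]) auto
qed


section \<open>Variation of an absolutely continuous function\<close>

fun path_variation :: "(real \<Rightarrow> real) \<Rightarrow> real \<Rightarrow> real list \<Rightarrow> real \<Rightarrow> real" where
  "path_variation f a [] b = \<bar>f b - f a\<bar>"
| "path_variation f a (t # ts) b = \<bar>f t - f a\<bar> + path_variation f t ts b"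

text \<open>Partitions are lists of break points because splitting and concatenating them are then
  plain inductions; \<open>chain_division\<close> translates back to divisions, in which absolute
  continuity is phrased.\<close>

fun chain :: "real \<Rightarrow> real list \<Rightarrow> real \<Rightarrow> bool" where
  "chain a [] b \<longleftrightarrow> a \<le> b"
| "chain a (t # ts) b \<longleftrightarrow> a \<le> t \<and> chain t ts b"

lemma chain_le: "chain a ts b \<Longrightarrow> a \<le> b"
  by (induction ts arbitrary: a) force+

lemma chain_append: "chain a us c \<Longrightarrow> chain c ws b \<Longrightarrow> chain a (us @ c # ws) b"
  by (induction us arbitrary: a) auto

lemma path_variation_append:
  "path_variation f a (us @ c # ws) b = path_variation f a us c + path_variation f c ws b"
  by (induction us arbitrary: a) auto

text \<open>Inserting a break point can only increase the sum, by the triangle inequality at the one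
  increment that it cuts.\<close>

lemma chain_split:
  assumes "chain a ts b" "a \<le> c" "c \<le> b"
  shows "\<exists>us ws. chain a us c \<and> chain c ws b \<and>
    path_variation f a ts b \<le> path_variation f a us c + path_variation f c ws b"
  using assms
proof (induction ts arbitrary: a)
  case Nil
  then show ?case by (intro exI[of _ "[]"]) auto
next
  case (Cons t ts)
  show ?case
  proof (cases "c \<le> t")
    case True
    with Cons.prems show ?thesis
      by (intro exI[of _ "[]"] exI[of _ "t # ts"]) auto
  next
    case False
    then obtain us ws where "chain t us c" "chain c ws b"
      "path_variation f t ts b \<le> path_variation f t us c + path_variation f c ws b"
      using Cons by force
    then show ?thesis
      using Cons.prems by (intro exI[of _ "t # us"] exI[of _ ws]) auto
  qed
qed

lemma chain_division:
  assumes "chain a ts b"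
  shows "\<exists>D. D division_of {a..b} \<and> path_variation f a ts b = (\<Sum>K\<in>D. \<bar>f (Sup K) - f (Inf K)\<bar>)"
  using assms
proof (induction ts arbitrary: a)
  case Nil
  then show ?case
    using division_of_self[of a b] by (intro exI[of _ "{{a..b}}"]) (auto simp: cbox_interval)
next
  case (Cons t ts)
  then obtain D where D: "D division_of {t..b}" "path_variation f t ts b = (\<Sum>K\<in>D. \<bar>f (Sup K) - f (Inf K)\<bar>)"
    by auto
  have at: "a \<le> t" "t \<le> b" using Cons.prems by (auto dest: chain_le)
  show ?case
  \<comment> \<open>A repeated break point contributes 0 and is skipped, so that the new interval is
    never already a member of \<open>D\<close>.\<close>
  proof (cases "a = t")
    case True
    then show ?thesis using D by auto
  next
    case False
    have un: "{a..t} \<union> {t..b} = {a..b}" using at by auto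
    have "{{a..t}} division_of {a..t}"
      using division_of_self[of a t] at by (auto simp: cbox_interval)
    then have "{{a..t}} \<union> D division_of {a..b}"
      using division_disjoint_union[OF _ D(1), of "{{a..t}}" "{a..t}"] unfolding un
      by (simp add: interior_atLeastAtMost_real)
    moreover have "{a..t} \<notin> D"
    proof
      assume "{a..t} \<in> D"
      then have "{a..t} \<subseteq> {t..b}" using D(1) by (rule division_ofD(2)[rotated])
      then have "a \<in> {t..b}" using at by auto
      with at False show False by auto
    qed
    moreover have "finite D" using D(1) by auto
    ultimately show ?thesis
      using D(2) at by (intro exI[of _ "{{a..t}} \<union> D"]) auto
  qed
qed

definition variation :: "(real \<Rightarrow> real) \<Rightarrow> real \<Rightarrow> real \<Rightarrow> real" where
  "variation f a b = (SUP ts\<in>{ts. chain a ts b}. path_variation f a ts b)"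

text \<open>Absolute continuity at tolerance 1 bounds every variation sum over a stretch shorter
  than \<open>d\<close> by 1, and finitely many such stretches cover the interval.\<close>

lemma variation_bounded:
  assumes "absolutely_continuous_on {a..b} f" "a \<le> x" "x \<le> b"
  shows "\<exists>B. \<forall>ts. chain a ts x \<longrightarrow> path_variation f a ts x \<le> B"
proof -
  obtain d where d: "d > 0"
    "\<And>D T. D division_of T \<Longrightarrow> T \<subseteq> {a..b} \<Longrightarrow> (\<Sum>K\<in>D. measure lborel K) < d \<Longrightarrow>
       (\<Sum>K\<in>D. norm (f (Sup K) - f (Inf K))) < 1"
    using absolutely_continuous_onD[OF assms(1) zero_less_one] by blast
  have short: "path_variation f u ts v \<le> 1" if "chain u ts v" "a \<le> u" "v \<le> b" "v - u < d" for u v ts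
  proof -
    obtain D where D: "D division_of {u..v}" "path_variation f u ts v = (\<Sum>K\<in>D. \<bar>f (Sup K) - f (Inf K)\<bar>)"
      using chain_division[OF \<open>chain u ts v\<close>] by blast
    have "(\<Sum>K\<in>D. measure lborel K) = v - u"
      using additive_content_division[of D u v] D chain_le[OF that(1)] by (auto simp: cbox_interval)
    with d(2)[OF D(1)] D(2) that show ?thesis by auto
  qed
  \<comment> \<open>Steps of \<open>d/2\<close> keep each new stretch strictly shorter than
    \<open>d\<close>; the bound is \<open>Suc n\<close> because the start \<open>n = 0\<close>
    already costs 1.\<close>
  have "\<forall>y. a \<le> y \<longrightarrow> y \<le> b \<longrightarrow> y \<le> a + real n * (d/2) \<longrightarrow> (\<forall>ts. chain a ts y \<longrightarrow> path_variation f a ts y \<le> real (Suc n))" for n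
  proof (induction n)
    case 0
    then show ?case using short d(1) by auto
  next
    case (Suc n)
    show ?case
    proof (intro allI impI)
      fix y ts assume y: "a \<le> y" "y \<le> b" "y \<le> a + real (Suc n) * (d/2)" and c: "chain a ts y"
      define c' where "c' = min y (a + real n * (d/2))"
      have c': "a \<le> c'" "c' \<le> y" "c' \<le> a + real n * (d/2)" "y - c' < d"
        using y d(1) by (auto simp: c'_def min_def field_simps)
      obtain us ws where s: "chain a us c'" "chain c' ws y"
        "path_variation f a ts y \<le> path_variation f a us c' + path_variation f c' ws y"
        using chain_split[OF c c'(1,2)] by blast
      have "path_variation f a us c' \<le> real (Suc n)" using Suc s(1) c' y by auto
      moreover have "path_variation f c' ws y \<le> 1" using short[OF s(2)] c' y by auto
      ultimately show "path_variation f a ts y \<le> real (Suc (Suc n))" using s(3) by simp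
    qed
  qed
  moreover obtain n where "x - a \<le> real n * (d/2)"
    using reals_Archimedean3[of "d/2"] d(1) by (metis half_gt_zero less_imp_le)
  ultimately show ?thesis using assms(2,3) by (smt (verit, best))
qed

text \<open>Both facts need the suprema to be bounded on every subinterval, so they share one proof.
  Additivity follows by splitting a chain at \<open>x\<close> in one direction and concatenating two
  chains in the other.\<close>

lemma chain_subinterval_variation:
  assumes f: "absolutely_continuous_on {a..b} f" and "a \<le> x" "x \<le> y" "y \<le> b"
  shows variation_upper: "chain x ts y \<Longrightarrow> path_variation f x ts y \<le> variation f x y"
    and variation_add: "variation f a y = variation f a x + variation f x y"
proof -
  have bdd: "bdd_above ((\<lambda>ts. path_variation f u ts v) ` {ts. chain u ts v})"
    if "a \<le> u" "u \<le> v" "v \<le> b" for u v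
  proof -
    have "absolutely_continuous_on {u..v} f"
      by (rule absolutely_continuous_on_subset[OF f]) (use that in auto)
    from variation_bounded[OF this, of v] that show ?thesis
      unfolding bdd_above_def by auto
  qed
  have up: "chain u ts v \<Longrightarrow> path_variation f u ts v \<le> variation f u v" if "a \<le> u" "u \<le> v" "v \<le> b" for u v ts
    unfolding variation_def using bdd[OF that] by (intro cSUP_upper) auto
  have least: "variation f u v \<le> B" if "u \<le> v" "\<And>ts. chain u ts v \<Longrightarrow> path_variation f u ts v \<le> B" for u v B
    unfolding variation_def using that by (intro cSUP_least) (auto intro: exI[of _ "[]"])
  show "chain x ts y \<Longrightarrow> path_variation f x ts y \<le> variation f x y"
    using up assms by auto
  show "variation f a y = variation f a x + variation f x y"
  proof (rule antisym)
    show "variation f a y \<le> variation f a x + variation f x y"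
    proof (rule least)
      fix ts assume c: "chain a ts y"
      then obtain us ws where s: "chain a us x" "chain x ws y"
        "path_variation f a ts y \<le> path_variation f a us x + path_variation f x ws y"
        using chain_split[OF c assms(2,3)] by blast
      then show "path_variation f a ts y \<le> variation f a x + variation f x y"
        using up[OF _ _ _ s(1)] up[OF _ _ _ s(2)] assms by force
    qed (use assms in auto)
    have "variation f a x \<le> variation f a y - variation f x y"
    proof (rule least)
      fix us assume us: "chain a us x"
      have "variation f x y \<le> variation f a y - path_variation f a us x"
      proof (rule least)
        fix ws assume ws: "chain x ws y"
        have "path_variation f a (us @ x # ws) y \<le> variation f a y"
          using up chain_append[OF us ws] assms by auto
        then show "path_variation f x ws y \<le> variation f a y - path_variation f a us x"
          by (simp add: path_variation_append)
      qed (use assms in auto)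
      then show "path_variation f a us x \<le> variation f a y - variation f x y" by simp
    qed (use assms in auto)
    then show "variation f a x + variation f x y \<le> variation f a y" by simp
  qed
qed

lemma variation_approx:
  assumes f: "absolutely_continuous_on {a..b} f" and "a \<le> x" "x \<le> y" "y \<le> b" and e: "e > 0"
  obtains D where "D division_of {x..y}" "variation f x y < (\<Sum>K\<in>D. \<bar>f (Sup K) - f (Inf K)\<bar>) + e"
proof -
  have "\<exists>ts. chain x ts y" using assms by (auto intro: exI[of _ "[]"])
  then have "\<exists>ts. chain x ts y \<and> variation f x y - e < path_variation f x ts y"
    using less_cSupD[of "(\<lambda>ts. path_variation f x ts y) ` {ts. chain x ts y}" "variation f x y - e"] e
    unfolding variation_def by auto
  then obtain ts where ts: "chain x ts y" "variation f x y - e < path_variation f x ts y" by blast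
  obtain D where "D division_of {x..y}" "path_variation f x ts y = (\<Sum>K\<in>D. \<bar>f (Sup K) - f (Inf K)\<bar>)"
    using chain_division[OF ts(1)] by blast
  with ts(2) show thesis by (intro that[of D]) auto
qed

text \<open>Each interval of a short division is refined until its variation is nearly attained. The
  refinements together form a division of no greater length, so the hypothesis on \<open>f\<close>
  bounds their total increment.\<close>

lemma absolutely_continuous_on_variation:
  assumes f: "absolutely_continuous_on {a..b} f"
  shows "absolutely_continuous_on {a..b} (variation f a)"
  unfolding absolutely_continuous_on_def
proof (intro allI impI)
  fix e :: real assume e: "e > 0"
  obtain d where d: "d > 0"
    "\<And>D T. D division_of T \<Longrightarrow> T \<subseteq> {a..b} \<Longrightarrow> (\<Sum>K\<in>D. measure lborel K) < d \<Longrightarrow>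
       (\<Sum>K\<in>D. norm (f (Sup K) - f (Inf K))) < e/2"
    using absolutely_continuous_onD[OF f half_gt_zero[OF e]] by blast
  show "\<exists>d>0. \<forall>D T. D division_of T \<and> T \<subseteq> {a..b} \<and> (\<Sum>K\<in>D. measure lborel K) < d \<longrightarrow>
      (\<Sum>K\<in>D. norm (variation f a (Sup K) - variation f a (Inf K))) < e"
  proof (intro exI[of _ d] conjI allI impI)
    fix E T assume A: "E division_of T \<and> T \<subseteq> {a..b} \<and> (\<Sum>K\<in>E. measure lborel K) < d"
    then have E: "E division_of T" and T: "T \<subseteq> {a..b}" and l: "(\<Sum>K\<in>E. measure lborel K) < d" by auto
    have finE: "finite E" using E by auto
    \<comment> \<open>Error allowed per interval: all of them together cost at most e/2, and the
      added 1 covers an empty \<open>E\<close>.\<close>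
    define e' where "e' = e / (2 * (real (card E) + 1))"
    have e': "e' > 0" using e by (simp add: e'_def add_pos_nonneg)
    define inc where "inc K = \<bar>f (Sup K) - f (Inf K)\<bar>" for K
    have "\<exists>D. D division_of K \<and> norm (variation f a (Sup K) - variation f a (Inf K)) \<le> (\<Sum>K\<in>D. inc K) + e'"
      if K: "K \<in> E" for K
    proof -
      obtain u v where uv: "u \<le> v" "K = {u..v}" "Inf K = u" "Sup K = v" "u \<in> T" "v \<in> T"
        using division_of_real_memE[OF E K] by metis
      then have ab: "a \<le> u" "v \<le> b" using T by auto
      obtain D where D: "D division_of {u..v}" "variation f u v < (\<Sum>K\<in>D. inc K) + e'"
        using variation_approx[OF f ab(1) uv(1) ab(2) e'] unfolding inc_def by blast
      have "variation f a v = variation f a u + variation f u v"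
        by (rule variation_add[OF f ab(1) uv(1) ab(2)])
      moreover have "variation f u v \<ge> 0"
        using variation_upper[OF f ab(1) uv(1) ab(2), of "[]"] uv(1) by simp
      ultimately show ?thesis using D uv by (intro exI[of _ D]) auto
    qed
    then obtain DD where DD: "\<And>K. K \<in> E \<Longrightarrow> DD K division_of K"
      "\<And>K. K \<in> E \<Longrightarrow> norm (variation f a (Sup K) - variation f a (Inf K)) \<le> (\<Sum>K\<in>DD K. inc K) + e'"
      by metis
    have finD: "finite (DD K)" if "K \<in> E" for K using DD(1)[OF that] by auto
    \<comment> \<open>One-point intervals may belong to the refinements of two neighbours and would
      spoil the disjoint sum; they carry no increment and are dropped.\<close>
    define nd where "nd K = {L \<in> DD K. interior L \<noteq> {}}" for K
    have inc_nd: "(\<Sum>K\<in>DD K. inc K) = (\<Sum>K\<in>nd K. inc K)" if K: "K \<in> E" for K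
    proof (rule sum.mono_neutral_right[OF finD[OF K]])
      show "\<forall>L\<in>DD K - nd K. inc L = 0"
      proof
        fix L assume L: "L \<in> DD K - nd K"
        then obtain u v where uv: "u \<le> v" "L = {u..v}" "Inf L = u" "Sup L = v"
          using L division_of_real_memE[OF DD(1)[OF K], of L thesis] by (auto simp: nd_def)
        with L have "{u<..<v} = {}" by (auto simp: nd_def interior_atLeastAtMost_real simp del: greaterThanLessThan_empty_iff)
        then have "u = v" using uv(1) by (simp add: greaterThanLessThan_empty_iff)
        with uv show "inc L = 0" by (simp add: inc_def)
      qed
    qed (auto simp: nd_def)
    have disj: "nd K \<inter> nd K' = {}" if "K \<in> E" "K' \<in> E" "K \<noteq> K'" for K K'
    proof -
      have "interior K \<inter> interior K' = {}" using division_ofD(5)[OF E] that by blast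
      moreover have "interior L \<subseteq> interior K \<inter> interior K'" if "L \<in> nd K \<inter> nd K'" for L
        using that DD(1) \<open>K \<in> E\<close> \<open>K' \<in> E\<close> division_ofD(2) unfolding nd_def
        by (metis (no_types, lifting) Int_iff interior_mono le_inf_iff mem_Collect_eq)
      ultimately show ?thesis unfolding nd_def by blast
    qed
    have Uf: "finite (\<Union>K\<in>E. nd K)" using finE finD by (auto simp: nd_def)
    define P where "P = (\<Union>K\<in>E. nd K)"
    have P: "P division_of \<Union>P"
      unfolding division_of_def
    proof (intro conjI ballI impI)
      show "finite P" using Uf by (simp add: P_def)
      fix L assume L: "L \<in> P"
      then obtain K where K: "K \<in> E" "L \<in> DD K" by (auto simp: P_def nd_def)
      show "L \<subseteq> \<Union>P" "L \<noteq> {}" "\<exists>a b. L = cbox a b"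
        using L division_ofD(3,4)[OF DD(1)[OF K(1)] K(2)] by auto
      fix L' assume L': "L' \<in> P" "L \<noteq> L'"
      then obtain K' where K': "K' \<in> E" "L' \<in> DD K'" by (auto simp: P_def nd_def)
      show "interior L \<inter> interior L' = {}"
      proof (cases "K = K'")
        case True
        then show ?thesis using division_ofD(5)[OF DD(1)[OF K(1)] K(2)] K' L'(2) by auto
      next
        case False
        then have "interior K \<inter> interior K' = {}" using division_ofD(5)[OF E] K K' by blast
        moreover have "interior L \<subseteq> interior K" "interior L' \<subseteq> interior K'"
          using division_ofD(2)[OF DD(1)[OF K(1)] K(2)] division_ofD(2)[OF DD(1)[OF K'(1)] K'(2)]
          by (simp_all add: interior_mono)
        ultimately show ?thesis by blast
      qed
    qed auto
    have UP: "\<Union>P \<subseteq> {a..b}"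
    proof
      fix x assume "x \<in> \<Union>P"
      then obtain K L where K: "K \<in> E" "L \<in> DD K" "x \<in> L" by (auto simp: P_def nd_def)
      have "L \<subseteq> K" using division_ofD(2)[OF DD(1)[OF K(1)] K(2)] .
      moreover have "K \<subseteq> T" using division_ofD(2)[OF E K(1)] .
      ultimately show "x \<in> {a..b}" using K(3) T by blast
    qed
    have sumP: "(\<Sum>L\<in>P. g L) = (\<Sum>K\<in>E. \<Sum>L\<in>nd K. g L)" for g :: "real set \<Rightarrow> real"
      unfolding P_def using finE finD disj by (intro sum.UNION_disjoint) (auto simp: nd_def)
    have "(\<Sum>L\<in>P. measure lborel L) \<le> (\<Sum>K\<in>E. measure lborel K)"
      unfolding sumP
    proof (rule sum_mono)
      fix K assume K: "K \<in> E"
      obtain u v where uv: "u \<le> v" "K = {u..v}" using division_of_real_memE[OF E K] by metis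
      have "(\<Sum>L\<in>nd K. measure lborel L) \<le> (\<Sum>L\<in>DD K. measure lborel L)"
        using finD[OF K] by (intro sum_mono2) (auto simp: nd_def)
      also have "\<dots> = measure lborel K"
        using additive_content_division[of "DD K" u v] DD(1)[OF K] uv by (simp add: cbox_interval)
      finally show "(\<Sum>L\<in>nd K. measure lborel L) \<le> measure lborel K" .
    qed
    with l have "(\<Sum>L\<in>P. measure lborel L) < d" by simp
    from d(2)[OF P UP this] have small: "(\<Sum>L\<in>P. inc L) < e/2" by (simp add: inc_def)
    have "(\<Sum>K\<in>E. norm (variation f a (Sup K) - variation f a (Inf K)))
        \<le> (\<Sum>K\<in>E. (\<Sum>L\<in>nd K. inc L) + e')"
      using DD(2) inc_nd by (intro sum_mono) fastforce
    also have "\<dots> = (\<Sum>L\<in>P. inc L) + real (card E) * e'"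
      by (simp add: sum.distrib sumP)
    also have "\<dots> < e/2 + e/2"
    proof (rule add_less_le_mono[OF small])
      show "real (card E) * e' \<le> e/2"
        unfolding e'_def using e by (simp add: field_simps)
    qed
    finally show "(\<Sum>K\<in>E. norm (variation f a (Sup K) - variation f a (Inf K))) < e" by simp
  qed (use d in auto)
qed


section \<open>Absolutely continuous functions as indefinite integrals\<close>

lemma absolutely_continuous_mono_imp_integral:
  fixes F :: "real \<Rightarrow> real"
  assumes F: "absolutely_continuous_on {a..b} F" and mono: "mono_on {a..b} F" and ab: "a \<le> b"
  obtains g where "g absolutely_integrable_on {a..b}"
    "\<And>x. x \<in> {a..b} \<Longrightarrow> F x = F a + integral {a..x} g"
proof -
  \<comment> \<open>Clamping the argument gives a function that is monotone and continuous on the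
    whole line, as a Stieltjes measure needs, and constant outside the interval.\<close>
  define F' where "F' x = F (max a (min b x))" for x
  have clamp: "max a (min b x) \<in> {a..b}" for x using ab by auto
  have F'F: "F' x = F x" if "x \<in> {a..b}" for x using that by (auto simp: F'_def max_def min_def)
  have F'mono: "F' x \<le> F' y" if "x \<le> y" for x y
    unfolding F'_def using that by (intro mono_onD[OF mono]) (use ab in auto)
  have F'cont: "continuous_on UNIV F'"
    unfolding F'_def
    by (rule continuous_on_compose2[OF absolutely_continuous_on_imp_continuous_on[OF F]])
       (use ab in \<open>auto intro!: continuous_intros\<close>)
  \<comment> \<open>The Radon-Nikodym density of this measure is the derivative sought; the work
    lies in showing that Lebesgue null sets are null for it.\<close>
  define \<mu> where "\<mu> = interval_measure F'"
  have Icc: "emeasure \<mu> {u..v} = ennreal (F' v - F' u)" if "u \<le> v" for u v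
    unfolding \<mu>_def using emeasure_interval_measure_Icc[OF that F'mono F'cont] .
  have sets_\<mu>: "sets \<mu> = sets borel" by (simp add: \<mu>_def)
  have out: "emeasure \<mu> {..a} = 0" "emeasure \<mu> {b..} = 0"
  proof -
    have "{a - real n..a} \<in> null_sets \<mu>" for n
      using Icc[of "a - real n" a] by (intro null_setsI) (auto simp: F'_def sets_\<mu> max_def min_def)
    then have "(\<Union>n. {a - real n..a}) \<in> null_sets \<mu>" by (intro null_sets_UN)
    moreover have "(\<Union>n. {a - real n..a}) = {..a}"
    proof (intro set_eqI iffI)
      fix x assume "x \<in> {..a}"
      moreover obtain n where "a - x \<le> real n" using real_arch_simple by blast
      ultimately show "x \<in> (\<Union>n. {a - real n..a})" by (auto intro!: exI[of _ n])
    qed auto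
    ultimately show "emeasure \<mu> {..a} = 0" by auto
    have "{b..b + real n} \<in> null_sets \<mu>" for n
      using Icc[of b "b + real n"] by (intro null_setsI) (auto simp: F'_def sets_\<mu> max_def min_def)
    then have "(\<Union>n. {b..b + real n}) \<in> null_sets \<mu>" by (intro null_sets_UN)
    moreover have "(\<Union>n. {b..b + real n}) = {b..}"
    proof (intro set_eqI iffI)
      fix x assume "x \<in> {b..}"
      moreover obtain n where "x - b \<le> real n" using real_arch_simple by blast
      ultimately show "x \<in> (\<Union>n. {b..b + real n})" by (auto intro!: exI[of _ n])
    qed auto
    ultimately show "emeasure \<mu> {b..} = 0" by auto
  qed
  have ac: "absolutely_continuous lborel \<mu>"
    unfolding absolutely_continuous_def
  proof
    fix N :: "real set" assume N: "N \<in> null_sets lborel"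
    then have Nb: "N \<in> sets borel" and NL: "N \<in> null_sets lebesgue" by (auto intro: null_sets_completionI)
    have "emeasure \<mu> (N \<inter> {a<..<b}) \<le> 0"
    proof (rule ennreal_le_epsilon)
      fix e :: real assume e: "0 < e"
      obtain d where d: "d > 0"
        "\<And>D T. D division_of T \<Longrightarrow> T \<subseteq> {a..b} \<Longrightarrow> (\<Sum>K\<in>D. measure lborel K) < d \<Longrightarrow>
           (\<Sum>K\<in>D. norm (F (Sup K) - F (Inf K))) < e"
        using absolutely_continuous_onD[OF F e] by blast
      \<comment> \<open>The null set is enclosed in an open set of measure below \<open>d\<close>.
        That set is exhausted by finite unions of closed intervals, and over each of them absolute
        continuity of \<open>F\<close> bounds the Stieltjes measure by \<open>e\<close>.\<close>
      obtain U' where U': "open U'" "N \<subseteq> U'" "U' - N \<in> lmeasurable" "emeasure lebesgue (U' - N) < ennreal d"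
        using sets_lebesgue_outer_open[of N d] NL d(1) by blast
      define U where "U = U' \<inter> {a<..<b}"
      have Uo: "open U" using U' by (auto simp: U_def)
      have mT: "measure lebesgue T < d" if "compact T" "T \<subseteq> U" for T
      proof -
        have Tm: "T \<in> lmeasurable" using that by (intro lmeasurable_compact)
        have "emeasure lebesgue T \<le> emeasure lebesgue (U' - N) + emeasure lebesgue N"
          using that U' NL by (intro order_trans[OF emeasure_mono emeasure_subadditive]) (auto simp: U_def)
        then have "emeasure lebesgue T < ennreal d"
          using NL U'(4) by auto
        with Tm show ?thesis using d(1) by (simp add: emeasure_eq_measure2 ennreal_less_iff)
      qed
      have \<mu>T: "emeasure \<mu> (\<Union>\<C>) \<le> ennreal e"
        if C: "finite \<C>" "\<And>X. X \<in> \<C> \<Longrightarrow> \<exists>a b. X = cbox a b" "\<Union>\<C> \<subseteq> U" for \<C> :: "real set set"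
      proof -
        obtain D where D: "D division_of \<Union>\<C>" using elementary_unions_intervals[OF C(1,2)] by blast
        have Tc: "compact (\<Union>\<C>)" using D by (metis division_ofD(1,4,6) compact_Union compact_cbox)
        have Tm: "(\<Union>\<C>) \<in> lmeasurable" using Tc by (rule lmeasurable_compact)
        have "measure lebesgue (\<Union>\<C>) = (\<Sum>K\<in>D. measure lborel K)"
          using lmeasure_integral[OF Tm] integral_combine_division_topdown[OF _ D, of "\<lambda>_. 1::real"] Tm
          by (auto simp: lmeasurable_iff_integrable_on intro!: sum.cong elim!: division_of_real_memE[OF D])
        then have l: "(\<Sum>K\<in>D. measure lborel K) < d" using mT[OF Tc C(3)] by simp
        have sub: "\<Union>\<C> \<subseteq> {a..b}" using C(3) by (auto simp: U_def)
        have finD: "finite D" using D by auto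
        have "emeasure \<mu> (\<Union>\<C>) = emeasure \<mu> (\<Union>K\<in>D. K)" using D by auto
        also have "\<dots> \<le> (\<Sum>K\<in>D. emeasure \<mu> K)"
          using finD by (rule emeasure_subadditive_finite)
             (auto simp: sets_\<mu> elim!: division_of_real_memE[OF D])
        also have "\<dots> = (\<Sum>K\<in>D. ennreal (norm (F (Sup K) - F (Inf K))))"
        proof (rule sum.cong[OF refl])
          fix K assume "K \<in> D"
          then obtain u v where uv: "u \<le> v" "K = {u..v}" "Inf K = u" "Sup K = v" "{u..v} \<subseteq> \<Union>\<C>"
            using division_of_real_memE[OF D] by metis
          moreover have "u \<in> {u..v}" "v \<in> {u..v}" using uv(1) by auto
          ultimately have "u \<in> {a..b}" "v \<in> {a..b}" using sub by blast+
          with uv show "emeasure \<mu> K = ennreal (norm (F (Sup K) - F (Inf K)))"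
            using Icc[OF uv(1)] F'F mono_onD[OF mono, of u v] by simp
        qed
        also have "\<dots> = ennreal (\<Sum>K\<in>D. norm (F (Sup K) - F (Inf K)))"
          by (rule sum_ennreal) simp
        also have "\<dots> \<le> ennreal e" using d(2)[OF D sub l] by (intro ennreal_leI) simp
        finally show ?thesis .
      qed
      have "emeasure \<mu> U \<le> ennreal e"
      proof -
        obtain \<D> where \<D>: "countable \<D>" "\<D> \<subseteq> Pow U" "\<And>X. X \<in> \<D> \<Longrightarrow> \<exists>a b. X = cbox a b" "\<Union>\<D> = U"
          using open_countable_Union_open_cbox[OF Uo] by blast
        show ?thesis
        proof (cases "\<D> = {}")
          case True
          then show ?thesis using \<D>(4) by auto
        next
          case False
          define T where "T n = \<Union>(from_nat_into \<D> ` {..n})" for n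
          have inD: "from_nat_into \<D> k \<in> \<D>" for k using False by (rule from_nat_into)
          have "(\<Union>n. T n) = \<Union>(range (from_nat_into \<D>))" by (auto simp: T_def)
          also have "\<dots> = U" using False \<D> by (simp add: range_from_nat_into)
          finally have UT: "(\<Union>n. T n) = U" .
          have "T n \<in> sets borel" for n
          proof -
            have "from_nat_into \<D> k \<in> sets borel" for k
              using \<D>(3)[OF inD[of k]] by (metis borel_closed closed_cbox)
            then show ?thesis unfolding T_def by (intro sets.finite_Union) auto
          qed
          then have "(SUP n. emeasure \<mu> (T n)) = emeasure \<mu> (\<Union>n. T n)"
            by (intro SUP_emeasure_incseq) (force simp: sets_\<mu> incseq_def T_def)+
          moreover have "emeasure \<mu> (T n) \<le> ennreal e" for n
            unfolding T_def using inD \<D> by (intro \<mu>T) auto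
          ultimately show ?thesis by (metis UT SUP_least)
        qed
      qed
      moreover have "emeasure \<mu> (N \<inter> {a<..<b}) \<le> emeasure \<mu> U"
        using U' Uo by (intro emeasure_mono) (auto simp: U_def sets_\<mu>)
      ultimately show "emeasure \<mu> (N \<inter> {a<..<b}) \<le> 0 + ennreal e" by simp
    qed
    then have "N \<inter> {a<..<b} \<union> {..a} \<union> {b..} \<in> null_sets \<mu>"
      using Nb out by (intro null_sets.Un null_setsI) (auto simp: sets_\<mu>)
    then show "N \<in> null_sets \<mu>"
      by (rule null_sets_subset) (use Nb in \<open>auto simp: sets_\<mu>\<close>)
  qed
  obtain \<phi> where \<phi>[measurable]: "\<phi> \<in> borel_measurable lborel" and dens: "density lborel \<phi> = \<mu>"
    using sigma_finite_measure.Radon_Nikodym[OF lborel.sigma_finite_measure_axioms ac] sets_\<mu> by auto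
  have nn: "(\<integral>\<^sup>+x. \<phi> x * indicator {a..v} x \<partial>lborel) = ennreal (F v - F a)" if "v \<in> {a..b}" for v
  proof -
    have "(\<integral>\<^sup>+x. \<phi> x * indicator {a..v} x \<partial>lborel) = emeasure \<mu> {a..v}"
      unfolding dens[symmetric] by (subst emeasure_density) auto
    also have "\<dots> = ennreal (F v - F a)" using Icc[of a v] F'F that by auto
    finally show ?thesis .
  qed
  \<comment> \<open>On the interval the density has finite integral, hence is finite almost
    everywhere, so nothing is lost in passing to real values.\<close>
  define g where "g x = enn2real (\<phi> x)" for x
  have [measurable]: "g \<in> borel_measurable borel" unfolding g_def by measurable
  have fin: "AE x in lborel. \<phi> x * indicator {a..b} x \<noteq> \<infinity>"
    by (rule nn_integral_PInf_AE) (use nn[of b] ab in auto)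
  have bi: "has_bochner_integral lborel (\<lambda>x. indicator {a..v} x *\<^sub>R g x) (F v - F a)" if v: "v \<in> {a..b}" for v
  proof (rule has_bochner_integral_nn_integral)
    show "0 \<le> F v - F a" using mono_onD[OF mono, of a v] v by auto
    have "(\<integral>\<^sup>+x. ennreal (indicator {a..v} x *\<^sub>R g x) \<partial>lborel) = (\<integral>\<^sup>+x. \<phi> x * indicator {a..v} x \<partial>lborel)"
    proof (rule nn_integral_cong_AE)
      show "AE x in lborel. ennreal (indicator {a..v} x *\<^sub>R g x) = \<phi> x * indicator {a..v} x"
        using fin
      proof eventually_elim
        case (elim x)
        then show ?case using v by (auto simp: indicator_def g_def less_top)
      qed
    qed
    with nn[OF v] show "(\<integral>\<^sup>+x. ennreal (indicator {a..v} x *\<^sub>R g x) \<partial>lborel) = ennreal (F v - F a)" by simp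
  qed (auto simp: g_def)
  have si: "set_integrable lebesgue {a..v} g" "integral {a..v} g = F v - F a" if "v \<in> {a..b}" for v
  proof -
    have "integrable lborel (\<lambda>x. indicator {a..v} x *\<^sub>R g x)" "integral\<^sup>L lborel (\<lambda>x. indicator {a..v} x *\<^sub>R g x) = F v - F a"
      using bi[OF that] by (auto simp: has_bochner_integral_iff)
    then show 1: "set_integrable lebesgue {a..v} g"
      unfolding set_integrable_def by (intro integrable_completion[THEN iffD2]) auto
    have "(LINT x:{a..v}|lebesgue. g x) = F v - F a"
      using bi[OF that] unfolding set_lebesgue_integral_def by (subst integral_completion) (auto simp: has_bochner_integral_iff)
    with 1 show "integral {a..v} g = F v - F a" by (simp add: set_lebesgue_integral_eq_integral(2))
  qed
  show thesis
    using si ab by (intro that[of g]) auto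
qed

text \<open>Jordan decomposition: \<open>f\<close> is its variation minus another increasing
  function, and both are absolutely continuous.\<close>

lemma absolutely_continuous_real_imp_integral:
  fixes f :: "real \<Rightarrow> real"
  assumes f: "absolutely_continuous_on {a..b} f" and ab: "a \<le> b"
  obtains g where "g absolutely_integrable_on {a..b}"
    "\<And>x. x \<in> {a..b} \<Longrightarrow> f x = f a + integral {a..x} g"
proof -
  define v where "v = variation f a"
  define w where "w x = v x - f x" for x
  have v: "absolutely_continuous_on {a..b} v"
    unfolding v_def by (rule absolutely_continuous_on_variation[OF f])
  have w: "absolutely_continuous_on {a..b} w"
    by (rule absolutely_continuous_on_dominated[OF v f, where C=1]) (auto simp: w_def)
  have inc: "v y - v x \<ge> \<bar>f y - f x\<bar>" if "a \<le> x" "x \<le> y" "y \<le> b" for x y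
    using variation_add[OF f that] variation_upper[OF f that, of "[]"] that by (simp add: v_def)
  have "mono_on {a..b} v" "mono_on {a..b} w"
    using inc by (force simp: mono_on_def w_def)+
  then obtain gv gw where "gv absolutely_integrable_on {a..b}" "\<And>x. x \<in> {a..b} \<Longrightarrow> v x = v a + integral {a..x} gv"
    "gw absolutely_integrable_on {a..b}" "\<And>x. x \<in> {a..b} \<Longrightarrow> w x = w a + integral {a..x} gw"
    using absolutely_continuous_mono_imp_integral[OF v _ ab] absolutely_continuous_mono_imp_integral[OF w _ ab] by metis
  note g = this
  show thesis
  proof (rule that[of "\<lambda>x. gv x - gw x"])
    show "(\<lambda>x. gv x - gw x) absolutely_integrable_on {a..b}" using g by (intro set_integral_diff)
    fix x assume x: "x \<in> {a..b}"
    have "gv absolutely_integrable_on {a..x}" "gw absolutely_integrable_on {a..x}"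
      using x by (auto intro: set_integrable_subset[OF g(1)] set_integrable_subset[OF g(3)])
    then have "integral {a..x} (\<lambda>x. gv x - gw x) = integral {a..x} gv - integral {a..x} gw"
      by (intro Henstock_Kurzweil_Integration.integral_diff) (auto simp: absolutely_integrable_on_def)
    then show "f x = f a + integral {a..x} (\<lambda>x. gv x - gw x)"
      using g(2)[OF x] g(4)[OF x] by (simp add: w_def)
  qed
qed

lemma absolutely_continuous_imp_integral:
  fixes f :: "real \<Rightarrow> 'a::euclidean_space"
  assumes f: "absolutely_continuous_on {a..b} f" and ab: "a \<le> b"
  obtains g where "g absolutely_integrable_on {a..b}"
    "\<And>x. x \<in> {a..b} \<Longrightarrow> f x = f a + integral {a..x} g"
proof -
  have "\<exists>g. g absolutely_integrable_on {a..b} \<and> (\<forall>x\<in>{a..b}. f x \<bullet> i = f a \<bullet> i + integral {a..x} g)"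
    if "i \<in> Basis" for i
  proof -
    have "absolutely_continuous_on {a..b} (\<lambda>x. f x \<bullet> i)"
    proof (rule absolutely_continuous_on_dominated[OF f f, where C=1])
      fix x y
      have "norm (f y \<bullet> i - f x \<bullet> i) \<le> norm (f y - f x)"
        using Basis_le_norm[OF that, of "f y - f x"] by (simp add: inner_diff_left)
      also have "\<dots> \<le> 1 * (norm (f y - f x) + norm (f y - f x))" by simp
      finally show "norm (f y \<bullet> i - f x \<bullet> i) \<le> 1 * (norm (f y - f x) + norm (f y - f x))" .
    qed
    from absolutely_continuous_real_imp_integral[OF this ab] show ?thesis by metis
  qed
  then obtain g where g: "\<And>i. i \<in> Basis \<Longrightarrow> g i absolutely_integrable_on {a..b}"
    "\<And>i x. i \<in> Basis \<Longrightarrow> x \<in> {a..b} \<Longrightarrow> f x \<bullet> i = f a \<bullet> i + integral {a..x} (g i)"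
    by metis
  show thesis
  proof (rule that[of "\<lambda>x. \<Sum>i\<in>Basis. g i x *\<^sub>R i"])
    show "(\<lambda>x. \<Sum>i\<in>Basis. g i x *\<^sub>R i) absolutely_integrable_on {a..b}"
      using g(1) by (intro absolutely_integrable_sum absolutely_integrable_scaleR_right[of _ "\<lambda>_. _"] set_integrable_scaleR_left) auto
    fix x assume x: "x \<in> {a..b}"
    have "((\<lambda>x. \<Sum>i\<in>Basis. g i x *\<^sub>R i) has_integral (\<Sum>i\<in>Basis. integral {a..x} (g i) *\<^sub>R i)) {a..x}"
    proof (intro has_integral_sum has_integral_scaleR_left integrable_integral)
      fix i :: 'a assume "i \<in> Basis"
      have "g i absolutely_integrable_on {a..x}"
        using x by (intro set_integrable_subset[OF g(1)[OF \<open>i \<in> Basis\<close>]]) auto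
      then show "g i integrable_on {a..x}" by (simp add: absolutely_integrable_on_def)
    qed auto
    then have "integral {a..x} (\<lambda>x. \<Sum>i\<in>Basis. g i x *\<^sub>R i) = (\<Sum>i\<in>Basis. integral {a..x} (g i) *\<^sub>R i)"
      by (rule integral_unique)
    also have "\<dots> = (\<Sum>i\<in>Basis. (f x \<bullet> i - f a \<bullet> i) *\<^sub>R i)"
    proof (rule sum.cong[OF refl])
      fix i :: 'a assume "i \<in> Basis"
      from g(2)[OF this x] show "integral {a..x} (g i) *\<^sub>R i = (f x \<bullet> i - f a \<bullet> i) *\<^sub>R i" by simp
    qed
    also have "\<dots> = f x - f a"
      by (simp add: scaleR_diff_left sum_subtractf euclidean_representation)
    finally show "f x = f a + integral {a..x} (\<lambda>x. \<Sum>i\<in>Basis. g i x *\<^sub>R i)" by simp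
  qed
qed

section \<open>The fundamental theorem of calculus almost everywhere\<close>

lemma AE_lebesgue_iff_negligible: "(AE x in lebesgue. P x) \<longleftrightarrow> negligible {x. \<not> P x}"
  unfolding eventually_ae_filter_negligible by (auto intro: negligible_subset)

lemma AE_lebesgue_reflect:
  assumes "AE x::real in lebesgue. P x"
  shows "AE x in lebesgue. P (- x)"
proof -
  have "negligible (uminus ` {x. \<not> P x})"
    using assms unfolding AE_lebesgue_iff_negligible
    by (intro negligible_differentiable_image_negligible[OF order_refl]) (auto intro!: derivative_intros)
  moreover have "{x. \<not> P (- x)} \<subseteq> uminus ` {x. \<not> P x}" by force
  ultimately show ?thesis unfolding AE_lebesgue_iff_negligible by (rule negligible_subset)
qed

lemma absolutely_integrable_cong_AE:
  fixes f g :: "real \<Rightarrow> 'a::euclidean_space"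
  assumes "f absolutely_integrable_on S" "AE x in lebesgue. x \<in> S \<longrightarrow> f x = g x"
  shows "g absolutely_integrable_on S" "integral S g = integral S f"
proof -
  have N: "negligible {x. \<not> (x \<in> S \<longrightarrow> f x = g x)}" using assms(2) by (simp add: AE_lebesgue_iff_negligible)
  show "g absolutely_integrable_on S"
    by (rule absolutely_integrable_spike[OF assms(1) N]) auto
  show "integral S g = integral S f"
    by (rule integral_spike[OF N]) auto
qed

lemma integral_mono_AE_real:
  fixes f g :: "real \<Rightarrow> real"
  assumes f: "f absolutely_integrable_on S" and g: "g absolutely_integrable_on S"
    and le: "AE x in lebesgue. x \<in> S \<longrightarrow> f x \<le> g x"
  shows "integral S f \<le> integral S g"
proof -
  have N: "negligible {x. \<not> (x \<in> S \<longrightarrow> f x \<le> g x)}" using le by (simp add: AE_lebesgue_iff_negligible)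
  have "integral S (\<lambda>x. if x \<in> {x. \<not> (x \<in> S \<longrightarrow> f x \<le> g x)} then g x else f x) \<le> integral S g"
  proof (rule integral_le)
    have "f integrable_on S" using f by (simp add: absolutely_integrable_on_def)
    then show "(\<lambda>x. if x \<in> {x. \<not> (x \<in> S \<longrightarrow> f x \<le> g x)} then g x else f x) integrable_on S"
      by (rule integrable_spike[OF _ N]) simp
    show "g integrable_on S" using g by (simp add: absolutely_integrable_on_def)
  qed auto
  also have "integral S (\<lambda>x. if x \<in> {x. \<not> (x \<in> S \<longrightarrow> f x \<le> g x)} then g x else f x) = integral S f"
    by (rule integral_spike[OF N]) auto
  finally show ?thesis .
qed

lemma absolutely_continuous_on_deriv:
  fixes f :: "real \<Rightarrow> 'a::euclidean_space"
  assumes f: "absolutely_continuous_on {a..b} f" and ab: "a \<le> b"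
  shows "AE x in lebesgue. x \<in> {a<..<b} \<longrightarrow> (f has_vector_derivative vector_derivative f (at x)) (at x)"
    and "(\<lambda>x. vector_derivative f (at x)) absolutely_integrable_on {a..b}"
    and "x \<in> {a..b} \<Longrightarrow> integral {a..x} (\<lambda>x. vector_derivative f (at x)) = f x - f a"
proof -
  obtain g where g: "g absolutely_integrable_on {a..b}"
    "\<And>x. x \<in> {a..b} \<Longrightarrow> f x = f a + integral {a..x} g"
    using absolutely_continuous_imp_integral[OF f ab] by blast
  have ae: "AE x in lebesgue. x \<in> {a<..<b} \<longrightarrow> (f has_vector_derivative g x) (at x)"
    using AE_deriv_integral[OF g(1), of "f a"]
  proof eventually_elim
    case (elim x)
    show ?case
    proof
      assume x: "x \<in> {a<..<b}"
      show "(f has_vector_derivative g x) (at x)"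
      proof (rule has_vector_derivative_transform_within_open[OF elim[rule_format, OF x], of "{a<..<b}"])
        fix y assume "y \<in> {a<..<b}"
        then show "f a + integral {a..y} g = f y" by (intro g(2)[symmetric]) auto
      qed (use x in auto)
    qed
  qed
  then have eq: "AE x in lebesgue. x \<in> {a<..<b} \<longrightarrow> g x = vector_derivative f (at x)"
    by eventually_elim (auto simp: vector_derivative_at)
  have "AE x in lebesgue. x \<notin> {a, b}"
    by (simp add: AE_lebesgue_iff_negligible negligible_finite)
  with eq have eq': "AE x in lebesgue. x \<in> {a..b} \<longrightarrow> g x = vector_derivative f (at x)"
    by eventually_elim force
  show "AE x in lebesgue. x \<in> {a<..<b} \<longrightarrow> (f has_vector_derivative vector_derivative f (at x)) (at x)"
    using ae by eventually_elim (auto simp: vector_derivative_at)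
  show "(\<lambda>x. vector_derivative f (at x)) absolutely_integrable_on {a..b}"
    by (rule absolutely_integrable_cong_AE[OF g(1) eq'])
  assume x: "x \<in> {a..b}"
  have 1: "g absolutely_integrable_on {a..x}" by (rule set_integrable_subset[OF g(1)]) (use x in auto)
  have 2: "AE y in lebesgue. y \<in> {a..x} \<longrightarrow> g y = vector_derivative f (at y)"
    using eq' by eventually_elim (use x in auto)
  show "integral {a..x} (\<lambda>x. vector_derivative f (at x)) = f x - f a"
    using g(2)[OF x] absolutely_integrable_cong_AE(2)[OF 1 2] by simp
qed

lemma absolutely_continuous_FTC:
  fixes f :: "real \<Rightarrow> 'a::euclidean_space"
  assumes f: "absolutely_continuous_on {a..b} f" and ab: "a \<le> b"
    and f': "AE x in lebesgue. x \<in> {a<..<b} \<longrightarrow> (f has_vector_derivative f' x) (at x)"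
  shows "f' absolutely_integrable_on {a..b}" "integral {a..b} f' = f b - f a"
proof -
  have "AE x in lebesgue. x \<notin> {a, b}"
    by (simp add: AE_lebesgue_iff_negligible negligible_finite)
  with f' have "AE x in lebesgue. x \<in> {a..b} \<longrightarrow> vector_derivative f (at x) = f' x"
    by eventually_elim (force simp: vector_derivative_at)
  from absolutely_integrable_cong_AE[OF absolutely_continuous_on_deriv(2)[OF f ab] this]
  show "f' absolutely_integrable_on {a..b}" "integral {a..b} f' = f b - f a"
    using absolutely_continuous_on_deriv(3)[OF f ab, of b] ab by auto
qed

lemma absolutely_continuous_on_linear:
  assumes "bounded_linear h" "absolutely_continuous_on S f"
  shows "absolutely_continuous_on S (\<lambda>x. h (f x))"
proof -
  interpret bounded_linear h by fact
  obtain K where K: "\<And>x. norm (h x) \<le> norm x * K" using bounded by blast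
  have "norm (h (f y) - h (f x)) \<le> \<bar>K\<bar> * (norm (f y - f x) + norm (f y - f x))" for x y
  proof -
    have "norm (h (f y) - h (f x)) \<le> norm (f y - f x) * K" using K[of "f y - f x"] by (simp add: diff)
    also have "\<dots> \<le> norm (f y - f x) * \<bar>K\<bar>" by (intro mult_left_mono) auto
    also have "\<dots> \<le> \<bar>K\<bar> * (norm (f y - f x) + norm (f y - f x))" by (simp add: algebra_simps)
    finally show ?thesis .
  qed
  then show ?thesis by (rule absolutely_continuous_on_dominated[OF assms(2,2)])
qed

lemma absolutely_continuous_on_add:
  assumes "absolutely_continuous_on S f" "absolutely_continuous_on S g"
  shows "absolutely_continuous_on S (\<lambda>x. f x + g x)"
  by (rule absolutely_continuous_on_dominated[OF assms, of _ 1])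
     (simp add: norm_diff_triangle_ineq[THEN order_trans] norm_triangle_ineq add_diff_add)

lemma absolutely_continuous_on_const: "absolutely_continuous_on S (\<lambda>x. c)"
  unfolding absolutely_continuous_on_def by (auto intro: exI[of _ 1])

lemma absolutely_continuous_on_bilinear:
  assumes "bounded_bilinear h" and f: "absolutely_continuous_on {a..b} f" and g: "absolutely_continuous_on {a..b} g"
  shows "absolutely_continuous_on {a..b} (\<lambda>x. h (f x) (g x))"
proof -
  interpret bounded_bilinear h by fact
  obtain K where K: "K > 0" "\<And>x y. norm (h x y) \<le> norm x * norm y * K" using pos_bounded by blast
  have "bounded (f ` {a..b})" "bounded (g ` {a..b})"
    using f g by (auto intro!: compact_imp_bounded compact_continuous_image absolutely_continuous_on_imp_continuous_on)
  then obtain Cf Cg where C: "\<And>x. x \<in> {a..b} \<Longrightarrow> norm (f x) \<le> Cf" "\<And>x. x \<in> {a..b} \<Longrightarrow> norm (g x) \<le> Cg" "Cf > 0" "Cg > 0"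
    unfolding bounded_pos by (metis imageI)
  show ?thesis
  proof (rule absolutely_continuous_on_dominated[OF f g, of _ "K * (Cf + Cg)"])
    fix x y assume x: "x \<in> {a..b}" and y: "y \<in> {a..b}"
    have "h (f y) (g y) - h (f x) (g x) = h (f y - f x) (g y) + h (f x) (g y - g x)"
      by (simp add: diff_left diff_right)
    then have "norm (h (f y) (g y) - h (f x) (g x)) \<le> norm (f y - f x) * norm (g y) * K + norm (f x) * norm (g y - g x) * K"
      using K(2) by (metis (no_types, lifting) add_mono norm_triangle_le)
    also have "\<dots> \<le> norm (f y - f x) * Cg * K + Cf * norm (g y - g x) * K"
      using C x y K(1) by (intro add_mono mult_right_mono mult_left_mono) auto
    also have "\<dots> \<le> norm (f y - f x) * (Cf + Cg) * K + (Cf + Cg) * norm (g y - g x) * K"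
      using C(3,4) K(1) by (intro add_mono mult_right_mono mult_left_mono) auto
    also have "\<dots> = K * (Cf + Cg) * (norm (f y - f x) + norm (g y - g x))" by (simp add: algebra_simps)
    finally show "norm (h (f y) (g y) - h (f x) (g x)) \<le> K * (Cf + Cg) * (norm (f y - f x) + norm (g y - g x))" .
  qed
qed

lemma absolutely_continuous_on_compose_C1:
  fixes f :: "real \<Rightarrow> real"
  assumes f: "absolutely_continuous_on {a..b} f" and sub: "f ` {a..b} \<subseteq> {l..u}"
    and d: "\<And>y. y \<in> {l..u} \<Longrightarrow> (\<phi> has_real_derivative \<phi>' y) (at y)" and c: "continuous_on {l..u} \<phi>'"
  shows "absolutely_continuous_on {a..b} (\<lambda>x. \<phi> (f x))"
proof -
  have "bounded (\<phi>' ` {l..u})" using c by (intro compact_imp_bounded compact_continuous_image) auto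
  then obtain C where C: "\<And>y. y \<in> {l..u} \<Longrightarrow> norm (\<phi>' y) \<le> C" "C > 0" unfolding bounded_pos by (metis imageI)
  show ?thesis
  proof (rule absolutely_continuous_on_dominated[OF f f, of _ C])
    fix x y assume "x \<in> {a..b}" "y \<in> {a..b}"
    then have xy: "f x \<in> {l..u}" "f y \<in> {l..u}" using sub by blast+
    have "norm (\<phi> (f y) - \<phi> (f x)) \<le> C * norm (f y - f x)"
      by (rule field_differentiable_bound[where S="{l..u}" and f'=\<phi>'])
         (use xy C d in \<open>auto intro: has_field_derivative_at_within\<close>)
    also have "\<dots> \<le> C * (norm (f y - f x) + norm (f y - f x))" using C(2) by simp
    finally show "norm (\<phi> (f y) - \<phi> (f x)) \<le> C * (norm (f y - f x) + norm (f y - f x))" .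
  qed
qed

text \<open>The integral representation is reflected instead of the divisions.\<close>

lemma absolutely_continuous_on_reflect:
  fixes f :: "real \<Rightarrow> 'a::euclidean_space"
  assumes f: "absolutely_continuous_on {-b..-a} f"
  shows "absolutely_continuous_on {a..b} (\<lambda>x. f (- x))"
proof (cases "a \<le> b")
  case True
  then have ab: "-b \<le> -a" by simp
  obtain g where g: "g absolutely_integrable_on {-b..-a}"
    "\<And>x. x \<in> {-b..-a} \<Longrightarrow> f x = f (-b) + integral {-b..x} g"
    using absolutely_continuous_imp_integral[OF f ab] by blast
  have gr: "(\<lambda>x. g (- x)) absolutely_integrable_on {a..b}"
    using g(1) absolutely_integrable_reflect_real[where f=g and a="-b" and b="-a"] by simp
  have eq: "f (- x) = f (- a) + integral {a..x} (\<lambda>x. - g (- x))" if x: "x \<in> {a..b}" for x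
  proof -
    have gi: "g integrable_on {-b..-a}" using g(1) by (auto simp: absolutely_integrable_on_def)
    have "integral {-b..-x} g + integral {-x..-a} g = integral {-b..-a} g"
      using x gi by (intro Henstock_Kurzweil_Integration.integral_combine) auto
    moreover have "integral {a..x} (\<lambda>x. g (- x)) = integral {-x..-a} g"
      using Henstock_Kurzweil_Integration.integral_reflect_real[where f=g and a="-x" and b="-a"] by simp
    moreover have "f (-x) = f (-b) + integral {-b..-x} g" "f (-a) = f (-b) + integral {-b..-a} g"
      using g(2)[of "-x"] g(2)[of "-a"] x by auto
    ultimately show ?thesis by (simp add: algebra_simps)
  qed
  have "absolutely_continuous_on {a..b} (\<lambda>x. f (- a) + integral {a..x} (\<lambda>x. - g (- x)))"
    using gr by (intro absolutely_continuous_on_integral) (auto simp: set_integrable_def)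
  then show ?thesis using eq absolutely_continuous_on_cong[of "{a..b}"] by (metis (no_types, lifting))
next
  case False
  then have "{a..b} = {}" by auto
  then show ?thesis by (auto simp: absolutely_continuous_on_def intro: exI[of _ 1])
qed

section \<open>Half-lines\<close>

text \<open>Both half-lines have the finite end 0, so most arguments treat them together; those that
  depend on orientation are proved on \<open>{0..}\<close> and transferred by reflection.\<close>

definition half_line :: "real set \<Rightarrow> bool" where
  "half_line I \<longleftrightarrow> I = {0..} \<or> I = {..0}"

lemma interior_half_line: "half_line I \<Longrightarrow> interior I = I - {0}"
  unfolding half_line_def by auto

lemma half_line_segment: "half_line I \<Longrightarrow> a \<in> I \<Longrightarrow> b \<in> I \<Longrightarrow> {a..b} \<subseteq> I"
  unfolding half_line_def by auto

lemma half_line_0: "half_line I \<Longrightarrow> 0 \<in> I"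
  unfolding half_line_def by auto

lemma half_line_measurable: "half_line I \<Longrightarrow> I \<in> sets borel" "half_line I \<Longrightarrow> I \<in> sets lebesgue"
  unfolding half_line_def by auto

lemma AE_interior_half_line: "half_line I \<Longrightarrow> AE x in lebesgue. x \<in> I \<longrightarrow> x \<in> interior I"
proof -
  assume I: "half_line I"
  have "{x. \<not> (x \<in> I \<longrightarrow> x \<in> interior I)} \<subseteq> {0}" unfolding interior_half_line[OF I] by blast
  then show ?thesis unfolding AE_lebesgue_iff_negligible by (rule negligible_subset[OF negligible_sing])
qed

text \<open>Countably many segments exhaust the half-line, so their exceptional sets still form a
  null set.\<close>

lemma AE_half_line_segments:
  assumes I: "half_line I" and P: "\<And>a b. {a..b} \<subseteq> I \<Longrightarrow> a \<le> b \<Longrightarrow> AE x in lebesgue. x \<in> {a<..<b} \<longrightarrow> P x"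
  shows "AE x in lebesgue. x \<in> I \<longrightarrow> P x"
proof -
  have "AE x in lebesgue. \<forall>n. x \<in> I \<inter> {-real n<..<real n} \<longrightarrow> x \<noteq> 0 \<longrightarrow> P x"
    unfolding AE_all_countable
  proof
    fix n
    show "AE x in lebesgue. x \<in> I \<inter> {-real n<..<real n} \<longrightarrow> x \<noteq> 0 \<longrightarrow> P x"
      using P[of 0 "real n"] P[of "-real n" 0] I unfolding half_line_def by (auto elim!: eventually_mono)
  qed
  moreover have "AE x in lebesgue. x \<notin> {0::real}"
    by (simp add: AE_lebesgue_iff_negligible)
  ultimately show ?thesis
  proof eventually_elim
    case (elim x)
    obtain n where "\<bar>x\<bar> < real n" using reals_Archimedean2 by blast
    then have "x \<in> {-real n<..<real n}" by auto
    with elim show ?case by blast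
  qed
qed

lemma AC_subset: "AC I f \<Longrightarrow> {a..b} \<subseteq> I \<Longrightarrow> absolutely_continuous_on {a..b} f"
  unfolding AC_def by blast

lemma AC_linear: "bounded_linear h \<Longrightarrow> AC I f \<Longrightarrow> AC I (\<lambda>x. h (f x))"
  unfolding AC_def by (blast intro: absolutely_continuous_on_linear)

lemma AC_add: "AC I f \<Longrightarrow> AC I g \<Longrightarrow> AC I (\<lambda>x. f x + g x)"
  unfolding AC_def by (blast intro: absolutely_continuous_on_add)

lemma AC_const: "AC I (\<lambda>x. c)"
  unfolding AC_def by (blast intro: absolutely_continuous_on_const)

lemma AC_bilinear: "bounded_bilinear h \<Longrightarrow> AC I f \<Longrightarrow> AC I g \<Longrightarrow> AC I (\<lambda>x. h (f x) (g x))"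
  unfolding AC_def by (blast intro: absolutely_continuous_on_bilinear)

lemma AC_cong: "(\<And>x. x \<in> I \<Longrightarrow> f x = g x) \<Longrightarrow> AC I f \<longleftrightarrow> AC I g"
  unfolding AC_def using absolutely_continuous_on_cong by (metis subsetD)

lemma AC_continuous_on:
  assumes I: "half_line I" and f: "AC I f"
  shows "continuous_on I f"
proof -
  have "isCont f x \<or> continuous (at x within I) f" if x: "x \<in> I" for x
  proof -
    define S where "S = (if I = {0..} then {0..\<bar>x\<bar>+1} else {-\<bar>x\<bar>-1..0})"
    have S: "x \<in> S" "S \<subseteq> I" "I \<inter> {-\<bar>x\<bar>-1<..<\<bar>x\<bar>+1} \<subseteq> S"
      using I x unfolding half_line_def S_def by (auto split: if_splits)
    have "continuous_on S f"
    proof (cases "I = {0..}")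
      case True
      then have "S = {0..\<bar>x\<bar>+1}" by (simp add: S_def)
      then show ?thesis using AC_subset[OF f] S(2) absolutely_continuous_on_imp_continuous_on by metis
    next
      case False
      then have "S = {-\<bar>x\<bar>-1..0}" by (simp add: S_def)
      then show ?thesis using AC_subset[OF f] S(2) absolutely_continuous_on_imp_continuous_on by metis
    qed
    then have "continuous (at x within S) f" using S(1) by (simp add: continuous_on_eq_continuous_within)
    moreover have "at x within S = at x within I"
      by (rule at_within_nhd[of x "{-\<bar>x\<bar>-1<..<\<bar>x\<bar>+1}"]) (use S in auto)
    ultimately show ?thesis by simp
  qed
  then show ?thesis
    unfolding continuous_on_eq_continuous_within using continuous_at_imp_continuous_within by blast
qed

text \<open>The derivative within \<open>I\<close>, in which solutions are defined, and the
  two-sided one agree off the end point 0. This is the passage between the definition of a solution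
  and ordinary calculus.\<close>

lemma AC_deriv_AE:
  fixes f :: "real \<Rightarrow> 'a::euclidean_space"
  assumes I: "half_line I" and f: "AC I f"
  shows "AE x in lebesgue. x \<in> I \<longrightarrow> (f has_vector_derivative vector_derivative f (at x within I)) (at x)"
proof -
  have "AE x in lebesgue. x \<in> I \<longrightarrow> (f has_vector_derivative vector_derivative f (at x)) (at x)"
    by (rule AE_half_line_segments[OF I]) (use AC_subset[OF f] absolutely_continuous_on_deriv(1) in blast)
  with AE_interior_half_line[OF I] show ?thesis
    by eventually_elim (simp add: at_within_interior[of _ I])
qed

lemma AC_deriv_unique_AE:
  fixes f :: "real \<Rightarrow> 'a::euclidean_space"
  assumes I: "half_line I" and f: "AE x in lebesgue. x \<in> I \<longrightarrow> (f has_vector_derivative f' x) (at x)"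
  shows "AE x in lebesgue. x \<in> I \<longrightarrow> vector_derivative f (at x within I) = f' x"
  using f AE_interior_half_line[OF I]
  by eventually_elim (simp add: at_within_interior[of _ I] vector_derivative_at)

lemma AC_FTC:
  fixes f :: "real \<Rightarrow> 'a::euclidean_space"
  assumes f: "AC I f" and ab: "a \<le> b" "{a..b} \<subseteq> I"
    and f': "AE x in lebesgue. x \<in> I \<longrightarrow> (f has_vector_derivative f' x) (at x)"
  shows "f' absolutely_integrable_on {a..b}" "integral {a..b} f' = f b - f a"
proof -
  have "AE x in lebesgue. x \<in> {a<..<b} \<longrightarrow> (f has_vector_derivative f' x) (at x)"
    using f' by eventually_elim (use ab(2) atLeastAtMost_iff in \<open>force simp: subset_iff\<close>)
  from absolutely_continuous_FTC[OF AC_subset[OF f ab(2)] ab(1) this]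
  show "f' absolutely_integrable_on {a..b}" "integral {a..b} f' = f b - f a" by auto
qed

lemma L1_locD: "L1_loc I f \<Longrightarrow> {a..b} \<subseteq> I \<Longrightarrow> f absolutely_integrable_on {a..b}"
  unfolding L1_loc_def by blast

lemma L1_loc_reflect:
  fixes f :: "real \<Rightarrow> 'a::euclidean_space"
  assumes "L1_loc {..0} f" shows "L1_loc {0..} (\<lambda>x. f (- x))"
  unfolding L1_loc_def
proof (intro allI impI)
  fix a b :: real assume "{a..b} \<subseteq> {0..}"
  then have "{-b..-a} \<subseteq> {..0}" by auto
  from L1_locD[OF assms this] show "(\<lambda>x. f (- x)) absolutely_integrable_on {a..b}"
    using absolutely_integrable_reflect_real[where f=f and a="-b" and b="-a"] by simp
qed

lemma AC_reflect:
  fixes f :: "real \<Rightarrow> 'a::euclidean_space"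
  assumes "AC {0..} f" shows "AC {..0} (\<lambda>x. f (- x))"
  unfolding AC_def
proof (intro allI impI)
  fix a b :: real assume "{a..b} \<subseteq> {..0}"
  then have "{-b..-a} \<subseteq> {0..}" by auto
  from AC_subset[OF assms this] show "absolutely_continuous_on {a..b} (\<lambda>x. f (- x))"
    by (rule absolutely_continuous_on_reflect)
qed

lemma L1_loc_integral:
  fixes g :: "real \<Rightarrow> 'a::euclidean_space"
  assumes g: "L1_loc {0..} g"
  shows "AC {0..} (\<lambda>x. c + integral {0..x} g)"
    and "AE x in lebesgue. x \<in> {0..} \<longrightarrow> ((\<lambda>x. c + integral {0..x} g) has_vector_derivative g x) (at x)"
proof -
  show "AC {0..} (\<lambda>x. c + integral {0..x} g)"
    unfolding AC_def
  proof (intro allI impI)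
    fix a b :: real assume "{a..b} \<subseteq> {0..}"
    then have sub: "{a..b} \<subseteq> {0..b}" by auto
    have "absolutely_continuous_on {0..b} (\<lambda>x. c + integral {0..x} g)"
      by (intro absolutely_continuous_on_integral L1_locD[OF g]) auto
    then show "absolutely_continuous_on {a..b} (\<lambda>x. c + integral {0..x} g)"
      by (rule absolutely_continuous_on_subset[OF _ sub])
  qed
  have "half_line {0..}" by (simp add: half_line_def)
  then show "AE x in lebesgue. x \<in> {0..} \<longrightarrow> ((\<lambda>x. c + integral {0..x} g) has_vector_derivative g x) (at x)"
  proof (rule AE_half_line_segments)
    fix a b :: real assume ab: "{a..b} \<subseteq> {0..}" "a \<le> b"
    have "AE x in lebesgue. x \<in> {0<..<b} \<longrightarrow> ((\<lambda>x. c + integral {0..x} g) has_vector_derivative g x) (at x)"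
      by (intro AE_deriv_integral L1_locD[OF g]) auto
    then show "AE x in lebesgue. x \<in> {a<..<b} \<longrightarrow> ((\<lambda>x. c + integral {0..x} g) has_vector_derivative g x) (at x)"
      by eventually_elim (use ab in auto)
  qed
qed

section \<open>Complex matrices and positive semi-definite forms\<close>

lemma bounded_bilinear_matrix_vector:
  "bounded_bilinear ((*v) :: complex ^ 'n ^ 'm \<Rightarrow> complex ^ 'n \<Rightarrow> complex ^ 'm)"
  unfolding bilinear_conv_bounded_bilinear[symmetric] bilinear_def linear_iff
  by (auto simp: vec_eq_iff matrix_vector_mult_def sum.distrib algebra_simps scaleR_sum_right)

lemma bounded_bilinear_matrix_matrix:
  "bounded_bilinear ((**) :: complex ^ 'n ^ 'm \<Rightarrow> complex ^ 'k ^ 'n \<Rightarrow> complex ^ 'k ^ 'm)"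
  unfolding bilinear_conv_bounded_bilinear[symmetric] bilinear_def linear_iff
  by (auto simp: vec_eq_iff matrix_matrix_mult_def sum.distrib algebra_simps scaleR_sum_right)

lemma bounded_bilinear_cdot: "bounded_bilinear (cdot :: complex ^ 'n \<Rightarrow> complex ^ 'n \<Rightarrow> complex)"
  unfolding bilinear_conv_bounded_bilinear[symmetric] bilinear_def linear_iff
  by (auto simp: cdot_def sum.distrib algebra_simps scaleR_sum_right)

lemma bounded_linear_ctranspose: "bounded_linear (ctranspose :: complex ^ 'n ^ 'm \<Rightarrow> complex ^ 'm ^ 'n)"
  unfolding linear_conv_bounded_linear[symmetric] linear_iff
  by (auto simp: vec_eq_iff ctranspose_def transpose_def map_matrix_def)

lemmas cdot_simps =
  bounded_bilinear.add_left[OF bounded_bilinear_cdot] bounded_bilinear.add_right[OF bounded_bilinear_cdot]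
  bounded_bilinear.diff_left[OF bounded_bilinear_cdot] bounded_bilinear.diff_right[OF bounded_bilinear_cdot]
  bounded_bilinear.minus_left[OF bounded_bilinear_cdot] bounded_bilinear.minus_right[OF bounded_bilinear_cdot]
  bounded_bilinear.zero_left[OF bounded_bilinear_cdot] bounded_bilinear.zero_right[OF bounded_bilinear_cdot]

lemmas mv_simps =
  bounded_bilinear.add_left[OF bounded_bilinear_matrix_vector] bounded_bilinear.add_right[OF bounded_bilinear_matrix_vector]
  bounded_bilinear.diff_left[OF bounded_bilinear_matrix_vector] bounded_bilinear.diff_right[OF bounded_bilinear_matrix_vector]
  bounded_bilinear.minus_left[OF bounded_bilinear_matrix_vector] bounded_bilinear.minus_right[OF bounded_bilinear_matrix_vector]
  bounded_bilinear.zero_left[OF bounded_bilinear_matrix_vector] bounded_bilinear.zero_right[OF bounded_bilinear_matrix_vector]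

lemma cdot_scale_right: "cdot u (c *s v) = c * cdot u v"
  by (simp add: cdot_def sum_distrib_left algebra_simps)

lemma cdot_scale_left: "cdot (c *s u) v = cnj c * cdot u v"
  by (simp add: cdot_def sum_distrib_left algebra_simps)

lemma cnj_cdot: "cnj (cdot u v) = cdot v u"
  by (simp add: cdot_def mult.commute)

lemma cdot_axis: "cdot (axis i 1) w = w $ i"
proof -
  have "cdot (axis i 1) w = (\<Sum>j\<in>UNIV. if j = i then w $ j else 0)"
    unfolding cdot_def by (intro sum.cong) (auto simp: axis_def)
  then show ?thesis by simp
qed

lemma matrix_vector_mult_axis: "((M :: complex ^ 'n ^ 'm) *v axis i 1) $ k = M $ k $ i"
  by (simp add: matrix_vector_mult_def axis_def if_distrib cong: if_cong)

lemma cdot_ctranspose: "cdot u (M *v v) = cdot (ctranspose M *v u) v"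
proof -
  have "cdot u (M *v v) = (\<Sum>i\<in>UNIV. \<Sum>j\<in>UNIV. cnj (u $ i) * (M $ i $ j * v $ j))"
    by (simp add: cdot_def matrix_vector_mult_def sum_distrib_left)
  also have "\<dots> = (\<Sum>j\<in>UNIV. \<Sum>i\<in>UNIV. cnj (u $ i) * (M $ i $ j * v $ j))" by (rule sum.swap)
  also have "\<dots> = cdot (ctranspose M *v u) v"
    by (simp add: cdot_def matrix_vector_mult_def ctranspose_def transpose_def map_matrix_def
        sum_distrib_right sum_distrib_left mult_ac)
  finally show ?thesis .
qed

lemma ctranspose_ctranspose [simp]: "ctranspose (ctranspose M) = M"
  by (simp add: vec_eq_iff ctranspose_def transpose_def map_matrix_def)

lemma ctranspose_linear:
  "ctranspose (c *\<^sub>R M) = c *\<^sub>R ctranspose M" "ctranspose (M + N) = ctranspose M + ctranspose N"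
  "ctranspose (M - N) = ctranspose M - ctranspose N" "ctranspose (- M) = - ctranspose M" "ctranspose 0 = 0"
  by (simp_all add: vec_eq_iff ctranspose_def transpose_def map_matrix_def)

lemma ctranspose_mult: "ctranspose (A ** B) = ctranspose B ** ctranspose A"
  by (simp add: vec_eq_iff ctranspose_def transpose_def map_matrix_def matrix_matrix_mult_def mult.commute)

lemma hermitian_cdot: "hermitian M \<Longrightarrow> cdot u (M *v v) = cdot (M *v u) v"
  by (simp add: cdot_ctranspose hermitian_def)

lemma hermitian_cdot_cnj: "hermitian M \<Longrightarrow> cdot v (M *v u) = cnj (cdot u (M *v v))"
  by (metis cnj_cdot hermitian_cdot)

lemma cdot_self: "cdot u u = of_real ((norm u)\<^sup>2)"
proof -
  have "cdot u u = (\<Sum>i\<in>UNIV. of_real ((norm (u $ i))\<^sup>2))"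
    unfolding cdot_def by (intro sum.cong refl) (simp add: complex_norm_square mult.commute del: of_real_power)
  also have "\<dots> = of_real ((norm u)\<^sup>2)"
    by (simp add: norm_vec_def L2_set_def sum_nonneg)
  finally show ?thesis .
qed

lemma norm_cdot_le: "norm (cdot u v) \<le> norm u * norm v"
proof -
  have "norm (cdot u v) \<le> (\<Sum>i\<in>UNIV. norm (u $ i) * norm (v $ i))"
    unfolding cdot_def by (rule order_trans[OF norm_sum]) (simp add: norm_mult)
  also have "\<dots> \<le> norm u * norm v"
    unfolding norm_vec_def using L2_set_mult_ineq[of "\<lambda>i. norm (u $ i)" "\<lambda>i. norm (v $ i)" UNIV] by simp
  finally show ?thesis .
qed

text \<open>With \<open>n\<close> the squared modulus of an off-diagonal entry this is the
  discriminant criterion. It serves the Cauchy-Schwarz inequality for matrices and again for the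
  weighted space of functions.\<close>

lemma discriminant_nonpos:
  fixes a n c :: real
  assumes nonneg: "\<And>t. 0 \<le> a - 2 * t * n + t\<^sup>2 * n * c" and "n \<ge> 0" "c \<ge> 0"
  shows "n \<le> a * c"
proof (cases "c = 0")
  case True
  show ?thesis
  proof (rule ccontr)
    assume "\<not> n \<le> a * c"
    with True have "n > 0" by simp
    \<comment> \<open>For \<open>c = 0\<close> the expression is linear in \<open>t\<close>, and
      this value makes it -1.\<close>
    with nonneg[of "(a + 1) / (2 * n)"] True show False by (simp add: field_simps)
  qed
next
  case False
  with nonneg[of "1 / c"] have "0 \<le> a - n / c" by (simp add: power2_eq_square field_simps)
  with False \<open>c \<ge> 0\<close> show ?thesis by (simp add: field_simps)
qed

lemma psd_hermitian: "psd M \<Longrightarrow> hermitian M"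
  and psd_nonneg: "psd M \<Longrightarrow> 0 \<le> Re (cdot v (M *v v))"
  by (auto simp: psd_def)

lemma hermitian_Im_zero: "hermitian M \<Longrightarrow> Im (cdot v (M *v v)) = 0"
  using hermitian_cdot_cnj[of M v v] by (simp add: complex_eq_iff)

lemma hermitian_cdot_of_real: "hermitian M \<Longrightarrow> cdot v (M *v v) = of_real (Re (cdot v (M *v v)))"
  using hermitian_Im_zero by (simp add: complex_eq_iff)

lemma psd_Cauchy_Schwarz:
  assumes "psd M"
  shows "(norm (cdot u (M *v v)))\<^sup>2 \<le> Re (cdot u (M *v u)) * Re (cdot v (M *v v))"
proof (rule discriminant_nonpos)
  define b where "b = cdot u (M *v v)"
  fix t :: real
  \<comment> \<open>The factor \<open>cnj b\<close> aligns the phases, so that the two cross terms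
    become the same real number.\<close>
  define c where "c = - of_real t * cnj b"
  have h: "hermitian M" using assms by (rule psd_hermitian)
  have vu: "cdot v (M *v u) = cnj b" unfolding b_def by (rule hermitian_cdot_cnj[OF h])
  have "cdot (u + c *s v) (M *v (u + c *s v))
      = cdot u (M *v u) + c * b + cnj c * cnj b + cnj c * c * cdot v (M *v v)"
    by (simp add: cdot_simps mv_simps vector_scalar_commute cdot_scale_left cdot_scale_right vu b_def algebra_simps)
  moreover have "c * b = of_real (- t * (norm b)\<^sup>2)" "cnj c * cnj b = of_real (- t * (norm b)\<^sup>2)"
    "cnj c * c = of_real (t\<^sup>2 * (norm b)\<^sup>2)"
  proof -
    have nb: "b * cnj b = of_real ((norm b)\<^sup>2)" by (rule complex_norm_square[symmetric])
    have "c * b = - of_real t * (b * cnj b)" "cnj c * cnj b = - of_real t * (b * cnj b)"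
      "cnj c * c = of_real (t\<^sup>2) * (b * cnj b)"
      by (simp_all add: c_def power2_eq_square mult_ac)
    then show "c * b = of_real (- t * (norm b)\<^sup>2)" "cnj c * cnj b = of_real (- t * (norm b)\<^sup>2)"
      "cnj c * c = of_real (t\<^sup>2 * (norm b)\<^sup>2)"
      unfolding nb by simp_all
  qed
  ultimately have "cdot (u + c *s v) (M *v (u + c *s v))
      = cdot u (M *v u) + of_real (- t * (norm b)\<^sup>2) + of_real (- t * (norm b)\<^sup>2) + of_real (t\<^sup>2 * (norm b)\<^sup>2) * cdot v (M *v v)"
    by simp
  then have "Re (cdot (u + c *s v) (M *v (u + c *s v)))
      = Re (cdot u (M *v u)) - 2 * t * (norm b)\<^sup>2 + t\<^sup>2 * (norm b)\<^sup>2 * Re (cdot v (M *v v))"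
    by (simp del: of_real_mult of_real_minus)
  then show "0 \<le> Re (cdot u (M *v u)) - 2 * t * (norm b)\<^sup>2 + t\<^sup>2 * (norm b)\<^sup>2 * Re (cdot v (M *v v))"
    using psd_nonneg[OF assms, of "u + c *s v"] by simp
qed (use psd_nonneg[OF assms] in auto)

lemma psd_zero_form: "psd M \<Longrightarrow> Re (cdot v (M *v v)) = 0 \<Longrightarrow> M *v v = 0"
  using psd_Cauchy_Schwarz[of M "M *v v" v] by (simp add: cdot_self)

text \<open>Cauchy-Schwarz for the form with first vector \<open>M *v v\<close>, divided by the
  squared norm of that vector. It replaces a factorisation through the square root, which is only
  constructed later and only for invertible matrices.\<close>

lemma psd_norm_le:
  assumes "psd M"
  shows "(norm (M *v v))\<^sup>2 \<le> onorm ((*v) M) * Re (cdot v (M *v v))"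
proof -
  define s where "s = norm (M *v v)"
  define k where "k = onorm ((*v) M)"
  have bl: "bounded_linear ((*v) M)"
    by (rule bounded_bilinear.bounded_linear_right[OF bounded_bilinear_matrix_vector])
  have k0: "k \<ge> 0" unfolding k_def by (rule onorm_pos_le[OF bl])
  have norm_sq: "(norm (cdot (M *v v) (M *v v)))\<^sup>2 = s\<^sup>2 * s\<^sup>2"
    unfolding cdot_self norm_of_real s_def by (simp add: power2_eq_square)
  have "(norm (cdot (M *v v) (M *v v)))\<^sup>2 \<le> Re (cdot (M *v v) (M *v (M *v v))) * Re (cdot v (M *v v))"
    by (rule psd_Cauchy_Schwarz[OF assms])
  also have "\<dots> \<le> (k * s\<^sup>2) * Re (cdot v (M *v v))"
  proof (rule mult_right_mono[OF _ psd_nonneg[OF assms]])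
    have "Re (cdot (M *v v) (M *v (M *v v))) \<le> norm (M *v v) * norm (M *v (M *v v))"
      by (rule order_trans[OF complex_Re_le_cmod norm_cdot_le])
    also have "\<dots> \<le> s * (k * s)" unfolding s_def k_def by (intro mult_left_mono onorm[OF bl]) auto
    finally show "Re (cdot (M *v v) (M *v (M *v v))) \<le> k * s\<^sup>2" by (simp add: power2_eq_square mult_ac)
  qed
  finally have "s\<^sup>2 * s\<^sup>2 \<le> s\<^sup>2 * (k * Re (cdot v (M *v v)))"
    by (simp add: norm_sq mult_ac)
  then have "s\<^sup>2 \<le> k * Re (cdot v (M *v v))"
    using k0 psd_nonneg[OF assms, of v] mult_le_cancel_left_pos[of "s\<^sup>2" "s\<^sup>2" "k * Re (cdot v (M *v v))"]
    by (cases "s = 0") (simp, simp del: mult_le_cancel_left_pos)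
  then show ?thesis unfolding s_def k_def .
qed

lemma matrix_inv_mult:
  fixes M :: "'a::field ^ 'n ^ 'n"
  assumes "det M \<noteq> 0" shows "M ** matrix_inv M = mat 1" "matrix_inv M ** M = mat 1"
proof -
  have "invertible M" using assms by (simp add: invertible_det_nz)
  then have "\<exists>A'. M ** A' = mat 1 \<and> A' ** M = mat 1" by (simp add: invertible_def)
  from someI_ex[OF this] show "M ** matrix_inv M = mat 1" "matrix_inv M ** M = mat 1"
    unfolding matrix_inv_def by auto
qed

lemma matrix_inv_mult_vec:
  fixes M :: "'a::field ^ 'n ^ 'n"
  assumes "det M \<noteq> 0" shows "M *v (matrix_inv M *v v) = v" "matrix_inv M *v (M *v v) = v"
  using matrix_inv_mult[OF assms] by (simp_all add: matrix_vector_mul_assoc)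

lemma continuous_on_det:
  fixes f :: "'a::topological_space \<Rightarrow> complex ^ 'n ^ 'n"
  assumes "\<And>i j. continuous_on S (\<lambda>x. f x $ i $ j)"
  shows "continuous_on S (\<lambda>x. det (f x))"
  unfolding det_def by (intro continuous_intros assms)

text \<open>By Cramer's rule the entries of the inverse are quotients of determinants, and these are
  polynomials in the entries of the matrix.\<close>

lemma continuous_on_matrix_inv:
  fixes J :: "real \<Rightarrow> complex ^ 'n ^ 'n"
  assumes J: "continuous_on S J" and d: "\<And>x. x \<in> S \<Longrightarrow> det (J x) \<noteq> 0"
  shows "continuous_on S (\<lambda>x. matrix_inv (J x))"
proof -
  define C where "C x k l = (\<chi> i j. if j = k then axis l 1 $ i else J x $ i $ j)" for x k l
  have Jc: "continuous_on S (\<lambda>x. J x $ i $ j)" for i j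
    using J by (intro continuous_intros)
  have eq: "matrix_inv (J x) = (\<chi> k l. det (C x k l) / det (J x))" if x: "x \<in> S" for x
  proof -
    have "matrix_inv (J x) $ k $ l = det (C x k l) / det (J x)" for k l
    proof -
      have "J x *v (matrix_inv (J x) *v axis l 1) = axis l 1" by (rule matrix_inv_mult_vec[OF d[OF x]])
      then have "matrix_inv (J x) *v axis l 1 = (\<chi> k. det (C x k l) / det (J x))"
        unfolding cramer[OF d[OF x]] C_def .
      then have "(matrix_inv (J x) *v axis l 1) $ k = det (C x k l) / det (J x)" by simp
      then show ?thesis by (simp add: matrix_vector_mult_axis)
    qed
    then show ?thesis by (simp add: vec_eq_iff)
  qed
  have Cc: "continuous_on S (\<lambda>x. C x k l $ i $ j)" for k l i j
    unfolding C_def using Jc by (cases "j = k") (auto intro!: continuous_intros)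
  have "continuous_on S (\<lambda>x. \<chi> k l. det (C x k l) / det (J x))"
    by (intro continuous_on_vec_lambda continuous_intros continuous_on_det Cc Jc) (use d in auto)
  then show ?thesis by (rule continuous_on_eq) (simp add: eq)
qed

lemma absolutely_integrable_continuous_bilinear:
  fixes h :: "'a::euclidean_space \<Rightarrow> 'b::euclidean_space \<Rightarrow> 'c::euclidean_space"
  assumes h: "bounded_bilinear h" and f: "continuous_on {a..b} f" and g: "g absolutely_integrable_on {a..b::real}"
  shows "(\<lambda>x. h (f x) (g x)) absolutely_integrable_on {a..b}"
proof (rule absolutely_integrable_bounded_measurable_product[where h=h and f=f and g=g])
  show "bilinear h" using h by (simp add: bilinear_conv_bounded_bilinear)
  show "f \<in> borel_measurable (lebesgue_on {a..b})"
    by (rule continuous_imp_measurable_on_sets_lebesgue[OF f]) auto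
  show "bounded (f ` {a..b})" using f by (intro compact_imp_bounded compact_continuous_image) auto
qed (use g in auto)

lemma L1_loc_bilinear:
  fixes h :: "'a::euclidean_space \<Rightarrow> 'b::euclidean_space \<Rightarrow> 'c::euclidean_space"
  assumes h: "bounded_bilinear h" and f: "continuous_on I f" and g: "L1_loc I g"
  shows "L1_loc I (\<lambda>x. h (f x) (g x))"
  unfolding L1_loc_def
  by (auto intro!: absolutely_integrable_continuous_bilinear[OF h] continuous_on_subset[OF f] L1_locD[OF g])

lemma L1_loc_linear:
  fixes h :: "'a::euclidean_space \<Rightarrow> 'b::euclidean_space"
  assumes "bounded_linear h" "L1_loc I g" shows "L1_loc I (\<lambda>x. h (g x))"
  using absolutely_integrable_linear[OF _ assms(1), where f=g] assms(2) unfolding L1_loc_def o_def by blast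

lemma L1_loc_add:
  fixes f g :: "real \<Rightarrow> 'a::euclidean_space"
  shows "L1_loc I f \<Longrightarrow> L1_loc I g \<Longrightarrow> L1_loc I (\<lambda>x. f x + g x)"
  unfolding L1_loc_def by (auto intro: set_integral_add)

lemma L1_loc_norm: "L1_loc I f \<Longrightarrow> L1_loc I (\<lambda>x. norm (f x))"
  unfolding L1_loc_def by (auto intro: set_integrable_norm)

section \<open>Linear differential equations with locally integrable coefficients\<close>

text \<open>Picard iteration in a weighted sup norm: dividing by an exponential of the integrated
  coefficients makes the integral operator a contraction on the entire half-line, so no local
  solutions have to be glued.\<close>

lemma linear_ode_exists_nonneg:
  fixes M :: "real \<Rightarrow> complex ^ 'm ^ 'm" and r :: "real \<Rightarrow> complex ^ 'm"
  assumes M: "L1_loc {0..} M" and r: "L1_loc {0..} r"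
  shows "\<exists>y. AC {0..} y \<and> y 0 = y0 \<and>
    (AE x in lebesgue. x \<in> {0..} \<longrightarrow> (y has_vector_derivative M x *v y x + r x) (at x))"
proof -
  obtain K where K: "K > 0" "\<And>(A::complex^'m^'m) v. norm (A *v v) \<le> norm A * norm v * K"
    using bounded_bilinear.pos_bounded[OF bounded_bilinear_matrix_vector] by blast
  have hl: "half_line {0..}" by (simp add: half_line_def)
  \<comment> \<open>One weight dominates the coefficient and the inhomogeneity together, so the
    exponential built from it controls both.\<close>
  define w where "w x = K * norm (M x) + norm (r x)" for x
  have wL: "L1_loc {0..} w"
    unfolding w_def using L1_loc_linear[OF bounded_linear_mult_right L1_loc_norm[OF M], of K]
    by (intro L1_loc_add L1_loc_norm[OF r]) 
  have w0: "w x \<ge> 0" for x using K by (simp add: w_def)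
  have wi: "w integrable_on {0..x}" for x
    using L1_locD[OF wL, of 0 x] by (auto simp: absolutely_integrable_on_def)
  define T where "T x = 0 + integral {0..x} w" for x
  have TAC: "AC {0..} T" and T': "AE x in lebesgue. x \<in> {0..} \<longrightarrow> (T has_vector_derivative w x) (at x)"
    unfolding T_def using L1_loc_integral[OF wL, of 0] by auto
  have T0: "T x \<ge> 0" for x unfolding T_def using wi w0 by (simp add: integral_nonneg)
  have Tmono: "T x \<le> T y" if "x \<le> y" for x y
    unfolding T_def using wi w0 that by (auto intro!: integral_subset_le)
  \<comment> \<open>The 2 in the exponent makes \<open>w * E\<close> half the derivative of
    \<open>E\<close>; this is the contraction constant 1/2.\<close>
  define E where "E x = exp (2 * T x)" for x
  have E1: "E x \<ge> 1" for x using T0 by (simp add: E_def)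
  have EAC: "AC {0..} E"
    unfolding AC_def
  proof (intro allI impI)
    fix a b :: real assume ab: "{a..b} \<subseteq> {0..}"
    show "absolutely_continuous_on {a..b} E"
      unfolding E_def
    proof (rule absolutely_continuous_on_compose_C1[OF AC_subset[OF TAC ab], where l=0 and u="T b"])
      show "((\<lambda>y. exp (2 * y)) has_real_derivative 2 * exp (2 * y)) (at y)" for y
        by (auto intro!: derivative_eq_intros)
    qed (use T0 Tmono in \<open>auto intro!: continuous_intros\<close>)
  qed
  have E': "AE x in lebesgue. x \<in> {0..} \<longrightarrow> (E has_vector_derivative 2 * (w x * E x)) (at x)"
    using T'
  proof eventually_elim
    case (elim x)
    show ?case
    proof
      assume "x \<in> {0..}"
      with elim have "(T has_real_derivative w x) (at x)"
        by (simp add: has_real_derivative_iff_has_vector_derivative)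
      then have "(E has_real_derivative 2 * (w x * E x)) (at x)"
        unfolding E_def by (auto intro!: derivative_eq_intros)
      then show "(E has_vector_derivative 2 * (w x * E x)) (at x)"
        by (simp add: has_real_derivative_iff_has_vector_derivative)
    qed
  qed
  have wE: "(\<lambda>s. w s * E s) absolutely_integrable_on {0..x}" "integral {0..x} (\<lambda>s. w s * E s) = (E x - 1) / 2"
    if x: "x \<ge> 0" for x
  proof -
    have sub: "{0..x} \<subseteq> {0..}" by auto
    from AC_FTC[OF EAC x sub E'] have *: "(\<lambda>s. 2 * (w s * E s)) absolutely_integrable_on {0..x}"
      "integral {0..x} (\<lambda>s. 2 * (w s * E s)) = E x - E 0" by auto
    then have "(\<lambda>s. (1/2) * (2 * (w s * E s))) absolutely_integrable_on {0..x}"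
      by (intro set_integrable_mult_right) auto
    then show "(\<lambda>s. w s * E s) absolutely_integrable_on {0..x}" by simp
    have "E 0 = 1" by (simp add: E_def T_def)
    with *(2) show "integral {0..x} (\<lambda>s. w s * E s) = (E x - 1) / 2" by simp
  qed
  have Ec: "continuous_on {0..} E" using AC_continuous_on[OF hl EAC] .
  \<comment> \<open>The unknown \<open>U\<close> is the solution divided by \<open>E\<close>, which
    stays bounded; \<open>P\<close> is the right-hand side of the equation expressed through
    it.\<close>
  define P where "P U s = M s *v (E s *\<^sub>R apply_bcontfun U s) + r s" for U s
  have Uc: "continuous_on S (apply_bcontfun U)" for S and U :: "real \<Rightarrow>\<^sub>C (complex ^ 'm)"
    by simp
  have MLU: "L1_loc {0..} (\<lambda>s. M s *v (E s *\<^sub>R apply_bcontfun U s))" for U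
    by (rule L1_loc_bilinear[OF bounded_bilinear.flip[OF bounded_bilinear_matrix_vector] _ M])
       (intro continuous_intros Ec Uc)
  have PL: "L1_loc {0..} (P U)" for U
    unfolding P_def by (intro L1_loc_add MLU r)
  define G where "G U x = y0 + integral {0..x} (P U)" for U x
  have GAC: "AC {0..} (G U)" and G': "AE x in lebesgue. x \<in> {0..} \<longrightarrow> (G U has_vector_derivative P U x) (at x)" for U
    unfolding G_def using L1_loc_integral[OF PL, of y0 U] by auto
  have MEU: "norm (M s *v (E s *\<^sub>R u)) \<le> B * (w s * E s)" if "norm u \<le> B" for s u B
  proof -
    have "norm (M s *v (E s *\<^sub>R u)) \<le> norm (M s) * norm (E s *\<^sub>R u) * K" by (rule K)
    also have "\<dots> = (K * norm (M s)) * E s * norm u" using E1[of s] by simp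
    also have "\<dots> \<le> w s * E s * B"
      using that E1[of s] K(1) by (intro mult_mono) (auto simp: w_def)
    finally show ?thesis by (simp add: mult_ac)
  qed
  have Gb: "norm (G U x) \<le> norm y0 + (norm U * ((E x - 1) / 2) + T x)" if x: "x \<ge> 0" for U x
  proof -
    have "norm (integral {0..x} (P U)) \<le> integral {0..x} (\<lambda>s. norm U * (w s * E s) + w s)"
    proof (rule Henstock_Kurzweil_Integration.integral_norm_bound_integral)
      show "P U integrable_on {0..x}" using L1_locD[OF PL[of U], of 0 x] by (auto simp: absolutely_integrable_on_def)
      show "(\<lambda>s. norm U * (w s * E s) + w s) integrable_on {0..x}"
        using wE(1)[OF x] wi by (intro integrable_add integrable_on_mult_right) (auto simp: absolutely_integrable_on_def)
      fix s
      have "norm (P U s) \<le> norm (M s *v (E s *\<^sub>R apply_bcontfun U s)) + norm (r s)"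
        unfolding P_def by (rule norm_triangle_ineq)
      also have "\<dots> \<le> norm U * (w s * E s) + w s"
        using MEU[OF norm_bounded[of U s], of s] K(1) by (intro add_mono) (auto simp: w_def)
      finally show "norm (P U s) \<le> norm U * (w s * E s) + w s" .
    qed
    also have "\<dots> = norm U * ((E x - 1) / 2) + T x"
      using wE[OF x] wi unfolding T_def
      by (subst Henstock_Kurzweil_Integration.integral_add) (auto simp: absolutely_integrable_on_def integrable_on_mult_right)
    finally show ?thesis unfolding G_def by (intro order_trans[OF norm_triangle_ineq] add_left_mono) auto
  qed
  have TE: "T x \<le> E x" for x
    using exp_ge_add_one_self[of "2 * T x"] T0[of x] unfolding E_def by linarith
  \<comment> \<open>Bounded continuous functions live on the whole line here, so the function is
    continued to the left of 0 by its value at 0.\<close>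
  define \<Phi> where "\<Phi> U = Bcontfun (\<lambda>x. inverse (E (max 0 x)) *\<^sub>R G U (max 0 x))" for U
  have \<Phi>: "apply_bcontfun (\<Phi> U) x = inverse (E (max 0 x)) *\<^sub>R G U (max 0 x)" for U x
  proof -
    have "(\<lambda>x. inverse (E (max 0 x)) *\<^sub>R G U (max 0 x)) \<in> bcontfun"
    proof (rule bcontfun_normI)
      have "continuous_on UNIV (\<lambda>x. E (max 0 x))"
        by (rule continuous_on_compose2[OF Ec]) (auto intro!: continuous_intros)
      moreover have "continuous_on UNIV (\<lambda>x. G U (max 0 x))"
        by (rule continuous_on_compose2[OF AC_continuous_on[OF hl GAC]]) (auto intro!: continuous_intros)
      moreover have "E x \<noteq> 0" for x using E1[of x] by auto
      ultimately show "continuous_on UNIV (\<lambda>x. inverse (E (max 0 x)) *\<^sub>R G U (max 0 x))"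
        by (intro continuous_intros) auto
      fix x :: real
      let ?x = "max 0 x"
      have "norm (G U ?x) \<le> norm y0 + (norm U * ((E ?x - 1) / 2) + T ?x)" by (rule Gb) simp
      also have "\<dots> \<le> norm y0 * E ?x + (norm U * E ?x + 1 * E ?x)"
        using E1[of ?x] TE[of ?x] by (intro add_mono mult_left_mono) (auto simp: mult_le_cancel_left1)
      also have "\<dots> = (norm y0 + norm U + 1) * E ?x" by (simp add: algebra_simps)
      finally show "norm (inverse (E ?x) *\<^sub>R G U ?x) \<le> norm y0 + norm U + 1"
        using E1[of ?x] by (simp add: field_simps)
    qed
    then show ?thesis unfolding \<Phi>_def by (simp add: Bcontfun_inverse)
  qed
  have "\<exists>!U. \<Phi> U = U"
  proof (rule banach_fix_type[of "1/2"])
    show "\<forall>U V. dist (\<Phi> U) (\<Phi> V) \<le> 1/2 * dist U V"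
    proof (intro allI dist_bound)
      fix U V and x :: real
      let ?x = "max 0 x"
      have x: "0 \<le> ?x" by simp
      have Pi: "P U integrable_on {0..?x}" for U using L1_locD[OF PL[of U], of 0 ?x] by (auto simp: absolutely_integrable_on_def)
      have "G U ?x - G V ?x = integral {0..?x} (\<lambda>s. P U s - P V s)"
        unfolding G_def using Pi by (simp add: Henstock_Kurzweil_Integration.integral_diff)
      moreover have "norm (integral {0..?x} (\<lambda>s. P U s - P V s)) \<le> integral {0..?x} (\<lambda>s. dist U V * (w s * E s))"
      proof (rule Henstock_Kurzweil_Integration.integral_norm_bound_integral)
        show "(\<lambda>s. P U s - P V s) integrable_on {0..?x}" using Pi by (intro integrable_diff)
        show "(\<lambda>s. dist U V * (w s * E s)) integrable_on {0..?x}"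
          using wE(1)[OF x] by (intro integrable_on_mult_right) (auto simp: absolutely_integrable_on_def)
        fix s
        have "P U s - P V s = M s *v (E s *\<^sub>R (apply_bcontfun U s - apply_bcontfun V s))"
          unfolding P_def by (simp add: mv_simps scaleR_diff_right)
        moreover have "norm (apply_bcontfun U s - apply_bcontfun V s) \<le> dist U V"
          using dist_bounded[of U s V] by (simp add: dist_norm)
        ultimately show "norm (P U s - P V s) \<le> dist U V * (w s * E s)" using MEU by simp
      qed
      moreover have "integral {0..?x} (\<lambda>s. dist U V * (w s * E s)) = dist U V * ((E ?x - 1) / 2)"
        using wE(2)[OF x] by simp
      ultimately have "norm (G U ?x - G V ?x) \<le> dist U V * ((E ?x - 1) / 2)" by metis
      also have "\<dots> \<le> dist U V * (E ?x / 2)" by (intro mult_left_mono) auto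
      finally have "inverse (E ?x) * norm (G U ?x - G V ?x) \<le> inverse (E ?x) * (dist U V * (E ?x / 2))"
        using E1[of ?x] by (intro mult_left_mono) auto
      also have "\<dots> = 1/2 * dist U V" using E1[of ?x] by (simp add: field_simps)
      finally show "dist (apply_bcontfun (\<Phi> U) x) (apply_bcontfun (\<Phi> V) x) \<le> 1/2 * dist U V"
        using E1[of ?x] unfolding \<Phi> dist_norm by (simp flip: scaleR_diff_right)
    qed
  qed auto
  then obtain U where U: "\<Phi> U = U" by blast
  have GE: "G U x = E x *\<^sub>R apply_bcontfun U x" if "x \<ge> 0" for x
    using \<Phi>[of U x] U that E1[of x] by auto
  show ?thesis
  proof (intro exI conjI)
    show "AC {0..} (G U)" by (rule GAC)
    show "G U 0 = y0" by (simp add: G_def)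
    show "AE x in lebesgue. x \<in> {0..} \<longrightarrow> (G U has_vector_derivative M x *v G U x + r x) (at x)"
      using G'[of U] by eventually_elim (auto simp: P_def GE)
  qed
qed

lemma linear_ode_exists:
  fixes M :: "real \<Rightarrow> complex ^ 'm ^ 'm" and r :: "real \<Rightarrow> complex ^ 'm"
  assumes I: "half_line I" and M: "L1_loc I M" and r: "L1_loc I r"
  shows "\<exists>y. AC I y \<and> y 0 = y0 \<and>
    (AE x in lebesgue. x \<in> I \<longrightarrow> (y has_vector_derivative M x *v y x + r x) (at x))"
proof (cases "I = {0..}")
  case True
  then show ?thesis using linear_ode_exists_nonneg M r by blast
next
  case False
  then have I': "I = {..0}" using I by (simp add: half_line_def)
  have "L1_loc {0..} (\<lambda>x. - M (- x))" "L1_loc {0..} (\<lambda>x. - r (- x))"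
    using M r unfolding I' by (auto intro!: L1_loc_linear[OF bounded_linear_minus[OF bounded_linear_ident]] L1_loc_reflect)
  from linear_ode_exists_nonneg[OF this, of y0] obtain y where y: "AC {0..} y" "y 0 = y0"
    "AE x in lebesgue. x \<in> {0..} \<longrightarrow> (y has_vector_derivative - M (- x) *v y x + - r (- x)) (at x)"
    by blast
  show ?thesis
  proof (intro exI conjI)
    show "AC I (\<lambda>x. y (- x))" unfolding I' using y(1) by (rule AC_reflect)
    show "y (- 0) = y0" using y(2) by simp
    show "AE x in lebesgue. x \<in> I \<longrightarrow> ((\<lambda>x. y (- x)) has_vector_derivative M x *v y (- x) + r x) (at x)"
      using AE_lebesgue_reflect[OF y(3)]
    proof eventually_elim
      case (elim x)
      show ?case
      proof
        assume "x \<in> I"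
        then have "(y has_vector_derivative - M x *v y (- x) + - r x) (at (- x))" using elim I' by auto
        moreover have "(uminus has_vector_derivative (-1)) (at x)"
          by (auto intro!: derivative_eq_intros)
        ultimately have "((y \<circ> uminus) has_vector_derivative (- 1) *\<^sub>R (- M x *v y (- x) + - r x)) (at x)"
          by (intro vector_diff_chain_at) auto
        then show "((\<lambda>x. y (- x)) has_vector_derivative M x *v y (- x) + r x) (at x)"
          by (simp add: o_def mv_simps add.commute)
      qed
    qed
  qed
qed


text \<open>A Gronwall argument by monotonicity: the squared norm \<open>u\<close> satisfies |u'| <=
  2 w u, so it increases when multiplied by exp(2T) and decreases when multiplied by exp(-2T). From
  the zero at \<open>c\<close> the two facts give u <= 0 to the left and to the right.\<close>

lemma linear_ode_zero:
  fixes M :: "real \<Rightarrow> complex ^ 'm ^ 'm" and d :: "real \<Rightarrow> complex ^ 'm"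
  assumes d: "absolutely_continuous_on {a..b} d" and M: "M absolutely_integrable_on {a..b}"
    and d': "AE x in lebesgue. x \<in> {a<..<b} \<longrightarrow> (d has_vector_derivative M x *v d x) (at x)"
    and c: "c \<in> {a..b}" "d c = 0" and x: "x \<in> {a..b}"
  shows "d x = 0"
proof -
  obtain K where K: "K > 0" "\<And>(A::complex^'m^'m) v. norm (A *v v) \<le> norm A * norm v * K"
    using bounded_bilinear.pos_bounded[OF bounded_bilinear_matrix_vector] by blast
  define w where "w x = K * norm (M x)" for x
  have w: "w absolutely_integrable_on {a..b}"
    unfolding w_def by (intro set_integrable_mult_right set_integrable_norm M)
  define T where "T x = 0 + integral {a..x} w" for x
  have T: "absolutely_continuous_on {a..b} T"
    unfolding T_def by (rule absolutely_continuous_on_integral[OF w])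
  have T': "AE x in lebesgue. x \<in> {a<..<b} \<longrightarrow> (T has_vector_derivative w x) (at x)"
    unfolding T_def by (rule AE_deriv_integral[OF w])
  have "bounded (T ` {a..b})"
    using T by (intro compact_imp_bounded compact_continuous_image absolutely_continuous_on_imp_continuous_on) auto
  then obtain B where "\<And>x. x \<in> {a..b} \<Longrightarrow> norm (T x) \<le> B" unfolding bounded_pos by (metis imageI)
  then have TB: "T ` {a..b} \<subseteq> {-B..B}" by force
  define u where "u x = d x \<bullet> d x" for x
  have u: "absolutely_continuous_on {a..b} u"
    unfolding u_def by (rule absolutely_continuous_on_bilinear[OF bounded_bilinear_inner d d])
  have dw: "\<bar>d x \<bullet> (M x *v d x)\<bar> \<le> w x * u x" for x
  proof -
    have "\<bar>d x \<bullet> (M x *v d x)\<bar> \<le> norm (d x) * norm (M x *v d x)" by (rule Cauchy_Schwarz_ineq2)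
    also have "\<dots> \<le> norm (d x) * (norm (M x) * norm (d x) * K)" by (intro mult_left_mono K) auto
    also have "\<dots> = w x * u x" by (simp add: u_def w_def power2_norm_eq_inner[symmetric] power2_eq_square)
    finally show ?thesis .
  qed
  define g where "g \<sigma> x = u x * exp (\<sigma> * (2 * T x))" for \<sigma> x
  have g: "absolutely_continuous_on {a..b} (g \<sigma>)" for \<sigma>
    unfolding g_def
  proof (intro absolutely_continuous_on_bilinear[OF bounded_bilinear_mult u]
        absolutely_continuous_on_compose_C1[OF T TB, of "\<lambda>t. exp (\<sigma> * (2 * t))" "\<lambda>t. 2 * \<sigma> * exp (\<sigma> * (2 * t))"])
    show "((\<lambda>y. exp (\<sigma> * (2 * y))) has_real_derivative 2 * \<sigma> * exp (\<sigma> * (2 * y))) (at y)" for y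
      by (auto intro!: derivative_eq_intros)
  qed (auto intro!: continuous_intros)
  define g' where "g' \<sigma> x = 2 * (d x \<bullet> (M x *v d x) + \<sigma> * (w x * u x)) * exp (\<sigma> * (2 * T x))" for \<sigma> x
  have g'd: "AE x in lebesgue. x \<in> {a<..<b} \<longrightarrow> (g \<sigma> has_vector_derivative g' \<sigma> x) (at x)" for \<sigma>
    using d' T'
  proof eventually_elim
    case (elim x)
    show ?case
    proof
      assume x: "x \<in> {a<..<b}"
      have "(u has_vector_derivative (d x \<bullet> (M x *v d x) + (M x *v d x) \<bullet> d x)) (at x)"
        unfolding u_def using elim x by (intro bounded_bilinear.has_vector_derivative[OF bounded_bilinear_inner]) auto
      moreover have "(T has_vector_derivative w x) (at x)" using elim x by auto
      ultimately have "(u has_real_derivative 2 * (d x \<bullet> (M x *v d x))) (at x)" "(T has_real_derivative w x) (at x)"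
        by (simp_all add: has_real_derivative_iff_has_vector_derivative inner_commute)
      then have "(g \<sigma> has_real_derivative g' \<sigma> x) (at x)"
        unfolding g_def g'_def by (auto intro!: derivative_eq_intros simp: algebra_simps)
      then show "(g \<sigma> has_vector_derivative g' \<sigma> x) (at x)"
        by (simp add: has_real_derivative_iff_has_vector_derivative)
    qed
  qed
  have mono: "\<sigma> * (g \<sigma> t - g \<sigma> s) \<ge> 0" if "\<sigma> = 1 \<or> \<sigma> = -1" "a \<le> s" "s \<le> t" "t \<le> b" for \<sigma> s t
  proof -
    have st: "{s..t} \<subseteq> {a..b}" using that by auto
    have "AE x in lebesgue. x \<in> {s<..<t} \<longrightarrow> (g \<sigma> has_vector_derivative g' \<sigma> x) (at x)"
      using g'd[of \<sigma>] by eventually_elim (use that in auto)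
    from absolutely_continuous_FTC[OF absolutely_continuous_on_subset[OF g st] \<open>s \<le> t\<close> this]
    have "integral {s..t} (\<lambda>x. \<sigma> * g' \<sigma> x) = \<sigma> * (g \<sigma> t - g \<sigma> s)" by simp
    moreover have "integral {s..t} (\<lambda>x. \<sigma> * g' \<sigma> x) \<ge> 0"
    \<comment> \<open>A function that is not integrable has integral 0, so the sign holds in either
      case.\<close>
    proof (cases "(\<lambda>x. \<sigma> * g' \<sigma> x) integrable_on {s..t}")
      case True
      have "\<sigma> * g' \<sigma> x \<ge> 0" for x
      proof -
        have "\<sigma> * (d x \<bullet> (M x *v d x) + \<sigma> * (w x * u x)) \<ge> 0"
          using dw[of x] that(1) by (auto simp: abs_le_iff)
        then have "\<sigma> * (d x \<bullet> (M x *v d x) + \<sigma> * (w x * u x)) * (2 * exp (\<sigma> * (2 * T x))) \<ge> 0"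
          by (rule mult_nonneg_nonneg) simp
        moreover have "\<sigma> * g' \<sigma> x = \<sigma> * (d x \<bullet> (M x *v d x) + \<sigma> * (w x * u x)) * (2 * exp (\<sigma> * (2 * T x)))"
          by (simp add: g'_def algebra_simps)
        ultimately show ?thesis by metis
      qed
      with True show ?thesis by (intro integral_nonneg) auto
    next
      case False
      then have "integral {s..t} (\<lambda>x. \<sigma> * g' \<sigma> x) = 0" by (rule not_integrable_integral)
      then show ?thesis by (metis order_refl)
    qed
    ultimately show ?thesis by metis
  qed
  have uc: "u c = 0" using c(2) by (simp add: u_def)
  have "u x \<le> 0"
  proof (cases "c \<le> x")
    case True
    from mono[of "-1" c x] True c(1) x uc show ?thesis by (simp add: g_def mult_le_0_iff)
  next
    case False
    from mono[of 1 x c] False c(1) x uc show ?thesis by (simp add: g_def mult_le_0_iff)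
  qed
  then show ?thesis using inner_ge_zero[of "d x"] by (simp add: u_def del: inner_ge_zero)
qed

lemma linear_ode_unique:
  fixes M :: "real \<Rightarrow> complex ^ 'm ^ 'm" and d :: "real \<Rightarrow> complex ^ 'm"
  assumes I: "half_line I" and d: "AC I d" and M: "L1_loc I M"
    and d': "AE x in lebesgue. x \<in> I \<longrightarrow> (d has_vector_derivative M x *v d x) (at x)"
    and c: "c \<in> I" "d c = 0" and x: "x \<in> I"
  shows "d x = 0"
proof (rule linear_ode_zero)
  have sub: "{min c x..max c x} \<subseteq> I" using half_line_segment[OF I] c(1) x by (auto simp: min_def max_def)
  show "absolutely_continuous_on {min c x..max c x} d" using AC_subset[OF d sub] .
  show "M absolutely_integrable_on {min c x..max c x}" using L1_locD[OF M sub] .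
  show "AE y in lebesgue. y \<in> {min c x<..<max c x} \<longrightarrow> (d has_vector_derivative M y *v d y) (at y)"
    using d'
  proof eventually_elim
    case (elim y)
    then show ?case using sub by (auto simp: subset_iff simp del: min_less_iff_conj max_less_iff_conj)
  qed
qed (use c in auto)

section \<open>Square roots of positive definite matrices\<close>

text \<open>With \<open>D = S - T\<close> one has \<open>S D + D T = 0\<close>, so \<open>D S D\<close> and \<open>D T D\<close> have
  diagonal entries with opposite sum; both are positive semi-definite, so their traces vanish.\<close>

lemma psd_sqrt_unique:
  fixes S T :: "complex ^ 'n ^ 'n"
  assumes S: "psd S" and T: "psd T" and eq: "S ** S = T ** T"
  shows "S = T"
proof -
  define D where "D = S - T"
  have hD: "hermitian D"
    using psd_hermitian[OF S] psd_hermitian[OF T]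
    by (simp add: hermitian_def D_def ctranspose_linear)
  interpret mm: bounded_bilinear "(**) :: complex ^ 'n ^ 'n \<Rightarrow> complex ^ 'n ^ 'n \<Rightarrow> complex ^ 'n ^ 'n"
    by (rule bounded_bilinear_matrix_matrix)
  have SD: "S ** D = - (D ** T)"
    by (simp add: D_def mm.diff_left mm.diff_right eq)
  define q where "q M v = Re (cdot v (M *v v))" for M :: "complex ^ 'n ^ 'n" and v
  have tr: "(\<Sum>i\<in>UNIV. q M (axis i 1)) = Re (trace M)" for M
    by (simp add: q_def trace_def cdot_axis matrix_vector_mult_axis)
  have qS: "q (D ** S ** D) v \<ge> 0" "q (D ** T ** D) v \<ge> 0" for v
    using psd_nonneg[OF S, of "D *v v"] psd_nonneg[OF T, of "D *v v"]
    by (simp_all add: q_def hermitian_cdot[OF hD, symmetric] matrix_vector_mul_assoc[symmetric] matrix_mul_assoc[symmetric])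
  have "trace (D ** S ** D) + trace (D ** T ** D) = 0"
  proof -
    have "trace (D ** T ** D) = trace (D ** (D ** T))" by (rule trace_mul_sym)
    also have "D ** (D ** T) = - (D ** (S ** D))" using SD by (simp add: mm.minus_right)
    finally show ?thesis by (simp add: matrix_mul_assoc trace_def sum_negf)
  qed
  then have "(\<Sum>i\<in>UNIV. q (D ** S ** D) (axis i 1)) + (\<Sum>i\<in>UNIV. q (D ** T ** D) (axis i 1)) = 0"
    unfolding tr by (simp flip: plus_complex.simps(1))
  then have sums: "(\<Sum>i\<in>UNIV. q (D ** S ** D) (axis i 1)) = 0" "(\<Sum>i\<in>UNIV. q (D ** T ** D) (axis i 1)) = 0"
    using qS by (simp_all add: add_nonneg_eq_0_iff sum_nonneg)
  have col: "P *v (D *v axis i 1) = 0" if P: "psd P" and z: "(\<Sum>i\<in>UNIV. q (D ** P ** D) (axis i 1)) = 0" for P i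
  proof (rule psd_zero_form[OF P])
    have eqP: "q (D ** P ** D) v = Re (cdot (D *v v) (P *v (D *v v)))" for v
      by (simp add: q_def hermitian_cdot[OF hD, symmetric] matrix_vector_mul_assoc[symmetric] matrix_mul_assoc[symmetric])
    have "\<forall>i\<in>UNIV. q (D ** P ** D) (axis i 1) = 0"
      using z psd_nonneg[OF P] by (subst (asm) sum_nonneg_eq_0_iff) (auto simp: eqP)
    then show "Re (cdot (D *v axis i 1) (P *v (D *v axis i 1))) = 0" by (simp add: eqP)
  qed
  have "D *v (D *v axis i 1) = 0" for i
    using col[OF S sums(1), of i] col[OF T sums(2), of i] by (simp add: D_def mv_simps)
  then have "cdot (D *v axis i 1) (D *v axis i 1) = 0" for i
    by (simp add: hermitian_cdot[OF hD, symmetric] cdot_simps)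
  then have "D *v axis i 1 = 0" for i by (simp add: cdot_self)
  then have "D $ k $ i = 0" for k i
    by (metis matrix_vector_mult_axis zero_index)
  then have "D = 0" by (simp add: vec_eq_iff)
  then show ?thesis by (simp add: D_def)
qed


text \<open>\<open>norm\<close> on matrices is the Frobenius norm. Read column by column, it turns
  an operator bound into a bound for products, which the contraction behind the square root
  requires.\<close>

lemma norm_matrix_columns:
  fixes B :: "complex ^ 'n ^ 'm"
  shows "(norm B)\<^sup>2 = (\<Sum>j\<in>UNIV. (norm (B *v axis j 1))\<^sup>2)"
proof -
  have "(norm B)\<^sup>2 = (\<Sum>i\<in>UNIV. \<Sum>j\<in>UNIV. (norm (B $ i $ j))\<^sup>2)"
    by (simp add: norm_vec_def L2_set_def sum_nonneg)
  also have "\<dots> = (\<Sum>j\<in>UNIV. \<Sum>i\<in>UNIV. (norm (B $ i $ j))\<^sup>2)" by (rule sum.swap)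
  also have "\<dots> = (\<Sum>j\<in>UNIV. (norm (B *v axis j 1))\<^sup>2)"
    by (simp add: norm_vec_def[of "_ *v _"] L2_set_def sum_nonneg matrix_vector_mult_axis)
  finally show ?thesis .
qed

lemma norm_matrix_mult_left_le:
  fixes A :: "complex ^ 'n ^ 'm" and B :: "complex ^ 'k ^ 'n"
  assumes "\<And>v. norm (A *v v) \<le> c * norm v" "c \<ge> 0"
  shows "norm (A ** B) \<le> c * norm B"
proof (rule power2_le_imp_le)
  have "(norm (A ** B))\<^sup>2 \<le> (\<Sum>j\<in>UNIV. (c * norm (B *v axis j 1))\<^sup>2)"
    unfolding norm_matrix_columns using assms
    by (intro sum_mono power_mono) (auto simp: matrix_vector_mul_assoc[symmetric])
  also have "\<dots> = (c * norm B)\<^sup>2"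
    by (simp add: power_mult_distrib norm_matrix_columns[of B] sum_distrib_left)
  finally show "(norm (A ** B))\<^sup>2 \<le> (c * norm B)\<^sup>2" .
qed (use assms in auto)

lemma norm_ctranspose: "norm (ctranspose B) = norm (B :: complex ^ 'n ^ 'm)"
proof -
  have "(norm (ctranspose B))\<^sup>2 = (\<Sum>i\<in>UNIV. \<Sum>j\<in>UNIV. (norm (B $ j $ i))\<^sup>2)"
    by (simp add: norm_vec_def L2_set_def sum_nonneg ctranspose_def transpose_def map_matrix_def)
  also have "\<dots> = (\<Sum>j\<in>UNIV. \<Sum>i\<in>UNIV. (norm (B $ j $ i))\<^sup>2)" by (rule sum.swap)
  also have "\<dots> = (norm B)\<^sup>2" by (simp add: norm_vec_def L2_set_def sum_nonneg)
  finally show ?thesis by (simp add: power2_eq_iff_nonneg)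
qed

lemma norm_matrix_mult_right_le:
  fixes A :: "complex ^ 'n ^ 'n" and B :: "complex ^ 'n ^ 'm"
  assumes "\<And>v. norm (A *v v) \<le> c * norm v" "c \<ge> 0" "hermitian A"
  shows "norm (B ** A) \<le> c * norm B"
proof -
  have "norm (B ** A) = norm (A ** ctranspose B)"
    using assms(3) norm_ctranspose[of "B ** A"] by (simp add: ctranspose_mult hermitian_def)
  also have "\<dots> \<le> c * norm (ctranspose B)" by (rule norm_matrix_mult_left_le[OF assms(1,2)])
  finally show ?thesis by (simp add: norm_ctranspose)
qed

lemma hermitian_scaleR: "hermitian M \<Longrightarrow> hermitian (c *\<^sub>R M)"
  and hermitian_add: "hermitian M \<Longrightarrow> hermitian N \<Longrightarrow> hermitian (M + N)"
  and hermitian_diff: "hermitian M \<Longrightarrow> hermitian N \<Longrightarrow> hermitian (M - N)"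
  by (simp_all add: hermitian_def ctranspose_linear)

lemma hermitian_mat_1: "hermitian (mat 1)"
  by (simp add: hermitian_def ctranspose_def transpose_def map_matrix_def mat_def vec_eq_iff)

lemma hermitian_square: "hermitian X \<Longrightarrow> hermitian (X ** X)"
  by (simp add: hermitian_def ctranspose_mult)

text \<open>Cauchy-Schwarz for the form with first vector \<open>N *v v\<close> converts a bound on
  the quadratic form into one on the operator norm.\<close>

lemma hermitian_contraction_norm:
  assumes N: "psd N" and le: "\<And>v. Re (cdot v (N *v v)) \<le> r * (norm v)\<^sup>2" and r: "r \<ge> 0"
  shows "norm (N *v v) \<le> r * norm v"
proof -
  define s where "s = norm (N *v v)"
  have "(norm (cdot (N *v v) (N *v v)))\<^sup>2 = s\<^sup>2 * s\<^sup>2"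
    unfolding cdot_self norm_of_real s_def by (simp add: power2_eq_square)
  then have "s\<^sup>2 * s\<^sup>2 \<le> Re (cdot (N *v v) (N *v (N *v v))) * Re (cdot v (N *v v))"
    using psd_Cauchy_Schwarz[OF N, of "N *v v" v] by simp
  also have "\<dots> \<le> (r * s\<^sup>2) * (r * (norm v)\<^sup>2)"
    unfolding s_def using r by (intro mult_mono le psd_nonneg[OF N]) auto
  finally have *: "s\<^sup>2 * s\<^sup>2 \<le> s\<^sup>2 * (r * norm v)\<^sup>2" by (simp add: power2_eq_square mult_ac)
  have "s\<^sup>2 \<le> (r * norm v)\<^sup>2"
  proof (cases "s = 0")
    case False
    then have "s\<^sup>2 > 0" by simp
    with * show ?thesis using mult_le_cancel_left_pos by blast
  qed simp
  then show ?thesis unfolding s_def using r by (meson mult_nonneg_nonneg norm_ge_zero power2_le_imp_le)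
qed

text \<open>After scaling, \<open>N = 1 - M\<close> is a strict contraction, and \<open>X \<mapsto> (N + X\<^sup>2) / 2\<close> is a
  contraction for the Frobenius norm whose fixed point is \<open>1 - sqrt M\<close>.\<close>

lemma posdef_sqrt_exists:
  fixes M :: "complex ^ 'n ^ 'n"
  assumes M: "hermitian M" and pos: "\<And>v. v \<noteq> 0 \<Longrightarrow> 0 < Re (cdot v (M *v v))"
  shows "\<exists>S. psd S \<and> S ** S = M"
proof -
  note mvb = bounded_bilinear_matrix_vector and cb = bounded_bilinear_cdot
  interpret mv: bounded_bilinear "(*v) :: complex ^ 'n ^ 'n \<Rightarrow> complex ^ 'n \<Rightarrow> complex ^ 'n"
    by (rule bounded_bilinear_matrix_vector)
  interpret mm: bounded_bilinear "(**) :: complex ^ 'n ^ 'n \<Rightarrow> complex ^ 'n ^ 'n \<Rightarrow> complex ^ 'n ^ 'n"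
    by (rule bounded_bilinear_matrix_matrix)
  interpret cd: bounded_bilinear "cdot :: complex ^ 'n \<Rightarrow> complex ^ 'n \<Rightarrow> complex"
    by (rule bounded_bilinear_cdot)
  have bl: "bounded_linear ((*v) M)" by (rule mv.bounded_linear_right)
  have cont: "continuous_on (sphere 0 1) (\<lambda>v. Re (cdot v (M *v v)))"
    by (intro continuous_intros cd.continuous_on mv.continuous_on)
  \<comment> \<open>Any coordinate vector shows that the unit sphere, on which the form is
    minimised, is not empty.\<close>
  have "complex_of_real ((norm (axis undefined 1 :: complex ^ 'n))\<^sup>2) = 1"
    by (simp only: cdot_self[symmetric] cdot_axis) (simp add: axis_def)
  then have "(norm (axis undefined 1 :: complex ^ 'n))\<^sup>2 = 1" using of_real_eq_1_iff by blast
  then have "norm (axis undefined 1 :: complex ^ 'n) = 1" by (simp add: power2_eq_1_iff)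
  then have "axis undefined 1 \<in> sphere (0::complex^'n) 1" by simp
  then have ne: "sphere (0::complex^'n) 1 \<noteq> {}" by blast
  obtain v0 :: "complex ^ 'n" where v0: "norm v0 = 1" "\<And>v. norm v = 1 \<Longrightarrow> Re (cdot v0 (M *v v0)) \<le> Re (cdot v (M *v v))"
    using continuous_attains_inf[OF compact_sphere ne cont] by auto
  define \<epsilon> where "\<epsilon> = Re (cdot v0 (M *v v0))"
  have \<epsilon>: "\<epsilon> > 0" unfolding \<epsilon>_def using v0(1) by (intro pos) auto
  have lower: "\<epsilon> * (norm v)\<^sup>2 \<le> Re (cdot v (M *v v))" for v
  proof (cases "v = 0")
    case False
    have "\<epsilon> \<le> Re (cdot (v /\<^sub>R norm v) (M *v (v /\<^sub>R norm v)))"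
      unfolding \<epsilon>_def using False by (intro v0) simp
    also have "\<dots> = Re (cdot v (M *v v)) / (norm v)\<^sup>2"
      by (simp add: mv.scaleR_right cd.scaleR_left cd.scaleR_right power2_eq_square field_simps)
    finally show ?thesis using False by (simp add: field_simps)
  qed (simp add: cdot_simps mv_simps)
  define t where "t = onorm ((*v) M)"
  have upper: "Re (cdot v (M *v v)) \<le> t * (norm v)\<^sup>2" for v
  proof -
    have "Re (cdot v (M *v v)) \<le> norm v * norm (M *v v)"
      by (rule order_trans[OF complex_Re_le_cmod norm_cdot_le])
    also have "\<dots> \<le> norm v * (t * norm v)" unfolding t_def by (intro mult_left_mono onorm[OF bl]) auto
    finally show ?thesis by (simp add: power2_eq_square mult_ac)
  qed
  have t\<epsilon>: "\<epsilon> \<le> t" using order_trans[OF lower[of v0] upper[of v0]] v0(1) by simp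
  then have t: "t > 0" using \<epsilon> by simp
  \<comment> \<open>\<open>\<epsilon>\<close> and \<open>t\<close> bound the form of
    \<open>M\<close> from below and above on unit vectors, so the form of \<open>1 - M/t\<close>
    lies between 0 and \<open>r\<close>, which is below 1.\<close>
  define r where "r = 1 - \<epsilon> / t"
  have r: "0 \<le> r" "r < 1" using t\<epsilon> t \<epsilon> by (auto simp: r_def field_simps)
  define N where "N = mat 1 - (1 / t) *\<^sub>R M"
  have Nh: "hermitian N" unfolding N_def by (intro hermitian_diff hermitian_mat_1 hermitian_scaleR M)
  have NQ: "Re (cdot v (N *v v)) = (norm v)\<^sup>2 - Re (cdot v (M *v v)) / t" for v
    by (simp add: N_def mv.diff_left mv.scaleR_left cd.diff_right cd.scaleR_right cdot_self)
  have Npsd: "psd N"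
    unfolding psd_def NQ using upper t Nh by (simp add: field_simps)
  have Nr: "norm (N *v v) \<le> r * norm v" for v
  proof (rule hermitian_contraction_norm[OF Npsd _ r(1)])
    show "Re (cdot v (N *v v)) \<le> r * (norm v)\<^sup>2" for v
      unfolding NQ using lower[of v] t by (simp add: r_def field_simps)
  qed
  define X where "X = {X :: complex ^ 'n ^ 'n. hermitian X \<and> (\<forall>v. norm (X *v v) \<le> r * norm v)}"
  define F where "F X = (1/2) *\<^sub>R (N + X ** X)" for X
  have "closed {X :: complex ^ 'n ^ 'n. ctranspose X = X}"
    by (intro closed_Collect_eq linear_continuous_on bounded_linear_ctranspose continuous_on_id)
  moreover have "closed {X :: complex ^ 'n ^ 'n. \<forall>v. norm (X *v v) \<le> r * norm v}"
    by (intro closed_Collect_all closed_Collect_le continuous_intros mv.continuous_on)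
  ultimately have "closed X" unfolding X_def hermitian_def by (rule closed_Collect_conj)
  then have "complete X" by (simp add: complete_eq_closed)
  moreover have "0 \<in> X"
    using r by (simp add: X_def hermitian_def ctranspose_linear mv_simps)
  moreover have "F ` X \<subseteq> X"
  proof safe
    fix Y assume Y: "Y \<in> X"
    have "norm (F Y *v v) \<le> r * norm v" for v
    proof -
      have "F Y *v v = (1/2) *\<^sub>R (N *v v + Y *v (Y *v v))"
        by (simp add: F_def mv.scaleR_left mv.add_left matrix_vector_mul_assoc)
      then have "norm (F Y *v v) \<le> (1/2) * (norm (N *v v) + norm (Y *v (Y *v v)))"
        using norm_triangle_ineq by simp
      also have "\<dots> \<le> (1/2) * (r * norm v + r * (1 * norm v))"
      proof (intro mult_left_mono add_mono Nr)
        have "norm (Y *v (Y *v v)) \<le> r * norm (Y *v v)" using Y by (simp add: X_def)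
        also have "\<dots> \<le> r * (1 * norm v)"
        proof (rule mult_left_mono[OF _ r(1)])
          have "norm (Y *v v) \<le> r * norm v" using Y by (simp add: X_def)
          also have "\<dots> \<le> 1 * norm v" using r by (intro mult_right_mono) auto
          finally show "norm (Y *v v) \<le> 1 * norm v" .
        qed
        finally show "norm (Y *v (Y *v v)) \<le> r * (1 * norm v)" .
      qed auto
      finally show ?thesis by simp
    qed
    then show "F Y \<in> X"
      using Y by (simp add: X_def F_def hermitian_scaleR hermitian_add Nh hermitian_square)
  qed
  moreover have "dist (F Y) (F Z) \<le> r * dist Y Z" if Y: "Y \<in> X" and Z: "Z \<in> X" for Y Z
  proof -
    \<comment> \<open>The noncommutative difference of squares: each summand contains one factor
      whose operator norm is at most \<open>r\<close>.\<close>
    have "F Y - F Z = (1/2) *\<^sub>R (Y ** (Y - Z) + (Y - Z) ** Z)"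
      by (simp add: F_def mm.diff_left mm.diff_right flip: scaleR_diff_right)
    then have "norm (F Y - F Z) \<le> (1/2) * (norm (Y ** (Y - Z)) + norm ((Y - Z) ** Z))"
      using norm_triangle_ineq by simp
    also have "\<dots> \<le> (1/2) * (r * norm (Y - Z) + r * norm (Y - Z))"
      using Y Z r(1) by (intro mult_left_mono add_mono norm_matrix_mult_left_le norm_matrix_mult_right_le) (auto simp: X_def)
    finally show ?thesis by (simp add: dist_norm)
  qed
  ultimately have "\<exists>!Y. Y \<in> X \<and> F Y = Y"
    using r Banach_fix[of X r F] by blast
  then obtain Y where Y: "hermitian Y" "\<And>v. norm (Y *v v) \<le> r * norm v" "F Y = Y" unfolding X_def by blast
  define S0 where "S0 = mat 1 - Y"
  have "S0 ** S0 = mat 1 - Y - Y + Y ** Y"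
    by (simp add: S0_def mm.diff_left mm.diff_right)
  also have "Y ** Y = Y + Y - N"
  proof -
    have "N + Y ** Y = 2 *\<^sub>R F Y" by (simp add: F_def)
    then show ?thesis using Y(3) by (simp add: scaleR_2 algebra_simps)
  qed
  finally have S0: "S0 ** S0 = (1 / t) *\<^sub>R M" by (simp add: N_def)
  define S where "S = sqrt t *\<^sub>R S0"
  have "S ** S = M" using t by (simp add: S_def mm.scaleR_left mm.scaleR_right S0)
  moreover have "psd S"
    unfolding psd_def
  proof (intro conjI allI)
    show "hermitian S" unfolding S_def S0_def by (intro hermitian_scaleR hermitian_diff hermitian_mat_1 Y)
    fix v
    have "Re (cdot v (Y *v v)) \<le> norm v * norm (Y *v v)"
      by (rule order_trans[OF complex_Re_le_cmod norm_cdot_le])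
    also have "\<dots> \<le> norm v * (r * norm v)" by (intro mult_left_mono Y) auto
    also have "\<dots> \<le> norm v * (1 * norm v)" using r by (intro mult_left_mono mult_right_mono) auto
    finally have "Re (cdot v (Y *v v)) \<le> (norm v)\<^sup>2" by (simp add: power2_eq_square)
    then show "0 \<le> Re (cdot v (S *v v))" using t
      by (simp add: S_def S0_def mv.scaleR_left mv.diff_left cd.scaleR_right cd.diff_right cdot_self)
  qed
  ultimately show ?thesis by blast
qed

text \<open>Existence and uniqueness together turn the definite description in \<open>msqrt\<close>
  into an actual root. The degenerate matrices are those for which c is infinite.\<close>

lemma msqrt_posdef:
  fixes M :: "complex ^ 'n ^ 'n"
  assumes M: "psd M" and d: "det M \<noteq> 0"
  shows "psd (msqrt M)" "msqrt M ** msqrt M = M" "det (msqrt M) \<noteq> 0"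
proof -
  have "\<exists>S. psd S \<and> S ** S = M"
  proof (rule posdef_sqrt_exists[OF psd_hermitian[OF M]])
    fix v :: "complex ^ 'n" assume v: "v \<noteq> 0"
    have "Re (cdot v (M *v v)) \<noteq> 0"
    proof
      assume "Re (cdot v (M *v v)) = 0"
      then have "M *v v = 0" by (rule psd_zero_form[OF M])
      then have "v = 0" using matrix_inv_mult_vec(2)[OF d, of v] by (simp add: mv_simps)
      with v show False by simp
    qed
    then show "0 < Re (cdot v (M *v v))" using psd_nonneg[OF M, of v] by simp
  qed
  then have "\<exists>!S. psd S \<and> S ** S = M" using psd_sqrt_unique by blast
  from theI'[OF this] show "psd (msqrt M)" and sq: "msqrt M ** msqrt M = M" unfolding msqrt_def by auto
  show "det (msqrt M) \<noteq> 0" using d sq by (metis det_mul mult_zero_left)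
qed

text \<open>Writing J = A^(1/2) N H^(1/2), with \<open>N\<close> the matrix in the definition of c,
  moves one root to each argument; the norms of H^(1/2) u and A^(1/2) w are the roots of the two
  forms.\<close>

lemma coupling_bound:
  fixes A J H :: "complex ^ 'n ^ 'n"
  assumes A: "psd A" and H: "psd H" and d: "det (A ** H) \<noteq> 0"
  shows "norm (cdot (J *v u) w) \<le> onorm (\<lambda>v. (minv_sqrt A ** J ** minv_sqrt H) *v v)
           * sqrt (Re (cdot u (H *v u)) * Re (cdot w (A *v w)))"
proof -
  have dA: "det A \<noteq> 0" and dH: "det H \<noteq> 0" using d by (auto simp: det_mul)
  note SA = msqrt_posdef[OF A dA] and SH = msqrt_posdef[OF H dH]
  let ?SA = "msqrt A" and ?SH = "msqrt H" and ?N = "minv_sqrt A ** J ** minv_sqrt H"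
  have sq: "norm (msqrt P *v v) = sqrt (Re (cdot v (P *v v)))"
    if "psd (msqrt P)" "msqrt P ** msqrt P = P" for P v
  proof -
    have "cdot v (P *v v) = cdot (msqrt P *v v) (msqrt P *v v)"
      using that(2) hermitian_cdot[OF psd_hermitian[OF that(1)]] by (metis matrix_vector_mul_assoc)
    then show ?thesis by (simp add: cdot_self)
  qed
  have "?SA *v (?N *v (?SH *v u)) = ?SA *v (matrix_inv ?SA *v (J *v (matrix_inv ?SH *v (?SH *v u))))"
    by (simp add: minv_sqrt_def matrix_vector_mul_assoc matrix_mul_assoc)
  then have "J *v u = ?SA *v (?N *v (?SH *v u))"
    by (simp add: matrix_inv_mult_vec SA SH)
  then have "cdot (J *v u) w = cdot (?N *v (?SH *v u)) (?SA *v w)"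
    by (simp add: hermitian_cdot[OF psd_hermitian[OF SA(1)]])
  then have "norm (cdot (J *v u) w) \<le> norm (?N *v (?SH *v u)) * norm (?SA *v w)"
    by (simp add: norm_cdot_le)
  also have "\<dots> \<le> onorm (\<lambda>v. ?N *v v) * norm (?SH *v u) * norm (?SA *v w)"
    by (intro mult_right_mono onorm bounded_bilinear.bounded_linear_right[OF bounded_bilinear_matrix_vector]) auto
  finally show ?thesis by (simp add: sq SA SH real_sqrt_mult mult_ac)
qed

section \<open>The space of square integrable functions\<close>

lemma L1_loc_measurable:
  fixes f :: "real \<Rightarrow> 'a::euclidean_space"
  assumes I: "half_line I" and f: "L1_loc I f"
  shows "(\<lambda>x. indicator I x *\<^sub>R f x) \<in> borel_measurable lebesgue"
proof (rule borel_measurable_LIMSEQ_metric)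
  define S where "S n = (if I = {0..} then {0..real n} else {- real n..0})" for n :: nat
  have SI: "S n \<subseteq> I" for n using I by (auto simp: S_def half_line_def)
  show "(\<lambda>x. indicator (S n) x *\<^sub>R f x) \<in> borel_measurable lebesgue" for n
  proof -
    have "f absolutely_integrable_on S n" using L1_locD[OF f] SI[of n] unfolding S_def by metis
    then show ?thesis unfolding set_integrable_def by (rule borel_measurable_integrable)
  qed
  fix x
  obtain N where N: "\<bar>x\<bar> \<le> real N" using real_arch_simple by blast
  have "indicator (S n) x *\<^sub>R f x = indicator I x *\<^sub>R f x" if "n \<ge> N" for n
  proof -
    have "\<bar>x\<bar> \<le> real n" using N that by linarith
    then have "x \<in> S n \<longleftrightarrow> x \<in> I" using I by (auto simp: S_def half_line_def)
    then show ?thesis by (simp add: indicator_def)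
  qed
  then show "(\<lambda>n. indicator (S n) x *\<^sub>R f x) \<longlonglongrightarrow> indicator I x *\<^sub>R f x"
    by (intro tendsto_eventually) (auto simp: eventually_sequentially)
qed

lemma borel_measurable_bounded_bilinear:
  fixes h :: "'a::euclidean_space \<Rightarrow> 'b::euclidean_space \<Rightarrow> 'c::euclidean_space"
  assumes "bounded_bilinear h" and [measurable]: "f \<in> borel_measurable M" "g \<in> borel_measurable M"
  shows "(\<lambda>x. h (f x) (g x)) \<in> borel_measurable M"
proof -
  have "continuous_on UNIV (\<lambda>x. h (fst x) (snd x))"
    by (intro bounded_bilinear.continuous_on[OF assms(1)] continuous_intros)
  from borel_measurable_continuous_Pair[OF assms(2,3) this] show ?thesis by simp
qed

lemma borel_measurable_indicator_restrict:
  fixes f :: "real \<Rightarrow> 'a::euclidean_space"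
  assumes I: "half_line I"
  shows "f \<in> borel_measurable (restrict_space borel I) \<longleftrightarrow> (\<lambda>x. indicator I x *\<^sub>R f x) \<in> borel_measurable borel"
  using half_line_measurable[OF I] by (subst borel_measurable_restrict_space_iff) auto

text \<open>The weight may be singular, so the form is only semi-definite, and the inequalities are
  proved for functions before classes are formed.\<close>

locale L2_weight =
  fixes H :: "real \<Rightarrow> complex ^ 'm ^ 'm" and I :: "real set"
  assumes I: "half_line I" and H: "L1_loc I H"
    and psd: "AE x in lebesgue. x \<in> I \<longrightarrow> psd (H x)"
begin

abbreviation "L2 \<equiv> L2_fun H I"
abbreviation "ip \<equiv> L2_fun_inner H I"
abbreviation "form f g x \<equiv> cdot (f x) (H x *v g x)"

lemma form_measurable:
  assumes "f \<in> borel_measurable (restrict_space borel I)" "g \<in> borel_measurable (restrict_space borel I)"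
  shows "(\<lambda>x. indicator I x *\<^sub>R form f g x) \<in> borel_measurable lebesgue"
proof -
  have m: "(\<lambda>x. indicator I x *\<^sub>R f x) \<in> borel_measurable lebesgue"
    if "f \<in> borel_measurable (restrict_space borel I)" for f :: "real \<Rightarrow> complex ^ 'm"
  proof (rule measurable_completion)
    show "(\<lambda>x. indicator I x *\<^sub>R f x) \<in> borel_measurable lborel"
      using that borel_measurable_indicator_restrict[OF I, of f] by simp
  qed
  have "(\<lambda>x. cdot (indicator I x *\<^sub>R f x) ((indicator I x *\<^sub>R H x) *v (indicator I x *\<^sub>R g x))) \<in> borel_measurable lebesgue"
    by (intro borel_measurable_bounded_bilinear[OF bounded_bilinear_cdot]
        borel_measurable_bounded_bilinear[OF bounded_bilinear_matrix_vector] m assms L1_loc_measurable[OF I H])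
  moreover have "cdot (indicator I x *\<^sub>R f x) ((indicator I x *\<^sub>R H x) *v (indicator I x *\<^sub>R g x))
      = indicator I x *\<^sub>R form f g x" for x
    by (auto simp: indicator_def cdot_simps)
  ultimately show ?thesis by simp
qed

lemma form_le: "psd (H x) \<Longrightarrow> norm (form f g x) \<le> Re (form f f x) + Re (form g g x)"
proof -
  assume p: "psd (H x)"
  have "(norm (form f g x))\<^sup>2 \<le> Re (form f f x) * Re (form g g x)"
    by (rule psd_Cauchy_Schwarz[OF p])
  also have "\<dots> \<le> (Re (form f f x) + Re (form g g x))\<^sup>2"
    using psd_nonneg[OF p] by (simp add: power2_eq_square algebra_simps)
  finally show ?thesis using psd_nonneg[OF p] by (meson add_nonneg_nonneg power2_le_imp_le)
qed

lemma form_integrable: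
  assumes "f \<in> L2" "g \<in> L2"
  shows "set_integrable lebesgue I (form f g)"
  unfolding set_integrable_def
proof (rule Bochner_Integration.integrable_bound)
  have "integrable lebesgue (\<lambda>x. indicator I x *\<^sub>R form f f x)" "integrable lebesgue (\<lambda>x. indicator I x *\<^sub>R form g g x)"
    using assms by (auto simp: L2_fun_def set_integrable_def)
  then show "integrable lebesgue (\<lambda>x. norm (indicator I x *\<^sub>R form f f x) + norm (indicator I x *\<^sub>R form g g x))"
    by (intro Bochner_Integration.integrable_add integrable_norm)
  show "(\<lambda>x. indicator I x *\<^sub>R form f g x) \<in> borel_measurable lebesgue"
    using assms by (intro form_measurable) (auto simp: L2_fun_def)
  show "AE x in lebesgue. norm (indicator I x *\<^sub>R form f g x)
      \<le> norm (norm (indicator I x *\<^sub>R form f f x) + norm (indicator I x *\<^sub>R form g g x))"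
    using psd
  proof eventually_elim
    case (elim x)
    show ?case
    proof (cases "x \<in> I")
      case True
      with elim have "norm (form f g x) \<le> Re (form f f x) + Re (form g g x)" by (intro form_le) auto
      also have "\<dots> \<le> norm (form f f x) + norm (form g g x)" by (intro add_mono complex_Re_le_cmod)
      finally show ?thesis using True by simp
    qed simp
  qed
qed

lemma measurable_scale:
  "f \<in> borel_measurable (restrict_space borel I) \<Longrightarrow> (\<lambda>x. c *s f x :: complex ^ 'm) \<in> borel_measurable (restrict_space borel I)"
proof -
  assume f: "f \<in> borel_measurable (restrict_space borel I)"
  have "bounded_linear (\<lambda>v::complex ^ 'm. c *s v)"
    unfolding linear_conv_bounded_linear[symmetric] linear_iff
    by (auto simp: vec_eq_iff algebra_simps)
  then have "continuous_on UNIV (\<lambda>v::complex ^ 'm. c *s v)" by (rule linear_continuous_on)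
  from borel_measurable_continuous_on[OF this f] show ?thesis .
qed

lemma L2_lincomb2:
  assumes f: "f \<in> L2" and g: "g \<in> L2"
  shows "(\<lambda>x. c *s f x + d *s g x) \<in> L2"
proof -
  have "form (\<lambda>x. c *s f x + d *s g x) (\<lambda>x. c *s f x + d *s g x) x
      = cnj c * c * form f f x + cnj c * d * form f g x + cnj d * c * form g f x + cnj d * d * form g g x" for x
    by (simp add: cdot_simps mv_simps vector_scalar_commute cdot_scale_left cdot_scale_right algebra_simps)
  moreover have "set_integrable lebesgue I (\<lambda>x. cnj c * c * form f f x + cnj c * d * form f g x + cnj d * c * form g f x + cnj d * d * form g g x)"
    by (intro set_integral_add set_integrable_mult_right form_integrable f g)
  ultimately have "set_integrable lebesgue I (form (\<lambda>x. c *s f x + d *s g x) (\<lambda>x. c *s f x + d *s g x))"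
    by simp
  moreover have "(\<lambda>x. c *s f x + d *s g x) \<in> borel_measurable (restrict_space borel I)"
    using f g by (intro borel_measurable_add measurable_scale) (auto simp: L2_fun_def)
  ultimately show ?thesis by (simp add: L2_fun_def)
qed

lemma L2_zero: "(\<lambda>x. 0) \<in> L2"
  by (simp add: L2_fun_def cdot_simps mv_simps set_integrable_def)

lemma L2_scale_mem: "f \<in> L2 \<Longrightarrow> (\<lambda>x. c *s f x) \<in> L2"
  using L2_lincomb2[of f f c 0] by simp

lemma L2_diff: "f \<in> L2 \<Longrightarrow> g \<in> L2 \<Longrightarrow> f - g \<in> L2"
  using L2_lincomb2[of f g 1 "-1"] by (simp add: fun_diff_def)

lemma L2_sum: "finite K \<Longrightarrow> (\<And>i. i \<in> K \<Longrightarrow> f i \<in> L2) \<Longrightarrow> (\<lambda>x. \<Sum>i\<in>K. a i *s f i x) \<in> L2"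
proof (induction K rule: finite_induct)
  case (insert i K)
  then have "(\<lambda>x. \<Sum>i\<in>K. a i *s f i x) \<in> L2" by auto
  with insert show ?case using L2_lincomb2[of "f i" _ "a i" 1] by simp
qed (simp add: L2_zero)

lemma ip_cnj: "f \<in> L2 \<Longrightarrow> g \<in> L2 \<Longrightarrow> cnj (ip f g) = ip g f"
proof -
  assume f: "f \<in> L2" and g: "g \<in> L2"
  have "cnj (ip f g) = (LINT x:I|lebesgue. cnj (form f g x))"
  proof -
    have "(LINT x:I|lebesgue. cnj (form f g x)) = integral\<^sup>L lebesgue (\<lambda>x. cnj (indicator I x *\<^sub>R form f g x))"
      unfolding set_lebesgue_integral_def by simp
    also have "\<dots> = cnj (ip f g)"
      unfolding L2_fun_inner_def set_lebesgue_integral_def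
      using Bochner_Integration.integral_cnj[of lebesgue "\<lambda>x. indicator I x *\<^sub>R form f g x"] by blast
    finally show ?thesis by simp
  qed
  also have "\<dots> = ip g f"
    unfolding L2_fun_inner_def set_lebesgue_integral_def
  proof (rule integral_cong_AE)
    have "(\<lambda>x. cnj (indicator I x *\<^sub>R form f g x)) \<in> borel_measurable lebesgue"
      using form_integrable[OF f g] unfolding set_integrable_def
      by (intro borel_measurable_integrable integrable_bounded_linear[OF bounded_linear_cnj])
    then show "(\<lambda>x. indicator I x *\<^sub>R cnj (form f g x)) \<in> borel_measurable lebesgue" by simp
    show "(\<lambda>x. indicator I x *\<^sub>R form g f x) \<in> borel_measurable lebesgue"
      using form_integrable[OF g f] unfolding set_integrable_def by auto
    show "AE x in lebesgue. indicator I x *\<^sub>R cnj (form f g x) = indicator I x *\<^sub>R form g f x"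
      using psd
    proof eventually_elim
      case (elim x)
      then show ?case
        using hermitian_cdot_cnj[OF psd_hermitian, of "H x" "g x" "f x"] by (auto simp: indicator_def)
    qed
  qed
  finally show ?thesis .
qed

lemma ip_lincomb_right:
  "f \<in> L2 \<Longrightarrow> g \<in> L2 \<Longrightarrow> h \<in> L2 \<Longrightarrow> ip f (\<lambda>x. c *s g x + d *s h x) = c * ip f g + d * ip f h"
proof -
  assume f: "f \<in> L2" and g: "g \<in> L2" and h: "h \<in> L2"
  have "form f (\<lambda>x. c *s g x + d *s h x) x = c * form f g x + d * form f h x" for x
    by (simp add: cdot_simps mv_simps vector_scalar_commute cdot_scale_right)
  then have "ip f (\<lambda>x. c *s g x + d *s h x) = (LINT x:I|lebesgue. c * form f g x + d * form f h x)"
    by (simp add: L2_fun_inner_def)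
  also have "\<dots> = c * ip f g + d * ip f h"
    unfolding L2_fun_inner_def using form_integrable[OF f g] form_integrable[OF f h]
    by (subst set_integral_add(2)) (auto intro: set_integrable_mult_right)
  finally show ?thesis .
qed

lemma ip_lincomb_left:
  "f \<in> L2 \<Longrightarrow> g \<in> L2 \<Longrightarrow> h \<in> L2 \<Longrightarrow> ip (\<lambda>x. c *s g x + d *s h x) f = cnj c * ip g f + cnj d * ip h f"
proof -
  assume f: "f \<in> L2" and g: "g \<in> L2" and h: "h \<in> L2"
  have "ip (\<lambda>x. c *s g x + d *s h x) f = cnj (ip f (\<lambda>x. c *s g x + d *s h x))"
    using f L2_lincomb2[OF g h] by (simp add: ip_cnj)
  also have "\<dots> = cnj c * ip g f + cnj d * ip h f"
    using f g h by (simp add: ip_lincomb_right ip_cnj)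
  finally show ?thesis .
qed

lemma ip_self: "ip f f = of_real (Re (ip f f))" "Re (ip f f) \<ge> 0" if f: "f \<in> L2" for f
proof -
  have "cnj (ip f f) = ip f f" by (rule ip_cnj[OF f f])
  then show "ip f f = of_real (Re (ip f f))" by (simp add: complex_eq_iff)
  have "Re (ip f f) = (LINT x:I|lebesgue. Re (form f f x))"
    using form_integrable[OF f f] unfolding L2_fun_inner_def set_lebesgue_integral_def set_integrable_def
    by (simp flip: integral_Re)
  also have "\<dots> \<ge> 0"
    unfolding set_lebesgue_integral_def
  proof (rule integral_nonneg_AE)
    show "AE x in lebesgue. 0 \<le> indicat_real I x *\<^sub>R Re (form f f x)"
      using psd by eventually_elim (auto simp: indicator_def psd_nonneg)
  qed
  finally show "Re (ip f f) \<ge> 0" .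
qed

lemma ip_Cauchy_Schwarz:
  assumes f: "f \<in> L2" and g: "g \<in> L2"
  shows "(norm (ip f g))\<^sup>2 \<le> Re (ip f f) * Re (ip g g)"
proof (rule discriminant_nonpos)
  define b where "b = ip f g"
  fix t :: real
  define c where "c = - of_real t * cnj b"
  have gf: "ip g f = cnj b" unfolding b_def by (rule ip_cnj[OF f g, symmetric])
  let ?h = "\<lambda>x. 1 *s f x + c *s g x"
  have h: "?h \<in> L2" by (rule L2_lincomb2[OF f g])
  have "ip ?h ?h = ip f f + c * b + cnj c * cnj b + cnj c * c * ip g g"
    unfolding ip_lincomb_right[OF h f g] ip_lincomb_left[OF f f g] ip_lincomb_left[OF g f g]
    by (simp add: gf b_def[symmetric] algebra_simps)
  moreover have nb: "b * cnj b = of_real ((norm b)\<^sup>2)" by (rule complex_norm_square[symmetric])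
  have "c * b = - of_real t * (b * cnj b)" "cnj c * cnj b = - of_real t * (b * cnj b)"
    "cnj c * c = of_real (t\<^sup>2) * (b * cnj b)"
    by (simp_all add: c_def power2_eq_square mult_ac)
  then have "c * b = of_real (- t * (norm b)\<^sup>2)" "cnj c * cnj b = of_real (- t * (norm b)\<^sup>2)"
    "cnj c * c = of_real (t\<^sup>2 * (norm b)\<^sup>2)"
    unfolding nb by simp_all
  ultimately have "ip ?h ?h = ip f f + of_real (- t * (norm b)\<^sup>2) + of_real (- t * (norm b)\<^sup>2) + of_real (t\<^sup>2 * (norm b)\<^sup>2) * ip g g"
    by simp
  then have "Re (ip ?h ?h) = Re (ip f f) - 2 * t * (norm b)\<^sup>2 + t\<^sup>2 * (norm b)\<^sup>2 * Re (ip g g)"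
    by (simp del: of_real_mult of_real_minus)
  then show "0 \<le> Re (ip f f) - 2 * t * (norm b)\<^sup>2 + t\<^sup>2 * (norm b)\<^sup>2 * Re (ip g g)"
    using ip_self(2)[OF h] by simp
qed (use ip_self[OF g] in auto)

lemma null_ip: "f \<in> L2_null H I \<Longrightarrow> g \<in> L2 \<Longrightarrow> ip f g = 0" "f \<in> L2_null H I \<Longrightarrow> g \<in> L2 \<Longrightarrow> ip g f = 0"
proof -
  assume f: "f \<in> L2_null H I" and g: "g \<in> L2"
  then have f': "f \<in> L2" "ip f f = 0" by (auto simp: L2_null_def)
  show "ip f g = 0" using ip_Cauchy_Schwarz[OF f'(1) g] f'(2) by simp
  then show "ip g f = 0" using ip_cnj[OF f'(1) g] by simp
qed

lemma null_AE_zero: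
  assumes f: "f \<in> L2" and 0: "AE x in lebesgue. x \<in> I \<longrightarrow> H x *v f x = 0"
  shows "f \<in> L2_null H I"
proof -
  have "ip f f = (LINT x:I|lebesgue. 0)"
    unfolding L2_fun_inner_def set_lebesgue_integral_def
  proof (rule integral_cong_AE)
    show "(\<lambda>x. indicator I x *\<^sub>R form f f x) \<in> borel_measurable lebesgue"
      using form_integrable[OF f f] unfolding set_integrable_def by auto
    show "AE x in lebesgue. indicator I x *\<^sub>R form f f x = indicat_real I x *\<^sub>R 0"
      using 0 by eventually_elim (auto simp: indicator_def cdot_simps)
  qed simp
  then show ?thesis using f by (simp add: L2_null_def set_lebesgue_integral_def)
qed

text \<open>Together with \<open>null_AE_zero\<close> this describes null functions by a pointwise
  linear condition, through which all questions about representatives are settled.\<close>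

lemma null_AE:
  assumes f: "f \<in> L2_null H I"
  shows "AE x in lebesgue. x \<in> I \<longrightarrow> H x *v f x = 0"
proof -
  have f': "f \<in> L2" "ip f f = 0" using f by (auto simp: L2_null_def)
  have "integrable lebesgue (\<lambda>x. Re (indicator I x *\<^sub>R form f f x))"
    using form_integrable[OF f'(1) f'(1)] unfolding set_integrable_def by (rule integrable_Re)
  moreover have "integral\<^sup>L lebesgue (\<lambda>x. Re (indicator I x *\<^sub>R form f f x)) = 0"
    using form_integrable[OF f'(1) f'(1)] f'(2) unfolding set_integrable_def L2_fun_inner_def set_lebesgue_integral_def
    by (subst integral_Re) auto
  moreover have "AE x in lebesgue. 0 \<le> Re (indicator I x *\<^sub>R form f f x)"
    using psd by eventually_elim (auto simp: indicator_def psd_nonneg)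
  ultimately have "AE x in lebesgue. Re (indicator I x *\<^sub>R form f f x) = 0"
    by (subst (asm) integral_nonneg_eq_0_iff_AE) auto
  with psd show ?thesis
  proof eventually_elim
    case (elim x)
    then show ?case using psd_zero_form[of "H x" "f x"] by (auto simp: indicator_def)
  qed
qed

lemma null_diff_sym: "f - g \<in> L2_null H I \<Longrightarrow> f \<in> L2 \<Longrightarrow> g \<in> L2 \<Longrightarrow> g - f \<in> L2_null H I"
proof (rule null_AE_zero)
  assume "f - g \<in> L2_null H I"
  from null_AE[OF this] show "AE x in lebesgue. x \<in> I \<longrightarrow> H x *v (g - f) x = 0"
    by eventually_elim (auto simp: mv_simps)
qed (auto intro: L2_diff)

lemma rel_equiv: "equiv L2 (L2_rel H I)"
proof (rule equivI)
  show "L2_rel H I \<subseteq> L2 \<times> L2" by (auto simp: L2_rel_def)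
  show "refl_on L2 (L2_rel H I)"
  proof (rule refl_onI)
    fix f assume f: "f \<in> L2"
    have "f - f \<in> L2_null H I"
      by (rule null_AE_zero[OF L2_diff[OF f f]]) (simp add: mv_simps)
    with f show "(f, f) \<in> L2_rel H I" by (simp add: L2_rel_def)
  qed
  show "sym (L2_rel H I)"
    by (rule symI) (auto simp: L2_rel_def null_diff_sym)
  show "trans (L2_rel H I)"
  proof (rule transI)
    fix f g h assume "(f, g) \<in> L2_rel H I" "(g, h) \<in> L2_rel H I"
    then have m: "f \<in> L2" "g \<in> L2" "h \<in> L2" "f - g \<in> L2_null H I" "g - h \<in> L2_null H I" by (auto simp: L2_rel_def)
    have "f - h \<in> L2_null H I"
    proof (rule null_AE_zero[OF L2_diff[OF m(1,3)]])
      show "AE x in lebesgue. x \<in> I \<longrightarrow> H x *v (f - h) x = 0"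
        using null_AE[OF m(4)] null_AE[OF m(5)] by eventually_elim (auto simp: mv_simps)
    qed
    with m show "(f, h) \<in> L2_rel H I" by (simp add: L2_rel_def)
  qed
qed

lemma class_mem: "f \<in> L2 \<Longrightarrow> L2_class H I f \<in> L2_space H I"
  by (simp add: L2_class_def L2_space_def quotientI)

lemma class_eq_iff: "f \<in> L2 \<Longrightarrow> g \<in> L2 \<Longrightarrow> L2_class H I f = L2_class H I g \<longleftrightarrow> f - g \<in> L2_null H I"
  unfolding L2_class_def using eq_equiv_class_iff[OF rel_equiv, of f g] by (simp add: L2_rel_def)

lemma rep_mem: "u \<in> L2_space H I \<Longrightarrow> L2_rep u \<in> L2"
  and class_rep: "u \<in> L2_space H I \<Longrightarrow> L2_class H I (L2_rep u) = u"
proof -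
  assume u: "u \<in> L2_space H I"
  then obtain f where f: "f \<in> L2" "u = L2_rel H I `` {f}"
    by (auto simp: L2_space_def elim: quotientE)
  have "f \<in> u" using f equiv_class_self[OF rel_equiv f(1)] by simp
  then have r: "L2_rep u \<in> u" unfolding L2_rep_def by (rule someI[of "\<lambda>f. f \<in> u"])
  then show m: "L2_rep u \<in> L2" using f by (auto simp: L2_rel_def)
  show "L2_class H I (L2_rep u) = u"
    using r equiv_class_eq[OF rel_equiv, of f "L2_rep u"] unfolding L2_class_def f(2) by auto
qed

lemma rep_class: "f \<in> L2 \<Longrightarrow> L2_rep (L2_class H I f) - f \<in> L2_null H I"
  using class_eq_iff[OF rep_mem[OF class_mem]] class_rep[OF class_mem] by blast

text \<open>Operations on classes are computed on arbitrarily chosen representatives; this allows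
  any other representative in their place.\<close>

lemma ip_null_cong:
  assumes "f \<in> L2" "f' \<in> L2" "g \<in> L2" "g' \<in> L2" "f - f' \<in> L2_null H I" "g - g' \<in> L2_null H I"
  shows "ip f g = ip f' g'"
proof -
  have f: "f = (\<lambda>x. 1 *s f' x + 1 *s (f - f') x)" and g: "g = (\<lambda>x. 1 *s g' x + 1 *s (g - g') x)" by auto
  have "ip f g = ip f' g"
    using ip_lincomb_left[OF assms(3,2) L2_diff[OF assms(1,2)], of 1 1] null_ip(1)[OF assms(5,3)] f by simp
  also have "\<dots> = ip f' g'"
    using ip_lincomb_right[OF assms(2,4) L2_diff[OF assms(3,4)], of 1 1] null_ip(2)[OF assms(6,2)] g by simp
  finally show ?thesis .
qed

lemma inner_class: "f \<in> L2 \<Longrightarrow> g \<in> L2 \<Longrightarrow> L2_inner H I (L2_class H I f) (L2_class H I g) = ip f g"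
  unfolding L2_inner_def by (intro ip_null_cong rep_mem class_mem rep_class)

lemma scale_class: "f \<in> L2 \<Longrightarrow> L2_scale H I z (L2_class H I f) = L2_class H I (\<lambda>x. z *s f x)"
  unfolding L2_scale_def
proof (subst class_eq_iff)
  assume f: "f \<in> L2"
  let ?r = "L2_rep (L2_class H I f)"
  show r: "(\<lambda>x. z *s ?r x) \<in> L2" "(\<lambda>x. z *s f x) \<in> L2" using f by (auto intro: L2_scale_mem rep_mem class_mem)
  show "(\<lambda>x. z *s ?r x) - (\<lambda>x. z *s f x) \<in> L2_null H I"
  proof (rule null_AE_zero[OF L2_diff[OF r]])
    show "AE x in lebesgue. x \<in> I \<longrightarrow> H x *v ((\<lambda>x. z *s ?r x) - (\<lambda>x. z *s f x)) x = 0"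
      using null_AE[OF rep_class[OF f]]
    proof eventually_elim
      case (elim x)
      have "((\<lambda>x. z *s ?r x) - (\<lambda>x. z *s f x)) x = z *s (?r - f) x"
        by (simp add: vec_eq_iff algebra_simps)
      then have "H x *v ((\<lambda>x. z *s ?r x) - (\<lambda>x. z *s f x)) x = z *s (H x *v (?r - f) x)"
        by (simp only: vector_scalar_commute)
      with elim show ?case by (metis vector_smult_rzero)
    qed
  qed
qed

lemma lincomb_class:
  assumes "\<And>i. i < k \<Longrightarrow> u i = L2_class H I (f i)" "\<And>i. i < k \<Longrightarrow> f i \<in> L2"
  shows "L2_lincomb H I k a u = L2_class H I (\<lambda>x. \<Sum>i<k. a i *s f i x)"
  unfolding L2_lincomb_def
proof (subst class_eq_iff)
  have ru: "L2_rep (u i) \<in> L2" if "i < k" for i using assms that by (metis rep_mem class_mem)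
  show m: "(\<lambda>x. \<Sum>i<k. a i *s L2_rep (u i) x) \<in> L2" "(\<lambda>x. \<Sum>i<k. a i *s f i x) \<in> L2"
    using ru assms by (auto intro: L2_sum)
  show "(\<lambda>x. \<Sum>i<k. a i *s L2_rep (u i) x) - (\<lambda>x. \<Sum>i<k. a i *s f i x) \<in> L2_null H I"
  proof (rule null_AE_zero[OF L2_diff[OF m]])
    have "AE x in lebesgue. \<forall>i\<in>{..<k}. x \<in> I \<longrightarrow> H x *v (L2_rep (u i) - f i) x = 0"
      by (rule AE_finite_allI) (use assms null_AE[OF rep_class] in auto)
    then show "AE x in lebesgue. x \<in> I \<longrightarrow> H x *v ((\<lambda>x. \<Sum>i<k. a i *s L2_rep (u i) x) - (\<lambda>x. \<Sum>i<k. a i *s f i x)) x = 0"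
    proof eventually_elim
      case (elim x)
      have "((\<lambda>x. \<Sum>i<k. a i *s L2_rep (u i) x) - (\<lambda>x. \<Sum>i<k. a i *s f i x)) x = (\<Sum>i<k. a i *s (L2_rep (u i) - f i) x)"
        by (simp add: vec_eq_iff algebra_simps sum_subtractf)
      then have "H x *v (((\<lambda>x. \<Sum>i<k. a i *s L2_rep (u i) x) - (\<lambda>x. \<Sum>i<k. a i *s f i x)) x)
          = (\<Sum>i<k. a i *s (H x *v (L2_rep (u i) - f i) x))"
        by (simp only: bounded_bilinear.sum_right[OF bounded_bilinear_matrix_vector] vector_scalar_commute)
      then show ?case using elim by auto
    qed
  qed
qed

lemma dist_class:
  assumes f: "f \<in> L2" and g: "g \<in> L2"
  shows "L2_dist H I (L2_class H I f) (L2_class H I g) = sqrt (Re (ip (f - g) (f - g)))"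
proof -
  let ?f = "L2_rep (L2_class H I f)" and ?g = "L2_rep (L2_class H I g)"
  have m: "?f \<in> L2" "?g \<in> L2" using f g by (auto intro: rep_mem class_mem)
  have "(?f - ?g) - (f - g) \<in> L2_null H I"
  proof (rule null_AE_zero)
    show "(?f - ?g) - (f - g) \<in> L2" using f g m by (intro L2_diff)
    show "AE x in lebesgue. x \<in> I \<longrightarrow> H x *v ((?f - ?g) - (f - g)) x = 0"
      using null_AE[OF rep_class[OF f]] null_AE[OF rep_class[OF g]]
      by eventually_elim (auto simp: mv_simps)
  qed
  then have "ip (?f - ?g) (?f - ?g) = ip (f - g) (f - g)"
    using f g m by (intro ip_null_cong L2_diff) auto
  then show ?thesis unfolding L2_dist_def by simp
qed

text \<open>Each pair in \<open>T\<close> belongs to the closure, being at distance 0 from itself,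
  so an element of the adjoint may be tested on \<open>T\<close> directly.\<close>

lemma rel_adjoint_closureD:
  assumes uv: "(u, v) \<in> rel_adjoint H I (rel_closure H I T)" and T: "(L2_class H I f, L2_class H I g) \<in> T"
    and f: "f \<in> L2" and g: "g \<in> L2"
  shows "ip (L2_rep u) g = ip (L2_rep v) f"
proof -
  have u: "u \<in> L2_space H I" "v \<in> L2_space H I" using uv by (auto simp: rel_adjoint_def)
  have d0: "L2_dist H I (L2_class H I f) (L2_class H I f) = 0" if "f \<in> L2" for f
    unfolding dist_class[OF that that] by (simp add: L2_fun_inner_def cdot_simps set_lebesgue_integral_def)
  have "(L2_class H I f, L2_class H I g) \<in> rel_closure H I T"
    unfolding rel_closure_def using f g T d0 by (auto simp: class_mem intro!: bexI[OF _ T])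
  then have "L2_inner H I u (L2_class H I g) = L2_inner H I v (L2_class H I f)"
    using uv unfolding rel_adjoint_def by auto
  then show ?thesis
    using inner_class[OF rep_mem[OF u(1)] g] inner_class[OF rep_mem[OF u(2)] f] class_rep u by simp
qed

text \<open>Conversely, the identity on \<open>T\<close> persists on the closure by continuity of
  the inner product.\<close>

lemma rel_adjoint_closureI:
  assumes u: "u \<in> L2" and v: "v \<in> L2"
    and T: "\<And>\<phi> \<psi>. (\<phi>, \<psi>) \<in> T \<Longrightarrow> \<exists>f g. f \<in> L2 \<and> g \<in> L2 \<and> \<phi> = L2_class H I f \<and> \<psi> = L2_class H I g \<and> ip u g = ip v f"
  shows "(L2_class H I u, L2_class H I v) \<in> rel_adjoint H I (rel_closure H I T)"
proof -
  have "L2_inner H I (L2_class H I u) \<psi> = L2_inner H I (L2_class H I v) \<phi>" if c: "(\<phi>, \<psi>) \<in> rel_closure H I T" for \<phi> \<psi>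
  proof -
    have m: "\<phi> \<in> L2_space H I" "\<psi> \<in> L2_space H I" using c by (auto simp: rel_closure_def)
    define p q where "p = L2_rep \<phi>" and "q = L2_rep \<psi>"
    have pq: "p \<in> L2" "q \<in> L2" "L2_class H I p = \<phi>" "L2_class H I q = \<psi>"
      using m by (auto simp: p_def q_def rep_mem class_rep)
    define B where "B = sqrt (Re (ip u u)) + sqrt (Re (ip v v))"
    have B: "B \<ge> 0" using ip_self(2)[OF u] ip_self(2)[OF v] by (simp add: B_def)
    have "norm (ip u q - ip v p) \<le> 0 + e" if e: "e > 0" for e
    proof -
      \<comment> \<open>\<open>B + 1\<close> keeps the divisor positive when \<open>u\<close> and
        \<open>v\<close> both have norm 0.\<close>
      define e' where "e' = e / (B + 1)"
      have e': "e' > 0" using e B by (simp add: e'_def)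
      obtain \<phi>' \<psi>' where T': "(\<phi>', \<psi>') \<in> T" "L2_dist H I \<phi> \<phi>' < e'" "L2_dist H I \<psi> \<psi>' < e'"
        using c e' unfolding rel_closure_def by auto
      obtain f g where fg: "f \<in> L2" "g \<in> L2" "\<phi>' = L2_class H I f" "\<psi>' = L2_class H I g" "ip u g = ip v f"
        using T[OF T'(1)] by blast
      have CS: "norm (ip a b) \<le> sqrt (Re (ip a a)) * sqrt (Re (ip b b))" if "a \<in> L2" "b \<in> L2" for a b
        using ip_Cauchy_Schwarz[OF that] by (metis real_le_rsqrt real_sqrt_mult)
      have diff: "ip a (b - d) = ip a b - ip a d" if "a \<in> L2" "b \<in> L2" "d \<in> L2" for a b d
        using ip_lincomb_right[OF that, of 1 "-1"] by (simp add: fun_diff_def)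
      have "ip u q - ip v p = ip u (q - g) - ip v (p - f)"
        using fg pq u v by (simp add: diff)
      also have "norm \<dots> \<le> norm (ip u (q - g)) + norm (ip v (p - f))" by (rule norm_triangle_ineq4)
      also have "\<dots> \<le> sqrt (Re (ip u u)) * e' + sqrt (Re (ip v v)) * e'"
      proof (rule add_mono)
        have "sqrt (Re (ip (q - g) (q - g))) < e'" "sqrt (Re (ip (p - f) (p - f))) < e'"
          using T' dist_class[OF pq(1) fg(1)] dist_class[OF pq(2) fg(2)] pq fg by auto
        then show "norm (ip u (q - g)) \<le> sqrt (Re (ip u u)) * e'" "norm (ip v (p - f)) \<le> sqrt (Re (ip v v)) * e'"
          using CS[OF u L2_diff[OF pq(2) fg(2)]] CS[OF v L2_diff[OF pq(1) fg(1)]] ip_self(2)[OF u] ip_self(2)[OF v]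
          by (meson less_imp_le mult_left_mono order_trans real_sqrt_ge_zero)+
      qed
      also have "\<dots> = B * e' " by (simp add: B_def algebra_simps)
      also have "\<dots> \<le> e" using B e by (simp add: e'_def field_simps)
      finally show ?thesis by simp
    qed
    then have "norm (ip u q - ip v p) \<le> 0" by (rule field_le_epsilon)
    then show ?thesis
      using inner_class[OF u pq(2)] inner_class[OF v pq(1)] pq by simp
  qed
  then show ?thesis using class_mem[OF u] class_mem[OF v] by (auto simp: rel_adjoint_def)
qed

end

section \<open>Dimensions\<close>

lemma linear_combination_sum:
  fixes \<Phi> :: "('x \<Rightarrow> complex ^ 'm) \<Rightarrow> complex ^ 'n"
  assumes zero: "(\<lambda>x. 0) \<in> S" "\<Phi> (\<lambda>x. 0) = 0"
    and comb: "\<And>f g c d. f \<in> S \<Longrightarrow> g \<in> S \<Longrightarrow> (\<lambda>x. c *s f x + d *s g x) \<in> S"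
    and lin: "\<And>f g c d. f \<in> S \<Longrightarrow> g \<in> S \<Longrightarrow> \<Phi> (\<lambda>x. c *s f x + d *s g x) = c *s \<Phi> f + d *s \<Phi> g"
    and K: "finite K" "\<And>i. i \<in> K \<Longrightarrow> f i \<in> S"
  shows "(\<lambda>x. \<Sum>i\<in>K. a i *s f i x) \<in> S \<and> \<Phi> (\<lambda>x. \<Sum>i\<in>K. a i *s f i x) = (\<Sum>i\<in>K. a i *s \<Phi> (f i))"
  using K
proof (induction K rule: finite_induct)
  case (insert i K)
  then have IH: "(\<lambda>x. \<Sum>i\<in>K. a i *s f i x) \<in> S" "\<Phi> (\<lambda>x. \<Sum>i\<in>K. a i *s f i x) = (\<Sum>i\<in>K. a i *s \<Phi> (f i))"
    by auto
  have "f i \<in> S" using insert by auto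
  from comb[OF this IH(1), of "a i" 1] lin[OF this IH(1), of "a i" 1] IH(2) insert(1,2) show ?case by simp
qed (use zero in simp)

lemma axis_expansion: "(v :: complex ^ 'n) = (\<Sum>i\<in>UNIV. v $ i *s axis i 1)"
  by (simp add: vec_eq_iff axis_def if_distrib cong: if_cong)

text \<open>The dimension is read off from a linear bijection onto coordinate space; in the
  application it is a boundary map at 0.\<close>

lemma function_space_dim:
  fixes \<Phi> :: "('x \<Rightarrow> complex ^ 'm) \<Rightarrow> complex ^ 'n"
  assumes zero: "(\<lambda>x. 0) \<in> S" "\<Phi> (\<lambda>x. 0) = 0"
    and comb: "\<And>f g c d. f \<in> S \<Longrightarrow> g \<in> S \<Longrightarrow> (\<lambda>x. c *s f x + d *s g x) \<in> S"
    and lin: "\<And>f g c d. f \<in> S \<Longrightarrow> g \<in> S \<Longrightarrow> \<Phi> (\<lambda>x. c *s f x + d *s g x) = c *s \<Phi> f + d *s \<Phi> g"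
    and inj: "\<And>f. f \<in> S \<Longrightarrow> \<Phi> f = 0 \<Longrightarrow> f = (\<lambda>x. 0)"
    and surj: "\<And>w. \<exists>f\<in>S. \<Phi> f = w"
  shows "vector_space.dim (\<lambda>(a::complex) f x. a *s f x) S = CARD('n)"
proof -
  interpret vs: vector_space "\<lambda>(a::complex) (f :: 'x \<Rightarrow> complex ^ 'm) x. a *s f x"
    by unfold_locales (auto simp: fun_eq_iff vec_eq_iff algebra_simps)
  have sums: "(\<lambda>x. \<Sum>i\<in>K. a i *s f i x) \<in> S \<and> \<Phi> (\<lambda>x. \<Sum>i\<in>K. a i *s f i x) = (\<Sum>i\<in>K. a i *s \<Phi> (f i))"
    if "finite K" "\<And>i. i \<in> K \<Longrightarrow> f i \<in> S" for K :: "'n set" and f and a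
    using that by (intro linear_combination_sum zero comb lin) auto
  have "\<forall>i. \<exists>f. f \<in> S \<and> \<Phi> f = axis i 1" using surj by blast
  then obtain b where b: "\<And>i. b i \<in> S" "\<And>i. \<Phi> (b i) = axis i 1" by metis
  have inj_b: "inj b"
  proof (rule injI)
    fix i j assume "b i = b j"
    then have "axis i (1::complex) = axis j 1" using b(2) by metis
    then show "i = j" by (simp add: axis_eq_axis)
  qed
  have sum_fun: "(\<Sum>i\<in>K. (\<lambda>x. a i *s b i x)) = (\<lambda>x. \<Sum>i\<in>K. a i *s b i x)" for a and K :: "'n set"
    by (induction K rule: infinite_finite_induct) (auto simp: fun_eq_iff)
  have indep: "vs.independent (range b)"
  proof (rule vs.independent_if_scalars_zero)
    fix u v assume z: "(\<Sum>v\<in>range b. (\<lambda>x. u v *s v x)) = 0" and v: "v \<in> range b"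
    have "(\<Sum>v\<in>range b. (\<lambda>x. u v *s v x)) = (\<Sum>i\<in>UNIV. (\<lambda>x. u (b i) *s b i x))"
      using inj_b by (simp add: sum.reindex)
    then have "(\<lambda>x. \<Sum>i\<in>UNIV. u (b i) *s b i x) = (\<lambda>x. 0)"
      using z unfolding sum_fun by (simp add: zero_fun_def)
    then have "(\<Sum>i\<in>UNIV. u (b i) *s axis i (1::complex)) = 0"
      using sums[of UNIV b "\<lambda>i. u (b i)"] b zero by simp
    then have "(\<chi> i. u (b i)) = 0" using axis_expansion[of "\<chi> i. u (b i)"] by simp
    with v show "u v = 0" by (auto simp: vec_eq_iff)
  qed simp
  show ?thesis
  proof (rule vs.dim_unique)
    show "range b \<subseteq> S" using b by auto
    show "card (range b) = CARD('n)" using inj_b by (simp add: card_image)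
    show "S \<subseteq> vs.span (range b)"
    proof
      fix f assume f: "f \<in> S"
      define g where "g = (\<lambda>x. \<Sum>i\<in>UNIV. \<Phi> f $ i *s b i x)"
      have g: "g \<in> S" "\<Phi> g = \<Phi> f"
        using sums[of UNIV b "\<lambda>i. \<Phi> f $ i"] b axis_expansion[of "\<Phi> f"] by (auto simp: g_def)
      have "\<Phi> (\<lambda>x. 1 *s f x + (-1) *s g x) = 0" using lin[OF f g(1), of 1 "-1"] g(2) by simp
      then have "(\<lambda>x. 1 *s f x + (-1) *s g x) = (\<lambda>x. 0)" by (rule inj[OF comb[OF f g(1)]])
      then have "f = g" by (simp add: fun_eq_iff)
      also have "g = (\<Sum>i\<in>UNIV. (\<lambda>x. \<Phi> f $ i *s b i x))" by (simp add: g_def sum_fun)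
      also have "\<dots> \<in> vs.span (range b)"
        by (intro vs.span_sum vs.span_scale vs.span_base) auto
      finally show "f \<in> vs.span (range b)" .
    qed
  qed (rule indep)
qed

lemma independent_family_card_le:
  fixes v :: "nat \<Rightarrow> complex ^ 'n"
  assumes "\<And>a. (\<Sum>i<k. a i *s v i) = 0 \<Longrightarrow> \<forall>i<k. a i = 0"
  shows "k \<le> CARD('n)"
proof -
  have inj: "inj_on v {..<k}"
  proof (rule inj_onI, rule ccontr)
    fix i j assume ij: "i \<in> {..<k}" "j \<in> {..<k}" "v i = v j" "i \<noteq> j"
    \<comment> \<open>If two members of the family coincided, their difference would be a nontrivial
      relation.\<close>
    define a where "a l = (if l = i then 1 else if l = j then - 1 else 0 :: complex)" for l
    have "(\<Sum>l<k. a l *s v l) = (\<Sum>l\<in>{i, j}. a l *s v l)"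
      using ij by (intro sum.mono_neutral_right) (auto simp: a_def)
    also have "\<dots> = 0" using ij by (simp add: a_def)
    finally have "a i = 0" using assms[of a] ij by auto
    then show False by (simp add: a_def)
  qed
  have "vec.independent (v ` {..<k})"
  proof (rule vec.independent_if_scalars_zero)
    fix u w assume z: "(\<Sum>x\<in>v ` {..<k}. u x *s x) = 0" and w: "w \<in> v ` {..<k}"
    have "(\<Sum>i<k. u (v i) *s v i) = 0" using z inj by (simp add: sum.reindex)
    from assms[OF this] w show "u w = 0" by auto
  qed simp
  then have "card (v ` {..<k}) \<le> vec.dim (UNIV :: (complex ^ 'n) set)"
    by (intro vec.independent_card_le_dim) auto
  then show ?thesis using inj by (simp add: card_image card_cart_basis)
qed

text \<open>The same count for classes. Since \<open>\<Phi>\<close> acts on functions rather than on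
  classes, \<open>S\<close> must in addition meet the null functions only in 0; otherwise
  independence could be lost in the quotient.\<close>

lemma (in L2_weight) L2_dim_image:
  fixes \<Phi> :: "(real \<Rightarrow> complex ^ 'm) \<Rightarrow> complex ^ 'n"
  assumes S: "S \<subseteq> L2" and zero: "(\<lambda>x. 0) \<in> S" "\<Phi> (\<lambda>x. 0) = 0"
    and comb: "\<And>f g c d. f \<in> S \<Longrightarrow> g \<in> S \<Longrightarrow> (\<lambda>x. c *s f x + d *s g x) \<in> S"
    and lin: "\<And>f g c d. f \<in> S \<Longrightarrow> g \<in> S \<Longrightarrow> \<Phi> (\<lambda>x. c *s f x + d *s g x) = c *s \<Phi> f + d *s \<Phi> g"
    and inj: "\<And>f. f \<in> S \<Longrightarrow> \<Phi> f = 0 \<Longrightarrow> f = (\<lambda>x. 0)"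
    and null: "\<And>f. f \<in> S \<Longrightarrow> f \<in> L2_null H I \<Longrightarrow> f = (\<lambda>x. 0)"
    and surj: "\<And>w. \<exists>f\<in>S. \<Phi> f = w"
  shows "L2_dim H I (L2_class H I ` S) = enat CARD('n)"
proof -
  have sums: "(\<lambda>x. \<Sum>i\<in>K. a i *s f i x) \<in> S \<and> \<Phi> (\<lambda>x. \<Sum>i\<in>K. a i *s f i x) = (\<Sum>i\<in>K. a i *s \<Phi> (f i))"
    if "finite K" "\<And>i. i \<in> K \<Longrightarrow> f i \<in> S" for K :: "nat set" and f and a
    using that by (intro linear_combination_sum zero comb lin) auto
  have class0: "L2_class H I f = L2_class H I (\<lambda>x. 0) \<longleftrightarrow> f \<in> L2_null H I" if "f \<in> L2" for f
    using class_eq_iff[OF that L2_zero] by (simp add: fun_diff_def)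
  show ?thesis
    unfolding L2_dim_def
  proof (rule antisym)
    show "Sup {enat k |k. \<exists>u. (\<forall>i<k. u i \<in> L2_class H I ` S) \<and>
        (\<forall>a. L2_lincomb H I k a u = L2_class H I (\<lambda>x. 0) \<longrightarrow> (\<forall>i<k. a i = 0))} \<le> enat CARD('n)"
    proof (rule Sup_least, clarify)
      fix k u assume u: "\<forall>i<k. u i \<in> L2_class H I ` S"
        and ind: "\<forall>a. L2_lincomb H I k a u = L2_class H I (\<lambda>x. 0) \<longrightarrow> (\<forall>i<k. a i = 0)"
      have "\<forall>i. \<exists>f. i < k \<longrightarrow> f \<in> S \<and> u i = L2_class H I f" using u by blast
      then obtain f where f: "\<And>i. i < k \<Longrightarrow> f i \<in> S" "\<And>i. i < k \<Longrightarrow> u i = L2_class H I (f i)" by metis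
      have "k \<le> CARD('n)"
      proof (rule independent_family_card_le)
        fix a assume z: "(\<Sum>i<k. a i *s \<Phi> (f i)) = 0"
        have s: "(\<lambda>x. \<Sum>i<k. a i *s f i x) \<in> S" "\<Phi> (\<lambda>x. \<Sum>i<k. a i *s f i x) = 0"
          using sums[of "{..<k}" f a] f(1) z by simp_all
        then have "(\<lambda>x. \<Sum>i<k. a i *s f i x) = (\<lambda>x. 0)" by (rule inj)
        moreover have "L2_lincomb H I k a u = L2_class H I (\<lambda>x. \<Sum>i<k. a i *s f i x)"
          by (rule lincomb_class) (use f S in \<open>blast+\<close>)
        ultimately show "\<forall>i<k. a i = 0" using ind by simp
      qed
      then show "enat k \<le> enat CARD('n)" by simp
    qed
    obtain e :: "nat \<Rightarrow> 'n" where e: "bij_betw e {..<CARD('n)} UNIV"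
      using ex_bij_betw_nat_finite[of "UNIV :: 'n set"] by (auto simp: atLeast0LessThan)
    have "\<forall>i. \<exists>f. f \<in> S \<and> \<Phi> f = axis i 1" using surj by blast
    then obtain b where b: "\<And>i. b i \<in> S" "\<And>i. \<Phi> (b i) = axis i 1" by metis
    have "\<forall>i<CARD('n). a i = 0"
      if a: "L2_lincomb H I CARD('n) a (\<lambda>i. L2_class H I (b (e i))) = L2_class H I (\<lambda>x. 0)" for a
    proof -
      have s: "(\<lambda>x. \<Sum>i<CARD('n). a i *s b (e i) x) \<in> S"
        "\<Phi> (\<lambda>x. \<Sum>i<CARD('n). a i *s b (e i) x) = (\<Sum>i<CARD('n). a i *s axis (e i) 1)"
        using sums[of "{..<CARD('n)}" "\<lambda>i. b (e i)" a] b by auto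
      have "L2_class H I (\<lambda>x. \<Sum>i<CARD('n). a i *s b (e i) x) = L2_class H I (\<lambda>x. 0)"
        using a b S lincomb_class[of "CARD('n)" "\<lambda>i. L2_class H I (b (e i))" "\<lambda>i. b (e i)" a] by auto
      then have "(\<lambda>x. \<Sum>i<CARD('n). a i *s b (e i) x) \<in> L2_null H I"
        using class0 s(1) S by blast
      from null[OF s(1) this] s(2) zero have 0: "(\<Sum>i<CARD('n). a i *s axis (e i) 1) = (0 :: complex ^ 'n)" by simp
      show ?thesis
      proof (intro allI impI)
        fix j assume j: "j < CARD('n)"
        have "(\<Sum>i<CARD('n). a i *s axis (e i) 1) $ e j = (\<Sum>i<CARD('n). if i = j then a i else 0)"
        proof -
          have "(a i *s axis (e i) 1 :: complex ^ 'n) $ e j = (if i = j then a i else 0)" if "i < CARD('n)" for i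
            using e j that by (auto simp: axis_def bij_betw_def inj_on_def)
          then show ?thesis by simp
        qed
        with 0 j show "a j = 0" by simp
      qed
    qed
    then show "enat CARD('n) \<le> Sup {enat k |k. \<exists>u. (\<forall>i<k. u i \<in> L2_class H I ` S) \<and>
        (\<forall>a. L2_lincomb H I k a u = L2_class H I (\<lambda>x. 0) \<longrightarrow> (\<forall>i<k. a i = 0))}"
      using b by (intro Sup_upper CollectI exI[of _ "CARD('n)"] conjI exI[of _ "\<lambda>i. L2_class H I (b (e i))"]) auto
  qed
qed

section \<open>Symmetric systems\<close>

lemma mat_mult_vec: "mat z *v v = z *s (v :: complex ^ 'm)"
  by (simp add: vec_eq_iff matrix_vector_mult_def mat_def if_distrib[of "\<lambda>x. x * _"] cong: if_cong)

lemma AC_zero_outside_iff: "AC I f \<longleftrightarrow> AC I (\<lambda>x. if x \<in> I then f x else 0)"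
  by (rule AC_cong) simp

text \<open>A complex linear map is real linear, so the finite-dimensional statement over the reals
  applies.\<close>

lemma linear_injective_surjective:
  fixes L :: "complex ^ 'n \<Rightarrow> complex ^ 'n"
  assumes lin: "\<And>u v c d. L (c *s u + d *s v) = c *s L u + d *s L v" and inj: "\<And>v. L v = 0 \<Longrightarrow> v = 0"
  shows "\<exists>v. L v = w"
proof -
  have "linear L"
  proof (rule linearI)
    show "L (u + v) = L u + L v" for u v using lin[of 1 u 1 v] by simp
    show "L (r *\<^sub>R v) = r *\<^sub>R L v" for r v
    proof -
      have "r *\<^sub>R u = of_real r *s u" for u :: "complex ^ 'n"
        by (simp add: vec_eq_iff) (simp add: scaleR_conv_of_real)
      then show ?thesis using lin[of "of_real r" v 0 0] by simp
    qed
  qed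
  moreover have "inj L" using linear_injective_0[OF \<open>linear L\<close>] inj by blast
  ultimately have "surj L" using \<open>linear L\<close> by (intro linear_inj_imp_surj)
  then show ?thesis by (metis surjD)
qed

text \<open>\<open>J_skew\<close> and \<open>B_sym\<close> express formal symmetry for a variable
  \<open>J\<close>: moving the derivative to the other factor produces the derivative of
  \<open>J\<close>, which the asymmetry of \<open>B\<close> has to absorb.\<close>

locale symmetric_system = L2_weight H I
  for H :: "real \<Rightarrow> complex ^ 'm ^ 'm" and I :: "real set" +
  fixes J B :: "real \<Rightarrow> complex ^ 'm ^ 'm"
  assumes J: "AC I J" and det_J: "\<And>x. x \<in> I \<Longrightarrow> det (J x) \<noteq> 0"
    and J_skew: "\<And>x. x \<in> I \<Longrightarrow> ctranspose (J x) = - J x"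
    and B: "L1_loc I B"
    and B_sym: "AE x in lebesgue. x \<in> I \<longrightarrow> ctranspose (B x) = B x - vector_derivative J (at x within I)"
begin

abbreviation "Ji x \<equiv> matrix_inv (J x)"
abbreviation "solves \<equiv> solves_system J B H I"

lemma Ji_continuous: "continuous_on I Ji"
  by (rule continuous_on_matrix_inv[OF AC_continuous_on[OF I J] det_J])

text \<open>Solving for the derivative brings the system into the scope of the linear existence and
  uniqueness theorems.\<close>

lemma solves_iff:
  assumes f: "AC I f"
  shows "solves f g \<longleftrightarrow> (AE x in lebesgue. x \<in> I \<longrightarrow> (f has_vector_derivative Ji x *v (H x *v g x - B x *v f x)) (at x))"
proof
  assume "solves f g"
  then have "AE x in lebesgue. x \<in> I \<longrightarrow> J x *v vector_derivative f (at x within I) + B x *v f x = H x *v g x"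
    by (simp add: solves_system_def)
  with AC_deriv_AE[OF I f]
  show "AE x in lebesgue. x \<in> I \<longrightarrow> (f has_vector_derivative Ji x *v (H x *v g x - B x *v f x)) (at x)"
  proof eventually_elim
    case (elim x)
    show ?case
    proof
      assume x: "x \<in> I"
      let ?d = "vector_derivative f (at x within I)"
      have "H x *v g x - B x *v f x = J x *v ?d" using elim x by (simp add: algebra_simps)
      then have "Ji x *v (H x *v g x - B x *v f x) = ?d" by (simp add: matrix_inv_mult_vec det_J[OF x])
      with elim x show "(f has_vector_derivative Ji x *v (H x *v g x - B x *v f x)) (at x)" by simp
    qed
  qed
next
  assume "AE x in lebesgue. x \<in> I \<longrightarrow> (f has_vector_derivative Ji x *v (H x *v g x - B x *v f x)) (at x)"
  from AC_deriv_unique_AE[OF I this] show "solves f g"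
    unfolding solves_system_def
  proof eventually_elim
    case (elim x)
    then show ?case by (simp add: matrix_inv_mult_vec det_J)
  qed
qed

lemma solves_lincomb:
  assumes "AC I f1" "AC I f2" "solves f1 g1" "solves f2 g2"
  shows "solves (\<lambda>x. c *s f1 x + d *s f2 x) (\<lambda>x. c *s g1 x + d *s g2 x)" "AC I (\<lambda>x. c *s f1 x + d *s f2 x)"
proof -
  have bl: "bounded_linear (\<lambda>v::complex ^ 'm. c *s v)" for c
    unfolding linear_conv_bounded_linear[symmetric] linear_iff by (auto simp: vec_eq_iff algebra_simps)
  show AC: "AC I (\<lambda>x. c *s f1 x + d *s f2 x)"
    using assms by (intro AC_add AC_linear[OF bl]) auto
  have "AE x in lebesgue. x \<in> I \<longrightarrow> (f1 has_vector_derivative Ji x *v (H x *v g1 x - B x *v f1 x)) (at x)"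
    "AE x in lebesgue. x \<in> I \<longrightarrow> (f2 has_vector_derivative Ji x *v (H x *v g2 x - B x *v f2 x)) (at x)"
    using assms by (auto simp: solves_iff)
  then show "solves (\<lambda>x. c *s f1 x + d *s f2 x) (\<lambda>x. c *s g1 x + d *s g2 x)"
    unfolding solves_iff[OF AC]
  proof eventually_elim
    case (elim x)
    show ?case
    proof
      assume x: "x \<in> I"
      have "((\<lambda>x. c *s f1 x + d *s f2 x) has_vector_derivative
          c *s (Ji x *v (H x *v g1 x - B x *v f1 x)) + d *s (Ji x *v (H x *v g2 x - B x *v f2 x))) (at x)"
        using elim x by (intro has_vector_derivative_add bounded_linear.has_vector_derivative[OF bl]) auto
      moreover have "c *s (Ji x *v (H x *v g1 x - B x *v f1 x)) + d *s (Ji x *v (H x *v g2 x - B x *v f2 x))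
          = Ji x *v (H x *v (c *s g1 x + d *s g2 x) - B x *v (c *s f1 x + d *s f2 x))"
        by (simp only: mv_simps vector_scalar_commute vector_sadd_rdistrib vector_add_ldistrib vector_ssub_ldistrib)
           (simp add: algebra_simps)
      ultimately show "((\<lambda>x. c *s f1 x + d *s f2 x) has_vector_derivative
          Ji x *v (H x *v (c *s g1 x + d *s g2 x) - B x *v (c *s f1 x + d *s f2 x))) (at x)" by simp
    qed
  qed
qed

lemma solves_cong:
  assumes "AC I f" "solves f g" "AE x in lebesgue. x \<in> I \<longrightarrow> f' x = f x \<and> H x *v g' x = H x *v g x"
    "\<And>x. x \<in> I \<Longrightarrow> f' x = f x"
  shows "solves f' g'"
proof -
  have AC': "AC I f'" using assms(1,4) AC_cong by metis
  have "AE x in lebesgue. x \<in> I \<longrightarrow> (f has_vector_derivative Ji x *v (H x *v g x - B x *v f x)) (at x)"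
    using assms(1,2) by (simp add: solves_iff)
  with AE_interior_half_line[OF I] assms(3) show ?thesis
    unfolding solves_iff[OF AC']
  proof eventually_elim
    case (elim x)
    show ?case
    proof
      assume x: "x \<in> I"
      then have xi: "x \<in> interior I" using elim by auto
      have "(f' has_vector_derivative Ji x *v (H x *v g x - B x *v f x)) (at x)"
      proof (rule has_vector_derivative_transform_within_open[OF _ open_interior xi])
        show "(f has_vector_derivative Ji x *v (H x *v g x - B x *v f x)) (at x)" using elim x by simp
        fix y assume "y \<in> interior I"
        then have "y \<in> I" by (rule subsetD[OF interior_subset])
        then show "f y = f' y" using assms(4) by simp
      qed
      with elim x show "(f' has_vector_derivative Ji x *v (H x *v g' x - B x *v f' x)) (at x)" by simp
    qed
  qed
qed

definition coeff :: "complex \<Rightarrow> real \<Rightarrow> complex ^ 'm ^ 'm" where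
  "coeff z x = Ji x ** (mat z ** H x - B x)"

lemma coeff_mult: "coeff z x *v v = Ji x *v (H x *v (z *s v) - B x *v v)"
  by (simp add: coeff_def matrix_vector_mul_assoc[symmetric] mv_simps mat_mult_vec vector_scalar_commute)

lemma coeff_L1: "L1_loc I (coeff z)"
proof -
  have "L1_loc I (\<lambda>x. mat z ** H x)"
    by (rule L1_loc_linear[OF bounded_bilinear.bounded_linear_right[OF bounded_bilinear_matrix_matrix] H])
  moreover have "L1_loc I (\<lambda>x. - B x)"
    by (rule L1_loc_linear[OF bounded_linear_minus[OF bounded_linear_ident] B])
  ultimately have "L1_loc I (\<lambda>x. mat z ** H x - B x)"
    using L1_loc_add[of I "\<lambda>x. mat z ** H x" "\<lambda>x. - B x"] by simp
  then show ?thesis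
    unfolding coeff_def[abs_def] by (rule L1_loc_bilinear[OF bounded_bilinear_matrix_matrix Ji_continuous])
qed

lemma solution_exists:
  assumes g: "L1_loc I (\<lambda>x. H x *v g x)"
  shows "\<exists>f. AC I f \<and> f 0 = y0 \<and> solves f (\<lambda>x. z *s f x + g x)"
proof -
  have "L1_loc I (\<lambda>x. Ji x *v (H x *v g x))"
    by (rule L1_loc_bilinear[OF bounded_bilinear_matrix_vector Ji_continuous g])
  from linear_ode_exists[OF I coeff_L1 this, of y0 z] obtain f where f: "AC I f" "f 0 = y0"
    "AE x in lebesgue. x \<in> I \<longrightarrow> (f has_vector_derivative coeff z x *v f x + Ji x *v (H x *v g x)) (at x)" by blast
  have "coeff z x *v f x + Ji x *v (H x *v g x) = Ji x *v (H x *v (z *s f x + g x) - B x *v f x)" for x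
    by (simp add: coeff_mult mv_simps)
  with f show ?thesis by (auto simp: solves_iff)
qed

lemma solution_unique:
  assumes f: "AC I f" "solves f (\<lambda>x. z *s f x)" and c: "c \<in> I" "f c = 0" and x: "x \<in> I"
  shows "f x = 0"
proof (rule linear_ode_unique[OF I f(1) coeff_L1 _ c x])
  show "AE x in lebesgue. x \<in> I \<longrightarrow> (f has_vector_derivative coeff z x *v f x) (at x)"
    using f(2) unfolding solves_iff[OF f(1)] coeff_mult .
qed

text \<open>Only the values on \<open>I\<close> are determined by the initial value; elsewhere the
  choice is arbitrary, which is why the identities for \<open>sol\<close> ask for a point of
  \<open>I\<close>.\<close>

definition sol :: "complex \<Rightarrow> complex ^ 'm \<Rightarrow> real \<Rightarrow> complex ^ 'm" where
  "sol z y = (SOME f. AC I f \<and> f 0 = y \<and> solves f (\<lambda>x. z *s f x))"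

lemma sol: "AC I (sol z y)" "sol z y 0 = y" "solves (sol z y) (\<lambda>x. z *s sol z y x)"
proof -
  have "\<exists>f. AC I f \<and> f 0 = y \<and> solves f (\<lambda>x. z *s f x)"
    using solution_exists[of "\<lambda>x. 0" y z] by (simp add: mv_simps L1_loc_def)
  from someI_ex[OF this] show "AC I (sol z y)" "sol z y 0 = y" "solves (sol z y) (\<lambda>x. z *s sol z y x)"
    unfolding sol_def by auto
qed

lemma solution_eqI:
  assumes f: "AC I f" "solves f (\<lambda>x. z *s f x)" and g: "AC I g" "solves g (\<lambda>x. z *s g x)"
    and c: "c \<in> I" "f c = g c" and x: "x \<in> I"
  shows "f x = g x"
proof -
  let ?d = "\<lambda>x. 1 *s f x + (-1) *s g x"
  have "solves ?d (\<lambda>x. z *s ?d x)"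
    using solves_lincomb(1)[OF f(1) g(1) f(2) g(2), of 1 "-1"] by (simp add: algebra_simps vector_ssub_ldistrib)
  from solution_unique[OF solves_lincomb(2)[OF f(1) g(1) f(2) g(2), of 1 "-1"] this c(1) _ x] c(2)
  show ?thesis by simp
qed

lemma sol_eq: "AC I f \<Longrightarrow> solves f (\<lambda>x. z *s f x) \<Longrightarrow> x \<in> I \<Longrightarrow> f x = sol z (f 0) x"
  by (rule solution_eqI[of f z _ 0]) (auto simp: sol half_line_0[OF I])

lemma sol_lincomb: "x \<in> I \<Longrightarrow> sol z (c *s u + d *s v) x = c *s sol z u x + d *s sol z v x"
proof -
  assume x: "x \<in> I"
  let ?f = "\<lambda>x. c *s sol z u x + d *s sol z v x"
  note l = solves_lincomb[OF sol(1) sol(1) sol(3) sol(3), of c z u d z v]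
  have "solves ?f (\<lambda>x. z *s ?f x)"
    using l(1) by (simp add: vector_add_ldistrib vector_smult_assoc mult.commute)
  from sol_eq[OF l(2) this x] show ?thesis by (simp add: sol)
qed

text \<open>Evaluation at \<open>c\<close> is linear in the initial value and, by uniqueness,
  injective.\<close>

lemma sol_at_surj: "c \<in> I \<Longrightarrow> \<exists>y. sol z y c = w"
proof (rule linear_injective_surjective)
  assume c: "c \<in> I"
  show "sol z (a *s u + b *s v) c = a *s sol z u c + b *s sol z v c" for a b u v by (rule sol_lincomb[OF c])
  fix v assume "sol z v c = 0"
  from solution_unique[OF sol(1) sol(3) c this half_line_0[OF I]] show "v = 0" by (simp add: sol)
qed

lemma solution_exists_at:
  assumes g: "L1_loc I (\<lambda>x. H x *v g x)" and c: "c \<in> I"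
  shows "\<exists>f. AC I f \<and> f c = 0 \<and> solves f g"
proof -
  obtain f where f: "AC I f" "solves f (\<lambda>x. 0 *s f x + g x)" using solution_exists[OF g, of 0 0] by blast
  obtain y where y: "sol 0 y c = f c" using sol_at_surj[OF c] by blast
  have s: "solves f g" using f(2) by simp
  from solves_lincomb[OF f(1) sol(1) s sol(3), of 1 "-1" 0 y] y show ?thesis
    by (intro exI[of _ "\<lambda>x. 1 *s f x + (-1) *s sol 0 y x"]) simp
qed

text \<open>Differentiate the pairing of \<open>f1\<close> and \<open>f2\<close> through
  \<open>J\<close>: by \<open>J_skew\<close> and \<open>B_sym\<close> the terms with
  \<open>B\<close> and with the derivative of \<open>J\<close> cancel, and only the weighted
  right-hand sides survive.\<close>

lemma Lagrange_identity:
  assumes f1: "AC I f1" "solves f1 g1" and f2: "AC I f2" "solves f2 g2"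
    and ab: "a \<le> b" "{a..b} \<subseteq> I"
  shows "(\<lambda>x. form f1 g2 x - cdot (H x *v g1 x) (f2 x)) absolutely_integrable_on {a..b}"
    "integral {a..b} (\<lambda>x. form f1 g2 x - cdot (H x *v g1 x) (f2 x)) = cdot (f1 b) (J b *v f2 b) - cdot (f1 a) (J a *v f2 a)"
proof -
  let ?F = "\<lambda>x. cdot (f1 x) (J x *v f2 x)"
  have AC: "AC I ?F"
    by (intro AC_bilinear[OF bounded_bilinear_cdot] AC_bilinear[OF bounded_bilinear_matrix_vector] J f1 f2)
  have "AE x in lebesgue. x \<in> I \<longrightarrow> (f1 has_vector_derivative Ji x *v (H x *v g1 x - B x *v f1 x)) (at x)"
    "AE x in lebesgue. x \<in> I \<longrightarrow> (f2 has_vector_derivative Ji x *v (H x *v g2 x - B x *v f2 x)) (at x)"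
    using f1 f2 by (auto simp: solves_iff)
  with AC_deriv_AE[OF I J] B_sym
  have "AE x in lebesgue. x \<in> I \<longrightarrow> (?F has_vector_derivative form f1 g2 x - cdot (H x *v g1 x) (f2 x)) (at x)"
  proof eventually_elim
    case (elim x)
    show ?case
    proof
      assume x: "x \<in> I"
      define r1 r2 J' where "r1 = H x *v g1 x - B x *v f1 x" and "r2 = H x *v g2 x - B x *v f2 x"
        and "J' = vector_derivative J (at x within I)"
      have d: "(f1 has_vector_derivative Ji x *v r1) (at x)" "(f2 has_vector_derivative Ji x *v r2) (at x)"
        "(J has_vector_derivative J') (at x)" "ctranspose (B x) = B x - J'"
        using elim x by (auto simp: r1_def r2_def J'_def)
      have "(?F has_vector_derivative
          cdot (f1 x) (J x *v (Ji x *v r2) + J' *v f2 x) + cdot (Ji x *v r1) (J x *v f2 x)) (at x)"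
        by (intro bounded_bilinear.has_vector_derivative[OF bounded_bilinear_cdot]
            bounded_bilinear.has_vector_derivative[OF bounded_bilinear_matrix_vector] d)
      moreover have "cdot (f1 x) (J x *v (Ji x *v r2) + J' *v f2 x) + cdot (Ji x *v r1) (J x *v f2 x)
          = form f1 g2 x - cdot (H x *v g1 x) (f2 x)"
      proof -
        have "cdot (Ji x *v r1) (J x *v f2 x) = cdot (ctranspose (J x) *v (Ji x *v r1)) (f2 x)"
          by (rule cdot_ctranspose)
        also have "\<dots> = - cdot r1 (f2 x)"
          using J_skew[OF x] det_J[OF x] by (simp add: mv_simps cdot_simps matrix_inv_mult_vec)
        finally have 1: "cdot (Ji x *v r1) (J x *v f2 x) = - cdot r1 (f2 x)" .
        have "cdot (B x *v f1 x) (f2 x) = cdot (f1 x) (ctranspose (B x) *v f2 x)"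
          by (simp add: cdot_ctranspose)
        also have "\<dots> = cdot (f1 x) (B x *v f2 x) - cdot (f1 x) (J' *v f2 x)"
          unfolding d(4) by (simp add: mv_simps cdot_simps)
        finally have 2: "cdot (B x *v f1 x) (f2 x) = cdot (f1 x) (B x *v f2 x) - cdot (f1 x) (J' *v f2 x)" .
        show ?thesis using det_J[OF x]
          unfolding 1 by (simp add: matrix_inv_mult_vec r1_def r2_def cdot_simps 2)
      qed
      ultimately show "(?F has_vector_derivative form f1 g2 x - cdot (H x *v g1 x) (f2 x)) (at x)" by simp
    qed
  qed
  from AC_FTC[OF AC ab this]
  show "(\<lambda>x. form f1 g2 x - cdot (H x *v g1 x) (f2 x)) absolutely_integrable_on {a..b}"
    "integral {a..b} (\<lambda>x. form f1 g2 x - cdot (H x *v g1 x) (f2 x)) = cdot (f1 b) (J b *v f2 b) - cdot (f1 a) (J a *v f2 a)" by auto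
qed

end

text \<open>\<open>f\<close> itself need not be locally integrable, but up to a constant |Hf|^2 is
  at most |H| times f*Hf, a product of two locally integrable functions. This makes the equation
  solvable for every square integrable right-hand side.\<close>

lemma (in L2_weight) weight_times_L2:
  assumes f: "f \<in> L2"
  shows "L1_loc I (\<lambda>x. H x *v f x)"
  unfolding L1_loc_def
proof (intro allI impI)
  fix a b assume ab: "{a..b} \<subseteq> I"
  obtain K where K: "K > 0" "\<And>(A::complex^'m^'m) v. norm (A *v v) \<le> norm A * norm v * K"
    using bounded_bilinear.pos_bounded[OF bounded_bilinear_matrix_vector] by blast
  have m: "(\<lambda>x. indicator I x *\<^sub>R f x) \<in> borel_measurable lebesgue"
  proof (rule measurable_completion)
    show "(\<lambda>x. indicator I x *\<^sub>R f x) \<in> borel_measurable lborel"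
      using f borel_measurable_indicator_restrict[OF I, of f] by (simp add: L2_fun_def)
  qed
  have mHf: "(\<lambda>x. (indicator I x *\<^sub>R H x) *v (indicator I x *\<^sub>R f x)) \<in> borel_measurable lebesgue"
    by (intro borel_measurable_bounded_bilinear[OF bounded_bilinear_matrix_vector] m L1_loc_measurable[OF I H])
  have i1: "integrable lebesgue (\<lambda>x. indicator {a..b} x *\<^sub>R norm (H x))"
    using set_integrable_norm[OF L1_locD[OF H ab]] unfolding set_integrable_def .
  have i2: "integrable lebesgue (\<lambda>x. indicator {a..b} x *\<^sub>R norm (form f f x))"
    using set_integrable_norm[OF set_integrable_subset[OF form_integrable[OF f f] _ ab]] unfolding set_integrable_def by simp
  show "(\<lambda>x. H x *v f x) absolutely_integrable_on {a..b}"
    unfolding set_integrable_def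
  proof (rule Bochner_Integration.integrable_bound)
    show "integrable lebesgue (\<lambda>x. K * (indicator {a..b} x *\<^sub>R norm (H x)) + indicator {a..b} x *\<^sub>R norm (form f f x))"
      by (intro Bochner_Integration.integrable_add integrable_mult_right i1 i2)
    have "(\<lambda>x. indicator {a..b} x *\<^sub>R ((indicator I x *\<^sub>R H x) *v (indicator I x *\<^sub>R f x))) \<in> borel_measurable lebesgue"
      by (intro borel_measurable_scaleR mHf borel_measurable_indicator) auto
    moreover have "indicator {a..b} x *\<^sub>R ((indicator I x *\<^sub>R H x) *v (indicator I x *\<^sub>R f x)) = indicator {a..b} x *\<^sub>R (H x *v f x)" for x
      using ab by (auto simp: indicator_def)
    ultimately show "(\<lambda>x. indicator {a..b} x *\<^sub>R (H x *v f x)) \<in> borel_measurable lebesgue" by simp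
    show "AE x in lebesgue. norm (indicator {a..b} x *\<^sub>R (H x *v f x))
        \<le> norm (K * (indicator {a..b} x *\<^sub>R norm (H x)) + indicator {a..b} x *\<^sub>R norm (form f f x))"
      using psd
    proof eventually_elim
      case (elim x)
      show ?case
      proof (cases "x \<in> {a..b}")
        case True
        then have p: "psd (H x)" using elim ab by auto
        have bl: "bounded_linear ((*v) (H x))"
          by (rule bounded_bilinear.bounded_linear_right[OF bounded_bilinear_matrix_vector])
        have on: "onorm ((*v) (H x)) \<le> K * norm (H x)"
          by (rule onorm_le) (use K(2)[of "H x"] in \<open>simp add: mult_ac\<close>)
        have "(norm (H x *v f x))\<^sup>2 \<le> onorm ((*v) (H x)) * Re (form f f x)"
          by (rule psd_norm_le[OF p])
        also have "\<dots> \<le> (K * norm (H x)) * norm (form f f x)"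
          using K(1) psd_nonneg[OF p] by (intro mult_mono on complex_Re_le_cmod) auto
        \<comment> \<open>A product of nonnegative numbers is at most the square of their sum, so
          the root can be taken without leaving integrable majorants.\<close>
        also have "\<dots> \<le> (K * norm (H x) + norm (form f f x))\<^sup>2"
          using K(1) by (simp add: power2_eq_square algebra_simps)
        finally have "norm (H x *v f x) \<le> K * norm (H x) + norm (form f f x)"
          by (rule power2_le_imp_le) (use K(1) in simp)
        with True K(1) show ?thesis by (auto simp: abs_of_nonneg)
      qed simp
    qed
  qed
qed

lemma (in L2_weight) continuous_cut_L2:
  assumes f: "continuous_on I f" and ab: "{a..b} \<subseteq> I"
  shows "(\<lambda>x. if x \<in> {a..b} then f x else 0) \<in> L2"
proof -
  have fab: "continuous_on {a..b} f" using continuous_on_subset[OF f ab] .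
  have "(\<lambda>x. indicator {a..b} x *\<^sub>R f x) \<in> borel_measurable borel"
    by (rule borel_measurable_continuous_on_indicator[OF _ fab]) auto
  then have m: "(\<lambda>x. if x \<in> {a..b} then f x else 0) \<in> borel_measurable borel"
    by (rule back_subst[of "\<lambda>f. f \<in> borel_measurable borel"]) (auto simp: fun_eq_iff)
  have "(\<lambda>x. H x *v f x) absolutely_integrable_on {a..b}"
    by (rule absolutely_integrable_continuous_bilinear[OF bounded_bilinear.flip[OF bounded_bilinear_matrix_vector] fab L1_locD[OF H ab]])
  then have "form f f absolutely_integrable_on {a..b}"
    by (rule absolutely_integrable_continuous_bilinear[OF bounded_bilinear_cdot fab])
  then have "set_integrable lebesgue I (\<lambda>x. cdot (if x \<in> {a..b} then f x else 0) (H x *v (if x \<in> {a..b} then f x else 0)))"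
    unfolding set_integrable_def
    by (rule back_subst[of "integrable lebesgue"]) (use ab in \<open>auto simp: fun_eq_iff indicator_def cdot_simps\<close>)
  then show ?thesis using m by (simp add: L2_fun_def measurable_restrict_space1)
qed

lemma (in L2_weight) cut_L2:
  assumes f: "f \<in> L2" and ab: "{a..b} \<subseteq> I"
  shows "(\<lambda>x. if x \<in> {a..b} then f x else 0) \<in> L2"
proof -
  have "(\<lambda>x. indicator {a..b} x *\<^sub>R (indicator I x *\<^sub>R f x)) \<in> borel_measurable borel"
  proof (rule borel_measurable_scaleR)
    show "(\<lambda>x. indicator I x *\<^sub>R f x) \<in> borel_measurable borel"
      using f borel_measurable_indicator_restrict[OF I, of f] by (simp add: L2_fun_def)
  qed auto
  then have m: "(\<lambda>x. if x \<in> {a..b} then f x else 0) \<in> borel_measurable borel"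
    by (rule back_subst[of "\<lambda>f. f \<in> borel_measurable borel"]) (use ab in \<open>auto simp: fun_eq_iff indicator_def\<close>)
  have "form f f absolutely_integrable_on {a..b}"
    by (rule set_integrable_subset[OF form_integrable[OF f f] _ ab]) auto
  then have "set_integrable lebesgue I (\<lambda>x. cdot (if x \<in> {a..b} then f x else 0) (H x *v (if x \<in> {a..b} then f x else 0)))"
    unfolding set_integrable_def
    by (rule back_subst[of "integrable lebesgue"]) (use ab in \<open>auto simp: fun_eq_iff indicator_def cdot_simps\<close>)
  then show ?thesis using m by (simp add: L2_fun_def measurable_restrict_space1)
qed

lemma (in L2_weight) ip_local:
  assumes ab: "{a..b} \<subseteq> I" and i: "form f g absolutely_integrable_on {a..b}"
    and z: "\<And>x. x \<in> I \<Longrightarrow> x \<notin> {a..b} \<Longrightarrow> f x = 0 \<or> g x = 0"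
  shows "ip f g = integral {a..b} (form f g)"
proof -
  have "ip f g = (LINT x:{a..b}|lebesgue. form f g x)"
    unfolding L2_fun_inner_def set_lebesgue_integral_def
    using ab z by (intro Bochner_Integration.integral_cong) (auto simp: indicator_def cdot_simps mv_simps dest!: z)
  also have "\<dots> = integral {a..b} (form f g)" using i by (rule set_lebesgue_integral_eq_integral(2))
  finally show ?thesis .
qed

section \<open>Exhaustion of the open half-line by compact segments\<close>

context L2_weight
begin

text \<open>The segments also keep away from 0, because supports in the minimal relation are compact
  in the interior. The added 1 avoids division by zero and puts the end points in order from
  \<open>n = 0\<close> on.\<close>

definition seg :: "nat \<Rightarrow> real set" where
  "seg n = (if I = {0..} then {1 / (real n + 1)..real n + 1} else {- (real n + 1)..- (1 / (real n + 1))})"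

lemma seg_form: "\<exists>a b. a \<le> b \<and> seg n = {a..b}"
proof -
  have "1 / (real n + 1) \<le> real n + 1" by (simp add: field_simps)
  then show ?thesis unfolding seg_def by (metis neg_le_iff_le)
qed

lemma seg_interior: "seg n \<subseteq> interior I"
proof -
  have p: "1 / (real n + 1) > 0" by (simp add: add_nonneg_pos)
  show ?thesis
    unfolding interior_half_line[OF I]
  proof
    fix x assume x: "x \<in> seg n"
    show "x \<in> I - {0}"
    proof (cases "I = {0..}")
      case True
      then have "x \<ge> 1 / (real n + 1)" using x unfolding seg_def by simp
      with p have "x > 0" by linarith
      with True show ?thesis by simp
    next
      case False
      then have "x \<le> - (1 / (real n + 1))" "I = {..0}" using x I unfolding seg_def half_line_def by simp_all
      moreover from this p have "x < 0" by linarith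
      ultimately show ?thesis by simp
    qed
  qed
qed

lemma seg_mono: "m \<le> n \<Longrightarrow> seg m \<subseteq> seg n"
proof -
  assume "m \<le> n"
  then have "1 / (real n + 1) \<le> 1 / (real m + 1)" "real m + 1 \<le> real n + 1"
    by (auto simp: frac_le)
  then show ?thesis unfolding seg_def by auto
qed

lemma in_seg: "x \<in> interior I \<Longrightarrow> \<exists>n. x \<in> seg n"
proof -
  assume "x \<in> interior I"
  then have x: "x \<in> I" "x \<noteq> 0" using interior_half_line[OF I] by auto
  obtain n where n: "max \<bar>x\<bar> (1 / \<bar>x\<bar>) \<le> real n" using real_arch_simple by blast
  have "1 / (real n + 1) \<le> \<bar>x\<bar>" "\<bar>x\<bar> \<le> real n + 1"
  proof -
    have "1 / \<bar>x\<bar> \<le> real n + 1" "\<bar>x\<bar> > 0" "real n + 1 > 0" using n x(2) by auto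
    then show "1 / (real n + 1) \<le> \<bar>x\<bar>" by (simp add: field_simps)
    show "\<bar>x\<bar> \<le> real n + 1" using n by simp
  qed
  then have "x \<in> seg n" using x I unfolding seg_def half_line_def by (auto split: if_splits)
  then show ?thesis by blast
qed

lemma compact_in_seg: "{a..b} \<subseteq> interior I \<Longrightarrow> a \<le> b \<Longrightarrow> \<exists>n. {a..b} \<subseteq> seg n"
proof -
  assume ab: "{a..b} \<subseteq> interior I" "a \<le> b"
  then have "a \<in> interior I" "b \<in> interior I" by auto
  then obtain m n where "a \<in> seg m" "b \<in> seg n" using in_seg by blast
  then have "a \<in> seg (max m n)" "b \<in> seg (max m n)" using seg_mono[of m "max m n"] seg_mono[of n "max m n"] by auto
  moreover obtain c d where "seg (max m n) = {c..d}" using seg_form by blast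
  ultimately have "{a..b} \<subseteq> seg (max m n)" by auto
  then show ?thesis by blast
qed

end

text \<open>Definiteness on a single compact interval suffices for what follows: it passes to every
  larger interval and makes the Gram matrices of homogeneous solutions invertible there.\<close>

locale definite_system = symmetric_system H I J B
  for H :: "real \<Rightarrow> complex ^ 'm ^ 'm" and I :: "real set" and J B :: "real \<Rightarrow> complex ^ 'm ^ 'm" +
  assumes definite: "\<exists>a b. a \<le> b \<and> {a..b} \<subseteq> interior I \<and>
    (\<forall>f. AC I f \<longrightarrow> solves f (\<lambda>x. 0) \<longrightarrow> (AE x in lebesgue. x \<in> {a..b} \<longrightarrow> H x *v f x = 0) \<longrightarrow> (\<forall>x\<in>I. f x = 0))"
begin

text \<open>Start from the value 0 at \<open>a\<close>. By the Lagrange identity the value at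
  \<open>b\<close> is detected by pairing \<open>g\<close> with homogeneous solutions, so
  orthogonality makes it 0, and outside the segment uniqueness continues the zero.\<close>

lemma compactly_supported_solution:
  assumes ab: "a \<le> b" "{a..b} \<subseteq> I" and g: "g \<in> L2" and g0: "\<And>x. x \<in> I \<Longrightarrow> x \<notin> {a..b} \<Longrightarrow> g x = 0"
    and orth: "\<And>c. ip (sol 0 c) g = 0"
  shows "\<exists>f. AC I f \<and> solves f g \<and> f a = 0 \<and> f b = 0 \<and> (\<forall>x\<in>I - {a..b}. f x = 0)"
proof -
  have aI: "a \<in> I" "b \<in> I" using ab by auto
  obtain f where f: "AC I f" "f a = 0" "solves f g"
    using solution_exists_at[OF weight_times_L2[OF g] aI(1)] by blast
  have zero: "f x = 0" if x: "x \<in> I" and c: "c \<in> I" "f c = 0" and out: "{min c x<..<max c x} \<inter> {a..b} = {}" for x c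
  proof (rule linear_ode_zero)
    have sub: "{min c x..max c x} \<subseteq> I" using half_line_segment[OF I] c(1) x by (auto simp: min_def max_def)
    show "absolutely_continuous_on {min c x..max c x} f" using AC_subset[OF f(1) sub] .
    show "coeff 0 absolutely_integrable_on {min c x..max c x}" using L1_locD[OF coeff_L1 sub] .
    show "AE y in lebesgue. y \<in> {min c x<..<max c x} \<longrightarrow> (f has_vector_derivative coeff 0 y *v f y) (at y)"
      using f(3) unfolding solves_iff[OF f(1)]
    proof eventually_elim
      case (elim y)
      show ?case
      proof
        assume y: "y \<in> {min c x<..<max c x}"
        then have "y \<in> {min c x..max c x}" by auto
        then have "y \<in> I" "y \<notin> {a..b}" using sub out y by blast+
        with elim g0 show "(f has_vector_derivative coeff 0 y *v f y) (at y)" by (simp add: coeff_mult mv_simps)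
      qed
    qed
  qed (use c in auto)
  \<comment> \<open>The homogeneous solution is chosen so that the boundary term at \<open>b\<close>
    is the squared norm of \<open>J b *v f b\<close>.\<close>
  obtain c where c: "sol 0 c b = J b *v f b" using sol_at_surj[OF aI(2)] by blast
  have s0: "solves (sol 0 c) (\<lambda>x. 0)" using sol(3)[of 0 c] by simp
  note Lg = Lagrange_identity[OF sol(1) s0 f(1) f(3) ab]
  have "ip (sol 0 c) g = integral {a..b} (form (sol 0 c) g)"
    by (rule ip_local[OF ab(2)]) (use Lg(1) g0 in \<open>auto simp: mv_simps cdot_simps\<close>)
  then have "cdot (J b *v f b) (J b *v f b) = 0"
    using Lg(2) orth[of c] c f(2) by (simp add: mv_simps cdot_simps)
  then have "J b *v f b = 0" by (simp add: cdot_self)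
  then have fb: "f b = 0" using matrix_inv_mult_vec(2)[OF det_J[OF aI(2)], of "f b"] by (simp add: mv_simps)
  have "f x = 0" if x: "x \<in> I" "x \<notin> {a..b}" for x
  proof (cases "x < a")
    case True
    show ?thesis by (rule zero[OF x(1) aI(1) f(2)]) (use True in auto)
  next
    case False
    show ?thesis by (rule zero[OF x(1) aI(2) fb]) (use False x in auto)
  qed
  with f fb show ?thesis by blast
qed

text \<open>A Fredholm argument. As \<open>y\<close> solves the equation with the right-hand side of
  the weak identity, \<phi> - y annihilates every \<open>g\<close> on the segment that is orthogonal
  to the homogeneous solutions. Those solutions span a finite-dimensional space, so \<phi> - y is
  one of them up to a null function.\<close>

lemma weak_solution_on_segment:
  assumes \<phi>: "\<phi> \<in> L2"
    and weak: "\<And>f g. AC I f \<Longrightarrow> g \<in> L2 \<Longrightarrow> compactly_supported_inside I f \<Longrightarrow> compactly_supported_inside I g \<Longrightarrow>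
      solves f g \<Longrightarrow> ip \<phi> g = ip (\<lambda>x. z *s \<phi> x) f"
    and y: "AC I y" "solves y (\<lambda>x. z *s \<phi> x)"
    and ab: "a \<le> b" "{a..b} \<subseteq> interior I"
    and def: "\<And>f. AC I f \<Longrightarrow> solves f (\<lambda>x. 0) \<Longrightarrow> (AE x in lebesgue. x \<in> {a..b} \<longrightarrow> H x *v f x = 0) \<Longrightarrow> \<forall>x\<in>I. f x = 0"
  shows "\<exists>c. AE x in lebesgue. x \<in> {a..b} \<longrightarrow> H x *v (\<phi> x - y x - sol 0 c x) = 0"
proof -
  have abI: "{a..b} \<subseteq> I" using ab(2) interior_subset by blast
  define cut where "cut f x = (if x \<in> {a..b} then f x else (0 :: complex ^ 'm))" for f x
  have cs: "cut (sol 0 c) \<in> L2" for c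
    unfolding cut_def[abs_def] by (rule continuous_cut_L2[OF AC_continuous_on[OF I sol(1)] abI])
  have c\<phi>: "cut \<phi> \<in> L2" unfolding cut_def[abs_def] by (rule cut_L2[OF \<phi> abI])
  have cy: "cut y \<in> L2" unfolding cut_def[abs_def] by (rule continuous_cut_L2[OF AC_continuous_on[OF I y(1)] abI])
  define h where "h = (\<lambda>x. 1 *s cut \<phi> x + (-1) *s cut y x)"
  have h: "h \<in> L2" unfolding h_def by (rule L2_lincomb2[OF c\<phi> cy])
  have ipcut: "ip u (cut g) = ip (cut u) (cut g)" for u g
    unfolding L2_fun_inner_def set_lebesgue_integral_def
    by (intro Bochner_Integration.integral_cong) (auto simp: cut_def cdot_simps mv_simps)
  have cutl: "cut (sol 0 (p *s u + q *s v)) = (\<lambda>x. p *s cut (sol 0 u) x + q *s cut (sol 0 v) x)" for p q u v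
    using abI by (auto simp: cut_def fun_eq_iff intro!: sol_lincomb)
  \<comment> \<open>The Gram matrix of the basis solutions cut to the segment; solving with it
    projects \<open>h\<close> onto their span.\<close>
  define L where "L c = (\<chi> i. ip (cut (sol 0 (axis i 1))) (cut (sol 0 c)))" for c :: "complex ^ 'm"
  have expand: "ip (cut (sol 0 c)) g = (\<Sum>i\<in>UNIV. cnj (c $ i) * ip (cut (sol 0 (axis i 1))) g)" if g: "g \<in> L2" for c g
  proof -
    have *: "ip (cut (sol 0 (\<Sum>i\<in>K. c $ i *s axis i 1))) g = (\<Sum>i\<in>K. cnj (c $ i) * ip (cut (sol 0 (axis i 1))) g)" for K :: "'m set"
    proof (induction K rule: infinite_finite_induct)
      case (insert i K)
      have "ip (cut (sol 0 (c $ i *s axis i 1 + 1 *s (\<Sum>i\<in>K. c $ i *s axis i 1)))) g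
          = cnj (c $ i) * ip (cut (sol 0 (axis i 1))) g + cnj 1 * ip (cut (sol 0 (\<Sum>i\<in>K. c $ i *s axis i 1))) g"
        unfolding cutl by (rule ip_lincomb_left[OF g cs cs])
      with insert show ?case by simp
    next
      case empty
      have "ip (cut (sol 0 (0 *s 0 + 0 *s 0))) g = 0" unfolding cutl using ip_lincomb_left[OF g cs cs, of 0 0 0 0] by simp
      then show ?case by simp
    next
      case (infinite A)
      then show ?case by simp
    qed
    from *[of UNIV] show ?thesis using axis_expansion[of c] by simp
  qed
  have "\<exists>c. L c = (\<chi> i. ip (cut (sol 0 (axis i 1))) h)"
  proof (rule linear_injective_surjective)
    show "L (p *s u + q *s v) = p *s L u + q *s L v" for p q u v
      unfolding L_def cutl vec_eq_iff by (auto simp: ip_lincomb_right[OF cs cs cs])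
    fix c assume Lc: "L c = 0"
    have "ip (cut (sol 0 (axis i 1))) (cut (sol 0 c)) = 0" for i
      using arg_cong[OF Lc, of "\<lambda>v. v $ i"] by (simp add: L_def)
    then have "ip (cut (sol 0 c)) (cut (sol 0 c)) = 0"
      by (subst expand[OF cs]) simp
    then have "cut (sol 0 c) \<in> L2_null H I" using cs by (simp add: L2_null_def)
    from null_AE[OF this] have "AE x in lebesgue. x \<in> {a..b} \<longrightarrow> H x *v sol 0 c x = 0"
      by eventually_elim (use abI in \<open>auto simp: cut_def\<close>)
    moreover have "solves (sol 0 c) (\<lambda>x. 0)" using sol(3)[of 0 c] by simp
    ultimately have "sol 0 c 0 = 0" using def[OF sol(1)] half_line_0[OF I] by blast
    then show "c = 0" by (simp add: sol)
  qed
  then obtain c where c: "L c = (\<chi> i. ip (cut (sol 0 (axis i 1))) h)" by blast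
  \<comment> \<open>The remainder after projection. It is orthogonal to the span, so the equation
    with right-hand side \<open>g\<close> has a solution supported in the segment; testing with that
    pair will show \<open>ip g g = 0\<close>.\<close>
  define g where "g = (\<lambda>x. 1 *s h x + (-1) *s cut (sol 0 c) x)"
  have g: "g \<in> L2" unfolding g_def by (rule L2_lincomb2[OF h cs])
  have gcut: "cut g = g" by (auto simp: g_def h_def cut_def fun_eq_iff)
  have g0: "g x = 0" if "x \<notin> {a..b}" for x using that gcut by (metis cut_def)
  have orth: "ip (sol 0 c') g = 0" for c'
  proof -
    have "ip (cut (sol 0 (axis i 1))) g = 0" for i
      using c unfolding g_def ip_lincomb_right[OF cs h cs] by (simp add: L_def vec_eq_iff)
    then have "ip (cut (sol 0 c')) g = 0" by (subst expand[OF g]) simp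
    then show ?thesis using ipcut[of "sol 0 c'" g] gcut by simp
  qed
  obtain f where f: "AC I f" "solves f g" "f a = 0" "f b = 0" "\<And>x. x \<in> I \<Longrightarrow> x \<notin> {a..b} \<Longrightarrow> f x = 0"
    using compactly_supported_solution[OF ab(1) abI g g0 orth] by auto
  have "ip \<phi> g = ip (\<lambda>x. z *s \<phi> x) f"
  proof (rule weak[OF f(1) g _ _ f(2)])
    show "compactly_supported_inside I f" "compactly_supported_inside I g"
      unfolding compactly_supported_inside_def using ab(2) f(5) g0 by (auto intro!: exI[of _ "{a..b}"])
  qed
  also have "ip (\<lambda>x. z *s \<phi> x) f = ip y g"
  proof -
    note Lg = Lagrange_identity[OF y f(1,2) ab(1) abI]
    have fc: "continuous_on {a..b} f" using continuous_on_subset[OF AC_continuous_on[OF I f(1)] abI] .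
    have yc: "continuous_on {a..b} y" using continuous_on_subset[OF AC_continuous_on[OF I y(1)] abI] .
    have i1: "form y g absolutely_integrable_on {a..b}"
      by (rule absolutely_integrable_continuous_bilinear[OF bounded_bilinear_cdot yc L1_locD[OF weight_times_L2[OF g] abI]])
    have i2: "(\<lambda>x. cdot (H x *v (z *s \<phi> x)) (f x)) absolutely_integrable_on {a..b}"
      by (rule absolutely_integrable_continuous_bilinear[OF bounded_bilinear.flip[OF bounded_bilinear_cdot] fc
            L1_locD[OF weight_times_L2[OF L2_scale_mem[OF \<phi>]] abI]])
    have i2': "AE x in lebesgue. x \<in> {a..b} \<longrightarrow> cdot (H x *v (z *s \<phi> x)) (f x) = form (\<lambda>x. z *s \<phi> x) f x"
      using psd by eventually_elim (metis abI hermitian_cdot[OF psd_hermitian] subsetD)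
    note i3 = absolutely_integrable_cong_AE[OF i2 i2']
    have "integral {a..b} (form y g) - integral {a..b} (\<lambda>x. cdot (H x *v (z *s \<phi> x)) (f x)) = 0"
      using Lg(2) f(3,4) i1 i2 by (subst Henstock_Kurzweil_Integration.integral_diff[symmetric]) (auto simp: absolutely_integrable_on_def mv_simps cdot_simps)
    moreover have "ip y g = integral {a..b} (form y g)"
      by (rule ip_local[OF abI i1]) (use g0 in auto)
    moreover have "ip (\<lambda>x. z *s \<phi> x) f = integral {a..b} (form (\<lambda>x. z *s \<phi> x) f)"
      by (rule ip_local[OF abI i3(1)]) (use f(5) in auto)
    ultimately show ?thesis using i3(2) by simp
  qed
  finally have "ip (cut \<phi>) g = ip (cut y) g"
    using ipcut[of \<phi> g] ipcut[of y g] gcut by simp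
  then have "ip h g = 0" unfolding h_def ip_lincomb_left[OF g c\<phi> cy] by simp
  moreover have "ip (cut (sol 0 c)) g = 0" using orth[of c] ipcut[of "sol 0 c" g] gcut by simp
  moreover have "ip g g = cnj 1 * ip h g + cnj (-1) * ip (cut (sol 0 c)) g"
    by (subst (1) g_def) (rule ip_lincomb_left[OF g h cs])
  ultimately have "ip g g = 0" by simp
  then have "g \<in> L2_null H I" using g by (simp add: L2_null_def)
  from null_AE[OF this] have "AE x in lebesgue. x \<in> {a..b} \<longrightarrow> H x *v (\<phi> x - y x - sol 0 c x) = 0"
    by eventually_elim (use abI in \<open>auto simp: g_def h_def cut_def\<close>)
  then show ?thesis by blast
qed

text \<open>Every large segment yields a homogeneous correction to \<open>y\<close>. Definiteness on
  the fixed interval forces these corrections to coincide, so one solution serves the whole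
  half-line.\<close>

theorem weak_solution_is_solution:
  assumes \<phi>: "\<phi> \<in> L2"
    and weak: "\<And>f g. AC I f \<Longrightarrow> g \<in> L2 \<Longrightarrow> compactly_supported_inside I f \<Longrightarrow> compactly_supported_inside I g \<Longrightarrow>
      solves f g \<Longrightarrow> ip \<phi> g = ip (\<lambda>x. z *s \<phi> x) f"
  shows "\<exists>f. AC I f \<and> solves f (\<lambda>x. z *s f x) \<and> f \<in> L2 \<and> \<phi> - f \<in> L2_null H I"
proof -
  obtain y where y: "AC I y" "solves y (\<lambda>x. z *s \<phi> x)"
    using solution_exists[OF weight_times_L2[OF L2_scale_mem[OF \<phi>, of z]], of 0 0] by auto
  obtain a b where ab: "a \<le> b" "{a..b} \<subseteq> interior I"
    and def: "\<And>f. AC I f \<Longrightarrow> solves f (\<lambda>x. 0) \<Longrightarrow> (AE x in lebesgue. x \<in> {a..b} \<longrightarrow> H x *v f x = 0) \<Longrightarrow> \<forall>x\<in>I. f x = 0"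
    using definite by blast
  obtain n0 where n0: "{a..b} \<subseteq> seg n0" using compact_in_seg[OF ab(2,1)] by blast
  have "\<exists>c. AE x in lebesgue. x \<in> seg n \<longrightarrow> H x *v (\<phi> x - y x - sol 0 c x) = 0" if n: "n \<ge> n0" for n
  proof -
    obtain u v where uv: "u \<le> v" "seg n = {u..v}" using seg_form by blast
    have sub: "{a..b} \<subseteq> {u..v}" using n0 seg_mono[OF n] uv by (metis order_trans)
    show ?thesis
      unfolding uv(2)
    proof (rule weak_solution_on_segment[OF \<phi> weak y uv(1)])
      show "{u..v} \<subseteq> interior I" using seg_interior[of n] uv by simp
      fix f assume f: "AC I f" "solves f (\<lambda>x. 0)" "AE x in lebesgue. x \<in> {u..v} \<longrightarrow> H x *v f x = 0"
      have "AE x in lebesgue. x \<in> {a..b} \<longrightarrow> H x *v f x = 0"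
        using f(3) by eventually_elim (use sub in blast)
      with f def show "\<forall>x\<in>I. f x = 0" by blast
    qed
  qed
  then have "\<forall>n. \<exists>c. n \<ge> n0 \<longrightarrow> (AE x in lebesgue. x \<in> seg n \<longrightarrow> H x *v (\<phi> x - y x - sol 0 c x) = 0)"
    by blast
  from choice[OF this] obtain c
    where c: "\<And>n. n \<ge> n0 \<Longrightarrow> AE x in lebesgue. x \<in> seg n \<longrightarrow> H x *v (\<phi> x - y x - sol 0 (c n) x) = 0"
    by blast
  have cc: "c n = c n0" if n: "n \<ge> n0" for n
  proof -
    let ?f = "\<lambda>x. 1 *s sol 0 (c n) x + (-1) *s sol 0 (c n0) x"
    have s: "solves (sol 0 c) (\<lambda>x. 0)" for c using sol(3)[of 0 c] by simp
    have "AE x in lebesgue. x \<in> {a..b} \<longrightarrow> H x *v ?f x = 0"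
      using c[OF n] c[OF order_refl]
    proof eventually_elim
      case (elim x)
      show ?case
      proof
        assume "x \<in> {a..b}"
        then have "x \<in> seg n0" "x \<in> seg n" using n0 seg_mono[OF n] by auto
        with elim have "H x *v (\<phi> x - y x - sol 0 (c n) x) = 0" "H x *v (\<phi> x - y x - sol 0 (c n0) x) = 0" by auto
        then have "H x *v ((\<phi> x - y x - sol 0 (c n0) x) - (\<phi> x - y x - sol 0 (c n) x)) = 0"
          by (simp only: bounded_bilinear.diff_right[OF bounded_bilinear_matrix_vector]) simp
        then show "H x *v ?f x = 0" by simp
      qed
    qed
    moreover have "solves ?f (\<lambda>x. 0)"
      using solves_lincomb(1)[OF sol(1) sol(1) s s, of 1 "c n" "-1" "c n0"] by simp
    ultimately have "?f 0 = 0"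
      using def[OF solves_lincomb(2)[OF sol(1) sol(1) s s]] half_line_0[OF I] by blast
    then show ?thesis by (simp add: sol)
  qed
  define f where "f = (\<lambda>x. 1 *s y x + 1 *s sol 0 (c n0) x)"
  have s0: "solves (sol 0 (c n0)) (\<lambda>x. 0)" using sol(3)[of 0 "c n0"] by simp
  have fAC: "AC I f" and fs: "solves f (\<lambda>x. z *s \<phi> x)"
    using solves_lincomb[OF y(1) sol(1) y(2) s0, of 1 1] by (simp_all add: f_def)
  have "AE x in lebesgue. \<forall>n. n \<ge> n0 \<longrightarrow> x \<in> seg n \<longrightarrow> H x *v (\<phi> x - f x) = 0"
    unfolding AE_all_countable
  proof
    fix n
    show "AE x in lebesgue. n \<ge> n0 \<longrightarrow> x \<in> seg n \<longrightarrow> H x *v (\<phi> x - f x) = 0"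
    proof (cases "n \<ge> n0")
      case True
      from c[OF True] show ?thesis
        unfolding cc[OF True] by eventually_elim (simp add: f_def algebra_simps)
    qed simp
  qed
  with AE_interior_half_line[OF I] have ae: "AE x in lebesgue. x \<in> I \<longrightarrow> H x *v (\<phi> x - f x) = 0"
  proof eventually_elim
    case (elim x)
    show ?case
    proof
      assume "x \<in> I"
      then obtain n where "x \<in> seg n" using elim in_seg by blast
      then have "x \<in> seg (max n n0)" using seg_mono[of n "max n n0"] by auto
      then show "H x *v (\<phi> x - f x) = 0" using elim(2) max.cobounded2 by blast
    qed
  qed
  have fm: "f \<in> borel_measurable (restrict_space borel I)"
    using AC_continuous_on[OF I fAC] by (rule borel_measurable_continuous_on_restrict)
  have "set_integrable lebesgue I (form f f)"
    unfolding set_integrable_def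
  proof (rule integrable_cong_AE_imp)
    show "integrable lebesgue (\<lambda>x. indicator I x *\<^sub>R form \<phi> \<phi> x)"
      using form_integrable[OF \<phi> \<phi>] unfolding set_integrable_def .
    show "(\<lambda>x. indicator I x *\<^sub>R form f f x) \<in> borel_measurable lebesgue" by (rule form_measurable[OF fm fm])
    show "AE x in lebesgue. indicator I x *\<^sub>R form \<phi> \<phi> x = indicator I x *\<^sub>R form f f x"
      using ae psd
    proof eventually_elim
      case (elim x)
      show ?case
      proof (cases "x \<in> I")
        case True
        with elim have eq: "H x *v \<phi> x = H x *v f x" and p: "psd (H x)" by (auto simp: mv_simps)
        have "form f f x = cdot (H x *v f x) (f x)" by (rule hermitian_cdot[OF psd_hermitian[OF p]])
        also have "\<dots> = cdot (H x *v \<phi> x) (f x)" by (simp add: eq)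
        also have "\<dots> = form \<phi> f x" by (rule hermitian_cdot[OF psd_hermitian[OF p], symmetric])
        also have "\<dots> = form \<phi> \<phi> x" by (simp add: eq)
        finally show ?thesis by simp
      qed simp
    qed
  qed
  then have fL: "f \<in> L2" using fm by (simp add: L2_fun_def)
  \<comment> \<open>Only \<open>Ht\<close>-type products of the right-hand side enter the equation:
    \<phi> and \<open>f\<close> agree after multiplication by \<open>H\<close>, so one may replace
    the other there.\<close>
  have "solves f (\<lambda>x. z *s f x)"
  proof (rule solves_cong[OF fAC fs])
    show "AE x in lebesgue. x \<in> I \<longrightarrow> f x = f x \<and> H x *v (z *s f x) = H x *v (z *s \<phi> x)"
      using ae by eventually_elim (auto simp: vector_scalar_commute mv_simps)
  qed simp
  moreover have "\<phi> - f \<in> L2_null H I"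
    by (rule null_AE_zero[OF L2_diff[OF \<phi> fL]]) (use ae in simp)
  ultimately show ?thesis using fAC fL by blast
qed

end

section \<open>The limit point argument\<close>

lemma mult_absolutely_integrable_bounded:
  fixes f g :: "real \<Rightarrow> real"
  assumes f: "f absolutely_integrable_on {a..b}" and g: "g \<in> borel_measurable lebesgue" and B: "\<And>x. x \<in> {a..b} \<Longrightarrow> \<bar>g x\<bar> \<le> B"
  shows "(\<lambda>x. g x * f x) absolutely_integrable_on {a..b}"
proof (rule absolutely_integrable_bounded_measurable_product_real)
  show "g \<in> borel_measurable (lebesgue_on {a..b})" using g by (rule measurable_restrict_space1)
  show "bounded (g ` {a..b})" using B by (auto intro!: boundedI[of _ B])
qed (use f in auto)

lemma bounded_measurable_absolutely_integrable:
  fixes g :: "real \<Rightarrow> real"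
  assumes g: "g \<in> borel_measurable lebesgue" and B: "\<And>x. x \<in> {a..b} \<Longrightarrow> \<bar>g x\<bar> \<le> B"
  shows "g absolutely_integrable_on {a..b}"
  using mult_absolutely_integrable_bounded[OF _ assms, where f="\<lambda>_. 1"] by (simp add: absolutely_integrable_on_const)

text \<open>Young's inequality with the weights chosen so that only half of
  \<open>y\<^sup>2 * v\<close> is spent; the other half remains available for absorption.\<close>

lemma two_mult_le_weighted:
  fixes u v C :: real
  assumes "u \<ge> 0" "v \<ge> 0" "C \<ge> 0" "y \<ge> 0"
  shows "2 * y * (C * sqrt (u * v)) \<le> y\<^sup>2 * v / 2 + 2 * C\<^sup>2 * u"
proof -
  have "0 \<le> (y * sqrt v - 2 * C * sqrt u)\<^sup>2" by simp
  also have "\<dots> = y\<^sup>2 * v + 4 * C\<^sup>2 * u - 4 * y * (C * sqrt (u * v))"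
    using assms by (simp add: power2_diff power_mult_distrib real_sqrt_mult)
  finally show ?thesis by simp
qed

text \<open>In the application \<open>p\<close> is the boundary form, \<open>h\<close> the energy
  density, \<open>a\<close> the form of A on the lower component and \<open>s\<close> the scale 1 /
  sqrt q. Integrate the derivative of \<eta>^2 Re p: the term with \<open>Re d\<close> is at most h
  - \<eta>^2 a, and the term with \<eta>' costs half of \<eta>^2 a plus a multiple of
  \<open>h\<close>.\<close>

lemma weighted_energy_bound:
  fixes p d :: "real \<Rightarrow> complex" and h a s \<eta> \<eta>' :: "real \<Rightarrow> real"
  assumes p: "AC {0..} p" and d: "AE x in lebesgue. x \<in> {0..} \<longrightarrow> (p has_vector_derivative d x) (at x)"
    and h: "set_integrable lebesgue {0..} h" and h0: "AE x in lebesgue. x \<in> {0..} \<longrightarrow> 0 \<le> h x"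
    and a: "L1_loc {0..} a" and a0: "AE x in lebesgue. x \<in> {0..} \<longrightarrow> 0 \<le> a x"
    and le: "AE x in lebesgue. x \<in> {0..} \<longrightarrow> (s x)\<^sup>2 * (Re (d x) + a x) \<le> h x"
    and X: "X \<ge> 0" and \<eta>: "absolutely_continuous_on {0..X} \<eta>"
    and \<eta>': "AE x in lebesgue. x \<in> {0<..<X} \<longrightarrow> (\<eta> has_vector_derivative \<eta>' x) (at x)"
    and \<eta>s: "\<And>x. x \<in> {0..X} \<Longrightarrow> 0 \<le> \<eta> x \<and> \<eta> x \<le> s x" and \<eta>X: "\<eta> X = 0"
    and C: "C \<ge> 0" "AE x in lebesgue. x \<in> {0<..<X} \<longrightarrow> \<bar>\<eta>' x\<bar> * norm (p x) \<le> C * sqrt (h x * a x)"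
  shows "(\<lambda>x. (\<eta> x)\<^sup>2 * a x) absolutely_integrable_on {0..X}"
    "integral {0..X} (\<lambda>x. (\<eta> x)\<^sup>2 * a x) \<le> 2 * ((1 + 2 * C\<^sup>2) * (LINT x:{0..}|lebesgue. h x) + (\<eta> 0)\<^sup>2 * norm (p 0))"
proof -
  have sub: "{0..X} \<subseteq> {0..}" by auto
  have \<eta>c: "continuous_on {0..X} \<eta>" by (rule absolutely_continuous_on_imp_continuous_on[OF \<eta>])
  have aX: "a absolutely_integrable_on {0..X}" using L1_locD[OF a sub] .
  show i1: "(\<lambda>x. (\<eta> x)\<^sup>2 * a x) absolutely_integrable_on {0..X}"
    by (rule absolutely_integrable_continuous_bilinear[OF bounded_bilinear_mult _ aX]) (intro continuous_intros \<eta>c)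
  have hX: "h absolutely_integrable_on {0..X}" by (rule set_integrable_subset[OF h _ sub]) auto
  define F where "F x = (\<eta> x * \<eta> x) * Re (p x)" for x
  have pX: "absolutely_continuous_on {0..X} p" using AC_subset[OF p sub] .
  have F: "absolutely_continuous_on {0..X} F"
    unfolding F_def
    by (intro absolutely_continuous_on_bilinear[OF bounded_bilinear_mult] \<eta> absolutely_continuous_on_linear[OF bounded_linear_Re] pX)
  have F': "AE x in lebesgue. x \<in> {0<..<X} \<longrightarrow> (F has_vector_derivative 2 * \<eta> x * \<eta>' x * Re (p x) + (\<eta> x)\<^sup>2 * Re (d x)) (at x)"
    using d \<eta>'
  proof eventually_elim
    case (elim x)
    show ?case
    proof
      assume x: "x \<in> {0<..<X}"
      then have 1: "(\<eta> has_real_derivative \<eta>' x) (at x)" and 2: "(p has_vector_derivative d x) (at x)"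
        using elim by (auto simp: has_real_derivative_iff_has_vector_derivative)
      have "((\<lambda>x. Re (p x)) has_real_derivative Re (d x)) (at x)"
        unfolding has_real_derivative_iff_has_vector_derivative
        by (rule bounded_linear.has_vector_derivative[OF bounded_linear_Re 2])
      with 1 have "(F has_real_derivative 2 * \<eta> x * \<eta>' x * Re (p x) + (\<eta> x)\<^sup>2 * Re (d x)) (at x)"
        unfolding F_def using DERIV_mult[OF DERIV_mult[OF 1 1], of "\<lambda>x. Re (p x)" "Re (d x)"]
        by (simp add: power2_eq_square algebra_simps)
      then show "(F has_vector_derivative 2 * \<eta> x * \<eta>' x * Re (p x) + (\<eta> x)\<^sup>2 * Re (d x)) (at x)"
        by (simp add: has_real_derivative_iff_has_vector_derivative)
    qed
  qed
  note FTC = absolutely_continuous_FTC[OF F X F']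
  have "integral {0..X} (\<lambda>x. 2 * \<eta> x * \<eta>' x * Re (p x) + (\<eta> x)\<^sup>2 * Re (d x))
      \<le> integral {0..X} (\<lambda>x. (1 + 2 * C\<^sup>2) * h x - (1/2) * ((\<eta> x)\<^sup>2 * a x))"
  proof (rule integral_mono_AE_real[OF FTC(1)])
    show "(\<lambda>x. (1 + 2 * C\<^sup>2) * h x - (1/2) * ((\<eta> x)\<^sup>2 * a x)) absolutely_integrable_on {0..X}"
      by (intro set_integral_diff set_integrable_mult_right hX i1)
    have "AE x in lebesgue. x \<notin> {0, X}" by (simp add: AE_lebesgue_iff_negligible negligible_finite)
    then show "AE x in lebesgue. x \<in> {0..X} \<longrightarrow>
        2 * \<eta> x * \<eta>' x * Re (p x) + (\<eta> x)\<^sup>2 * Re (d x) \<le> (1 + 2 * C\<^sup>2) * h x - (1/2) * ((\<eta> x)\<^sup>2 * a x)"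
      using h0 a0 le C(2)
    proof eventually_elim
      case (elim x)
      show ?case
      proof
        assume xX: "x \<in> {0..X}"
        with elim(1) have x: "x \<in> {0<..<X}" "x \<in> {0..}" by auto
        have hx: "0 \<le> h x" "0 \<le> a x" "(s x)\<^sup>2 * (Re (d x) + a x) \<le> h x" "\<bar>\<eta>' x\<bar> * norm (p x) \<le> C * sqrt (h x * a x)"
          using elim x by auto
        have e: "0 \<le> \<eta> x" "\<eta> x \<le> s x" using \<eta>s[OF xX] by auto
        have "\<eta>' x * Re (p x) \<le> \<bar>\<eta>' x\<bar> * norm (p x)"
          by (metis abs_Re_le_cmod abs_ge_self abs_ge_zero abs_mult mult_left_mono order_trans)
        also have "\<dots> \<le> C * sqrt (h x * a x)" by (rule hx)
        finally have "2 * \<eta> x * (\<eta>' x * Re (p x)) \<le> 2 * \<eta> x * (C * sqrt (h x * a x))"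
          using e by (intro mult_left_mono) auto
        also have "\<dots> \<le> (\<eta> x)\<^sup>2 * a x / 2 + 2 * C\<^sup>2 * h x"
          by (rule two_mult_le_weighted) (use hx C e in auto)
        finally have 1: "2 * \<eta> x * \<eta>' x * Re (p x) \<le> (\<eta> x)\<^sup>2 * a x / 2 + 2 * C\<^sup>2 * h x" by (simp add: mult.assoc)
        have "(\<eta> x)\<^sup>2 * (Re (d x) + a x) \<le> h x"
        \<comment> \<open>Passing from \<open>s\<close> down to \<eta> preserves the inequality only
          for a nonnegative bracket; for a negative one the left side is at most 0 and hence below
          \<open>h x\<close>.\<close>
        proof (cases "Re (d x) + a x \<ge> 0")
          case True
          have "(\<eta> x)\<^sup>2 \<le> (s x)\<^sup>2" using e by (intro power_mono)
          with True have "(\<eta> x)\<^sup>2 * (Re (d x) + a x) \<le> (s x)\<^sup>2 * (Re (d x) + a x)" by (intro mult_right_mono)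
          with hx show ?thesis by linarith
        next
          case False
          then have "(\<eta> x)\<^sup>2 * (Re (d x) + a x) \<le> 0" by (simp add: mult_nonneg_nonpos)
          with hx show ?thesis by linarith
        qed
        with 1 show "2 * \<eta> x * \<eta>' x * Re (p x) + (\<eta> x)\<^sup>2 * Re (d x) \<le> (1 + 2 * C\<^sup>2) * h x - (1/2) * ((\<eta> x)\<^sup>2 * a x)"
          by (simp add: algebra_simps)
      qed
    qed
  qed
  also have "\<dots> = (1 + 2 * C\<^sup>2) * integral {0..X} h - (1/2) * integral {0..X} (\<lambda>x. (\<eta> x)\<^sup>2 * a x)"
    using hX i1 by (subst Henstock_Kurzweil_Integration.integral_diff)
      (auto simp: absolutely_integrable_on_def intro: integrable_on_mult_right)
  finally have "F X - F 0 \<le> (1 + 2 * C\<^sup>2) * integral {0..X} h - (1/2) * integral {0..X} (\<lambda>x. (\<eta> x)\<^sup>2 * a x)"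
    using FTC(2) by simp
  moreover have "F X = 0" by (simp add: F_def \<eta>X)
  moreover have "F 0 \<le> (\<eta> 0)\<^sup>2 * norm (p 0)"
    unfolding F_def power2_eq_square by (intro mult_left_mono complex_Re_le_cmod) simp
  moreover have "integral {0..X} h \<le> (LINT x:{0..}|lebesgue. h x)"
  proof -
    have "integral {0..X} h = (LINT x:{0..X}|lebesgue. h x)" using hX by (simp add: set_lebesgue_integral_eq_integral(2))
    also have "\<dots> \<le> (LINT x:{0..}|lebesgue. h x)"
      unfolding set_lebesgue_integral_def
    proof (rule integral_mono_AE)
      show "AE x in lebesgue. indicat_real {0..X} x *\<^sub>R h x \<le> indicat_real {0..} x *\<^sub>R h x"
        using h0 by eventually_elim (auto simp: indicator_def)
    qed (use h hX in \<open>auto simp: set_integrable_def\<close>)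
    finally show ?thesis .
  qed
  then have "(1 + 2 * C\<^sup>2) * integral {0..X} h \<le> (1 + 2 * C\<^sup>2) * (LINT x:{0..}|lebesgue. h x)"
    by (intro mult_left_mono) auto
  moreover have "Y \<le> 2 * (A' + B)" if "FX - F0 \<le> A - 1/2 * Y" "FX = 0" "F0 \<le> B" "A \<le> A'"
    for Y A A' B FX F0 :: real using that by (simp add: field_simps)
  ultimately show "integral {0..X} (\<lambda>x. (\<eta> x)\<^sup>2 * a x)
      \<le> 2 * ((1 + 2 * C\<^sup>2) * (LINT x:{0..}|lebesgue. h x) + (\<eta> 0)\<^sup>2 * norm (p 0))"
    by blast
qed

lemma integral_tendsto_half_line:
  fixes h :: "real \<Rightarrow> real"
  assumes h: "set_integrable lebesgue {0..} h"
  shows "((\<lambda>X. integral {0..X} h) \<longlongrightarrow> (LINT x:{0..}|lebesgue. h x)) at_top"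
proof -
  have "((\<lambda>X. LINT x|lebesgue. indicator {0..X} x *\<^sub>R h x) \<longlongrightarrow> (LINT x|lebesgue. indicator {0..} x *\<^sub>R h x)) at_top"
  proof (rule integral_dominated_convergence_at_top[where w="\<lambda>x. norm (indicator {0..} x *\<^sub>R h x)"])
    show "integrable lebesgue (\<lambda>x. norm (indicat_real {0..} x *\<^sub>R h x))"
      using h unfolding set_integrable_def by (rule integrable_norm)
    show "(\<lambda>x. indicat_real {0..} x *\<^sub>R h x) \<in> borel_measurable lebesgue"
      using h unfolding set_integrable_def by (rule borel_measurable_integrable)
    show "(\<lambda>x. indicat_real {0..X} x *\<^sub>R h x) \<in> borel_measurable lebesgue" for X
      using set_integrable_subset[OF h, of "{0..X}"] unfolding set_integrable_def by auto
    show "\<forall>\<^sub>F X in at_top. AE x in lebesgue. norm (indicat_real {0..X} x *\<^sub>R h x) \<le> norm (indicat_real {0..} x *\<^sub>R h x)"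
      by (intro always_eventually allI AE_I2) (auto simp: indicator_def)
    show "AE x in lebesgue. ((\<lambda>X. indicat_real {0..X} x *\<^sub>R h x) \<longlongrightarrow> indicat_real {0..} x *\<^sub>R h x) at_top"
    proof (intro AE_I2 tendsto_eventually)
      fix x :: real
      show "\<forall>\<^sub>F X in at_top. indicat_real {0..X} x *\<^sub>R h x = indicat_real {0..} x *\<^sub>R h x"
        using eventually_ge_at_top[of x] by eventually_elim (auto simp: indicator_def)
    qed
  qed
  moreover have "integral {0..X} h = (LINT x|lebesgue. indicator {0..X} x *\<^sub>R h x)" for X
    using set_lebesgue_integral_eq_integral(2)[OF set_integrable_subset[OF h, of "{0..X}"]]
    by (simp add: set_lebesgue_integral_def)
  ultimately show ?thesis by (simp add: set_lebesgue_integral_def)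
qed

text \<open>The test functions force \<open>\<integral> \<eta> k |p|\<close> to stay bounded, whereas \<open>\<integral> \<eta> k\<close> does not; hence
  \<open>p\<close> cannot stay away from zero, although its imaginary part is monotone.\<close>

lemma boundary_form_vanishes:
  fixes p d :: "real \<Rightarrow> complex" and h a s k :: "real \<Rightarrow> real" and \<epsilon> :: real
  assumes p: "AC {0..} p" and d: "AE x in lebesgue. x \<in> {0..} \<longrightarrow> (p has_vector_derivative d x) (at x)"
    and h: "set_integrable lebesgue {0..} h" and h0: "AE x in lebesgue. x \<in> {0..} \<longrightarrow> 0 \<le> h x"
    and a: "L1_loc {0..} a" and a0: "AE x in lebesgue. x \<in> {0..} \<longrightarrow> 0 \<le> a x"
    and le: "AE x in lebesgue. x \<in> {0..} \<longrightarrow> (s x)\<^sup>2 * (Re (d x) + a x) \<le> h x"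
    and Imd: "AE x in lebesgue. x \<in> {0..} \<longrightarrow> Im (d x) = \<epsilon> * h x"
    and k: "k \<in> borel_measurable lebesgue" "\<And>x. x \<ge> 0 \<Longrightarrow> 0 \<le> k x \<and> k x \<le> 1"
    and kp: "AE x in lebesgue. x \<in> {0..} \<longrightarrow> k x * norm (p x) \<le> sqrt (h x * a x)"
    and sM: "\<And>x. x \<ge> 0 \<Longrightarrow> s x \<le> M" and C: "C \<ge> 0"
    and test: "\<And>R. \<exists>X \<eta> \<eta>'. X \<ge> 0 \<and> absolutely_continuous_on {0..X} \<eta> \<and>
       (AE x in lebesgue. x \<in> {0<..<X} \<longrightarrow> (\<eta> has_vector_derivative \<eta>' x) (at x)) \<and>
       (\<forall>x\<in>{0..X}. 0 \<le> \<eta> x \<and> \<eta> x \<le> s x) \<and> \<eta> X = 0 \<and>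
       (AE x in lebesgue. x \<in> {0<..<X} \<longrightarrow> \<bar>\<eta>' x\<bar> * norm (p x) \<le> C * sqrt (h x * a x)) \<and>
       R \<le> integral {0..X} (\<lambda>x. k x * \<eta> x)"
  shows "Im (p 0) = - \<epsilon> * (LINT x:{0..}|lebesgue. h x)"
proof (rule ccontr)
  define Ht where "Ht = (LINT x:{0..}|lebesgue. h x)"
  \<comment> \<open>The limit of \<open>Im (p x)\<close> at infinity, since \<open>Im d\<close>
    integrates to \<epsilon> times the energy.\<close>
  define L where "L = Im (p 0) + \<epsilon> * Ht"
  assume "Im (p 0) \<noteq> - \<epsilon> * (LINT x:{0..}|lebesgue. h x)"
  then have L0: "L \<noteq> 0" by (simp add: L_def Ht_def)
  have hi: "h absolutely_integrable_on {0..X}" for X by (rule set_integrable_subset[OF h]) auto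
  have Imp: "Im (p x) = Im (p 0) + \<epsilon> * integral {0..x} h" if x: "x \<ge> 0" for x
  proof -
    have "AE x in lebesgue. x \<in> {0..} \<longrightarrow> ((\<lambda>x. Im (p x)) has_vector_derivative \<epsilon> * h x) (at x)"
      using d Imd
    proof eventually_elim
      case (elim x)
      then show ?case using bounded_linear.has_vector_derivative[OF bounded_linear_Im, of p "d x" "at x"] by auto
    qed
    from AC_FTC(2)[OF AC_linear[OF bounded_linear_Im p] x _ this] show ?thesis by simp
  qed
  have "((\<lambda>X. Im (p 0) + \<epsilon> * integral {0..X} h) \<longlongrightarrow> L) at_top"
    unfolding L_def Ht_def by (intro tendsto_intros integral_tendsto_half_line h)
  then have "\<forall>\<^sub>F X in at_top. dist (Im (p 0) + \<epsilon> * integral {0..X} h) L < \<bar>L\<bar> / 2"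
    using L0 by (intro tendstoD) auto
  then obtain x0 where x0: "\<And>X. X \<ge> x0 \<Longrightarrow> dist (Im (p 0) + \<epsilon> * integral {0..X} h) L < \<bar>L\<bar> / 2"
    unfolding eventually_at_top_linorder by blast
  define y0 where "y0 = max x0 0"
  have big: "\<bar>L\<bar> / 2 \<le> norm (p x)" if x: "x \<ge> y0" for x
  proof -
    have "dist (Im (p x)) L < \<bar>L\<bar> / 2" using x0[of x] Imp[of x] x by (simp add: y0_def)
    then have "\<bar>L\<bar> / 2 \<le> \<bar>Im (p x)\<bar>" unfolding dist_real_def by linarith
    then show ?thesis using abs_Im_le_cmod[of "p x"] by linarith
  qed
  define M' where "M' = max M 0"
  \<comment> \<open>A bound for \<integral> k \<eta> |p|: half of the weighted energy bound plus
    half of the total energy.\<close>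
  define K where "K = ((1 + 2 * C\<^sup>2) * Ht + M'\<^sup>2 * norm (p 0)) + Ht / 2"
  \<comment> \<open>The threshold is chosen so that the final comparison would read K + 1 <= K; the
    summand \<open>M' * y0\<close> pays for \<open>{0..y0}\<close>, where |p| may be small.\<close>
  obtain X \<eta> \<eta>' where X: "X \<ge> 0" and \<eta>: "absolutely_continuous_on {0..X} \<eta>"
    and \<eta>': "AE x in lebesgue. x \<in> {0<..<X} \<longrightarrow> (\<eta> has_vector_derivative \<eta>' x) (at x)"
    and \<eta>s: "\<And>x. x \<in> {0..X} \<Longrightarrow> 0 \<le> \<eta> x \<and> \<eta> x \<le> s x" and \<eta>X: "\<eta> X = 0"
    and C': "AE x in lebesgue. x \<in> {0<..<X} \<longrightarrow> \<bar>\<eta>' x\<bar> * norm (p x) \<le> C * sqrt (h x * a x)"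
    and R: "(K + 1) / (\<bar>L\<bar> / 2) + M' * y0 \<le> integral {0..X} (\<lambda>x. k x * \<eta> x)"
    using test[of "(K + 1) / (\<bar>L\<bar> / 2) + M' * y0"] by auto
  note en = weighted_energy_bound[OF p d h h0 a a0 le X \<eta> \<eta>' \<eta>s \<eta>X C C']
  have \<eta>M: "0 \<le> \<eta> x" "\<eta> x \<le> M'" if "x \<in> {0..X}" for x
    using \<eta>s[OF that] sM[of x] that by (auto simp: M'_def)
  have \<eta>c: "continuous_on {0..X} \<eta>" by (rule absolutely_continuous_on_imp_continuous_on[OF \<eta>])
  have pc: "continuous_on {0..X} p" using AC_subset[OF p, of 0 X] absolutely_continuous_on_imp_continuous_on by auto
  have kb: "\<bar>k x\<bar> \<le> 1" if "x \<in> {0..X}" for x using k(2)[of x] that by auto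
  have i1: "(\<lambda>x. k x * \<eta> x) absolutely_integrable_on {0..X}"
    by (rule mult_absolutely_integrable_bounded[OF _ k(1) kb]) (intro absolutely_integrable_continuous_real \<eta>c, simp)
  have i2: "(\<lambda>x. k x * (\<eta> x * norm (p x))) absolutely_integrable_on {0..X}"
    by (rule mult_absolutely_integrable_bounded[OF _ k(1) kb]) (intro absolutely_integrable_continuous_real continuous_intros \<eta>c pc, simp)
  have i3: "(\<lambda>x. indicator {0..y0} x * M') absolutely_integrable_on {0..X}"
  proof (rule bounded_measurable_absolutely_integrable)
    show "(\<lambda>x. indicat_real {0..y0} x * M') \<in> borel_measurable lebesgue"
      by (intro borel_measurable_times borel_measurable_indicator borel_measurable_const) auto
    show "\<bar>indicat_real {0..y0} x * M'\<bar> \<le> M'" for x by (auto simp: indicator_def M'_def)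
  qed
  have "integral {0..X} (\<lambda>x. k x * (\<eta> x * norm (p x))) \<le> integral {0..X} (\<lambda>x. (1/2) * ((\<eta> x)\<^sup>2 * a x) + (1/2) * h x)"
  proof (rule integral_mono_AE_real[OF i2])
    show "(\<lambda>x. (1/2) * ((\<eta> x)\<^sup>2 * a x) + (1/2) * h x) absolutely_integrable_on {0..X}"
      by (intro set_integral_add set_integrable_mult_right hi en(1))
    show "AE x in lebesgue. x \<in> {0..X} \<longrightarrow> k x * (\<eta> x * norm (p x)) \<le> (1/2) * ((\<eta> x)\<^sup>2 * a x) + (1/2) * h x"
      using kp h0 a0
    proof eventually_elim
      case (elim x)
      show ?case
      proof
        assume x: "x \<in> {0..X}"
        then have e: "k x * norm (p x) \<le> sqrt (h x * a x)" "0 \<le> h x" "0 \<le> a x" using elim by auto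
        have "k x * (\<eta> x * norm (p x)) = \<eta> x * (k x * norm (p x))" by (simp add: mult_ac)
        also have "\<dots> \<le> \<eta> x * sqrt (h x * a x)" using \<eta>M[OF x] e by (intro mult_left_mono) auto
        also have "\<dots> \<le> (1/2) * ((\<eta> x)\<^sup>2 * a x) + (1/2) * h x"
          using two_mult_le_weighted[of "h x" "a x" "1/2" "\<eta> x"] e \<eta>M[OF x] by (simp add: power2_eq_square)
        finally show "k x * (\<eta> x * norm (p x)) \<le> (1/2) * ((\<eta> x)\<^sup>2 * a x) + (1/2) * h x" .
      qed
    qed
  qed
  also have "\<dots> = (1/2) * integral {0..X} (\<lambda>x. (\<eta> x)\<^sup>2 * a x) + (1/2) * integral {0..X} h"
    using en(1) hi[of X] by (subst Henstock_Kurzweil_Integration.integral_add)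
      (auto simp: absolutely_integrable_on_def intro: integrable_on_mult_right)
  also have "\<dots> \<le> K"
  proof -
    have "(\<eta> 0)\<^sup>2 * norm (p 0) \<le> M'\<^sup>2 * norm (p 0)"
      using \<eta>M[of 0] X by (intro mult_right_mono power_mono) auto
    moreover have "integral {0..X} h \<le> Ht"
    proof -
      have "integral {0..X} h = (LINT x:{0..X}|lebesgue. h x)" using hi[of X] by (simp add: set_lebesgue_integral_eq_integral(2))
      also have "\<dots> \<le> Ht"
        unfolding set_lebesgue_integral_def Ht_def
      proof (rule integral_mono_AE)
        show "AE x in lebesgue. indicat_real {0..X} x *\<^sub>R h x \<le> indicat_real {0..} x *\<^sub>R h x"
          using h0 by eventually_elim (auto simp: indicator_def)
      qed (use h hi[of X] in \<open>auto simp: set_integrable_def\<close>)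
      finally show ?thesis .
    qed
    moreover have "integral {0..X} (\<lambda>x. (\<eta> x)\<^sup>2 * a x) \<le> 2 * ((1 + 2 * C\<^sup>2) * Ht + (\<eta> 0)\<^sup>2 * norm (p 0))"
      using en(2) unfolding Ht_def by blast
    moreover have "1/2 * y + 1/2 * i \<le> (A + B') + Ht / 2" if "B \<le> B'" "i \<le> Ht" "y \<le> 2 * (A + B)"
      for y i A B B' :: real using that by (simp add: field_simps)
    ultimately show ?thesis unfolding K_def by blast
  qed
  finally have up: "integral {0..X} (\<lambda>x. k x * (\<eta> x * norm (p x))) \<le> K" .
  have "integral {0..X} (\<lambda>x. (\<bar>L\<bar> / 2) * (k x * \<eta> x))
      \<le> integral {0..X} (\<lambda>x. k x * (\<eta> x * norm (p x)) + (\<bar>L\<bar> / 2) * (indicator {0..y0} x * M'))"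
  proof (rule integral_mono_AE_real)
    show "(\<lambda>x. (\<bar>L\<bar> / 2) * (k x * \<eta> x)) absolutely_integrable_on {0..X}"
      by (intro set_integrable_mult_right i1)
    show "(\<lambda>x. k x * (\<eta> x * norm (p x)) + (\<bar>L\<bar> / 2) * (indicator {0..y0} x * M')) absolutely_integrable_on {0..X}"
      by (intro set_integral_add set_integrable_mult_right i2 i3)
    have "(\<bar>L\<bar> / 2) * (k x * \<eta> x) \<le> k x * (\<eta> x * norm (p x)) + (\<bar>L\<bar> / 2) * (indicator {0..y0} x * M')"
      if x: "x \<in> {0..X}" for x
    proof (cases "x \<le> y0")
      case True
      have "k x * \<eta> x \<le> 1 * M'" using k(2)[of x] \<eta>M[OF x] x by (intro mult_mono) auto
      then have "(\<bar>L\<bar> / 2) * (k x * \<eta> x) \<le> (\<bar>L\<bar> / 2) * M'" by (intro mult_left_mono) auto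
      moreover have "0 \<le> k x * (\<eta> x * norm (p x))" using k(2)[of x] \<eta>M[OF x] x by auto
      moreover have "indicator {0..y0} x * M' = M'" using True x by simp
      ultimately show ?thesis by (metis add.commute add_increasing2)
    next
      case False
      have "k x * \<eta> x * (\<bar>L\<bar> / 2) \<le> k x * \<eta> x * norm (p x)"
        using big[of x] False k(2)[of x] \<eta>M[OF x] x by (intro mult_left_mono) auto
      then show ?thesis using False by (simp add: mult_ac)
    qed
    then show "AE x in lebesgue. x \<in> {0..X} \<longrightarrow>
        (\<bar>L\<bar> / 2) * (k x * \<eta> x) \<le> k x * (\<eta> x * norm (p x)) + (\<bar>L\<bar> / 2) * (indicator {0..y0} x * M')" by auto
  qed
  also have "\<dots> = integral {0..X} (\<lambda>x. k x * (\<eta> x * norm (p x))) + (\<bar>L\<bar> / 2) * integral {0..X} (\<lambda>x. indicator {0..y0} x * M')"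
    using i2 i3 by (subst Henstock_Kurzweil_Integration.integral_add)
      (auto simp: absolutely_integrable_on_def intro: integrable_on_mult_right)
  also have "\<dots> \<le> K + (\<bar>L\<bar> / 2) * (M' * y0)"
  proof (intro add_mono up mult_left_mono)
    have "integral {0..X} (\<lambda>x. indicator {0..y0} x * M') = (LINT x:{0..X}|lebesgue. indicator {0..y0} x * M')"
      using i3 by (rule set_lebesgue_integral_eq_integral(2)[symmetric])
    also have "\<dots> \<le> (LINT x|lebesgue. indicator {0..y0} x * M')"
      unfolding set_lebesgue_integral_def
    proof (rule integral_mono)
      show "integrable lebesgue (\<lambda>x. indicat_real {0..X} x *\<^sub>R (indicat_real {0..y0} x * M'))" using i3 unfolding set_integrable_def .
      have "integrable lebesgue (indicat_real {0..y0})"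
        by (rule integrable_real_indicator) (auto simp: emeasure_lborel_Icc_eq)
      then show "integrable lebesgue (\<lambda>x. indicat_real {0..y0} x * M')" by (intro integrable_mult_left)
    qed (auto simp: indicator_def M'_def)
    also have "\<dots> = M' * y0" by (simp add: y0_def mult.commute)
    finally show "integral {0..X} (\<lambda>x. indicator {0..y0} x * M') \<le> M' * y0" .
  qed auto
  finally have "(\<bar>L\<bar> / 2) * integral {0..X} (\<lambda>x. k x * \<eta> x) \<le> K + (\<bar>L\<bar> / 2) * (M' * y0)" by simp
  moreover have "(\<bar>L\<bar> / 2) * ((K + 1) / (\<bar>L\<bar> / 2) + M' * y0) \<le> (\<bar>L\<bar> / 2) * integral {0..X} (\<lambda>x. k x * \<eta> x)"
    using R by (intro mult_left_mono) auto
  moreover have "(\<bar>L\<bar> / 2) * ((K + 1) / (\<bar>L\<bar> / 2) + M' * y0) = K + 1 + (\<bar>L\<bar> / 2) * (M' * y0)"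
    using L0 by (simp add: field_simps)
  ultimately show False by linarith
qed


text \<open>\<open>s\<close> is multiplied by a factor that falls from 1 to 0 linearly in the
  variable T = \<integral> k s. The derivative consists of a part bounded by |s'| and of s^2 k /
  T(X), which is a multiple of \<open>k\<close>; in the variable T the integral of k \<eta> is
  elementary and equals T(X)/2.\<close>

lemma test_function_Lipschitz:
  fixes s k :: "real \<Rightarrow> real" and p :: "real \<Rightarrow> complex"
  assumes k: "\<And>x. x \<ge> 0 \<Longrightarrow> 0 \<le> k x"
    and s: "\<And>x. x \<ge> 0 \<Longrightarrow> 0 \<le> s x \<and> s x \<le> M"
    and ks: "\<And>X. (\<lambda>x. k x * s x) absolutely_integrable_on {0..X}"
    and kp: "AE x in lebesgue. x \<in> {0..} \<longrightarrow> k x * norm (p x) \<le> r x"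
    and unb: "\<And>R. \<exists>X\<ge>0. R \<le> integral {0..X} (\<lambda>x. k x * s x)"
    and sAC: "AC {0..} s" and s': "AE x in lebesgue. x \<in> {0..} \<longrightarrow> (s has_vector_derivative s' x) (at x)"
    and s'p: "AE x in lebesgue. x \<in> {0..} \<longrightarrow> \<bar>s' x\<bar> * norm (p x) \<le> C\<^sub>1 * r x"
  shows "\<exists>X \<eta> \<eta>'. X \<ge> 0 \<and> absolutely_continuous_on {0..X} \<eta> \<and>
       (AE x in lebesgue. x \<in> {0<..<X} \<longrightarrow> (\<eta> has_vector_derivative \<eta>' x) (at x)) \<and>
       (\<forall>x\<in>{0..X}. 0 \<le> \<eta> x \<and> \<eta> x \<le> s x) \<and> \<eta> X = 0 \<and>
       (AE x in lebesgue. x \<in> {0<..<X} \<longrightarrow> \<bar>\<eta>' x\<bar> * norm (p x) \<le> (C\<^sub>1 + M\<^sup>2) * r x) \<and>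
       R \<le> integral {0..X} (\<lambda>x. k x * \<eta> x)"
proof -
  define T where "T x = 0 + integral {0..x} (\<lambda>x. k x * s x)" for x
  \<comment> \<open>\<open>1\<close> makes the division by \<open>T X\<close> harmless in the
    derivative bound, and \<open>2 * R\<close> makes up for the lost half.\<close>
  obtain X where X: "X \<ge> 0" "max 1 (2 * R) \<le> T X" using unb[of "max 1 (2 * R)"] by (auto simp: T_def)
  then have TX: "T X \<ge> 1" "T X \<ge> 2 * R" by auto
  have T: "absolutely_continuous_on {0..X} T" unfolding T_def by (rule absolutely_continuous_on_integral[OF ks])
  have T': "AE x in lebesgue. x \<in> {0<..<X} \<longrightarrow> (T has_vector_derivative k x * s x) (at x)"
    unfolding T_def by (rule AE_deriv_integral[OF ks])
  have ks0: "0 \<le> k x * s x" if "x \<ge> 0" for x using k[OF that] s[OF that] by simp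
  have Tb: "0 \<le> T x \<and> T x \<le> T X" if "x \<in> {0..X}" for x
  proof
    have i: "(\<lambda>x. k x * s x) integrable_on {0..x}" for x using ks by (simp add: absolutely_integrable_on_def)
    show "0 \<le> T x" unfolding T_def using integral_nonneg[OF i] ks0 by auto
    show "T x \<le> T X" unfolding T_def using that i ks0 by (auto intro!: integral_subset_le)
  qed
  define w where "w x = 1 + (- 1 / T X) * T x" for x
  have w: "absolutely_continuous_on {0..X} w"
    unfolding w_def by (intro absolutely_continuous_on_add absolutely_continuous_on_const
        absolutely_continuous_on_linear[OF bounded_linear_mult_right] T)
  have wb: "0 \<le> w x \<and> w x \<le> 1" if "x \<in> {0..X}" for x
    using Tb[OF that] TX by (simp add: w_def field_simps)
  define \<eta> where "\<eta> x = s x * w x" for x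
  define \<eta>' where "\<eta>' x = s' x * w x - s x * (k x * s x) / T X" for x
  have sX: "absolutely_continuous_on {0..X} s" using AC_subset[OF sAC] by auto
  have D: "AE x in lebesgue. x \<in> {0<..<X} \<longrightarrow> (\<eta> has_vector_derivative \<eta>' x) (at x)"
    using T' s'
  proof eventually_elim
    case (elim x)
    show ?case
    proof
      assume "x \<in> {0<..<X}"
      with elim have 1: "(T has_real_derivative k x * s x) (at x)" and 2: "(s has_real_derivative s' x) (at x)"
        by (auto simp: has_real_derivative_iff_has_vector_derivative)
      have "(\<eta> has_real_derivative \<eta>' x) (at x)"
        unfolding \<eta>_def w_def \<eta>'_def
        by (rule derivative_eq_intros 1 2 refl | simp)+
      then show "(\<eta> has_vector_derivative \<eta>' x) (at x)" by (simp add: has_real_derivative_iff_has_vector_derivative)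
    qed
  qed
  have bound: "AE x in lebesgue. x \<in> {0<..<X} \<longrightarrow> \<bar>\<eta>' x\<bar> * norm (p x) \<le> (C\<^sub>1 + M\<^sup>2) * r x"
    using kp s'p
  proof eventually_elim
    case (elim x)
    show ?case
    proof
      assume x: "x \<in> {0<..<X}"
      then have wx: "0 \<le> w x" "w x \<le> 1" and sx: "0 \<le> s x" "s x \<le> M" and kx: "0 \<le> k x"
        using wb[of x] s[of x] k[of x] by auto
      have "\<bar>\<eta>' x\<bar> \<le> \<bar>s' x * w x\<bar> + \<bar>s x * (k x * s x) / T X\<bar>" unfolding \<eta>'_def by (rule abs_triangle_ineq4)
      also have "\<bar>s' x * w x\<bar> \<le> \<bar>s' x\<bar>" using wx by (simp add: abs_mult mult_left_le)
      also have "\<bar>s x * (k x * s x) / T X\<bar> \<le> M\<^sup>2 * k x"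
      proof -
        have "\<bar>s x * (k x * s x) / T X\<bar> = (s x * s x * k x) / T X" using sx kx TX by (simp add: abs_mult)
        also have "\<dots> \<le> (s x * s x * k x) / 1" using sx kx TX by (intro divide_left_mono) auto
        also have "\<dots> \<le> (M * M * k x) / 1" using sx kx by (intro divide_right_mono mult_right_mono mult_mono) auto
        finally show ?thesis by (simp add: power2_eq_square)
      qed
      finally have "\<bar>\<eta>' x\<bar> * norm (p x) \<le> (\<bar>s' x\<bar> + M\<^sup>2 * k x) * norm (p x)" by (intro mult_right_mono) auto
      also have "\<dots> = \<bar>s' x\<bar> * norm (p x) + M\<^sup>2 * (k x * norm (p x))" by (simp add: algebra_simps)
      also have "\<dots> \<le> C\<^sub>1 * r x + M\<^sup>2 * r x" using elim x by (intro add_mono mult_left_mono) auto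
      finally show "\<bar>\<eta>' x\<bar> * norm (p x) \<le> (C\<^sub>1 + M\<^sup>2) * r x" by (simp add: algebra_simps)
    qed
  qed
  \<comment> \<open>A primitive of \<open>k * \<eta>\<close>, found by taking \<open>T\<close> as
    the variable of integration.\<close>
  define Q where "Q x = T x + (- 1 / (2 * T X)) * (T x * T x)" for x
  have Q: "absolutely_continuous_on {0..X} Q"
    unfolding Q_def by (intro absolutely_continuous_on_add absolutely_continuous_on_linear[OF bounded_linear_mult_right]
        absolutely_continuous_on_bilinear[OF bounded_bilinear_mult] T)
  have "AE x in lebesgue. x \<in> {0<..<X} \<longrightarrow> (Q has_vector_derivative k x * \<eta> x) (at x)"
    using T'
  proof eventually_elim
    case (elim x)
    show ?case
    proof
      assume "x \<in> {0<..<X}"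
      with elim have 1: "(T has_real_derivative k x * s x) (at x)"
        by (auto simp: has_real_derivative_iff_has_vector_derivative)
      have "(Q has_real_derivative k x * \<eta> x) (at x)"
        unfolding Q_def \<eta>_def w_def using TX
        by (auto intro!: derivative_eq_intros 1 simp: field_simps)
      then show "(Q has_vector_derivative k x * \<eta> x) (at x)" by (simp add: has_real_derivative_iff_has_vector_derivative)
    qed
  qed
  from absolutely_continuous_FTC(2)[OF Q X(1) this]
  have "integral {0..X} (\<lambda>x. k x * \<eta> x) = T X / 2" using TX by (simp add: Q_def T_def[of 0] field_simps)
  with TX have Rle: "R \<le> integral {0..X} (\<lambda>x. k x * \<eta> x)" by simp
  have \<eta>AC: "absolutely_continuous_on {0..X} \<eta>"
    unfolding \<eta>_def by (intro absolutely_continuous_on_bilinear[OF bounded_bilinear_mult] sX w)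
  have \<eta>b: "0 \<le> \<eta> x \<and> \<eta> x \<le> s x" if "x \<in> {0..X}" for x
    using wb[OF that] s[of x] that by (auto simp: \<eta>_def mult_left_le)
  have "\<eta> X = 0" using TX by (simp add: \<eta>_def w_def)
  with X(1) \<eta>AC D \<eta>b bound Rle show ?thesis by blast
qed

text \<open>The solution of \<open>\<eta>' = k (\<eta> - s)\<close> that vanishes at \<open>X\<close> is an exponentially weighted average
  of the values of \<open>s\<close> to the right, hence lies below \<open>s\<close> when \<open>s\<close> is decreasing.\<close>

lemma test_function_decreasing:
  fixes s k :: "real \<Rightarrow> real" and p :: "real \<Rightarrow> complex"
  assumes k: "k \<in> borel_measurable lebesgue" "\<And>x. x \<ge> 0 \<Longrightarrow> 0 \<le> k x \<and> k x \<le> 1"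
    and s: "\<And>x. x \<ge> 0 \<Longrightarrow> 0 \<le> s x \<and> s x \<le> M"
    and ks: "\<And>X. (\<lambda>x. k x * s x) absolutely_integrable_on {0..X}"
    and kp: "AE x in lebesgue. x \<in> {0..} \<longrightarrow> k x * norm (p x) \<le> r x"
    and unb: "\<And>R. \<exists>X\<ge>0. R \<le> integral {0..X} (\<lambda>x. k x * s x)"
    and anti: "\<And>x y. 0 \<le> x \<Longrightarrow> x \<le> y \<Longrightarrow> s y \<le> s x"
  shows "\<exists>X \<eta> \<eta>'. X \<ge> 0 \<and> absolutely_continuous_on {0..X} \<eta> \<and>
       (AE x in lebesgue. x \<in> {0<..<X} \<longrightarrow> (\<eta> has_vector_derivative \<eta>' x) (at x)) \<and>
       (\<forall>x\<in>{0..X}. 0 \<le> \<eta> x \<and> \<eta> x \<le> s x) \<and> \<eta> X = 0 \<and>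
       (AE x in lebesgue. x \<in> {0<..<X} \<longrightarrow> \<bar>\<eta>' x\<bar> * norm (p x) \<le> M * r x) \<and>
       R \<le> integral {0..X} (\<lambda>x. k x * \<eta> x)"
proof -
  \<comment> \<open>Integrating \<eta>' = k (\<eta> - s) gives \<integral> k \<eta> = \<integral> k
    s - \<eta>(0), and \<eta>(0) is at most \<open>M\<close>.\<close>
  obtain X where X: "X \<ge> 0" "R + M \<le> integral {0..X} (\<lambda>x. k x * s x)" using unb by blast
  have ki: "k absolutely_integrable_on {0..X}" for X
    by (rule bounded_measurable_absolutely_integrable[OF k(1), of _ _ 1]) (use k(2) in auto)
  define t where "t x = 0 + integral {0..x} k" for x
  have t: "absolutely_continuous_on {0..X} t" unfolding t_def by (rule absolutely_continuous_on_integral[OF ki])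
  have t': "AE x in lebesgue. x \<in> {0<..<X} \<longrightarrow> (t has_vector_derivative k x) (at x)"
    unfolding t_def by (rule AE_deriv_integral[OF ki])
  have tb: "0 \<le> t x \<and> t x \<le> t X" if "x \<in> {0..X}" for x
  proof
    have i: "k integrable_on {0..x}" for x using ki by (simp add: absolutely_integrable_on_def)
    show "0 \<le> t x" unfolding t_def using integral_nonneg[OF i] k(2) by auto
    show "t x \<le> t X" unfolding t_def using that i k(2) by (auto intro!: integral_subset_le)
  qed
  have exp: "absolutely_continuous_on {0..X} (\<lambda>x. exp (c * t x))" for c
  proof (rule absolutely_continuous_on_compose_C1[OF t, where l=0 and u="t X"])
    show "((\<lambda>y. exp (c * y)) has_real_derivative c * exp (c * y)) (at y)" for y
      by (auto intro!: derivative_eq_intros)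
  qed (use tb in \<open>auto intro!: continuous_intros\<close>)
  define E where "E x = exp ((-1) * t x)" for x
  have E: "absolutely_continuous_on {0..X} E" unfolding E_def by (rule exp)
  have Ec: "continuous_on {0..X} E" by (rule absolutely_continuous_on_imp_continuous_on[OF E])
  have Ei: "(\<lambda>x. E x * (k x * s x)) absolutely_integrable_on {0..X}"
    by (rule absolutely_integrable_continuous_bilinear[OF bounded_bilinear_mult Ec ks])
  define G where "G x = 0 + integral {0..x} (\<lambda>x. E x * (k x * s x))" for x
  have G: "absolutely_continuous_on {0..X} G" unfolding G_def by (rule absolutely_continuous_on_integral[OF Ei])
  have G': "AE x in lebesgue. x \<in> {0<..<X} \<longrightarrow> (G has_vector_derivative E x * (k x * s x)) (at x)"
    unfolding G_def by (rule AE_deriv_integral[OF Ei])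
  \<comment> \<open>Variation of constants; \<open>G X - G x\<close> is the integral of
    \<open>E * k * s\<close> from \<open>x\<close> to \<open>X\<close>.\<close>
  define \<eta> where "\<eta> x = exp (1 * t x) * (G X + (-1) * G x)" for x
  have \<eta>: "absolutely_continuous_on {0..X} \<eta>"
    unfolding \<eta>_def by (intro absolutely_continuous_on_bilinear[OF bounded_bilinear_mult] exp absolutely_continuous_on_add
        absolutely_continuous_on_const absolutely_continuous_on_linear[OF bounded_linear_mult_right] G)
  define \<eta>' where "\<eta>' x = k x * \<eta> x - k x * s x" for x
  have D: "AE x in lebesgue. x \<in> {0<..<X} \<longrightarrow> (\<eta> has_vector_derivative \<eta>' x) (at x)"
    using t' G'
  proof eventually_elim
    case (elim x)
    show ?case
    proof
      assume "x \<in> {0<..<X}"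
      with elim have 1: "(t has_real_derivative k x) (at x)" and 2: "(G has_real_derivative E x * (k x * s x)) (at x)"
        by (auto simp: has_real_derivative_iff_has_vector_derivative)
      have "(\<eta> has_real_derivative k x * \<eta> x - exp (t x) * (E x * (k x * s x))) (at x)"
        unfolding \<eta>_def by (auto intro!: derivative_eq_intros 1 2 simp: algebra_simps)
      also have "exp (t x) * (E x * (k x * s x)) = k x * s x"
        by (simp add: E_def mult.assoc[symmetric] exp_add[symmetric])
      finally show "(\<eta> has_vector_derivative \<eta>' x) (at x)"
        by (simp add: has_real_derivative_iff_has_vector_derivative \<eta>'_def)
    qed
  qed
  have E': "AE x in lebesgue. x \<in> {0<..<X} \<longrightarrow> (E has_vector_derivative - (E x * k x)) (at x)"
    using t'
  proof eventually_elim
    case (elim x)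
    show ?case
    proof
      assume "x \<in> {0<..<X}"
      with elim have 1: "(t has_real_derivative k x) (at x)"
        by (auto simp: has_real_derivative_iff_has_vector_derivative)
      have "(E has_real_derivative - (E x * k x)) (at x)"
        unfolding E_def by (auto intro!: derivative_eq_intros 1)
      then show "(E has_vector_derivative - (E x * k x)) (at x)" by (simp add: has_real_derivative_iff_has_vector_derivative)
    qed
  qed
  have \<eta>b: "0 \<le> \<eta> x \<and> \<eta> x \<le> s x" if x: "x \<in> {0..X}" for x
  proof -
    have sub: "{x..X} \<subseteq> {0..X}" and xX: "x \<le> X" using x by auto
    have AE1: "AE y in lebesgue. y \<in> {x<..<X} \<longrightarrow> (G has_vector_derivative E y * (k y * s y)) (at y)"
      using G' by eventually_elim (use x in auto)
    note FG = absolutely_continuous_FTC[OF absolutely_continuous_on_subset[OF G sub] xX AE1]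
    have AE2: "AE y in lebesgue. y \<in> {x<..<X} \<longrightarrow> (E has_vector_derivative - (E y * k y)) (at y)"
      using E' by eventually_elim (use x in auto)
    note FE = absolutely_continuous_FTC[OF absolutely_continuous_on_subset[OF E sub] xX AE2]
    have FE1: "(\<lambda>y. s x * (-1) * - (E y * k y)) absolutely_integrable_on {x..X}"
      by (intro set_integrable_mult_right FE(1))
    have E0: "E y > 0" for y by (simp add: E_def)
    have "0 \<le> integral {x..X} (\<lambda>y. E y * (k y * s y))"
      using FG(1) E0 k(2) s x by (intro integral_nonneg) (auto simp: absolutely_integrable_on_def less_imp_le)
    then have ge: "0 \<le> G X - G x" using FG(2) by simp
    \<comment> \<open>For \<open>y\<close> to the right of \<open>x\<close> the value
      \<open>s y\<close> may be replaced by \<open>s x\<close>; what is left,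
      \<open>E y * k y\<close>, is minus the derivative of \<open>E\<close>.\<close>
    have "integral {x..X} (\<lambda>y. E y * (k y * s y)) \<le> integral {x..X} (\<lambda>y. s x * (-1) * - (E y * k y))"
    proof (rule integral_mono_AE_real[OF FG(1) FE1])
      have "E y * (k y * s y) \<le> s x * (-1) * - (E y * k y)" if "y \<in> {x..X}" for y
      proof -
        have "(E y * k y) * s y \<le> (E y * k y) * s x"
          using that x E0[of y] k(2)[of y] anti[of x y] by (intro mult_left_mono) (auto simp: less_imp_le)
        then show ?thesis by (simp add: mult_ac)
      qed
      then show "AE y in lebesgue. y \<in> {x..X} \<longrightarrow> E y * (k y * s y) \<le> s x * (-1) * - (E y * k y)" by auto
    qed
    also have "\<dots> = s x * (-1) * (E X - E x)"
      using FE(2) by (simp only: integral_mult_right)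
    also have "\<dots> \<le> s x * E x" using s[of x] x E0[of X] by (simp add: algebra_simps)
    finally have le: "G X - G x \<le> s x * E x" using FG(2) by simp
    have "\<eta> x \<le> exp (t x) * (s x * E x)" unfolding \<eta>_def using le by simp
    also have "\<dots> = s x" by (simp add: E_def exp_minus)
    finally show ?thesis using ge by (simp add: \<eta>_def)
  qed
  have bound: "AE x in lebesgue. x \<in> {0<..<X} \<longrightarrow> \<bar>\<eta>' x\<bar> * norm (p x) \<le> M * r x"
    using kp
  proof eventually_elim
    case (elim x)
    show ?case
    proof
      assume x: "x \<in> {0<..<X}"
      have "\<bar>\<eta>' x\<bar> = k x * (s x - \<eta> x)"
        using \<eta>b[of x] k(2)[of x] x unfolding \<eta>'_def right_diff_distrib[symmetric] abs_mult by auto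
      also have "\<dots> \<le> k x * M" using \<eta>b[of x] k(2)[of x] s[of x] x by (intro mult_left_mono) auto
      finally have "\<bar>\<eta>' x\<bar> * norm (p x) \<le> k x * M * norm (p x)" by (intro mult_right_mono) auto
      also have "\<dots> = M * (k x * norm (p x))" by simp
      also have "\<dots> \<le> M * r x" using elim x s[of x] by (intro mult_left_mono) auto
      finally show "\<bar>\<eta>' x\<bar> * norm (p x) \<le> M * r x" .
    qed
  qed
  have \<eta>X: "\<eta> X = 0" by (simp add: \<eta>_def)
  have k\<eta>: "(\<lambda>x. k x * \<eta> x) absolutely_integrable_on {0..X}"
    by (rule absolutely_integrable_continuous_bilinear[OF bounded_bilinear.flip[OF bounded_bilinear_mult] _ ki])
       (rule absolutely_continuous_on_imp_continuous_on[OF \<eta>])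
  have "integral {0..X} \<eta>' = \<eta> X - \<eta> 0" by (rule absolutely_continuous_FTC(2)[OF \<eta> X(1) D])
  moreover have "integral {0..X} \<eta>' = integral {0..X} (\<lambda>x. k x * \<eta> x) - integral {0..X} (\<lambda>x. k x * s x)"
    unfolding \<eta>'_def using k\<eta> ks by (intro Henstock_Kurzweil_Integration.integral_diff) (auto simp: absolutely_integrable_on_def)
  moreover have "\<eta> 0 \<le> M" using \<eta>b[of 0] s[of 0] X(1) by auto
  ultimately have Rle: "R \<le> integral {0..X} (\<lambda>x. k x * \<eta> x)" using X(2) \<eta>X by linarith
  show ?thesis using X(1) \<eta> D \<eta>b \<eta>X bound Rle by blast
qed

section \<open>The adjoint of the minimal relation\<close>

lemma (in L2_weight) compact_interior_seg:
  assumes K: "compact K" "K \<subseteq> interior I"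
  obtains n where "K \<subseteq> seg n"
proof (cases "K = {}")
  case False
  have m: "Inf K \<in> K" "Sup K \<in> K"
    using K(1) False by (auto intro!: closed_contains_Inf closed_contains_Sup compact_imp_closed bounded_imp_bdd_below bounded_imp_bdd_above compact_imp_bounded)
  then obtain i j where "Inf K \<in> seg i" "Sup K \<in> seg j" using in_seg K(2) by (meson subsetD)
  then have "Inf K \<in> seg (max i j)" "Sup K \<in> seg (max i j)" using seg_mono[of i "max i j"] seg_mono[of j "max i j"] by auto
  moreover obtain c d where cd: "seg (max i j) = {c..d}" using seg_form by blast
  moreover have "Inf K \<le> x \<and> x \<le> Sup K" if "x \<in> K" for x
    using that K(1) by (auto intro!: cInf_lower cSup_upper bounded_imp_bdd_below bounded_imp_bdd_above compact_imp_bounded)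
  ultimately have "K \<subseteq> seg (max i j)" by (fastforce simp: cd)
  then show thesis by (rule that)
qed (use that in auto)

text \<open>Raising the index by one moves both end points off a segment containing the supports, so
  that boundary terms can be evaluated where they vanish.\<close>

lemma (in L2_weight) seg_endpoints:
  "\<exists>a b. a < b \<and> seg (Suc n) = {a..b} \<and> a \<notin> seg n \<and> b \<notin> seg n"
proof -
  have "1 / (real (Suc n) + 1) < 1 / (real n + 1)" "real n + 1 < real (Suc n) + 1" "1 / (real n + 1) \<le> real n + 1"
    by (auto simp: field_simps)
  then show ?thesis
    unfolding seg_def by (auto intro!: exI[of _ "1 / (real (Suc n) + 1)"] exI[of _ "- (real (Suc n) + 1)"])
qed

context definite_system
begin

lemma compact_support_L2:
  assumes f: "AC I f" and c: "compactly_supported_inside I f"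
  shows "f \<in> L2"
proof -
  obtain K where K: "compact K" "K \<subseteq> interior I" "\<And>x. x \<in> I - K \<Longrightarrow> f x = 0"
    using c by (auto simp: compactly_supported_inside_def)
  obtain n where n: "K \<subseteq> seg n" using compact_interior_seg[OF K(1,2)] .
  obtain a b where ab: "seg n = {a..b}" using seg_form by blast
  have sub: "{a..b} \<subseteq> I" using seg_interior[of n] interior_subset unfolding ab by blast
  let ?f = "\<lambda>x. if x \<in> {a..b} then f x else 0"
  have fc: "continuous_on I f" by (rule AC_continuous_on[OF I f])
  have eq: "?f x = f x" if "x \<in> I" for x using that K(3)[of x] n unfolding ab by (metis DiffI subsetD)
  have "set_integrable lebesgue I (form ?f ?f)"
    using continuous_cut_L2[OF fc sub] by (simp add: L2_fun_def)
  moreover have "indicator I x *\<^sub>R form ?f ?f x = indicator I x *\<^sub>R form f f x" for x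
  proof (cases "x \<in> I")
    case True
    show ?thesis unfolding eq[OF True] ..
  qed simp
  ultimately have "set_integrable lebesgue I (form f f)"
    unfolding set_integrable_def by (simp only:)
  then show ?thesis using borel_measurable_continuous_on_restrict[OF fc] by (simp add: L2_fun_def)
qed

lemma Lagrange_compact_support:
  assumes f: "AC I f" "solves f (\<lambda>x. z *s f x)" "f \<in> L2"
    and g: "AC I f'" "solves f' g'" "g' \<in> L2"
    and cs: "compactly_supported_inside I f'" "compactly_supported_inside I g'"
  shows "ip f g' = ip (\<lambda>x. z *s f x) f'"
proof -
  obtain K K' where K: "compact K" "K \<subseteq> interior I" "\<And>x. x \<in> I - K \<Longrightarrow> f' x = 0"
    and K': "compact K'" "K' \<subseteq> interior I" "\<And>x. x \<in> I - K' \<Longrightarrow> g' x = 0"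
    using cs by (auto simp: compactly_supported_inside_def)
  obtain n where n: "K \<union> K' \<subseteq> seg n" using compact_interior_seg[OF compact_Un[OF K(1) K'(1)]] K(2) K'(2) by blast
  obtain a b where ab: "a < b" "seg (Suc n) = {a..b}" "a \<notin> seg n" "b \<notin> seg n" using seg_endpoints by blast
  have sub: "{a..b} \<subseteq> I" using seg_interior[of "Suc n"] interior_subset unfolding ab(2) by blast
  have nn: "seg n \<subseteq> {a..b}" using seg_mono[of n "Suc n"] ab(2) by auto
  have z: "f' a = 0" "f' b = 0"
  proof -
    have "a \<in> I - K" "b \<in> I - K" using n ab sub by auto
    then show "f' a = 0" "f' b = 0" using K(3) by auto
  qed
  have out: "f' x = 0" "g' x = 0" if "x \<in> I" "x \<notin> {a..b}" for x
  proof -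
    have "x \<in> I - K" "x \<in> I - K'" using n nn that by auto
    then show "f' x = 0" "g' x = 0" using K(3) K'(3) by auto
  qed
  note Lg = Lagrange_identity[OF f(1,2) g(1,2) less_imp_le[OF ab(1)] sub]
  have fc: "continuous_on {a..b} f" using continuous_on_subset[OF AC_continuous_on[OF I f(1)] sub] .
  have f'c: "continuous_on {a..b} f'" using continuous_on_subset[OF AC_continuous_on[OF I g(1)] sub] .
  have i1: "form f g' absolutely_integrable_on {a..b}"
    by (rule absolutely_integrable_continuous_bilinear[OF bounded_bilinear_cdot fc L1_locD[OF weight_times_L2[OF g(3)] sub]])
  have i2: "(\<lambda>x. cdot (H x *v (z *s f x)) (f' x)) absolutely_integrable_on {a..b}"
    by (rule absolutely_integrable_continuous_bilinear[OF bounded_bilinear.flip[OF bounded_bilinear_cdot] f'c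
          L1_locD[OF weight_times_L2[OF L2_scale_mem[OF f(3)]] sub]])
  have i2': "AE x in lebesgue. x \<in> {a..b} \<longrightarrow> cdot (H x *v (z *s f x)) (f' x) = form (\<lambda>x. z *s f x) f' x"
    using psd by eventually_elim (metis sub hermitian_cdot[OF psd_hermitian] subsetD)
  note i3 = absolutely_integrable_cong_AE[OF i2 i2']
  have "integral {a..b} (form f g') - integral {a..b} (\<lambda>x. cdot (H x *v (z *s f x)) (f' x)) = 0"
    using Lg(2) z i1 i2 by (subst Henstock_Kurzweil_Integration.integral_diff[symmetric]) (auto simp: absolutely_integrable_on_def mv_simps cdot_simps)
  moreover have "ip f g' = integral {a..b} (form f g')"
    by (rule ip_local[OF sub i1]) (use out in auto)
  moreover have "ip (\<lambda>x. z *s f x) f' = integral {a..b} (form (\<lambda>x. z *s f x) f')"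
    by (rule ip_local[OF sub i3(1)]) (use out in auto)
  ultimately show ?thesis using i3(2) by simp
qed

text \<open>In one direction an element of the adjoint is a weak solution, hence represented by a
  genuine one. In the other the Lagrange identity has no boundary terms for compactly supported
  pairs, and continuity extends it to the closure.\<close>

theorem deficiency_space_eq:
  "{u \<in> L2_space H I. (u, L2_scale H I z u) \<in> rel_adjoint H I (minimal_relation J B H I)}
    = L2_class H I ` {f. (\<forall>x. x \<notin> I \<longrightarrow> f x = 0) \<and> AC I f \<and> f \<in> L2 \<and> solves f (\<lambda>x. z *s f x)}"
  (is "?U = L2_class H I ` ?S")
proof (intro equalityI subsetI)
  define T where "T = {(L2_class H I f, L2_class H I g) | f g. AC I f \<and> g \<in> L2 \<and>
        compactly_supported_inside I f \<and> compactly_supported_inside I g \<and> solves f g}"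
  have mr: "minimal_relation J B H I = rel_closure H I T" by (simp add: minimal_relation_def T_def)
  {
    fix u assume "u \<in> ?U"
    then have u: "u \<in> L2_space H I" and adj: "(u, L2_scale H I z u) \<in> rel_adjoint H I (rel_closure H I T)"
      by (auto simp: mr)
    define \<phi> where "\<phi> = L2_rep u"
    have \<phi>: "\<phi> \<in> L2" "L2_class H I \<phi> = u" using u by (auto simp: \<phi>_def rep_mem class_rep)
    have z\<phi>: "(\<lambda>x. z *s \<phi> x) \<in> L2" by (rule L2_scale_mem[OF \<phi>(1)])
    have sc: "L2_scale H I z u = L2_class H I (\<lambda>x. z *s \<phi> x)" using scale_class[OF \<phi>(1)] \<phi>(2) by simp
    have "\<exists>f. AC I f \<and> solves f (\<lambda>x. z *s f x) \<and> f \<in> L2 \<and> \<phi> - f \<in> L2_null H I"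
    proof (rule weak_solution_is_solution[OF \<phi>(1)])
      fix f g assume A: "AC I f" "g \<in> L2" "compactly_supported_inside I f" "compactly_supported_inside I g" "solves f g"
      have fL: "f \<in> L2" by (rule compact_support_L2[OF A(1,3)])
      have "(L2_class H I f, L2_class H I g) \<in> T" using A by (auto simp: T_def)
      from rel_adjoint_closureD[OF adj this fL A(2)]
      have "ip \<phi> g = ip (L2_rep (L2_scale H I z u)) f" by (simp add: \<phi>_def)
      also have "\<dots> = ip (\<lambda>x. z *s \<phi> x) f"
        unfolding sc using fL z\<phi> null_AE_zero[OF L2_diff[OF fL fL]]
        by (intro ip_null_cong rep_mem class_mem rep_class) (auto simp: mv_simps)
      finally show "ip \<phi> g = ip (\<lambda>x. z *s \<phi> x) f" .
    qed
    then obtain f where f: "AC I f" "solves f (\<lambda>x. z *s f x)" "f \<in> L2" "\<phi> - f \<in> L2_null H I" by blast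
    \<comment> \<open>The representative that vanishes off \<open>I\<close>, which the formal
      deficiency space prescribes.\<close>
    define f0 where "f0 x = (if x \<in> I then f x else 0)" for x
    have f0: "AC I f0" unfolding f0_def using f(1) AC_zero_outside_iff by blast
    have f0s: "solves f0 (\<lambda>x. z *s f0 x)"
      by (rule solves_cong[OF f(1,2)]) (auto simp: f0_def)
    have "set_integrable lebesgue I (form f0 f0)"
      using form_integrable[OF f(3,3)] unfolding set_integrable_def
      by (rule back_subst[of "integrable lebesgue"]) (auto simp: fun_eq_iff indicator_def f0_def)
    then have f0L: "f0 \<in> L2"
      using borel_measurable_continuous_on_restrict[OF AC_continuous_on[OF I f0]] by (simp add: L2_fun_def)
    have "\<phi> - f0 \<in> L2_null H I"
    proof (rule null_AE_zero[OF L2_diff[OF \<phi>(1) f0L]])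
      show "AE x in lebesgue. x \<in> I \<longrightarrow> H x *v (\<phi> - f0) x = 0"
        using null_AE[OF f(4)] by eventually_elim (simp add: f0_def)
    qed
    then have "u = L2_class H I f0" using class_eq_iff[OF \<phi>(1) f0L] \<phi>(2) by simp
    moreover have "f0 \<in> ?S" using f0 f0s f0L by (simp add: f0_def)
    ultimately show "u \<in> L2_class H I ` ?S" by blast
  }
  {
    fix u assume "u \<in> L2_class H I ` ?S"
    then obtain f where f: "AC I f" "f \<in> L2" "solves f (\<lambda>x. z *s f x)" "u = L2_class H I f" by blast
    have "(L2_class H I f, L2_class H I (\<lambda>x. z *s f x)) \<in> rel_adjoint H I (rel_closure H I T)"
    proof (rule rel_adjoint_closureI[OF f(2) L2_scale_mem[OF f(2)]])
      fix \<phi> \<psi> assume "(\<phi>, \<psi>) \<in> T"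
      then obtain f' g' where A: "\<phi> = L2_class H I f'" "\<psi> = L2_class H I g'" "AC I f'" "g' \<in> L2"
        "compactly_supported_inside I f'" "compactly_supported_inside I g'" "solves f' g'" by (auto simp: T_def)
      from Lagrange_compact_support[OF f(1,3,2) A(3,7,4,5,6)] compact_support_L2[OF A(3,5)] A
      show "\<exists>f' g. f' \<in> L2 \<and> g \<in> L2 \<and> \<phi> = L2_class H I f' \<and> \<psi> = L2_class H I g \<and> ip f g = ip (\<lambda>x. z *s f x) f'"
        by blast
    qed
    then show "u \<in> ?U" using f class_mem[OF f(2)] scale_class[OF f(2)] by (simp add: mr)
  }
qed

end

text \<open>The nonnegative integral is a supremum over simple functions below the integrand.
  Countably many of them already have unbounded integrals, and their supremum is measurable. The
  integrand in question contains c, for which no measurability is assumed.\<close>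

lemma nn_integral_measurable_minorant:
  fixes f :: "'a \<Rightarrow> ennreal"
  assumes "(\<integral>\<^sup>+x. f x \<partial>M) = \<infinity>"
  obtains m where "m \<in> borel_measurable M" "\<And>x. m x \<le> f x" "(\<integral>\<^sup>+x. m x \<partial>M) = \<infinity>"
proof -
  have "\<exists>g. simple_function M g \<and> g \<le> f \<and> of_nat n < integral\<^sup>S M g" for n
  proof -
    have "of_nat n < (SUP g \<in> {g. simple_function M g \<and> g \<le> f}. integral\<^sup>S M g)"
      unfolding nn_integral_def[of M f, symmetric] assms by (simp add: of_nat_less_top)
    then show ?thesis unfolding less_SUP_iff by auto
  qed
  then obtain g where g: "\<And>n. simple_function M (g n)" "\<And>n. g n \<le> f" "\<And>n. of_nat n < integral\<^sup>S M (g n)" by metis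
  define m where "m x = (SUP n. g n x)" for x
  have [measurable]: "g n \<in> borel_measurable M" for n using g(1) by (rule borel_measurable_simple_function)
  show thesis
  proof (rule that[of m])
    show "m \<in> borel_measurable M" unfolding m_def by measurable
    show "m x \<le> f x" for x unfolding m_def using g(2) by (intro SUP_least) (auto simp: le_fun_def)
    have "of_nat n \<le> (\<integral>\<^sup>+x. m x \<partial>M)" for n
    proof -
      have "of_nat n \<le> integral\<^sup>S M (g n)" using g(3) by (rule less_imp_le)
      also have "\<dots> = (\<integral>\<^sup>+x. g n x \<partial>M)" using g(1) by (rule nn_integral_eq_simple_integral[symmetric])
      also have "\<dots> \<le> (\<integral>\<^sup>+x. m x \<partial>M)" unfolding m_def by (intro nn_integral_mono SUP_upper) auto
      finally show ?thesis .
    qed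
    then have "(SUP n. of_nat n :: ennreal) \<le> (\<integral>\<^sup>+x. m x \<partial>M)" by (intro SUP_least)
    then show "(\<integral>\<^sup>+x. m x \<partial>M) = \<infinity>" by (simp add: ennreal_SUP_of_nat_eq_top top_unique)
  qed
qed

text \<open>If the integrals over the growing segments were bounded by \<open>R\<close>, monotone
  convergence would make the integral over \<open>I\<close> finite.\<close>

lemma unbounded_integrals:
  fixes m :: "real \<Rightarrow> real"
  assumes I: "half_line I" and m: "m \<in> borel_measurable lebesgue" "\<And>x. 0 \<le> m x \<and> m x \<le> B"
    and inf: "(\<integral>\<^sup>+x\<in>I. ennreal (m x) \<partial>lebesgue) = \<infinity>"
  shows "\<exists>X\<ge>0. R \<le> integral (I \<inter> {-X..X}) m"
proof (rule ccontr)
  assume neg: "\<not> (\<exists>X\<ge>0. R \<le> integral (I \<inter> {-X..X}) m)"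
  have [measurable]: "I \<in> sets lebesgue" using half_line_measurable[OF I] by simp
  note m(1)[measurable]
  have eq: "(\<integral>\<^sup>+x. ennreal (m x) * indicator (I \<inter> {-real n..real n}) x \<partial>lebesgue) = ennreal (integral (I \<inter> {-real n..real n}) m)" for n
  proof -
    have S: "I \<inter> {-real n..real n} = {(if I = {0..} then 0 else - real n)..(if I = {0..} then real n else 0)}"
      using I by (auto simp: half_line_def)
    have ai: "m absolutely_integrable_on (I \<inter> {-real n..real n})"
      unfolding S by (rule bounded_measurable_absolutely_integrable[OF m(1), of _ _ B]) (use m(2) in auto)
    then have i: "integrable lebesgue (\<lambda>x. indicator (I \<inter> {-real n..real n}) x *\<^sub>R m x)"
      "integral (I \<inter> {-real n..real n}) m = (LINT x|lebesgue. indicator (I \<inter> {-real n..real n}) x *\<^sub>R m x)"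
      using ai set_lebesgue_integral_eq_integral(2)[OF ai] unfolding set_integrable_def set_lebesgue_integral_def by auto
    have "(\<integral>\<^sup>+x. ennreal (indicator (I \<inter> {-real n..real n}) x *\<^sub>R m x) \<partial>lebesgue) = ennreal (integral (I \<inter> {-real n..real n}) m)"
      unfolding i(2) using m(2) by (intro nn_integral_eq_integral[OF i(1)]) auto
    moreover have "ennreal (indicator (I \<inter> {-real n..real n}) x *\<^sub>R m x) = ennreal (m x) * indicator (I \<inter> {-real n..real n}) x" for x
      by (auto simp: indicator_def)
    ultimately show ?thesis by simp
  qed
  have "(\<integral>\<^sup>+x. ennreal (m x) * indicator I x \<partial>lebesgue)
      = (\<integral>\<^sup>+x. (SUP n. ennreal (m x) * indicator (I \<inter> {-real n..real n}) x) \<partial>lebesgue)"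
  proof (rule nn_integral_cong)
    fix x :: real
    show "ennreal (m x) * indicator I x = (SUP n. ennreal (m x) * indicator (I \<inter> {-real n..real n}) x)"
    proof (rule antisym)
      obtain n where "\<bar>x\<bar> \<le> real n" using real_arch_simple by blast
      then have "ennreal (m x) * indicator I x = ennreal (m x) * indicator (I \<inter> {-real n..real n}) x"
        by (auto simp: indicator_def)
      then show "ennreal (m x) * indicator I x \<le> (SUP n. ennreal (m x) * indicator (I \<inter> {-real n..real n}) x)"
        by (rule order_trans[OF eq_refl SUP_upper[OF UNIV_I]])
      show "(SUP n. ennreal (m x) * indicator (I \<inter> {-real n..real n}) x) \<le> ennreal (m x) * indicator I x"
        by (rule SUP_least) (auto simp: indicator_def)
    qed
  qed
  also have "\<dots> = (SUP n. (\<integral>\<^sup>+x. ennreal (m x) * indicator (I \<inter> {-real n..real n}) x \<partial>lebesgue))"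
  proof (rule nn_integral_monotone_convergence_SUP)
    show "incseq (\<lambda>n x. ennreal (m x) * indicator (I \<inter> {-real n..real n}) x)"
      by (auto simp: incseq_def le_fun_def indicator_def)
    show "(\<lambda>x. ennreal (m x) * indicator (I \<inter> {-real n..real n}) x) \<in> borel_measurable lebesgue" for n
      by (intro borel_measurable_times_ennreal borel_measurable_indicator measurable_compose[OF m(1) measurable_ennreal] sets.Int) auto
  qed
  also have "\<dots> \<le> ennreal R"
    unfolding eq using neg by (intro SUP_least ennreal_leI) (metis linear of_nat_0_le_iff)
  finally show False using inf by (simp add: top_unique)
qed

text \<open>Vanishing at infinity reads Im p(0) = -\<epsilon> \<integral> h. Multiplied by
  \<epsilon> this has a sign, and equality forces the nonnegative \<open>h\<close> to vanish almost
  everywhere. The two alternatives for \<open>s\<close> select the test function.\<close>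

lemma boundary_form_zero_nonneg:
  fixes p d :: "real \<Rightarrow> complex" and h a s k :: "real \<Rightarrow> real" and \<epsilon> :: real
  assumes p: "AC {0..} p" and d: "AE x in lebesgue. x \<in> {0..} \<longrightarrow> (p has_vector_derivative d x) (at x)"
    and h: "set_integrable lebesgue {0..} h" and h0: "AE x in lebesgue. x \<in> {0..} \<longrightarrow> 0 \<le> h x"
    and a: "L1_loc {0..} a" and a0: "AE x in lebesgue. x \<in> {0..} \<longrightarrow> 0 \<le> a x"
    and le: "AE x in lebesgue. x \<in> {0..} \<longrightarrow> (s x)\<^sup>2 * (Re (d x) + a x) \<le> h x"
    and Imd: "AE x in lebesgue. x \<in> {0..} \<longrightarrow> Im (d x) = \<epsilon> * h x"
    and k: "k \<in> borel_measurable lebesgue" "\<And>x. x \<ge> 0 \<Longrightarrow> 0 \<le> k x \<and> k x \<le> 1"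
    and kp: "AE x in lebesgue. x \<in> {0..} \<longrightarrow> k x * norm (p x) \<le> sqrt (h x * a x)"
    and s: "\<And>x. x \<ge> 0 \<Longrightarrow> 0 \<le> s x \<and> s x \<le> M"
    and ks: "\<And>X. (\<lambda>x. k x * s x) absolutely_integrable_on {0..X}"
    and unb: "\<And>R. \<exists>X\<ge>0. R \<le> integral {0..X} (\<lambda>x. k x * s x)"
    and alt: "(\<exists>s' C\<^sub>1. AC {0..} s \<and> C\<^sub>1 \<ge> 0 \<and> (AE x in lebesgue. x \<in> {0..} \<longrightarrow> (s has_vector_derivative s' x) (at x)) \<and>
        (AE x in lebesgue. x \<in> {0..} \<longrightarrow> \<bar>s' x\<bar> * norm (p x) \<le> C\<^sub>1 * sqrt (h x * a x)))
      \<or> (\<forall>x y. 0 \<le> x \<longrightarrow> x \<le> y \<longrightarrow> s y \<le> s x)"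
  shows "\<epsilon> * Im (p 0) \<le> 0 \<and> (\<epsilon> * Im (p 0) = 0 \<longrightarrow> \<epsilon> \<noteq> 0 \<longrightarrow> (AE x in lebesgue. x \<in> {0..} \<longrightarrow> h x = 0))"
proof -
  have M: "M \<ge> 0" using s[of 0] by auto
  have sM: "\<And>x. x \<ge> 0 \<Longrightarrow> s x \<le> M" using s by auto
  have k0: "\<And>x. x \<ge> 0 \<Longrightarrow> 0 \<le> k x" using k(2) by auto
  note bv = boundary_form_vanishes[OF p d h h0 a a0 le Imd k kp sM]
  have eq: "Im (p 0) = - \<epsilon> * (LINT x:{0..}|lebesgue. h x)"
    using alt
  proof
    assume "\<exists>s' C\<^sub>1. AC {0..} s \<and> C\<^sub>1 \<ge> 0 \<and> (AE x in lebesgue. x \<in> {0..} \<longrightarrow> (s has_vector_derivative s' x) (at x)) \<and>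
        (AE x in lebesgue. x \<in> {0..} \<longrightarrow> \<bar>s' x\<bar> * norm (p x) \<le> C\<^sub>1 * sqrt (h x * a x))"
    then obtain s' C\<^sub>1 where A: "AC {0..} s" "C\<^sub>1 \<ge> 0" "AE x in lebesgue. x \<in> {0..} \<longrightarrow> (s has_vector_derivative s' x) (at x)"
      "AE x in lebesgue. x \<in> {0..} \<longrightarrow> \<bar>s' x\<bar> * norm (p x) \<le> C\<^sub>1 * sqrt (h x * a x)" by blast
    show ?thesis
      by (rule bv[where C="C\<^sub>1 + M\<^sup>2"]) (simp, simp, use A(2) in simp, rule test_function_Lipschitz[OF k0 s ks kp unb A(1,3,4)])
  next
    assume anti: "\<forall>x y. 0 \<le> x \<longrightarrow> x \<le> y \<longrightarrow> s y \<le> s x"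
    show ?thesis
      by (rule bv[where C=M]) (simp, simp, use M in simp, rule test_function_decreasing[OF k s ks kp unb], use anti in auto)
  qed
  have nn: "AE x in lebesgue. 0 \<le> indicat_real {0..} x *\<^sub>R h x" using h0 by eventually_elim (auto simp: indicator_def)
  have L0: "0 \<le> (LINT x:{0..}|lebesgue. h x)" unfolding set_lebesgue_integral_def by (rule integral_nonneg_AE[OF nn])
  have LZ: "AE x in lebesgue. x \<in> {0..} \<longrightarrow> h x = 0" if "(LINT x:{0..}|lebesgue. h x) = 0"
  proof -
    have "AE x in lebesgue. indicat_real {0..} x *\<^sub>R h x = 0"
      using that h unfolding set_lebesgue_integral_def set_integrable_def by (subst (asm) integral_nonneg_eq_0_iff_AE[OF _ nn]) auto
    then show ?thesis by eventually_elim (auto simp: indicator_def)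
  qed
  have e: "\<epsilon> * Im (p 0) = - (\<epsilon> * \<epsilon> * (LINT x:{0..}|lebesgue. h x))" unfolding eq by simp
  show ?thesis
  proof (intro conjI impI)
    have "0 \<le> \<epsilon> * \<epsilon> * (LINT x:{0..}|lebesgue. h x)" using L0 by (intro mult_nonneg_nonneg zero_le_square)
    with e show "\<epsilon> * Im (p 0) \<le> 0" by linarith
    assume "\<epsilon> * Im (p 0) = 0" "\<epsilon> \<noteq> 0"
    then have "(LINT x:{0..}|lebesgue. h x) = 0" using e by simp
    then show "AE x in lebesgue. x \<in> {0..} \<longrightarrow> h x = 0" by (rule LZ)
  qed
qed

definition half_line_sign :: "real set \<Rightarrow> real" where
  "half_line_sign I = (if I = {0..} then 1 else -1)"

lemma AC_reflect': 
  fixes f :: "real \<Rightarrow> 'a::euclidean_space"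
  assumes "AC {..0} f" shows "AC {0..} (\<lambda>x. f (- x))"
  unfolding AC_def
proof (intro allI impI)
  fix a b :: real assume "{a..b} \<subseteq> {0..}"
  then have "{-b..-a} \<subseteq> {..0}" by auto
  from AC_subset[OF assms this] show "absolutely_continuous_on {a..b} (\<lambda>x. f (- x))"
    by (rule absolutely_continuous_on_reflect)
qed

lemma has_vector_derivative_reflect:
  assumes "(f has_vector_derivative f') (at (- x))"
  shows "((\<lambda>x. f (- x)) has_vector_derivative - f') (at (x::real))"
proof -
  have "(uminus has_vector_derivative (-1)) (at x)" by (auto intro!: derivative_eq_intros)
  then have "((f \<circ> uminus) has_vector_derivative (- 1) *\<^sub>R f') (at x)"
    using assms by (intro vector_diff_chain_at) auto
  then show ?thesis by (simp add: o_def)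
qed

text \<open>On the left half-line \<open>p\<close> is replaced by -p(-x), whose derivative is d(-x).
  Every hypothesis on \<open>d\<close> is then kept without change of sign, and the reflection shows
  only in the sign of Im p(0).\<close>

lemma boundary_form_zero:
  fixes p d :: "real \<Rightarrow> complex" and h a s k :: "real \<Rightarrow> real" and \<epsilon> :: real
  assumes I: "half_line I"
    and p: "AC I p" and d: "AE x in lebesgue. x \<in> I \<longrightarrow> (p has_vector_derivative d x) (at x)"
    and h: "set_integrable lebesgue I h" and h0: "AE x in lebesgue. x \<in> I \<longrightarrow> 0 \<le> h x"
    and a: "L1_loc I a" and a0: "AE x in lebesgue. x \<in> I \<longrightarrow> 0 \<le> a x"
    and le: "AE x in lebesgue. x \<in> I \<longrightarrow> (s x)\<^sup>2 * (Re (d x) + a x) \<le> h x"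
    and Imd: "AE x in lebesgue. x \<in> I \<longrightarrow> Im (d x) = \<epsilon> * h x"
    and k: "k \<in> borel_measurable lebesgue" "\<And>x. 0 \<le> k x \<and> k x \<le> 1"
    and kp: "AE x in lebesgue. x \<in> I \<longrightarrow> k x * norm (p x) \<le> sqrt (h x * a x)"
    and s: "\<And>x. x \<in> I \<Longrightarrow> 0 \<le> s x \<and> s x \<le> M"
    and ks: "\<And>X. (\<lambda>x. k x * s x) absolutely_integrable_on (I \<inter> {-X..X})"
    and unb: "\<And>R. \<exists>X\<ge>0. R \<le> integral (I \<inter> {-X..X}) (\<lambda>x. k x * s x)"
    and alt: "(\<exists>s' C\<^sub>1. AC I s \<and> C\<^sub>1 \<ge> 0 \<and> (AE x in lebesgue. x \<in> I \<longrightarrow> (s has_vector_derivative s' x) (at x)) \<and>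
        (AE x in lebesgue. x \<in> I \<longrightarrow> \<bar>s' x\<bar> * norm (p x) \<le> C\<^sub>1 * sqrt (h x * a x)))
      \<or> (\<forall>x\<in>I. \<forall>y\<in>I. \<bar>x\<bar> \<le> \<bar>y\<bar> \<longrightarrow> s y \<le> s x)"
  shows "half_line_sign I * \<epsilon> * Im (p 0) \<le> 0 \<and>
    (Im (p 0) = 0 \<longrightarrow> \<epsilon> \<noteq> 0 \<longrightarrow> (AE x in lebesgue. x \<in> I \<longrightarrow> h x = 0))"
proof (cases "I = {0..}")
  case True
  have seg: "I \<inter> {-X..X} = {0..X}" for X using True by auto
  have "\<epsilon> * Im (p 0) \<le> 0 \<and> (\<epsilon> * Im (p 0) = 0 \<longrightarrow> \<epsilon> \<noteq> 0 \<longrightarrow> (AE x in lebesgue. x \<in> {0..} \<longrightarrow> h x = 0))"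
  proof (rule boundary_form_zero_nonneg[where p=p and d=d and s=s and k=k and a=a and M=M])
    show "\<exists>X\<ge>0. R \<le> integral {0..X} (\<lambda>x. k x * s x)" for R using unb[of R] unfolding seg .
    show "(\<lambda>x. k x * s x) absolutely_integrable_on {0..X}" for X using ks[of X] unfolding seg .
    show "(\<exists>s' C\<^sub>1. AC {0..} s \<and> C\<^sub>1 \<ge> 0 \<and> (AE x in lebesgue. x \<in> {0..} \<longrightarrow> (s has_vector_derivative s' x) (at x)) \<and>
        (AE x in lebesgue. x \<in> {0..} \<longrightarrow> \<bar>s' x\<bar> * norm (p x) \<le> C\<^sub>1 * sqrt (h x * a x)))
      \<or> (\<forall>x y. 0 \<le> x \<longrightarrow> x \<le> y \<longrightarrow> s y \<le> s x)"
    proof -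
      have "\<forall>x y. 0 \<le> x \<longrightarrow> x \<le> y \<longrightarrow> s y \<le> s x" if "\<forall>x\<in>{0..}. \<forall>y\<in>{0..}. \<bar>x\<bar> \<le> \<bar>y\<bar> \<longrightarrow> s y \<le> s x"
        using that by auto
      then show ?thesis using alt unfolding True by blast
    qed
  qed (use assms in \<open>simp_all add: True\<close>)
  then show ?thesis by (simp add: half_line_sign_def True)
next
  case False
  then have I': "I = {..0}" using I by (simp add: half_line_def)
  have sign: "half_line_sign I = -1" using False by (simp add: half_line_sign_def)
  have seg: "I \<inter> {-X..X} = {-X..0}" for X using I' by auto
  have refl: "AE x in lebesgue. x \<in> {0..} \<longrightarrow> P (- x)" if "AE x in lebesgue. x \<in> I \<longrightarrow> P x" for P
    using AE_lebesgue_reflect[OF that] by eventually_elim (auto simp: I')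
  have "\<epsilon> * Im (- p (- 0)) \<le> 0 \<and> (\<epsilon> * Im (- p (- 0)) = 0 \<longrightarrow> \<epsilon> \<noteq> 0 \<longrightarrow> (AE x in lebesgue. x \<in> {0..} \<longrightarrow> h (- x) = 0))"
  proof (rule boundary_form_zero_nonneg[where p="\<lambda>x. - p (- x)" and d="\<lambda>x. d (- x)" and s="\<lambda>x. s (- x)"
        and k="\<lambda>x. k (- x)" and a="\<lambda>x. a (- x)" and h="\<lambda>x. h (- x)" and M=M])
    show "AC {0..} (\<lambda>x. - p (- x))"
      by (rule AC_linear[OF bounded_linear_minus[OF bounded_linear_ident]]) (rule AC_reflect'[OF p[unfolded I']])
    show "AE x in lebesgue. x \<in> {0..} \<longrightarrow> ((\<lambda>x. - p (- x)) has_vector_derivative d (- x)) (at x)"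
      using refl[OF d]
    proof eventually_elim
      case (elim x)
      show ?case
      proof
        assume "x \<in> {0..}"
        with elim have "(p has_vector_derivative d (- x)) (at (- x))" by simp
        from has_vector_derivative_minus[OF has_vector_derivative_reflect[OF this]]
        show "((\<lambda>x. - p (- x)) has_vector_derivative d (- x)) (at x)" by simp
      qed
    qed
    have "h absolutely_integrable_on {..0}" using h unfolding I' .
    then show "set_integrable lebesgue {0..} (\<lambda>x. h (- x))"
      using has_absolute_integral_reflect_real[of "{0..}" "{..0}" h "integral {..0} h"] by (auto simp: image_iff)
    show "L1_loc {0..} (\<lambda>x. a (- x))" using L1_loc_reflect[OF a[unfolded I']] .
    show "(\<lambda>x. k (- x)) \<in> borel_measurable lebesgue"
      using measurable_compose[OF lebesgue_measurable_scaling[of "-1"] k(1)] by simp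
    show "(\<lambda>x. k (- x) * s (- x)) absolutely_integrable_on {0..X}" for X
      using ks[of X] absolutely_integrable_reflect_real[where f="\<lambda>x. k x * s x" and a="-X" and b=0] unfolding seg by simp
    show "\<exists>X\<ge>0. R \<le> integral {0..X} (\<lambda>x. k (- x) * s (- x))" for R
    proof -
      have "integral {0..X} (\<lambda>x. k (- x) * s (- x)) = integral {-X..0} (\<lambda>x. k x * s x)" for X
        using Henstock_Kurzweil_Integration.integral_reflect_real[where f="\<lambda>x. k x * s x" and a="-X" and b=0] by simp
      then show ?thesis using unb[of R] unfolding seg by simp
    qed
    show "AE x in lebesgue. x \<in> {0..} \<longrightarrow> k (- x) * norm (- p (- x)) \<le> sqrt (h (- x) * a (- x))"
      using refl[OF kp] by simp
    show "(\<exists>s' C\<^sub>1. AC {0..} (\<lambda>x. s (- x)) \<and> C\<^sub>1 \<ge> 0 \<and>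
        (AE x in lebesgue. x \<in> {0..} \<longrightarrow> ((\<lambda>x. s (- x)) has_vector_derivative s' x) (at x)) \<and>
        (AE x in lebesgue. x \<in> {0..} \<longrightarrow> \<bar>s' x\<bar> * norm (- p (- x)) \<le> C\<^sub>1 * sqrt (h (- x) * a (- x))))
      \<or> (\<forall>x y. 0 \<le> x \<longrightarrow> x \<le> y \<longrightarrow> s (- y) \<le> s (- x))"
      using alt
    proof
      assume "\<exists>s' C\<^sub>1. AC I s \<and> C\<^sub>1 \<ge> 0 \<and> (AE x in lebesgue. x \<in> I \<longrightarrow> (s has_vector_derivative s' x) (at x)) \<and>
        (AE x in lebesgue. x \<in> I \<longrightarrow> \<bar>s' x\<bar> * norm (p x) \<le> C\<^sub>1 * sqrt (h x * a x))"
      then obtain s' C\<^sub>1 where A: "AC I s" "C\<^sub>1 \<ge> 0" "AE x in lebesgue. x \<in> I \<longrightarrow> (s has_vector_derivative s' x) (at x)"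
        "AE x in lebesgue. x \<in> I \<longrightarrow> \<bar>s' x\<bar> * norm (p x) \<le> C\<^sub>1 * sqrt (h x * a x)" by blast
      have 1: "AE x in lebesgue. x \<in> {0..} \<longrightarrow> ((\<lambda>x. s (- x)) has_vector_derivative - s' (- x)) (at x)"
        using refl[OF A(3)] by eventually_elim (auto intro: has_vector_derivative_reflect)
      have 2: "AE x in lebesgue. x \<in> {0..} \<longrightarrow> \<bar>- s' (- x)\<bar> * norm (- p (- x)) \<le> C\<^sub>1 * sqrt (h (- x) * a (- x))"
        using refl[OF A(4)] by simp
      show ?thesis
        by (intro disjI1 exI[of _ "\<lambda>x. - s' (- x)"] exI[of _ C\<^sub>1] conjI AC_reflect'[OF A(1)[unfolded I']] A(2) 1 2)
    next
      assume "\<forall>x\<in>I. \<forall>y\<in>I. \<bar>x\<bar> \<le> \<bar>y\<bar> \<longrightarrow> s y \<le> s x"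
      then show ?thesis by (auto simp: I')
    qed
    show "AE x in lebesgue. x \<in> {0..} \<longrightarrow> 0 \<le> h (- x)" by (rule refl[OF h0])
    show "AE x in lebesgue. x \<in> {0..} \<longrightarrow> 0 \<le> a (- x)" by (rule refl[OF a0])
    show "AE x in lebesgue. x \<in> {0..} \<longrightarrow> (s (- x))\<^sup>2 * (Re (d (- x)) + a (- x)) \<le> h (- x)" by (rule refl[OF le])
    show "AE x in lebesgue. x \<in> {0..} \<longrightarrow> Im (d (- x)) = \<epsilon> * h (- x)" by (rule refl[OF Imd])
    show "0 \<le> k (- x) \<and> k (- x) \<le> 1" for x by (rule k(2))
    show "0 \<le> s (- x) \<and> s (- x) \<le> M" if "x \<ge> 0" for x using s[of "- x"] that by (simp add: I')
  qed
  moreover have "AE x in lebesgue. x \<in> I \<longrightarrow> h x = 0" if "AE x in lebesgue. x \<in> {0..} \<longrightarrow> h (- x) = 0"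
    using AE_lebesgue_reflect[OF that] by eventually_elim (auto simp: I')
  ultimately show ?thesis unfolding sign by auto
qed

section \<open>Block matrices\<close>

definition upper :: "complex ^ ('n + 'n) \<Rightarrow> complex ^ 'n" where "upper f = (\<chi> i. f $ Inl i)"
definition lower :: "complex ^ ('n + 'n) \<Rightarrow> complex ^ 'n" where "lower f = (\<chi> i. f $ Inr i)"
definition join :: "complex ^ 'n \<Rightarrow> complex ^ 'n \<Rightarrow> complex ^ ('n + 'n)" where
  "join u w = (\<chi> i. case i of Inl a \<Rightarrow> u $ a | Inr a \<Rightarrow> w $ a)"

lemma upper_join [simp]: "upper (join u w) = u" and lower_join [simp]: "lower (join u w) = w"
  by (simp_all add: upper_def lower_def join_def vec_eq_iff)

lemma join_eq_iff: "f = g \<longleftrightarrow> upper f = upper g \<and> lower f = lower g"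
proof
  assume "upper f = upper g \<and> lower f = lower g"
  then have "f $ Inl i = g $ Inl i" "f $ Inr i = g $ Inr i" for i
    by (auto simp: upper_def lower_def vec_eq_iff)
  then show "f = g" by (auto simp: vec_eq_iff split: sum.splits) (metis sum.exhaust)
qed auto

lemma upper_lower_linear [simp]:
  "upper (f + g) = upper f + upper g" "lower (f + g) = lower f + lower g"
  "upper (f - g) = upper f - upper g" "lower (f - g) = lower f - lower g"
  "upper (c *s f) = c *s upper f" "lower (c *s f) = c *s lower f"
  "upper (r *\<^sub>R f) = r *\<^sub>R upper f" "lower (r *\<^sub>R f) = r *\<^sub>R lower f"
  "upper 0 = 0" "lower 0 = 0"
  by (simp_all add: upper_def lower_def vec_eq_iff)

lemma bounded_linear_upper: "bounded_linear upper" and bounded_linear_lower: "bounded_linear lower"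
  unfolding linear_conv_bounded_linear[symmetric] linear_iff by auto

lemma sum_UNIV_Plus: "(\<Sum>i\<in>UNIV. g i) = (\<Sum>a\<in>UNIV. g (Inl a)) + (\<Sum>b\<in>UNIV. g (Inr b))"
  for g :: "'a::finite + 'b::finite \<Rightarrow> complex"
  unfolding UNIV_Plus_UNIV[symmetric] by (subst sum.Plus) (auto simp: o_def)

lemma block_matrix_mult:
  "upper (block_matrix P Q R S *v f) = P *v upper f + Q *v lower f"
  "lower (block_matrix P Q R S *v f) = R *v upper f + S *v lower f"
  by (simp_all add: upper_def lower_def vec_eq_iff matrix_vector_mult_def sum_UNIV_Plus block_matrix_def)

lemma cdot_upper_lower: "cdot f g = cdot (upper f) (upper g) + cdot (lower f) (lower g)"
  by (simp add: cdot_def upper_def lower_def sum_UNIV_Plus)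

lemma block_matrix_linear:
  "block_matrix (P + P') (Q + Q') (R + R') (S + S') = block_matrix P Q R S + block_matrix P' Q' R' S'"
  "block_matrix (P - P') (Q - Q') (R - R') (S - S') = block_matrix P Q R S - block_matrix P' Q' R' S'"
  "block_matrix (r *\<^sub>R P) (r *\<^sub>R Q) (r *\<^sub>R R) (r *\<^sub>R S) = r *\<^sub>R block_matrix P Q R S"
  by (simp_all add: block_matrix_def vec_eq_iff split: sum.split)

lemma ctranspose_block: "ctranspose (block_matrix P Q R S) = block_matrix (ctranspose P) (ctranspose R) (ctranspose Q) (ctranspose S)"
  by (simp add: block_matrix_def vec_eq_iff ctranspose_def transpose_def map_matrix_def split: sum.split)

lemma bounded_linear_block:
  "bounded_linear (\<lambda>M. block_matrix M 0 0 0)" "bounded_linear (\<lambda>M. block_matrix 0 M 0 0)"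
  "bounded_linear (\<lambda>M. block_matrix 0 0 M 0)" "bounded_linear (\<lambda>M. block_matrix 0 0 0 M)"
  unfolding linear_conv_bounded_linear[symmetric] linear_iff
  by (simp_all add: block_matrix_linear(1)[symmetric] block_matrix_linear(3)[symmetric])

lemma block_matrix_split:
  "block_matrix P Q R S = block_matrix P 0 0 0 + block_matrix 0 Q 0 0 + (block_matrix 0 0 R 0 + block_matrix 0 0 0 S)"
  by (simp add: block_matrix_linear(1)[symmetric])

text \<open>Nondegeneracy of block matrices is decided through their kernels, without expanding
  determinants.\<close>

lemma det_nonzero_iff_injective: "det (M :: complex ^ 'n ^ 'n) \<noteq> 0 \<longleftrightarrow> (\<forall>v. M *v v = 0 \<longrightarrow> v = 0)"
proof
  assume "det M \<noteq> 0"
  then show "\<forall>v. M *v v = 0 \<longrightarrow> v = 0"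
    using matrix_inv_mult_vec(2)[of M] by (metis matrix_vector_mult_0_right)
next
  assume "\<forall>v. M *v v = 0 \<longrightarrow> v = 0"
  then have "inj ((*v) M)" by (simp add: vec.inj_iff_eq_0)
  then obtain N where "N ** M = mat 1" using matrix_left_invertible_injective by blast
  then have "det N * det M = 1" by (metis det_I det_mul)
  then show "det M \<noteq> 0" by auto
qed

lemma det_ctranspose_nonzero: "det (M :: complex ^ 'n ^ 'n) \<noteq> 0 \<Longrightarrow> det (ctranspose M) \<noteq> 0"
proof -
  assume d: "det M \<noteq> 0"
  have "ctranspose M *v v = 0 \<Longrightarrow> v = 0" for v
  proof -
    assume v: "ctranspose M *v v = 0"
    have "cdot v (M *v (matrix_inv M *v v)) = cdot (ctranspose M *v v) (matrix_inv M *v v)" by (rule cdot_ctranspose)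
    then have "cdot v v = 0" using v by (simp add: matrix_inv_mult_vec(1)[OF d] cdot_simps)
    then show "v = 0" by (simp add: cdot_self)
  qed
  then show ?thesis by (simp add: det_nonzero_iff_injective)
qed

text \<open>Each isolated point is alone in some interval with rational end points. Hence almost
  every zero of a function is an accumulation point of zeros, and by
  \<open>derivative_zero_at_accumulation\<close> its derivative there, if any, is 0.\<close>

lemma countable_isolated_points: "countable {x \<in> Z. \<not> x islimpt Z}" for Z :: "real set"
proof -
  have "\<exists>ab\<in>\<rat> \<times> \<rat>. fst ab < x \<and> x < snd ab \<and> Z \<inter> {fst ab<..<snd ab} = {x}" if x: "x \<in> Z" "\<not> x islimpt Z" for x
  proof -
    obtain T where T: "open T" "x \<in> T" "\<And>y. y \<in> Z \<Longrightarrow> y \<in> T \<Longrightarrow> y = x"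
      using x(2) unfolding islimpt_def by blast
    obtain e where e: "e > 0" "ball x e \<subseteq> T" using T openE by blast
    obtain a where a: "a \<in> \<rat>" "x - e < a" "a < x" using Rats_dense_in_real[of "x - e" x] e by auto
    obtain b where b: "b \<in> \<rat>" "x < b" "b < x + e" using Rats_dense_in_real[of x "x + e"] e by auto
    have "{a<..<b} \<subseteq> ball x e" using a b by (auto simp: dist_real_def)
    then have "y = x" if "y \<in> Z" "y \<in> {a<..<b}" for y using T(3)[of y] that e(2) by blast
    moreover have "x \<in> Z" "x \<in> {a<..<b}" using x(1) a b by simp_all
    ultimately have "Z \<inter> {a<..<b} = {x}" by blast
    with a b show ?thesis by (intro bexI[of _ "(a, b)"]) auto
  qed
  then obtain F where F: "\<And>x. x \<in> Z \<Longrightarrow> \<not> x islimpt Z \<Longrightarrow> F x \<in> \<rat> \<times> \<rat> \<and> Z \<inter> {fst (F x)<..<snd (F x)} = {x}" by metis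
  have "inj_on F {x \<in> Z. \<not> x islimpt Z}"
  proof (rule inj_onI)
    fix x y assume x: "x \<in> {x \<in> Z. \<not> x islimpt Z}" and y: "y \<in> {x \<in> Z. \<not> x islimpt Z}" and eq: "F x = F y"
    have "Z \<inter> {fst (F x)<..<snd (F x)} = {x}" "Z \<inter> {fst (F y)<..<snd (F y)} = {y}"
      using F[of x] F[of y] x y by blast+
    then show "x = y" using eq by (metis singleton_inject)
  qed
  moreover have "countable (F ` {x \<in> Z. \<not> x islimpt Z})"
    proof (rule countable_subset[of _ "\<rat> \<times> \<rat>"])
    show "F ` {x \<in> Z. \<not> x islimpt Z} \<subseteq> \<rat> \<times> \<rat>" using F by blast
  qed (simp add: countable_rat)
  ultimately show ?thesis using countable_image_inj_on by blast
qed

lemma derivative_zero_at_accumulation: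
  fixes f :: "real \<Rightarrow> 'a::real_normed_vector"
  assumes f: "(f has_vector_derivative d) (at x)" and x: "f x = 0" and lim: "x islimpt {y. f y = 0}"
  shows "d = 0"
proof (rule ccontr)
  assume d: "d \<noteq> 0"
  have "((\<lambda>y. norm ((f y - f x) - (y - x) *\<^sub>R d) / norm (y - x)) \<longlongrightarrow> 0) (at x)"
    using f unfolding has_vector_derivative_def has_derivative_iff_norm by blast
  then have "\<forall>\<^sub>F y in at x. norm ((f y - f x) - (y - x) *\<^sub>R d) / norm (y - x) < norm d"
    using d by (intro order_tendstoD(2)[of _ 0]) auto
  moreover have "\<forall>\<^sub>F y in at x. y \<noteq> x" by (auto simp: eventually_at_filter)
  ultimately have "\<forall>\<^sub>F y in at x. f y \<noteq> 0"
  proof eventually_elim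
    case (elim y)
    then have "norm ((f y - f x) - (y - x) *\<^sub>R d) / norm (y - x) = norm d" if "f y = 0" using that x by simp
    then show ?case using elim by auto
  qed
  then show False using lim by (auto simp: islimpt_iff_eventually)
qed

section \<open>The limit point criterion\<close>

locale limit_point_system =
  fixes I :: "real set"
    and J V B A H :: "real \<Rightarrow> complex ^ 'n ^ 'n"
    and q :: "real \<Rightarrow> real"
    and \<delta> :: real
  assumes half_line: "half_line I"
    and J_AC: "AC I J"
    and J_det: "\<And>x. x \<in> I \<Longrightarrow> det (J x) \<noteq> 0"
    and V_L1: "L1_loc I V" and B_L1: "L1_loc I B" and A_L1: "L1_loc I A" and H_L1: "L1_loc I H"
    and V_herm: "AE x in lebesgue. x \<in> I \<longrightarrow> hermitian (V x)"
    and H_psd: "AE x in lebesgue. x \<in> I \<longrightarrow> psd (H x)"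
    and A_psd: "\<And>x. x \<in> I \<Longrightarrow> psd (A x)"
    and \<delta>_pos: "\<delta> > 0"
    and q_ge: "\<And>x. x \<in> I \<Longrightarrow> q x \<ge> \<delta>"
    and V_ge: "AE x in lebesgue. x \<in> I \<longrightarrow> psd (V x + q x *\<^sub>R H x)"
    and diverges: "(\<integral>\<^sup>+x\<in>I. 1 / (c_coeff A J H x * ennreal (sqrt (q x))) \<partial>lebesgue) = \<infinity>"
    and alternatives:
      "(AC I q \<and>
        (\<exists>C\<^sub>1::real. AE x in lebesgue. x \<in> I \<longrightarrow>
           ennreal \<bar>vector_derivative (\<lambda>t. 1 / sqrt (q t)) (at x within I)\<bar> * c_coeff A J H x
             \<le> ennreal C\<^sub>1))
       \<or> (I = {0..} \<and> mono_on I q) \<or> (I = {..0} \<and> antimono_on I q)"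
begin

abbreviation "Jt \<equiv> J_tilde J"
abbreviation "Bt \<equiv> B_tilde I J V B A"
abbreviation "Ht \<equiv> H_tilde H"
abbreviation "J' x \<equiv> vector_derivative J (at x within I)"

lemma J'_L1: "L1_loc I J'"
  unfolding L1_loc_def
proof (intro allI impI)
  fix a b assume ab: "{a..b} \<subseteq> I"
  show "J' absolutely_integrable_on {a..b}"
  proof (cases "a \<le> b")
    case True
    from AC_FTC(1)[OF J_AC True ab AC_deriv_AE[OF half_line J_AC]] show ?thesis .
  qed simp
qed

lemma Ht_mult: "upper (Ht x *v f) = H x *v upper f" "lower (Ht x *v f) = 0"
  by (simp_all add: H_tilde_def block_matrix_mult mv_simps)

lemma Jt_mult: "upper (Jt x *v f) = ctranspose (J x) *v lower f" "lower (Jt x *v f) = - (J x *v upper f)"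
  by (simp_all add: J_tilde_def block_matrix_mult mv_simps)

lemma Bt_mult: "upper (Bt x *v f) = V x *v upper f + B x *v lower f"
  "lower (Bt x *v f) = ctranspose (B x) *v upper f - J' x *v upper f - A x *v lower f"
  by (simp_all add: B_tilde_def block_matrix_mult mv_simps)

lemma form_Ht: "cdot f (Ht x *v g) = cdot (upper f) (H x *v upper g)"
  by (simp add: cdot_upper_lower Ht_mult cdot_simps)

lemma Ht_psd: "AE x in lebesgue. x \<in> I \<longrightarrow> psd (Ht x)"
  using H_psd
proof eventually_elim
  case (elim x)
  show ?case
  proof
    assume "x \<in> I"
    with elim have p: "psd (H x)" by simp
    have "ctranspose (Ht x) = Ht x"
      using psd_hermitian[OF p] by (simp add: H_tilde_def ctranspose_block hermitian_def ctranspose_linear)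
    then show "psd (Ht x)" using psd_nonneg[OF p] by (simp add: psd_def hermitian_def form_Ht)
  qed
qed

lemma Ht_L1: "L1_loc I Ht"
  unfolding H_tilde_def[abs_def] by (rule L1_loc_linear[OF bounded_linear_block(1) H_L1])

lemma Jt_split: "Jt x = block_matrix 0 (ctranspose (J x)) 0 0 + block_matrix 0 0 (- J x) 0"
  by (simp add: J_tilde_def block_matrix_linear(1)[symmetric])

lemma Jt_AC: "AC I Jt"
  unfolding Jt_split[abs_def]
  by (intro AC_add AC_linear[OF bounded_linear_block(2)] AC_linear[OF bounded_linear_block(3)]
      AC_linear[OF bounded_linear_ctranspose] AC_linear[OF bounded_linear_minus[OF bounded_linear_ident]] J_AC)

lemma Jt_det: "x \<in> I \<Longrightarrow> det (Jt x) \<noteq> 0"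
  unfolding det_nonzero_iff_injective
proof (intro allI impI)
  fix f assume x: "x \<in> I" and "Jt x *v f = 0"
  then have "ctranspose (J x) *v lower f = 0" "J x *v upper f = 0"
    using Jt_mult[of x f] by auto
  then have "upper f = 0" "lower f = 0"
    using J_det[OF x] det_ctranspose_nonzero[OF J_det[OF x]] det_nonzero_iff_injective by blast+
  then show "f = 0" by (simp add: join_eq_iff)
qed

lemma Jt_skew: "ctranspose (Jt x) = - Jt x"
proof -
  have "- Jt x = block_matrix (-0) (- ctranspose (J x)) (J x) (-0)"
    unfolding J_tilde_def by (simp add: block_matrix_def vec_eq_iff split: sum.split)
  then show ?thesis by (simp add: J_tilde_def ctranspose_block ctranspose_linear)
qed

lemma Bt_L1: "L1_loc I Bt"
proof -
  have "L1_loc I (\<lambda>x. ctranspose (B x) + (- J' x))"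
    by (rule L1_loc_add[OF L1_loc_linear[OF bounded_linear_ctranspose B_L1] L1_loc_linear[OF bounded_linear_minus[OF bounded_linear_ident] J'_L1]])
  moreover have "L1_loc I (\<lambda>x. - A x)" by (rule L1_loc_linear[OF bounded_linear_minus[OF bounded_linear_ident] A_L1])
  ultimately have "L1_loc I (\<lambda>x. block_matrix (V x) 0 0 0 + block_matrix 0 (B x) 0 0
      + (block_matrix 0 0 (ctranspose (B x) + (- J' x)) 0 + block_matrix 0 0 0 (- A x)))"
    by (rule L1_loc_add[OF L1_loc_add[OF L1_loc_linear[OF bounded_linear_block(1) V_L1] L1_loc_linear[OF bounded_linear_block(2) B_L1]]
        L1_loc_add[OF L1_loc_linear[OF bounded_linear_block(3)] L1_loc_linear[OF bounded_linear_block(4)]]])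
  then show ?thesis unfolding B_tilde_def[abs_def] block_matrix_split[symmetric] by simp
qed

text \<open>The lower left block B* - J' is what compensates the derivatives of the off-diagonal
  blocks of \<open>Jt\<close>, so \<open>J\<close> may be arbitrary apart from being
  invertible.\<close>

lemma Bt_sym: "AE x in lebesgue. x \<in> I \<longrightarrow> ctranspose (Bt x) = Bt x - vector_derivative Jt (at x within I)"
proof -
  have "AE x in lebesgue. x \<in> I \<longrightarrow> (Jt has_vector_derivative block_matrix 0 (ctranspose (J' x)) 0 0 + block_matrix 0 0 (- J' x) 0) (at x)"
    using AC_deriv_AE[OF half_line J_AC]
  proof eventually_elim
    case (elim x)
    show ?case
    proof
      assume "x \<in> I"
      with elim have "(J has_vector_derivative J' x) (at x)" by simp
      then show "(Jt has_vector_derivative block_matrix 0 (ctranspose (J' x)) 0 0 + block_matrix 0 0 (- J' x) 0) (at x)"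
        unfolding Jt_split[abs_def]
        by (intro has_vector_derivative_add bounded_linear.has_vector_derivative[OF bounded_linear_block(2)]
            bounded_linear.has_vector_derivative[OF bounded_linear_block(3)] has_vector_derivative_minus
            bounded_linear.has_vector_derivative[OF bounded_linear_ctranspose])
    qed
  qed
  from AC_deriv_unique_AE[OF half_line this] V_herm show ?thesis
  proof eventually_elim
    case (elim x)
    show ?case
    proof
      assume x: "x \<in> I"
      have "vector_derivative Jt (at x within I) = block_matrix 0 (ctranspose (J' x)) (- J' x) 0"
        using elim x by (simp add: block_matrix_linear(1)[symmetric])
      moreover have "ctranspose (V x) = V x" "ctranspose (A x) = A x"
        using elim x psd_hermitian[OF A_psd[OF x]] by (auto simp: hermitian_def)
      ultimately show "ctranspose (Bt x) = Bt x - vector_derivative Jt (at x within I)"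
        by (simp add: B_tilde_def ctranspose_block ctranspose_linear block_matrix_linear(2)[symmetric])
    qed
  qed
qed

sublocale symmetric_system Ht I Jt Bt
  by unfold_locales (use half_line Ht_L1 Ht_psd Jt_AC Jt_det Jt_skew Bt_L1 Bt_sym in auto)

text \<open>The two block rows. The weight enters only the first; the second is the one that will
  recover the lower component from the upper one.\<close>

lemma solves_components:
  assumes f: "AC I f" "solves f (\<lambda>x. z *s f x)"
  shows "AE x in lebesgue. x \<in> I \<longrightarrow> (\<exists>u' w'. ((\<lambda>x. upper (f x)) has_vector_derivative u') (at x) \<and>
    ((\<lambda>x. lower (f x)) has_vector_derivative w') (at x) \<and> (J has_vector_derivative J' x) (at x) \<and>
    ctranspose (J x) *v w' = z *s (H x *v upper (f x)) - V x *v upper (f x) - B x *v lower (f x) \<and>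
    J x *v u' = ctranspose (B x) *v upper (f x) - J' x *v upper (f x) - A x *v lower (f x))"
  using f(2)[unfolded solves_system_def] AC_deriv_AE[OF half_line f(1)] AC_deriv_AE[OF half_line J_AC]
proof eventually_elim
  case (elim x)
  show ?case
  proof
    assume x: "x \<in> I"
    let ?d = "vector_derivative f (at x within I)"
    have eq: "Jt x *v ?d + Bt x *v f x = Ht x *v (z *s f x)" and d: "(f has_vector_derivative ?d) (at x)"
      and J: "(J has_vector_derivative J' x) (at x)" using elim x by auto
    from arg_cong[OF eq, of upper] arg_cong[OF eq, of lower]
    have "ctranspose (J x) *v lower ?d + (V x *v upper (f x) + B x *v lower (f x)) = z *s (H x *v upper (f x))"
      "- (J x *v upper ?d) + (ctranspose (B x) *v upper (f x) - J' x *v upper (f x) - A x *v lower (f x)) = 0"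
      by (simp_all add: Jt_mult Bt_mult Ht_mult vector_scalar_commute)
    then have "ctranspose (J x) *v lower ?d = z *s (H x *v upper (f x)) - V x *v upper (f x) - B x *v lower (f x)"
      "J x *v upper ?d = ctranspose (B x) *v upper (f x) - J' x *v upper (f x) - A x *v lower (f x)"
      by (auto simp: algebra_simps eq_neg_iff_add_eq_0)
    moreover have "((\<lambda>x. upper (f x)) has_vector_derivative upper ?d) (at x)" "((\<lambda>x. lower (f x)) has_vector_derivative lower ?d) (at x)"
      using d by (auto intro: bounded_linear.has_vector_derivative[OF bounded_linear_upper] bounded_linear.has_vector_derivative[OF bounded_linear_lower])
    ultimately show "\<exists>u' w'. ((\<lambda>x. upper (f x)) has_vector_derivative u') (at x) \<and>
      ((\<lambda>x. lower (f x)) has_vector_derivative w') (at x) \<and> (J has_vector_derivative J' x) (at x) \<and>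
      ctranspose (J x) *v w' = z *s (H x *v upper (f x)) - V x *v upper (f x) - B x *v lower (f x) \<and>
      J x *v u' = ctranspose (B x) *v upper (f x) - J' x *v upper (f x) - A x *v lower (f x)"
      using J by blast
  qed
qed

definition bform :: "(real \<Rightarrow> complex ^ ('n + 'n)) \<Rightarrow> real \<Rightarrow> complex" where
  "bform f x = cdot (J x *v upper (f x)) (lower (f x))"

lemma bform_AC: "AC I f \<Longrightarrow> AC I (bform f)"
  unfolding bform_def[abs_def]
  by (intro AC_bilinear[OF bounded_bilinear_cdot] AC_bilinear[OF bounded_bilinear_matrix_vector] J_AC
      AC_linear[OF bounded_linear_upper] AC_linear[OF bounded_linear_lower])

text \<open>The contributions of \<open>B\<close> and of the derivative of \<open>J\<close> cancel
  between the two rows, which leaves the three quadratic forms.\<close>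

lemma bform_deriv:
  assumes f: "AC I f" "solves f (\<lambda>x. z *s f x)"
  shows "AE x in lebesgue. x \<in> I \<longrightarrow> (bform f has_vector_derivative
    z * cdot (upper (f x)) (H x *v upper (f x)) - cdot (upper (f x)) (V x *v upper (f x)) - cdot (lower (f x)) (A x *v lower (f x))) (at x)"
  using solves_components[OF f]
proof eventually_elim
  case (elim x)
  show ?case
  proof
    assume x: "x \<in> I"
    define u w where "u = upper (f x)" and "w = lower (f x)"
    obtain u' w' where d: "((\<lambda>x. upper (f x)) has_vector_derivative u') (at x)"
      "((\<lambda>x. lower (f x)) has_vector_derivative w') (at x)" "(J has_vector_derivative J' x) (at x)"
      and e: "ctranspose (J x) *v w' = z *s (H x *v u) - V x *v u - B x *v w"
      "J x *v u' = ctranspose (B x) *v u - J' x *v u - A x *v w"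
      using elim x unfolding u_def w_def by blast
    have "(bform f has_vector_derivative cdot (J x *v u) w' + cdot (J x *v u' + J' x *v u) w) (at x)"
      unfolding bform_def[abs_def] u_def w_def
      by (intro bounded_bilinear.has_vector_derivative[OF bounded_bilinear_cdot]
          bounded_bilinear.has_vector_derivative[OF bounded_bilinear_matrix_vector] d)
    moreover have "cdot (J x *v u) w' = cdot u (ctranspose (J x) *v w')" by (simp add: cdot_ctranspose)
    moreover have "cdot (ctranspose (B x) *v u) w = cdot u (B x *v w)" by (simp add: cdot_ctranspose)
    moreover have "cdot (A x *v w) w = cdot w (A x *v w)"
      using hermitian_cdot[OF psd_hermitian[OF A_psd[OF x]]] by metis
    ultimately show "(bform f has_vector_derivative z * cdot (upper (f x)) (H x *v upper (f x)) -
        cdot (upper (f x)) (V x *v upper (f x)) - cdot (lower (f x)) (A x *v lower (f x))) (at x)"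
      unfolding u_def[symmetric] w_def[symmetric] by (simp add: e cdot_simps cdot_scale_right algebra_simps)
  qed
qed

text \<open>Otherwise c would be infinite almost everywhere on \<open>I\<close>, and by
  1/\<infinity> = 0 the divergent integral would be 0.\<close>

lemma c_positive: "\<exists>n. \<not> (AE x in lebesgue. x \<in> seg n \<longrightarrow> det (A x ** H x) = 0)"
proof (rule ccontr)
  assume "\<nexists>n. \<not> (AE x in lebesgue. x \<in> seg n \<longrightarrow> det (A x ** H x) = 0)"
  then have "AE x in lebesgue. \<forall>n. x \<in> seg n \<longrightarrow> det (A x ** H x) = 0" unfolding AE_all_countable by blast
  with AE_interior_half_line[OF half_line]
  have "AE x in lebesgue. 1 / (c_coeff A J H x * ennreal (sqrt (q x))) * indicator I x = 0"
  proof eventually_elim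
    case (elim x)
    show ?case
    proof (cases "x \<in> I")
      case True
      then have "det (A x ** H x) = 0" using elim in_seg by blast
      moreover have "q x > 0" using q_ge[OF True] \<delta>_pos by linarith
      ultimately show ?thesis by (simp add: c_coeff_def ennreal_top_mult)
    qed simp
  qed
  then have "(\<integral>\<^sup>+x\<in>I. 1 / (c_coeff A J H x * ennreal (sqrt (q x))) \<partial>lebesgue) = (\<integral>\<^sup>+x. 0 \<partial>(lebesgue :: real measure))"
    by (rule nn_integral_cong_AE)
  with diverges show False by simp
qed

text \<open>The determinant may be nonzero only on a set without interior points, so
  \<open>upper f = 0\<close> cannot simply be differentiated. But almost every zero of
  \<open>upper f\<close> is an accumulation point of zeros; there its derivative is 0 and the second
  row leaves A w = 0.\<close>

lemma null_solution_zero: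
  assumes n: "\<not> (AE x in lebesgue. x \<in> seg n \<longrightarrow> det (A x ** H x) = 0)"
    and f: "AC I f" "solves f (\<lambda>x. z *s f x)" and null: "AE x in lebesgue. x \<in> seg n \<longrightarrow> Ht x *v f x = 0"
    and x: "x \<in> I"
  shows "f x = 0"
proof -
  define Z where "Z = {x. upper (f x) = 0}"
  have "negligible {x \<in> Z. \<not> x islimpt Z}"
    unfolding negligible_iff_null_sets
    by (rule null_sets_completionI[OF countable_imp_null_set_lborel[OF countable_isolated_points]])
  then have iso: "AE x in lebesgue. x \<in> Z \<longrightarrow> x islimpt Z"
    unfolding AE_lebesgue_iff_negligible by (rule negligible_subset) auto
  have "AE x in lebesgue. x \<in> seg n \<longrightarrow> (det (A x ** H x) \<noteq> 0 \<longrightarrow> f x = 0)"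
    using null iso solves_components[OF f]
  proof eventually_elim
    case (elim x)
    show ?case
    proof (intro impI)
      assume x: "x \<in> seg n" and d: "det (A x ** H x) \<noteq> 0"
      then have dA: "det (A x) \<noteq> 0" and dH: "det (H x) \<noteq> 0" by (auto simp: det_mul)
      have xI: "x \<in> I" using x seg_interior interior_subset by blast
      have "upper (Ht x *v f x) = 0" using elim(1) x by simp
      then have "H x *v upper (f x) = 0" by (simp add: Ht_mult)
      then have u0: "upper (f x) = 0" using dH det_nonzero_iff_injective by blast
      then have "x islimpt Z" using elim(2) by (simp add: Z_def)
      moreover obtain u' w' where u': "((\<lambda>x. upper (f x)) has_vector_derivative u') (at x)"
        "J x *v u' = ctranspose (B x) *v upper (f x) - J' x *v upper (f x) - A x *v lower (f x)"
        using elim(3) xI by blast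
      ultimately have "u' = 0" using derivative_zero_at_accumulation[OF u'(1) u0] by (simp add: Z_def)
      then have "A x *v lower (f x) = 0" using u'(2) u0 by (simp add: mv_simps)
      then have "lower (f x) = 0" using dA det_nonzero_iff_injective by blast
      with u0 show "f x = 0" by (simp add: join_eq_iff)
    qed
  qed
  \<comment> \<open>The points of the segment with nonzero determinant are not negligible, so at
    least one is a zero of \<open>f\<close>; uniqueness spreads it over \<open>I\<close>.\<close>
  then have "\<exists>x\<in>seg n. f x = 0"
  proof (rule contrapos_pp)
    assume "\<not> (\<exists>x\<in>seg n. f x = 0)"
    then show "\<not> (AE x in lebesgue. x \<in> seg n \<longrightarrow> (det (A x ** H x) \<noteq> 0 \<longrightarrow> f x = 0))"
      using n by (auto elim!: eventually_mono)
  qed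
  then obtain y where "y \<in> seg n" "f y = 0" by blast
  then show ?thesis using solution_unique[OF f _ _ x, of y] seg_interior interior_subset by blast
qed

text \<open>Definiteness is the case \<open>z = 0\<close> of \<open>null_solution_zero\<close>, on a
  segment where the determinant does not vanish almost everywhere.\<close>

sublocale definite_system Ht I Jt Bt
proof unfold_locales
  obtain n where n: "\<not> (AE x in lebesgue. x \<in> seg n \<longrightarrow> det (A x ** H x) = 0)" using c_positive by blast
  obtain a b where ab: "a \<le> b" "seg n = {a..b}" using seg_form by blast
  show "\<exists>a b. a \<le> b \<and> {a..b} \<subseteq> interior I \<and>
    (\<forall>f. AC I f \<longrightarrow> solves f (\<lambda>x. 0) \<longrightarrow> (AE x in lebesgue. x \<in> {a..b} \<longrightarrow> Ht x *v f x = 0) \<longrightarrow> (\<forall>x\<in>I. f x = 0))"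
  proof (intro exI conjI allI impI ballI)
    show "a \<le> b" by fact
    show "{a..b} \<subseteq> interior I" using seg_interior[of n] ab by simp
    fix f x assume f: "AC I f" "solves f (\<lambda>x. 0)" "AE x in lebesgue. x \<in> {a..b} \<longrightarrow> Ht x *v f x = 0" and x: "x \<in> I"
    show "f x = 0"
      by (rule null_solution_zero[OF n f(1), of 0]) (use f ab x in simp_all)
  qed
qed

lemma weight_null_solution:
  assumes f: "AC I f" "solves f (\<lambda>x. z *s f x)" and null: "AE x in lebesgue. x \<in> I \<longrightarrow> Ht x *v f x = 0" and x: "x \<in> I"
  shows "f x = 0"
proof -
  obtain n where n: "\<not> (AE x in lebesgue. x \<in> seg n \<longrightarrow> det (A x ** H x) = 0)" using c_positive by blast
  have "AE x in lebesgue. x \<in> seg n \<longrightarrow> Ht x *v f x = 0"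
    using null by eventually_elim (use seg_interior interior_subset in blast)
  from null_solution_zero[OF n f this x] show ?thesis .
qed

end

lemma set_integrable_half_line_bounded:
  fixes h :: "real \<Rightarrow> real"
  assumes h: "(\<lambda>x. indicator I x *\<^sub>R h x) \<in> borel_measurable lebesgue"
    and h0: "AE x in lebesgue. x \<in> I \<longrightarrow> 0 \<le> h x"
    and i: "\<And>n::nat. set_integrable lebesgue (I \<inter> {- real n..real n}) h"
    and C: "\<And>n::nat. (LINT x:I \<inter> {- real n..real n}|lebesgue. h x) \<le> C"
  shows "set_integrable lebesgue I h"
proof -
  define f where "f n x = indicator (I \<inter> {- real n..real n}) x *\<^sub>R h x" for n x
  have fi: "integrable lebesgue (f n)" for n using i[of n] by (simp add: set_integrable_def f_def[abs_def])
  have mono: "AE x in lebesgue. mono (\<lambda>n. f n x)"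
    using h0 by eventually_elim (auto simp: mono_def f_def indicator_def)
  have "AE x in lebesgue. (\<lambda>n. f n x) \<longlonglongrightarrow> indicator I x *\<^sub>R h x"
  proof (rule AE_I2)
    fix x :: real
    obtain N :: nat where "\<bar>x\<bar> \<le> real N" using real_arch_simple by blast
    then have "eventually (\<lambda>n. indicator I x *\<^sub>R h x = f n x) sequentially"
      by (intro eventually_sequentiallyI[of N]) (auto simp: f_def indicator_def)
    then show "(\<lambda>n. f n x) \<longlonglongrightarrow> indicator I x *\<^sub>R h x"
      by (rule Lim_transform_eventually[OF tendsto_const])
  qed
  moreover have "incseq (\<lambda>n. LINT x|lebesgue. f n x)"
  proof (rule incseq_SucI)
    fix n
    show "(LINT x|lebesgue. f n x) \<le> (LINT x|lebesgue. f (Suc n) x)"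
      by (rule integral_mono_AE[OF fi fi]) (use mono in \<open>eventually_elim, simp add: mono_def\<close>)
  qed
  then obtain L where "(\<lambda>n. LINT x|lebesgue. f n x) \<longlonglongrightarrow> L"
  proof (rule incseq_convergent[of "\<lambda>n. LINT x|lebesgue. f n x" C])
    show "\<forall>n. (LINT x|lebesgue. f n x) \<le> C" using C by (simp add: set_lebesgue_integral_def f_def)
  qed
  ultimately show ?thesis
    unfolding set_integrable_def using integrable_monotone_convergence[OF fi mono _ _ h] by blast
qed

text \<open>One statement covers both uses of c: the weight, with \<open>r = k\<close> and
  \<open>K = 1\<close>, and the derivative of 1 / sqrt q, with \<open>r\<close> its modulus and
  \<open>K\<close> the constant of the hypothesis. Where c is infinite the assumption forces
  \<open>r = 0\<close>.\<close>

lemma c_coeff_coupling_bound: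
  assumes A: "psd (A x)" and H: "psd (H x)" and r: "0 \<le> r" and K: "0 \<le> K"
    and le: "ennreal r * c_coeff A J H x \<le> ennreal K"
  shows "r * norm (cdot (J x *v u) w) \<le> K * sqrt (Re (cdot u (H x *v u)) * Re (cdot w (A x *v w)))"
proof (cases "det (A x ** H x) = 0")
  case True
  then have "ennreal r * \<infinity> \<le> ennreal K" using le by (simp add: c_coeff_def)
  then have "r = 0" using r by (auto simp: ennreal_mult_top top_unique split: if_splits)
  then show ?thesis using K psd_nonneg[OF A] psd_nonneg[OF H] by simp
next
  case False
  define C where "C = onorm (\<lambda>v. (minv_sqrt (A x) ** J x ** minv_sqrt (H x)) *v v)"
  define g where "g = sqrt (Re (cdot u (H x *v u)) * Re (cdot w (A x *v w)))"
  have g0: "g \<ge> 0" using psd_nonneg[OF A] psd_nonneg[OF H] by (simp add: g_def)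
  have "ennreal (r * max 1 C) \<le> ennreal K"
    using le False r by (simp add: c_coeff_def C_def ennreal_mult[symmetric])
  then have "r * max 1 C \<le> K" using K by (simp add: ennreal_le_iff)
  moreover have "norm (cdot (J x *v u) w) \<le> max 1 C * g"
    using coupling_bound[OF A H False, of "J x" u w] g0 unfolding C_def[symmetric] g_def[symmetric]
    by (rule order_trans[OF _ mult_right_mono[OF max.cobounded2]])
  ultimately have "r * norm (cdot (J x *v u) w) \<le> K * g"
    using mult_left_mono[OF _ r, of "norm (cdot (J x *v u) w)" "max 1 C * g"] mult_right_mono[OF _ g0, of "r * max 1 C" K]
    by (simp add: mult.assoc)
  then show ?thesis by (simp add: g_def)
qed

lemma norm_add_i_scale:
  "(norm (a + (\<i> * of_real t) *s b))\<^sup>2 = (norm a)\<^sup>2 + t\<^sup>2 * (norm b)\<^sup>2 - 2 * t * Im (cdot a b)"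
proof -
  have "(norm v)\<^sup>2 = Re (cdot v v)" for v :: "complex ^ 'a" by (simp add: cdot_self)
  moreover have "Re (cdot b a) = Re (cdot a b)" "Im (cdot b a) = - Im (cdot a b)"
    using cnj_cdot[of a b] by (metis cnj.simps)+
  moreover have "Im (cdot b b) = 0" by (simp add: cdot_self)
  ultimately show ?thesis
    by (simp add: cdot_simps cdot_scale_left cdot_scale_right algebra_simps power2_eq_square)
qed

section \<open>The sign of the boundary form for square integrable solutions\<close>

context limit_point_system
begin

lemma c_ge_1: "1 \<le> c_coeff A J H x"
  by (simp add: c_coeff_def ennreal_ge_1)

lemma q_measurable: "(\<lambda>x. indicator I x *\<^sub>R q x) \<in> borel_measurable lebesgue"
proof -
  have "q \<in> borel_measurable (restrict_space borel I)"
    using alternatives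
  proof (elim disjE conjE)
    assume "AC I q"
    then show ?thesis by (rule borel_measurable_continuous_on_restrict[OF AC_continuous_on[OF half_line]])
  next
    assume "mono_on I q"
    then show ?thesis by (rule borel_measurable_mono_on_fnc)
  next
    assume "antimono_on I q"
    then have "mono_on I (\<lambda>x. - q x)" by (auto simp: monotone_on_def)
    then have "(\<lambda>x. - q x) \<in> borel_measurable (restrict_space borel I)" by (rule borel_measurable_mono_on_fnc)
    from borel_measurable_uminus[OF this] show ?thesis by simp
  qed
  then show ?thesis using borel_measurable_indicator_restrict[OF half_line, of q] by (auto intro: measurable_completion)
qed

text \<open>Take a measurable minorant of the divergent integrand and multiply it by sqrt q. The
  result lies below 1/c, is measurable, and retains the divergence after division by sqrt q.\<close>

lemma coupling_weight:
  obtains k where "k \<in> borel_measurable lebesgue" "\<And>x. 0 \<le> k x \<and> k x \<le> 1"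
    "\<And>x. x \<in> I \<Longrightarrow> ennreal (k x) * c_coeff A J H x \<le> 1"
    "\<And>X. (\<lambda>x. k x * (1 / sqrt (q x))) absolutely_integrable_on (I \<inter> {-X..X})"
    "\<And>R. \<exists>X\<ge>0. R \<le> integral (I \<inter> {-X..X}) (\<lambda>x. k x * (1 / sqrt (q x)))"
proof -
  define c where "c = c_coeff A J H"
  have c1: "1 \<le> c x" for x by (simp add: c_def c_ge_1)
  obtain m where m: "m \<in> borel_measurable lebesgue" "\<And>x. m x \<le> 1 / (c x * ennreal (sqrt (q x))) * indicator I x"
    "(\<integral>\<^sup>+x. m x \<partial>lebesgue) = \<infinity>"
    using nn_integral_measurable_minorant[OF diverges] unfolding c_def by blast
  have off: "m x = 0" if "x \<notin> I" for x using m(2)[of x] that by simp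
  \<comment> \<open>This includes \<open>y = 0\<close> and \<open>y = \<infinity>\<close>, where the
    product is 0 by convention.\<close>
  have inv: "1 / y * y \<le> 1" for y :: ennreal
  proof (cases y)
    case (real r)
    then show ?thesis by (cases "r = 0") (auto simp: divide_ennreal ennreal_mult[symmetric] simp flip: ennreal_1)
  qed simp
  have mc: "m x * ennreal (sqrt (q x)) * c x \<le> 1" if "x \<in> I" for x
  proof -
    have "m x * (c x * ennreal (sqrt (q x))) \<le> 1 / (c x * ennreal (sqrt (q x))) * (c x * ennreal (sqrt (q x)))"
      using m(2)[of x] that by (intro mult_right_mono) auto
    also have "\<dots> \<le> 1" by (rule inv)
    finally show ?thesis by (simp add: mult_ac)
  qed
  have mq: "m x * ennreal (sqrt (q x)) \<le> 1" if "x \<in> I" for x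
    using mult_left_mono[OF c1[of x], of "m x * ennreal (sqrt (q x))"] mc[OF that] by (auto intro: order_trans)
  have q0: "q x > 0" if "x \<in> I" for x using q_ge[OF that] \<delta>_pos by linarith
  define M where "M x = enn2real (m x)" for x
  have mM: "m x = ennreal (M x)" for x
  proof (cases "x \<in> I")
    case True
    have "m x \<noteq> \<infinity>" using mq[OF True] q0[OF True] by (auto simp: ennreal_top_mult top_unique)
    then show ?thesis by (simp add: M_def less_top)
  qed (simp add: off M_def)
  have M0: "0 \<le> M x" for x by (simp add: M_def)
  have Mq: "M x * sqrt (q x) \<le> 1" if "x \<in> I" for x
    using mq[OF that] q0[OF that] M0 unfolding mM by (simp add: ennreal_mult[symmetric] ennreal_le_1)
  have MB: "0 \<le> M x \<and> M x \<le> 1 / sqrt \<delta>" for x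
  proof (cases "x \<in> I")
    case True
    have "M x * sqrt \<delta> \<le> M x * sqrt (q x)" using q_ge[OF True] M0 by (intro mult_left_mono) auto
    with Mq[OF True] have "M x * sqrt \<delta> \<le> 1" by linarith
    then show ?thesis using \<delta>_pos M0 by (simp add: pos_le_divide_eq)
  qed (use \<delta>_pos in \<open>simp add: off M_def\<close>)
  have Mm: "M \<in> borel_measurable lebesgue" using m(1) unfolding M_def[abs_def] by measurable
  \<comment> \<open>The indicator makes the second factor measurable on the whole line and sets
    \<open>k\<close> to 0 off \<open>I\<close>.\<close>
  define k where "k x = M x * sqrt (indicator I x *\<^sub>R q x)" for x
  have kI: "k x = M x * sqrt (q x)" if "x \<in> I" for x using that by (simp add: k_def)
  have ks: "k x * (1 / sqrt (q x)) = M x" if "x \<in> I" for x using q0[OF that] by (simp add: kI[OF that])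
  show thesis
  proof (rule that[of k])
    show "k \<in> borel_measurable lebesgue"
      unfolding k_def[abs_def] by (intro borel_measurable_times Mm measurable_compose[OF q_measurable borel_measurable_sqrt])
    show "0 \<le> k x \<and> k x \<le> 1" for x
    proof (cases "x \<in> I")
      case True
      then show ?thesis using Mq[OF True] M0[of x] q0[OF True] by (simp add: kI)
    qed (simp add: k_def)
    show "ennreal (k x) * c_coeff A J H x \<le> 1" if "x \<in> I" for x
      using mc[OF that] q0[OF that] M0 unfolding mM kI[OF that] c_def by (simp add: ennreal_mult)
    show "(\<lambda>x. k x * (1 / sqrt (q x))) absolutely_integrable_on (I \<inter> {-X..X})" for X
    proof -
      have "I \<inter> {-X..X} = {(if I = {0..} then 0 else - X)..(if I = {0..} then X else 0)}"
        using half_line by (auto simp: half_line_def)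
      then have "M absolutely_integrable_on (I \<inter> {-X..X})"
        using bounded_measurable_absolutely_integrable[OF Mm, of _ _ "1 / sqrt \<delta>"] MB by (metis abs_of_nonneg)
      then show ?thesis by (rule absolutely_integrable_cong_AE(1)) (rule AE_I2, use ks in auto)
    qed
    have "(\<integral>\<^sup>+x\<in>I. ennreal (M x) \<partial>lebesgue) = (\<integral>\<^sup>+x. m x \<partial>lebesgue)"
      by (rule nn_integral_cong) (auto simp: mM[symmetric] indicator_def off)
    then have inf: "(\<integral>\<^sup>+x\<in>I. ennreal (M x) \<partial>lebesgue) = \<infinity>" using m(3) by simp
    show "\<exists>X\<ge>0. R \<le> integral (I \<inter> {-X..X}) (\<lambda>x. k x * (1 / sqrt (q x)))" for R
    proof -
      have "integral (I \<inter> {-X..X}) (\<lambda>x. k x * (1 / sqrt (q x))) = integral (I \<inter> {-X..X}) M" for X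
        by (rule Henstock_Kurzweil_Integration.integral_cong) (use ks in auto)
      then show ?thesis using unbounded_integrals[OF half_line Mm MB inf, of R] by simp
    qed
  qed
qed

lemma test_function_alternatives:
  "(\<exists>s' C. AC I (\<lambda>x. 1 / sqrt (q x)) \<and> C \<ge> 0 \<and>
      (AE x in lebesgue. x \<in> I \<longrightarrow> ((\<lambda>x. 1 / sqrt (q x)) has_vector_derivative s' x) (at x)) \<and>
      (AE x in lebesgue. x \<in> I \<longrightarrow> ennreal \<bar>s' x\<bar> * c_coeff A J H x \<le> ennreal C))
   \<or> (\<forall>x\<in>I. \<forall>y\<in>I. \<bar>x\<bar> \<le> \<bar>y\<bar> \<longrightarrow> 1 / sqrt (q y) \<le> 1 / sqrt (q x))"
proof -
  have q0: "q x > 0" if "x \<in> I" for x using q_ge[OF that] \<delta>_pos by linarith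
  have mono: "1 / sqrt (q y) \<le> 1 / sqrt (q x)" if "x \<in> I" "y \<in> I" "q x \<le> q y" for x y
    using q0[OF that(1)] that(3) by (intro divide_left_mono) auto
  from alternatives show ?thesis
  proof (elim disjE conjE exE)
    fix C\<^sub>1 :: real
    assume q: "AC I q" and C: "AE x in lebesgue. x \<in> I \<longrightarrow>
           ennreal \<bar>vector_derivative (\<lambda>t. 1 / sqrt (q t)) (at x within I)\<bar> * c_coeff A J H x
             \<le> ennreal C\<^sub>1"
    have s: "AC I (\<lambda>x. 1 / sqrt (q x))"
      unfolding AC_def
    proof (intro allI impI)
      fix a b assume ab: "{a..b} \<subseteq> I"
      have "compact (q ` {a..b})"
        by (rule compact_continuous_image[OF continuous_on_subset[OF AC_continuous_on[OF half_line q] ab] compact_Icc])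
      then have bdd: "bdd_above (q ` {a..b})" by (intro bounded_imp_bdd_above compact_imp_bounded)
      define u where "u = Sup (q ` {a..b})"
      have u: "q x \<le> u" if "x \<in> {a..b}" for x unfolding u_def by (rule cSup_upper[OF imageI[OF that] bdd])
      show "absolutely_continuous_on {a..b} (\<lambda>x. 1 / sqrt (q x))"
      \<comment> \<open>On the range of \<open>q\<close> the map is continuously differentiable,
        since that range stays above \<open>\<delta>\<close>.\<close>
      proof (rule absolutely_continuous_on_compose_C1[OF AC_subset[OF q ab], where \<phi>="\<lambda>y. 1 / sqrt y"
            and \<phi>'="\<lambda>y. - (inverse (sqrt y) / 2) / (sqrt y * sqrt y)" and l=\<delta> and u=u])
        show "q ` {a..b} \<subseteq> {\<delta>..u}" using u q_ge ab by auto
        show "((\<lambda>y. 1 / sqrt y) has_real_derivative - (inverse (sqrt y) / 2) / (sqrt y * sqrt y)) (at y)" if "y \<in> {\<delta>..u}" for y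
          using that \<delta>_pos by (auto intro!: derivative_eq_intros)
        show "continuous_on {\<delta>..u} (\<lambda>y. - (inverse (sqrt y) / 2) / (sqrt y * sqrt y))"
          using \<delta>_pos by (intro continuous_intros) auto
      qed
    qed
    \<comment> \<open>\<open>C\<^sub>1\<close> may be negative; as an extended nonnegative bound it
      then counts as 0, hence the maximum.\<close>
    have "AE x in lebesgue. x \<in> I \<longrightarrow>
           ennreal \<bar>vector_derivative (\<lambda>t. 1 / sqrt (q t)) (at x within I)\<bar> * c_coeff A J H x
             \<le> ennreal (max C\<^sub>1 0)"
      using C by eventually_elim (auto intro: order_trans ennreal_leI)
    with s AC_deriv_AE[OF half_line s] show ?thesis by (intro disjI1 exI conjI) (auto intro: max.cobounded2)
  next
    assume I: "I = {0..}" and q: "mono_on I q"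
    have "\<forall>x\<in>I. \<forall>y\<in>I. \<bar>x\<bar> \<le> \<bar>y\<bar> \<longrightarrow> 1 / sqrt (q y) \<le> 1 / sqrt (q x)"
      using mono_onD[OF q] mono I by auto
    then show ?thesis by blast
  next
    assume I: "I = {..0}" and q: "antimono_on I q"
    have "\<forall>x\<in>I. \<forall>y\<in>I. \<bar>x\<bar> \<le> \<bar>y\<bar> \<longrightarrow> 1 / sqrt (q y) \<le> 1 / sqrt (q x)"
      using monotone_onD[OF q] mono I by auto
    then show ?thesis by blast
  qed
qed

text \<open>Since \<open>Ht\<close> has one nonzero block, this is the form of \<open>H\<close> on
  the upper component alone; see \<open>form_Ht\<close>.\<close>

definition energy :: "(real \<Rightarrow> complex ^ ('n + 'n)) \<Rightarrow> real \<Rightarrow> real" where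
  "energy f x = Re (form f f x)"

lemma form_energy:
  "AE x in lebesgue. x \<in> I \<longrightarrow> 0 \<le> energy f x \<and> form f f x = of_real (energy f x)"
  using Ht_psd
proof eventually_elim
  case (elim x)
  show ?case
  proof
    assume "x \<in> I"
    with elim have p: "psd (Ht x)" by simp
    show "0 \<le> energy f x \<and> form f f x = of_real (energy f x)"
      using psd_nonneg[OF p] hermitian_cdot_of_real[OF psd_hermitian[OF p]] by (simp add: energy_def)
  qed
qed

lemma energy_set_integrable: "f \<in> L2 \<Longrightarrow> set_integrable lebesgue I (energy f)"
proof -
  assume "f \<in> L2"
  then have "integrable lebesgue (\<lambda>x. indicator I x *\<^sub>R form f f x)" by (simp add: L2_fun_def set_integrable_def)
  from integrable_bounded_linear[OF bounded_linear_Re this] show ?thesis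
    unfolding set_integrable_def energy_def[abs_def] by simp
qed

lemma Im_bform_deriv:
  assumes z: "Re z = 0" and f: "AC I f" "solves f (\<lambda>x. z *s f x)"
  shows "AE x in lebesgue. x \<in> I \<longrightarrow> (bform f has_vector_derivative
    Complex (- Re (cdot (upper (f x)) (V x *v upper (f x))) - Re (cdot (lower (f x)) (A x *v lower (f x))))
      (Im z * energy f x)) (at x)"
  using bform_deriv[OF f] V_herm form_energy[of f]
proof eventually_elim
  case (elim x)
  show ?case
  proof
    assume x: "x \<in> I"
    have "Im (cdot (upper (f x)) (V x *v upper (f x))) = 0" "Im (cdot (lower (f x)) (A x *v lower (f x))) = 0"
      using elim x hermitian_Im_zero psd_hermitian[OF A_psd[OF x]] by auto
    moreover have "cdot (upper (f x)) (H x *v upper (f x)) = of_real (energy f x)"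
      using elim x by (simp add: form_Ht)
    ultimately have "z * cdot (upper (f x)) (H x *v upper (f x)) - cdot (upper (f x)) (V x *v upper (f x))
        - cdot (lower (f x)) (A x *v lower (f x))
      = Complex (- Re (cdot (upper (f x)) (V x *v upper (f x))) - Re (cdot (lower (f x)) (A x *v lower (f x))))
          (Im z * energy f x)"
      using z by (simp add: complex_eq_iff)
    with elim x show "(bform f has_vector_derivative
      Complex (- Re (cdot (upper (f x)) (V x *v upper (f x))) - Re (cdot (lower (f x)) (A x *v lower (f x))))
      (Im z * energy f x)) (at x)" by simp
  qed
qed

text \<open>The abstract argument applied to \<open>bform f\<close> with s = 1 / sqrt q. When Im
  p(0) = 0 the energy density vanishes almost everywhere, and definiteness leaves only the zero
  solution.\<close>

lemma bform_sign:
  assumes z: "Re z = 0" "Im z \<noteq> 0" and f: "AC I f" "solves f (\<lambda>x. z *s f x)" "f \<in> L2"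
  shows "half_line_sign I * Im z * Im (bform f 0) \<le> 0"
    and "Im (bform f 0) = 0 \<Longrightarrow> x \<in> I \<Longrightarrow> f x = 0"
proof -
  define a where "a x = Re (cdot (lower (f x)) (A x *v lower (f x)))" for x
  define v where "v x = Re (cdot (upper (f x)) (V x *v upper (f x)))" for x
  have q0: "q x > 0" if "x \<in> I" for x using q_ge[OF that] \<delta>_pos by linarith
  obtain k where k: "k \<in> borel_measurable lebesgue" "\<And>x. 0 \<le> k x \<and> k x \<le> 1"
    "\<And>x. x \<in> I \<Longrightarrow> ennreal (k x) * c_coeff A J H x \<le> 1"
    "\<And>X. (\<lambda>x. k x * (1 / sqrt (q x))) absolutely_integrable_on (I \<inter> {-X..X})"
    "\<And>R. \<exists>X\<ge>0. R \<le> integral (I \<inter> {-X..X}) (\<lambda>x. k x * (1 / sqrt (q x)))"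
    using coupling_weight by blast
  have coup: "r * norm (bform f x) \<le> K * sqrt (energy f x * a x)"
    if "psd (H x)" "x \<in> I" "0 \<le> r" "0 \<le> K" "ennreal r * c_coeff A J H x \<le> ennreal K" for r K x
    using c_coeff_coupling_bound[OF A_psd[OF that(2)] that(1,3-5), of "upper (f x)" "lower (f x)"]
    by (simp add: bform_def energy_def form_Ht a_def)
  have main: "half_line_sign I * Im z * Im (bform f 0) \<le> 0 \<and>
    (Im (bform f 0) = 0 \<longrightarrow> Im z \<noteq> 0 \<longrightarrow> (AE x in lebesgue. x \<in> I \<longrightarrow> energy f x = 0))"
  proof (rule boundary_form_zero[OF half_line bform_AC[OF f(1)] Im_bform_deriv[OF z(1) f(1,2)]
        energy_set_integrable[OF f(3)], where a=a and k=k and s="\<lambda>x. 1 / sqrt (q x)" and M="1 / sqrt \<delta>"])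
    show "AE x in lebesgue. x \<in> I \<longrightarrow> 0 \<le> energy f x" using form_energy[of f] by eventually_elim auto
    have wc: "continuous_on I (\<lambda>x. lower (f x))"
      by (rule AC_continuous_on[OF half_line AC_linear[OF bounded_linear_lower f(1)]])
    have "L1_loc I (\<lambda>x. A x *v lower (f x))"
      by (rule L1_loc_bilinear[OF bounded_bilinear.flip[OF bounded_bilinear_matrix_vector] wc A_L1])
    then have "L1_loc I (\<lambda>x. cdot (lower (f x)) (A x *v lower (f x)))"
      by (rule L1_loc_bilinear[OF bounded_bilinear_cdot wc])
    from L1_loc_linear[OF bounded_linear_Re this] show "L1_loc I a" unfolding a_def[abs_def] .
    show "AE x in lebesgue. x \<in> I \<longrightarrow> 0 \<le> a x"
      by (rule AE_I2) (use psd_nonneg[OF A_psd] in \<open>simp add: a_def\<close>)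
    show "AE x in lebesgue. x \<in> I \<longrightarrow> (1 / sqrt (q x))\<^sup>2 *
        (Re (Complex (- Re (cdot (upper (f x)) (V x *v upper (f x))) - Re (cdot (lower (f x)) (A x *v lower (f x))))
          (Im z * energy f x)) + a x) \<le> energy f x"
      using V_ge
    proof eventually_elim
      case (elim x)
      show ?case
      proof
        assume x: "x \<in> I"
        \<comment> \<open>V >= -qH tested on the upper component. Divided by \<open>q x\<close> it
          is the required inequality, because \<open>Re d + a\<close> is minus the form of
          \<open>V\<close>.\<close>
        have "0 \<le> Re (cdot (upper (f x)) ((V x + q x *\<^sub>R H x) *v upper (f x)))"
          using elim x psd_nonneg by blast
        also have "\<dots> = v x + q x * energy f x"
          by (simp add: v_def energy_def form_Ht mv_simps cdot_simps
              bounded_bilinear.scaleR_left[OF bounded_bilinear_matrix_vector] bounded_bilinear.scaleR_right[OF bounded_bilinear_cdot])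
        finally have "- v x \<le> q x * energy f x" by simp
        then have "- v x / q x \<le> energy f x" using q0[OF x] by (simp add: field_simps)
        moreover have "(1 / sqrt (q x))\<^sup>2 = 1 / q x" using q0[OF x] by (simp add: power_divide)
        ultimately show "(1 / sqrt (q x))\<^sup>2 *
            (Re (Complex (- Re (cdot (upper (f x)) (V x *v upper (f x))) - Re (cdot (lower (f x)) (A x *v lower (f x))))
              (Im z * energy f x)) + a x) \<le> energy f x" by (simp add: v_def a_def)
      qed
    qed
    show "AE x in lebesgue. x \<in> I \<longrightarrow> k x * norm (bform f x) \<le> sqrt (energy f x * a x)"
      using H_psd
    proof eventually_elim
      case (elim x)
      show ?case using coup[of x "k x" 1] k(2,3) elim by simp
    qed
    show "0 \<le> 1 / sqrt (q x) \<and> 1 / sqrt (q x) \<le> 1 / sqrt \<delta>" if "x \<in> I" for x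
      using q_ge[OF that] q0[OF that] \<delta>_pos by (auto intro!: divide_left_mono)
    show "(\<exists>s' C\<^sub>1. AC I (\<lambda>x. 1 / sqrt (q x)) \<and> C\<^sub>1 \<ge> 0 \<and>
        (AE x in lebesgue. x \<in> I \<longrightarrow> ((\<lambda>x. 1 / sqrt (q x)) has_vector_derivative s' x) (at x)) \<and>
        (AE x in lebesgue. x \<in> I \<longrightarrow> \<bar>s' x\<bar> * norm (bform f x) \<le> C\<^sub>1 * sqrt (energy f x * a x)))
      \<or> (\<forall>x\<in>I. \<forall>y\<in>I. \<bar>x\<bar> \<le> \<bar>y\<bar> \<longrightarrow> 1 / sqrt (q y) \<le> 1 / sqrt (q x))"
      using test_function_alternatives
    proof (elim disjE exE conjE)
      fix s' C
      assume s: "AC I (\<lambda>x. 1 / sqrt (q x))" "C \<ge> 0"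
        "AE x in lebesgue. x \<in> I \<longrightarrow> ((\<lambda>x. 1 / sqrt (q x)) has_vector_derivative s' x) (at x)"
        and c: "AE x in lebesgue. x \<in> I \<longrightarrow> ennreal \<bar>s' x\<bar> * c_coeff A J H x \<le> ennreal C"
      have "AE x in lebesgue. x \<in> I \<longrightarrow> \<bar>s' x\<bar> * norm (bform f x) \<le> C * sqrt (energy f x * a x)"
        using H_psd c by eventually_elim (use coup[of _ "\<bar>s' _\<bar>" C] s(2) in auto)
      with s show ?thesis by (intro disjI1 exI conjI)
    next
      assume "\<forall>x\<in>I. \<forall>y\<in>I. \<bar>x\<bar> \<le> \<bar>y\<bar> \<longrightarrow> 1 / sqrt (q y) \<le> 1 / sqrt (q x)"
      then show ?thesis by (rule disjI2)
    qed
  qed (use k in auto)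
  then show "half_line_sign I * Im z * Im (bform f 0) \<le> 0" by (rule conjunct1)
  assume 0: "Im (bform f 0) = 0" and x: "x \<in> I"
  have "AE x in lebesgue. x \<in> I \<longrightarrow> energy f x = 0" using main 0 z(2) by blast
  then have "AE x in lebesgue. x \<in> I \<longrightarrow> Ht x *v f x = 0"
    using Ht_psd by eventually_elim (auto simp: energy_def intro: psd_zero_form)
  from weight_null_solution[OF f(1,2) this x] show "f x = 0" .
qed

end

section \<open>Counting square integrable solutions\<close>

lemma norm_upper_lower: "(norm y)\<^sup>2 = (norm (upper y))\<^sup>2 + (norm (lower y))\<^sup>2"
proof -
  have "complex_of_real ((norm y)\<^sup>2) = of_real ((norm (upper y))\<^sup>2 + (norm (lower y))\<^sup>2)"
    using cdot_upper_lower[of y y] by (simp add: cdot_self)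
  then show ?thesis by (simp only: of_real_eq_iff)
qed

lemma scaleR_eq_scale: "r *\<^sub>R u = of_real r *s (u :: complex ^ 'n)"
  unfolding vec_eq_iff vector_scaleR_component vector_smult_component by (simp add: scaleR_conv_of_real)

locale deficiency_equation = limit_point_system I J V B A H q \<delta>
  for I :: "real set" and J V B A H :: "real \<Rightarrow> complex ^ 'n ^ 'n" and q :: "real \<Rightarrow> real" and \<delta> :: real +
  fixes z :: complex
  assumes z: "z = \<i> \<or> z = - \<i>"
begin

text \<open>\<open>\<sigma>\<close> is the direction of the half-line and \<open>\<tau>\<close>
  combines it with the sign of the spectral parameter, so that the energy over a segment is the
  increment of \<tau> Im p from 0 outwards in all four cases.\<close>

definition \<sigma> :: real where "\<sigma> = half_line_sign I"
definition \<tau> :: real where "\<tau> = \<sigma> * Im z"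

lemma signs: "\<sigma> * \<sigma> = 1" "\<tau> * \<tau> = 1" "Im z * Im z = 1" "Re z = 0" "Im z \<noteq> 0" "\<tau> \<noteq> 0"
  using z by (auto simp: \<tau>_def \<sigma>_def half_line_sign_def)

lemma segment_end:
  assumes "X \<ge> 0"
  shows "\<sigma> * X \<in> I" "I \<inter> {-X..X} = {min 0 (\<sigma> * X)..max 0 (\<sigma> * X)}"
  using assms half_line by (auto simp: \<sigma>_def half_line_sign_def half_line_def)

lemma energy_integral:
  assumes f: "AC I f" "solves f (\<lambda>x. z *s f x)" and X: "X \<ge> 0"
  shows "energy f absolutely_integrable_on (I \<inter> {-X..X})"
    and "integral (I \<inter> {-X..X}) (energy f) = \<tau> * Im (bform f (\<sigma> * X)) - \<tau> * Im (bform f 0)"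
proof -
  define a b where "a = min 0 (\<sigma> * X)" and "b = max 0 (\<sigma> * X)"
  have seg: "I \<inter> {-X..X} = {a..b}" unfolding a_def b_def by (rule segment_end(2)[OF X])
  have ab: "a \<le> b" "{a..b} \<subseteq> I" using seg by (auto simp: a_def b_def)
  define d where "d x = Complex (- Re (cdot (upper (f x)) (V x *v upper (f x))) - Re (cdot (lower (f x)) (A x *v lower (f x))))
      (Im z * energy f x)" for x
  have d: "d absolutely_integrable_on {a..b}" "integral {a..b} d = bform f b - bform f a"
    using AC_FTC[OF bform_AC[OF f(1)] ab Im_bform_deriv[OF signs(4) f]] by (simp_all add: d_def[abs_def])
  have bl: "bounded_linear (\<lambda>w. Im z * Im w)"
    using bounded_linear_compose[OF bounded_linear_mult_right[of "Im z"] bounded_linear_Im] by simp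
  have e: "Im z * Im (d x) = energy f x" for x using signs(3) by (simp add: d_def mult.assoc[symmetric])
  have "(\<lambda>x. Im z * Im (d x)) absolutely_integrable_on {a..b}"
    using absolutely_integrable_linear[OF d(1) bl] by (simp add: o_def)
  then show "energy f absolutely_integrable_on (I \<inter> {-X..X})" unfolding e[abs_def] seg .
  have "integral {a..b} (\<lambda>x. Im z * Im (d x)) = Im z * Im (integral {a..b} d)"
    using integral_linear[OF set_lebesgue_integral_eq_integral(1)[OF d(1)] bl] by (simp add: o_def)
  then have "integral {a..b} (energy f) = Im z * (Im (bform f b) - Im (bform f a))"
    unfolding e by (simp add: d(2))
  also have "\<dots> = \<tau> * Im (bform f (\<sigma> * X)) - \<tau> * Im (bform f 0)"
    using X by (auto simp: a_def b_def \<tau>_def \<sigma>_def half_line_sign_def algebra_simps)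
  finally show "integral (I \<inter> {-X..X}) (energy f) = \<tau> * Im (bform f (\<sigma> * X)) - \<tau> * Im (bform f 0)" unfolding seg .
qed

lemma energy_mono:
  assumes f: "AC I f" "solves f (\<lambda>x. z *s f x)" and X: "0 \<le> X" "X \<le> Y"
  shows "\<tau> * Im (bform f (\<sigma> * X)) \<le> \<tau> * Im (bform f (\<sigma> * Y))"
proof -
  have sub: "I \<inter> {-X..X} \<subseteq> I \<inter> {-Y..Y}" using X by auto
  have Y: "0 \<le> Y" using X by simp
  have cut: "(\<lambda>x. if x \<in> I \<inter> {-X..X} then energy f x else 0) absolutely_integrable_on (I \<inter> {-Y..Y})"
  proof -
    have "(\<lambda>x. if x \<in> I \<inter> {-X..X} then energy f x else 0) absolutely_integrable_on UNIV"
      using energy_integral(1)[OF f X(1)] absolutely_integrable_restrict_UNIV by blast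
    then show "(\<lambda>x. if x \<in> I \<inter> {-X..X} then energy f x else 0) absolutely_integrable_on (I \<inter> {-Y..Y})"
      by (rule set_integrable_subset) (use half_line_measurable[OF half_line] in auto)
  qed
  have "integral (I \<inter> {-Y..Y}) (\<lambda>x. if x \<in> I \<inter> {-X..X} then energy f x else 0) \<le> integral (I \<inter> {-Y..Y}) (energy f)"
    by (rule integral_mono_AE_real[OF cut energy_integral(1)[OF f Y]]) (use form_energy[of f] in \<open>eventually_elim, auto\<close>)
  moreover have "integral (I \<inter> {-Y..Y}) (\<lambda>x. if x \<in> I \<inter> {-X..X} then energy f x else 0) = integral (I \<inter> {-X..X}) (energy f)"
    using integral_restrict_Int[of "I \<inter> {-Y..Y}" "I \<inter> {-X..X}" "energy f"] sub by (simp add: Int_absorb2 Int_absorb1)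
  ultimately show ?thesis using energy_integral(2)[OF f X(1)] energy_integral(2)[OF f Y] by linarith
qed

text \<open>By the energy identity an upper bound for \<tau> Im p along the half-line bounds the
  energy over all segments, and monotone convergence does the rest.\<close>

lemma L2_of_bounded:
  assumes f: "AC I f" "solves f (\<lambda>x. z *s f x)"
    and C: "\<And>X. X \<ge> 0 \<Longrightarrow> \<tau> * Im (bform f (\<sigma> * X)) \<le> C"
  shows "f \<in> L2"
proof -
  have m: "f \<in> borel_measurable (restrict_space borel I)"
    by (rule borel_measurable_continuous_on_restrict[OF AC_continuous_on[OF half_line f(1)]])
  note fm = form_measurable[OF m m]
  have "set_integrable lebesgue I (energy f)"
  proof (rule set_integrable_half_line_bounded)
    have "(\<lambda>x. Re (indicator I x *\<^sub>R form f f x)) \<in> borel_measurable lebesgue"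
      using fm by (rule borel_measurable_Re[THEN measurable_compose_rev, rotated])
    then show "(\<lambda>x. indicator I x *\<^sub>R energy f x) \<in> borel_measurable lebesgue" by (simp add: energy_def[abs_def])
    show "AE x in lebesgue. x \<in> I \<longrightarrow> 0 \<le> energy f x" using form_energy[of f] by eventually_elim auto
    fix n :: nat
    note e = energy_integral[OF f, of "real n", OF of_nat_0_le_iff]
    show "set_integrable lebesgue (I \<inter> {- real n..real n}) (energy f)" by (rule e(1))
    show "(LINT x:I \<inter> {- real n..real n}|lebesgue. energy f x) \<le> C - \<tau> * Im (bform f 0)"
      using e(2) C[of "real n"] set_lebesgue_integral_eq_integral(2)[OF e(1)] by simp
  qed
  then have i: "integrable lebesgue (\<lambda>x. indicator I x *\<^sub>R energy f x)" by (simp add: set_integrable_def)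
  have "integrable lebesgue (\<lambda>x. indicator I x *\<^sub>R form f f x)"
  proof (rule Bochner_Integration.integrable_bound[OF i fm])
    show "AE x in lebesgue. norm (indicator I x *\<^sub>R form f f x) \<le> norm (indicator I x *\<^sub>R energy f x)"
      using form_energy[of f] by eventually_elim (auto simp: indicator_def)
  qed
  with m show ?thesis by (simp add: L2_fun_def set_integrable_def)
qed

text \<open>Cayley-type coordinates of the initial value: 4 \<tau> Im p(0) is the squared norm of
  \<open>bdry (- \<tau>)\<close> minus that of \<open>bdry \<tau>\<close>. The indefinite form thus
  splits into two definite parts of n complex dimensions each.\<close>

definition bdry :: "real \<Rightarrow> complex ^ ('n + 'n) \<Rightarrow> complex ^ 'n" where
  "bdry t y = J 0 *v upper y + (\<i> * of_real t) *s lower y"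

lemma bdry_linear: "bdry t (c *s u + d *s v) = c *s bdry t u + d *s bdry t v"
  by (simp add: bdry_def mv_simps vector_scalar_commute vec.add vec_eq_iff algebra_simps)

lemma bdry_norm: "(norm (bdry \<tau> y))\<^sup>2 - (norm (bdry (- \<tau>) y))\<^sup>2 = - 4 * \<tau> * Im (cdot (J 0 *v upper y) (lower y))"
  unfolding bdry_def norm_add_i_scale by simp

lemma bdry_bform: "(norm (bdry \<tau> (f 0)))\<^sup>2 - (norm (bdry (- \<tau>) (f 0)))\<^sup>2 = - 4 * (\<tau> * Im (bform f 0))"
  using bdry_norm[of "f 0"] by (simp add: bform_def)

text \<open>With datum 0 the boundary form is nonnegative by \<open>bdry_bform\<close> and
  nonpositive by \<open>bform_sign\<close>; the case of equality then applies.\<close>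

lemma bdry_zero_imp_zero:
  assumes f: "AC I f" "solves f (\<lambda>x. z *s f x)" "f \<in> L2" and 0: "bdry \<tau> (f 0) = 0" and x: "x \<in> I"
  shows "f x = 0"
proof -
  have "\<tau> * Im (bform f 0) \<le> 0" using bform_sign(1)[OF signs(4,5) f] by (simp add: \<tau>_def \<sigma>_def)
  moreover have "4 * (\<tau> * Im (bform f 0)) = (norm (bdry (- \<tau>) (f 0)))\<^sup>2" using bdry_bform[of f] 0 by simp
  moreover have "(norm (bdry (- \<tau>) (f 0)))\<^sup>2 \<ge> 0" by simp
  ultimately have "\<tau> * Im (bform f 0) = 0" by linarith
  then have "Im (bform f 0) = 0" using signs(6) by simp
  from bform_sign(2)[OF signs(4,5) f this x] show ?thesis .
qed

lemma sol_linear_continuous: "b \<in> I \<Longrightarrow> continuous_on UNIV (\<lambda>y. sol z y b)"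
proof -
  assume b: "b \<in> I"
  have "linear (\<lambda>y. sol z y b)"
  proof (rule linearI)
    show "sol z (u + v) b = sol z u b + sol z v b" for u v using sol_lincomb[OF b, of z 1 u 1 v] by simp
    show "sol z (r *\<^sub>R u) b = r *\<^sub>R sol z u b" for r u
      using sol_lincomb[OF b, of z "of_real r" u 0 0] by (simp add: scaleR_eq_scale)
  qed
  then show ?thesis by (rule linear_continuous_on[OF linear_conv_bounded_linear[THEN iffD1]])
qed

text \<open>The boundary condition at the far end makes the Weyl form there semi-definite, which bounds
  the energy of the solution on the segment by the datum \<open>w\<close> alone.\<close>

lemma bounded_energy_solution:
  assumes b: "X \<ge> 0"
  shows "\<exists>y. bdry \<tau> y = w \<and> \<tau> * Im (bform (sol z y) (\<sigma> * X)) \<le> 0 \<and> norm (bdry (- \<tau>) y) \<le> norm w"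
proof -
  define b where "b = \<sigma> * X"
  have bI: "b \<in> I" unfolding b_def by (rule segment_end(1)[OF b])
  \<comment> \<open>The condition w = -i \<tau> J u at the far end makes \<tau> Im p there equal to
    minus the squared norm of J u.\<close>
  define g where "g u = join u ((- \<i> * of_real \<tau>) *s (J b *v u))" for u
  have g_lin: "g (c *s u + d *s v) = c *s g u + d *s g v" for c d u v
    by (simp add: g_def join_eq_iff mv_simps vector_scalar_commute vec_eq_iff algebra_simps)
  have "\<forall>u. \<exists>y. sol z y b = g u" using sol_at_surj[OF bI] by blast
  \<comment> \<open>\<open>Y u\<close> is the initial value that reaches \<open>g u\<close> at
    \<open>b\<close>. It is linear in \<open>u\<close> by uniqueness, which reduces prescribing the
    datum at 0 to an injectivity question.\<close>
  then obtain Y where Y: "\<And>u. sol z (Y u) b = g u" by metis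
  have uniq: "y = y'" if "sol z y b = sol z y' b" for y y'
    using solution_eqI[OF sol(1,3) sol(1,3) bI that half_line_0[OF half_line]] by (simp add: sol)
  have Y_lin: "Y (c *s u + d *s v) = c *s Y u + d *s Y v" for c d u v
    by (rule uniq) (simp add: Y sol_lincomb[OF bI] g_lin)
  have far: "\<tau> * Im (bform (sol z (Y u)) b) = - (norm (J b *v u))\<^sup>2" for u
  proof -
    have "bform (sol z (Y u)) b = cdot (J b *v u) ((- \<i> * of_real \<tau>) *s (J b *v u))"
      by (simp add: bform_def Y g_def)
    also have "\<dots> = - \<i> * of_real (\<tau> * (norm (J b *v u))\<^sup>2)"
      by (simp only: cdot_scale_right cdot_self) simp
    finally show ?thesis using signs(2) by (simp add: mult.assoc[symmetric])
  qed
  have le: "\<tau> * Im (bform (sol z y) 0) \<le> \<tau> * Im (bform (sol z y) b)" for y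
    using energy_mono[OF sol(1,3) order_refl b, of y] by (simp add: b_def)
  have near: "4 * (\<tau> * Im (bform (sol z y) 0)) = (norm (bdry (- \<tau>) y))\<^sup>2 - (norm (bdry \<tau> y))\<^sup>2" for y
    using bdry_bform[of "sol z y"] by (simp add: sol)
  have "\<exists>u. bdry \<tau> (Y u) = w"
  proof (rule linear_injective_surjective)
    show "bdry \<tau> (Y (c *s u + d *s v)) = c *s bdry \<tau> (Y u) + d *s bdry \<tau> (Y v)" for u v c d
      unfolding Y_lin by (rule bdry_linear)
    \<comment> \<open>With datum 0 the form at 0 is nonnegative, while at \<open>b\<close> it is
      nonpositive; as it does not decrease outwards, J u must vanish.\<close>
    fix u assume "bdry \<tau> (Y u) = 0"
    then have "(norm (bdry (- \<tau>) (Y u)))\<^sup>2 \<le> - 4 * (norm (J b *v u))\<^sup>2"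
      using near[of "Y u"] le[of "Y u"] far[of u] by simp
    then have "(norm (J b *v u))\<^sup>2 \<le> 0" using zero_le_power2[of "norm (bdry (- \<tau>) (Y u))"] by linarith
    then have "J b *v u = 0" by simp
    then show "u = 0" using J_det[OF bI] det_nonzero_iff_injective by blast
  qed
  then obtain u where u: "bdry \<tau> (Y u) = w" by blast
  have f0: "\<tau> * Im (bform (sol z (Y u)) b) \<le> 0" unfolding far by simp
  have "(norm (bdry (- \<tau>) (Y u)))\<^sup>2 \<le> (norm w)\<^sup>2" using near[of "Y u", unfolded u] le[of "Y u"] f0 by linarith
  then have "norm (bdry (- \<tau>) (Y u)) \<le> norm w" by (rule power2_le_imp_le) simp
  with u f0 show ?thesis unfolding b_def by blast
qed

text \<open>The two boundary values have sum 2 J(0) u and difference 2 i \<tau> w, so together they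
  control the initial value.\<close>

lemma bdry_bounds: "norm y \<le> (onorm ((*v) (matrix_inv (J 0))) + 1) * (norm (bdry \<tau> y) + norm (bdry (- \<tau>) y))"
proof -
  define N where "N = norm (bdry \<tau> y) + norm (bdry (- \<tau>) y)"
  define K where "K = onorm ((*v) (matrix_inv (J 0)))"
  have bl: "bounded_linear ((*v) (matrix_inv (J 0)))"
    by (rule bounded_bilinear.bounded_linear_right[OF bounded_bilinear_matrix_vector])
  have N0: "N \<ge> 0" by (simp add: N_def)
  have "2 *\<^sub>R (J 0 *v upper y) = bdry \<tau> y + bdry (- \<tau>) y"
    by (simp add: bdry_def vec_eq_iff scaleR_conv_of_real)
  from arg_cong[OF this, of norm] have "2 * norm (J 0 *v upper y) \<le> N"
    using norm_triangle_ineq[of "bdry \<tau> y" "bdry (- \<tau>) y"] by (simp add: N_def)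
  then have JN: "norm (J 0 *v upper y) \<le> N" using norm_ge_zero[of "J 0 *v upper y"] by linarith
  have "norm (upper y) = norm (matrix_inv (J 0) *v (J 0 *v upper y))"
    by (simp add: matrix_inv_mult_vec(2)[OF J_det[OF half_line_0[OF half_line]]])
  also have "\<dots> \<le> K * norm (J 0 *v upper y)" unfolding K_def by (rule onorm[OF bl])
  also have "\<dots> \<le> K * N" by (rule mult_left_mono[OF JN]) (simp add: K_def onorm_pos_le[OF bl])
  finally have u: "norm (upper y) \<le> K * N" .
  have "2 *\<^sub>R lower y = (- \<i> * of_real \<tau>) *s (bdry \<tau> y - bdry (- \<tau>) y)"
  proof -
    have "bdry \<tau> y - bdry (- \<tau>) y = (2 * \<i> * of_real \<tau>) *s lower y" by (simp add: bdry_def vec_eq_iff)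
    then have "(- \<i> * of_real \<tau>) *s (bdry \<tau> y - bdry (- \<tau>) y) = (2 * of_real (\<tau> * \<tau>)) *s lower y"
      by (simp add: vector_smult_assoc mult_ac)
    then show ?thesis by (simp add: signs(2) vec_eq_iff scaleR_conv_of_real)
  qed
  from arg_cong[OF this, of norm]
  have "2 * norm (lower y) = norm ((- \<i> * of_real \<tau>) *s (bdry \<tau> y - bdry (- \<tau>) y))" by simp
  also have "\<dots> = norm (bdry \<tau> y - bdry (- \<tau>) y)"
  proof -
    have "norm (c *s v) = norm v" if "cmod c = 1" for c and v :: "complex ^ 'n"
      using that by (simp add: norm_vec_def L2_set_def norm_mult)
    moreover have "\<bar>\<tau>\<bar> = 1" using signs(2) by (metis abs_mult_self_eq abs_square_eq_1 power2_eq_square)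
    ultimately show ?thesis by (metis norm_minus_cancel norm_mult norm_ii norm_of_real mult_1)
  qed
  also have "\<dots> \<le> N" unfolding N_def by (rule norm_triangle_ineq4)
  finally have l: "norm (lower y) \<le> N" using norm_ge_zero[of "lower y"] by linarith
  have "norm y \<le> norm (upper y) + norm (lower y)"
    by (rule power2_le_imp_le) (simp_all add: norm_upper_lower power2_sum)
  then show ?thesis using u l unfolding N_def[symmetric] K_def[symmetric] by (simp add: algebra_simps)
qed

text \<open>The initial values belonging to far ends at distance \<open>n\<close> stay in a fixed
  ball, so a subsequence converges. At a fixed distance the boundary form is eventually bounded by
  its value at the far end, through \<open>energy_mono\<close>, and this bound survives the
  limit.\<close>

lemma L2_solution_exists: "\<exists>y. bdry \<tau> y = w \<and> sol z y \<in> L2"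
proof -
  have "\<forall>n::nat. \<exists>y. bdry \<tau> y = w \<and> \<tau> * Im (bform (sol z y) (\<sigma> * real n)) \<le> 0 \<and> norm (bdry (- \<tau>) y) \<le> norm w"
    using bounded_energy_solution by simp
  then obtain Y where Y: "\<And>n::nat. bdry \<tau> (Y n) = w" "\<And>n. \<tau> * Im (bform (sol z (Y n)) (\<sigma> * real n)) \<le> 0"
    "\<And>n. norm (bdry (- \<tau>) (Y n)) \<le> norm w" by metis
  define R where "R = (onorm ((*v) (matrix_inv (J 0))) + 1) * (norm w + norm w)"
  have bl: "bounded_linear ((*v) (matrix_inv (J 0)))"
    by (rule bounded_bilinear.bounded_linear_right[OF bounded_bilinear_matrix_vector])
  have "Y n \<in> cball 0 R" for n
  proof -
    have "norm (Y n) \<le> (onorm ((*v) (matrix_inv (J 0))) + 1) * (norm w + norm (bdry (- \<tau>) (Y n)))"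
      using bdry_bounds[of "Y n"] Y(1) by simp
    also have "\<dots> \<le> R" unfolding R_def using Y(3)[of n] onorm_pos_le[OF bl] by (intro mult_left_mono) auto
    finally show ?thesis by simp
  qed
  then obtain y r where y: "strict_mono r" "(Y \<circ> r) \<longlonglongrightarrow> y"
    using compact_cball[of "0 :: complex ^ ('n + 'n)" R] unfolding compact_def by metis
  have lim: "(\<lambda>n. g (Y (r n))) \<longlonglongrightarrow> g y" if "continuous_on UNIV g" for g :: "complex ^ ('n + 'n) \<Rightarrow> 'a::topological_space"
    using continuous_on_tendsto_compose[OF that y(2)] by (simp add: o_def)
  have "linear (bdry \<tau>)"
  proof (rule linearI)
    show "bdry \<tau> (u + v) = bdry \<tau> u + bdry \<tau> v" for u v using bdry_linear[of \<tau> 1 u 1 v] by simp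
    show "bdry \<tau> (c *\<^sub>R u) = c *\<^sub>R bdry \<tau> u" for c u
      using bdry_linear[of \<tau> "of_real c" u 0 0] by (simp add: scaleR_eq_scale)
  qed
  then have "continuous_on UNIV (bdry \<tau>)" by (rule linear_continuous_on[OF linear_conv_bounded_linear[THEN iffD1]])
  from lim[OF this] have "bdry \<tau> y = w" by (simp add: Y(1) LIMSEQ_const_iff)
  moreover have "sol z y \<in> L2"
  proof (rule L2_of_bounded[OF sol(1,3)])
    fix X :: real assume X: "X \<ge> 0"
    have "continuous_on UNIV (\<lambda>y. \<tau> * Im (bform (sol z y) (\<sigma> * X)))"
      unfolding bform_def
      by (intro continuous_intros bounded_bilinear.continuous_on[OF bounded_bilinear_cdot]
          bounded_linear.continuous_on[OF bounded_bilinear.bounded_linear_right[OF bounded_bilinear_matrix_vector]]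
          bounded_linear.continuous_on[OF bounded_linear_upper] bounded_linear.continuous_on[OF bounded_linear_lower]
          sol_linear_continuous segment_end(1)[OF X])
    from lim[OF this] show "\<tau> * Im (bform (sol z y) (\<sigma> * X)) \<le> 0"
    proof (rule LIMSEQ_le_const2)
      obtain N :: nat where N: "X \<le> real N" using real_arch_simple by blast
      have "\<tau> * Im (bform (sol z (Y (r n))) (\<sigma> * X)) \<le> 0" if n: "n \<ge> N" for n
      proof -
        have "X \<le> real (r n)" using N n seq_suble[OF y(1), of n] by linarith
        then have "\<tau> * Im (bform (sol z (Y (r n))) (\<sigma> * X)) \<le> \<tau> * Im (bform (sol z (Y (r n))) (\<sigma> * real (r n)))"
          by (rule energy_mono[OF sol(1,3) X])
        with Y(2)[of "r n"] show ?thesis by linarith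
      qed
      then show "\<exists>N. \<forall>n\<ge>N. \<tau> * Im (bform (sol z (Y (r n))) (\<sigma> * X)) \<le> 0" by blast
    qed
  qed
  ultimately show ?thesis by blast
qed

definition L2_solutions :: "(real \<Rightarrow> complex ^ ('n + 'n)) set" where
  "L2_solutions = {f. (\<forall>x. x \<notin> I \<longrightarrow> f x = 0) \<and> AC I f \<and> f \<in> L2 \<and> solves f (\<lambda>x. z *s f x)}"

text \<open>These are the common hypotheses of the two dimension counts, for the map sending
  \<open>f\<close> to \<open>bdry \<tau> (f 0)\<close>; the fifth item is the extra one for
  classes.\<close>

lemma L2_solutions_bdry:
  "(\<lambda>x. 0) \<in> L2_solutions" "bdry \<tau> 0 = 0"
  "f \<in> L2_solutions \<Longrightarrow> g \<in> L2_solutions \<Longrightarrow> (\<lambda>x. c *s f x + d *s g x) \<in> L2_solutions"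
  "f \<in> L2_solutions \<Longrightarrow> bdry \<tau> (f 0) = 0 \<Longrightarrow> f = (\<lambda>x. 0)"
  "f \<in> L2_solutions \<Longrightarrow> f \<in> L2_null Ht I \<Longrightarrow> f = (\<lambda>x. 0)"
  "\<exists>f\<in>L2_solutions. bdry \<tau> (f 0) = w"
proof -
  show "bdry \<tau> 0 = 0" by (simp add: bdry_def mv_simps)
  show "(\<lambda>x. 0) \<in> L2_solutions"
    \<comment> \<open>The combination of two solutions with zero coefficients shows that 0 solves
      the equation.\<close>
    using solves_lincomb(1)[OF sol(1) sol(1) sol(3) sol(3), of 0 z 0 0 z 0] by (simp add: L2_solutions_def AC_const L2_zero)
  {
    fix f g c d assume f: "f \<in> L2_solutions" and g: "g \<in> L2_solutions"
    note l = solves_lincomb[of f g "\<lambda>x. z *s f x" "\<lambda>x. z *s g x" c d]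
    have "solves (\<lambda>x. c *s f x + d *s g x) (\<lambda>x. z *s (c *s f x + d *s g x))"
      using l(1) f g by (simp add: L2_solutions_def vector_add_ldistrib vector_smult_assoc mult.commute)
    then show "(\<lambda>x. c *s f x + d *s g x) \<in> L2_solutions"
      using f g l(2) L2_lincomb2[of f g c d] by (simp add: L2_solutions_def)
  }
  {
    fix f assume f: "f \<in> L2_solutions" and 0: "bdry \<tau> (f 0) = 0"
    have "f x = 0" for x
      using f bdry_zero_imp_zero[of f x] 0 by (cases "x \<in> I") (auto simp: L2_solutions_def)
    then show "f = (\<lambda>x. 0)" by blast
  }
  {
    fix f assume f: "f \<in> L2_solutions" and 0: "f \<in> L2_null Ht I"
    have "f x = 0" for x
      using f weight_null_solution[OF _ _ null_AE[OF 0], of z x] by (cases "x \<in> I") (auto simp: L2_solutions_def)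
    then show "f = (\<lambda>x. 0)" by blast
  }
  obtain y where y: "bdry \<tau> y = w" "sol z y \<in> L2" using L2_solution_exists by blast
  let ?f = "\<lambda>x. if x \<in> I then sol z y x else 0"
  have AC: "AC I ?f" using AC_cong[of I ?f "sol z y"] sol(1) by simp
  have s: "solves ?f (\<lambda>x. z *s ?f x)" by (rule solves_cong[OF sol(1,3)]) auto
  have "?f \<in> L2"
  proof -
    have "set_integrable lebesgue I (form ?f ?f) = set_integrable lebesgue I (form (sol z y) (sol z y))"
      by (rule set_integrable_cong) auto
    then show ?thesis using y(2) borel_measurable_continuous_on_restrict[OF AC_continuous_on[OF half_line AC]]
      by (simp add: L2_fun_def)
  qed
  with AC s have "?f \<in> L2_solutions" by (simp add: L2_solutions_def)
  moreover have "bdry \<tau> (?f 0) = w" using y(1) half_line_0[OF half_line] by (simp add: sol)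
  ultimately show "\<exists>f\<in>L2_solutions. bdry \<tau> (f 0) = w" by (intro bexI[of _ ?f]) simp_all
qed

lemma L2_solutions_subset: "L2_solutions \<subseteq> L2"
  by (auto simp: L2_solutions_def)

lemma formal_deficiency_index_eq: "formal_deficiency_index Jt Bt Ht I z = CARD('n)"
  unfolding formal_deficiency_index_def L2_solutions_def[symmetric]
  by (rule function_space_dim[of L2_solutions "\<lambda>f. bdry \<tau> (f 0)", OF L2_solutions_bdry(1-3) bdry_linear L2_solutions_bdry(4,6)])

lemma deficiency_index_eq: "deficiency_index Ht I (minimal_relation Jt Bt Ht I) z = enat CARD('n)"
  unfolding deficiency_index_def deficiency_space_eq L2_solutions_def[symmetric]
  by (rule L2_dim_image[of L2_solutions "\<lambda>f. bdry \<tau> (f 0)", OF L2_solutions_subset L2_solutions_bdry(1-3) bdry_linear L2_solutions_bdry(4-6)])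

end

theorem theorem5p6:
  fixes I :: "real set"
    and J V B A H :: "real \<Rightarrow> complex ^ 'n ^ 'n"
    and q :: "real \<Rightarrow> real"
    and \<delta> :: real
  assumes half_line: "I = {0..} \<or> I = {..0}"
    and J_AC: "AC I J"
    and J_det: "\<And>x. x \<in> I \<Longrightarrow> det (J x) \<noteq> 0"
    and V_L1: "L1_loc I V" and B_L1: "L1_loc I B" and A_L1: "L1_loc I A" and H_L1: "L1_loc I H"
    and V_herm: "AE x in lebesgue. x \<in> I \<longrightarrow> hermitian (V x)"
    and H_psd: "AE x in lebesgue. x \<in> I \<longrightarrow> psd (H x)"
    and A_psd: "\<And>x. x \<in> I \<Longrightarrow> psd (A x)"
    and \<delta>_pos: "\<delta> > 0"
    and q_ge: "\<And>x. x \<in> I \<Longrightarrow> q x \<ge> \<delta>"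
    and V_ge: "AE x in lebesgue. x \<in> I \<longrightarrow> psd (V x + q x *\<^sub>R H x)"
    and diverges: "(\<integral>\<^sup>+x\<in>I. 1 / (c_coeff A J H x * ennreal (sqrt (q x))) \<partial>lebesgue) = \<infinity>"
    and alternatives:
      "(AC I q \<and>
        (\<exists>C\<^sub>1::real. AE x in lebesgue. x \<in> I \<longrightarrow>
           ennreal \<bar>vector_derivative (\<lambda>t. 1 / sqrt (q t)) (at x within I)\<bar> * c_coeff A J H x
             \<le> ennreal C\<^sub>1))
       \<or> (I = {0..} \<and> mono_on I q) \<or> (I = {..0} \<and> antimono_on I q)"
  shows "\<forall>z\<in>{\<i>, - \<i>}.
    formal_deficiency_index (J_tilde J) (B_tilde I J V B A) (H_tilde H) I z = CARD('n) \<and>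
    deficiency_index (H_tilde H) I
      (minimal_relation (J_tilde J) (B_tilde I J V B A) (H_tilde H) I) z = enat CARD('n)"
proof
  fix z :: complex assume "z \<in> {\<i>, - \<i>}"
  then interpret deficiency_equation I J V B A H q \<delta> z
    by unfold_locales (use assms in \<open>auto simp: half_line_def\<close>)
  show "formal_deficiency_index (J_tilde J) (B_tilde I J V B A) (H_tilde H) I z = CARD('n) \<and>
    deficiency_index (H_tilde H) I
      (minimal_relation (J_tilde J) (B_tilde I J V B A) (H_tilde H) I) z = enat CARD('n)"
    using formal_deficiency_index_eq deficiency_index_eq by blast
qed

end
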